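(* The Fixed Edge-Length Planar Realization problem is NP-hard for weighted $2$-trees, even for instances whose number of distinct edge lengths is $4$.
   Context: A $2$-tree is defined recursively: a $3$-cycle is a $2$-tree, and if $G$ is a $2$-tree containing an edge $(u,w)$, then adding a new vertex $v$ and edges $(v,u),(v,w)$ yields a $2$-tree. A weighted graph $G=(V,E,\lambda)$ has a length function $\lambda:E\to\mathbb{R}^+$. The Fixed Edge-Length Planar Realization problem takes as input a weighted planar graph $G$ and asks whether $G$ admits a planar straight-line realization, i.e., a planar straight-line drawing of $G$ (no two edges crossing) in which each edge $e$ is a segment of Euclidean length $\lambda(e)$. The number of distinct edge lengths is $|\lambda(E)|$. *)

theory Defs
  imports "HOL-Analysis.Analysis" "HOL-Computational_Algebra.Polynomial"
begin

section \<open>Turing machines, NP and NP-hardness\<close>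

datatype move = Move_Left | Stay | Move_Right

text \<open>
  A nondeterministic multi-tape machine is a number of tapes and a finite set of transitions
  (current state, symbols read, new state, symbols written with head moves). States and tape
  symbols are natural numbers; since the transition set is finite, only finitely many of each
  occur. State 0 is the start state and state 1 the accepting state. Symbol 0 is the blank, and
  symbols 1 and 2 represent the bits \<^const>\<open>False\<close> and \<^const>\<open>True\<close>; all others are work symbols.
\<close>

type_synonym transition = "nat \<times> nat list \<times> nat \<times> (nat \<times> move) list"

record tm =
  tape_count :: nat
  transitions :: "transition set"

definition wf_tm :: "tm \<Rightarrow> bool" where
  "wf_tm M \<longleftrightarrow> 1 \<le> tape_count M \<and> finite (transitions M) \<and>
     (\<forall>(q, rs, q', as) \<in> transitions M. length rs = tape_count M \<and> length as = tape_count M)"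

definition deterministic :: "tm \<Rightarrow> bool" where
  "deterministic M \<longleftrightarrow>
     (\<forall>q rs q1 as1 q2 as2. (q, rs, q1, as1) \<in> transitions M \<longrightarrow> (q, rs, q2, as2) \<in> transitions M \<longrightarrow>
        q1 = q2 \<and> as1 = as2)"

text \<open>Tapes are infinite in both directions; a tape consists of the head position and the contents.\<close>

type_synonym tape = "int \<times> (int \<Rightarrow> nat)"
type_synonym config = "nat \<times> tape list"

fun read_tape :: "tape \<Rightarrow> nat" where
  "read_tape (h, c) = c h"

fun move_head :: "move \<Rightarrow> int \<Rightarrow> int" where
  "move_head Move_Left h = h - 1"
| "move_head Stay h = h"
| "move_head Move_Right h = h + 1"

fun act_tape :: "nat \<times> move \<Rightarrow> tape \<Rightarrow> tape" where
  "act_tape (s, m) (h, c) = (move_head m h, c(h := s))"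

inductive tm_step :: "tm \<Rightarrow> config \<Rightarrow> config \<Rightarrow> bool" for M where
  "(q, map read_tape ts, q', as) \<in> transitions M \<Longrightarrow> tm_step M (q, ts) (q', map2 act_tape as ts)"

definition halted :: "tm \<Rightarrow> config \<Rightarrow> bool" where
  "halted M c \<longleftrightarrow> (\<nexists>c'. tm_step M c c')"

definition string_contents :: "bool list \<Rightarrow> int \<Rightarrow> nat" where
  "string_contents x i =
     (if 0 \<le> i \<and> i < int (length x) then (if x ! nat i then 2 else 1) else 0)"

definition initial_config :: "tm \<Rightarrow> bool list \<Rightarrow> config" where
  "initial_config M x =
     (0, (0, string_contents x) # replicate (tape_count M - 1) (0, string_contents []))"

definition accepts :: "tm \<Rightarrow> bool list \<Rightarrow> bool" where
  "accepts M x \<longleftrightarrow>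
     (\<exists>t c. (tm_step M ^^ t) (initial_config M x) c \<and> halted M c \<and> fst c = 1)"

text \<open>All computations, accepting or not, are required to respect the time bound.\<close>

definition runs_in_time :: "tm \<Rightarrow> nat poly \<Rightarrow> bool" where
  "runs_in_time M p \<longleftrightarrow>
     (\<forall>x t c. (tm_step M ^^ t) (initial_config M x) c \<longrightarrow> t \<le> poly p (length x))"

definition NP :: "bool list set set" where
  "NP = {L. \<exists>M p. wf_tm M \<and> runs_in_time M p \<and> L = {x. accepts M x}}"

text \<open>The output of a computation is the contents of the last tape.\<close>

definition polytime_computable :: "(bool list \<Rightarrow> bool list) \<Rightarrow> bool" where
  "polytime_computable f \<longleftrightarrow>
     (\<exists>M p. wf_tm M \<and> deterministic M \<and> runs_in_time M p \<and>
        (\<forall>x. \<exists>t c. (tm_step M ^^ t) (initial_config M x) c \<and> halted M c \<and>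
           snd (last (snd c)) = string_contents (f x)))"

text \<open>
  A decision problem is given by its set of (encoded) instances and its set of (encoded)
  yes-instances. A reduction must produce an instance of the problem on every input, so hardness
  of a restricted problem really is hardness on the restricted inputs.
\<close>

record problem =
  instances :: "bool list set"
  yes_instances :: "bool list set"

definition NP_hard :: "problem \<Rightarrow> bool" where
  "NP_hard P \<longleftrightarrow>
     (\<forall>L \<in> NP. \<exists>f. polytime_computable f \<and>
        (\<forall>x. f x \<in> instances P \<and> (x \<in> L \<longleftrightarrow> f x \<in> yes_instances P)))"


section \<open>Weighted graphs, 2-trees and planar realizations\<close>

record 'a wgraph =
  verts :: "'a set"
  edges :: "'a set set"
  len :: "'a set \<Rightarrow> real"

definition weighted_graph :: "'a wgraph \<Rightarrow> bool" where
  "weighted_graph G \<longleftrightarrow> finite (verts G) \<and>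
     (\<forall>e \<in> edges G. e \<subseteq> verts G \<and> card e = 2 \<and> len G e > 0)"

inductive two_tree :: "'a set \<Rightarrow> 'a set set \<Rightarrow> bool" where
  triangle: "distinct [a, b, c] \<Longrightarrow> two_tree {a, b, c} {{a, b}, {b, c}, {a, c}}"
| extend: "two_tree V E \<Longrightarrow> {u, w} \<in> E \<Longrightarrow> v \<notin> V \<Longrightarrow>
    two_tree (insert v V) (E \<union> {{v, u}, {v, w}})"

text \<open>
  A drawing places each vertex \<open>v\<close> at the point \<open>p v\<close> and represents each edge \<open>e\<close> by the simple
  arc \<open>D e\<close> between its end vertices; it is planar if arcs meet only at common end vertices.
\<close>

definition planar_drawing ::
  "'a wgraph \<Rightarrow> ('a \<Rightarrow> complex) \<Rightarrow> ('a set \<Rightarrow> complex set) \<Rightarrow> bool" where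
  "planar_drawing G p D \<longleftrightarrow>
     inj_on p (verts G) \<and>
     (\<forall>e \<in> edges G. \<exists>g. arc g \<and> path_image g = D e \<and> {pathstart g, pathfinish g} = p ` e) \<and>
     (\<forall>e \<in> edges G. D e \<inter> p ` verts G \<subseteq> p ` e) \<and>
     (\<forall>e \<in> edges G. \<forall>e' \<in> edges G. e \<noteq> e' \<longrightarrow> D e \<inter> D e' \<subseteq> p ` (e \<inter> e'))"

definition planar :: "'a wgraph \<Rightarrow> bool" where
  "planar G \<longleftrightarrow> (\<exists>p D. planar_drawing G p D)"

text \<open>The convex hull of the two end points of an edge is the segment between them.\<close>

definition planar_straight_line_realization :: "'a wgraph \<Rightarrow> ('a \<Rightarrow> complex) \<Rightarrow> bool" where
  "planar_straight_line_realization G p \<longleftrightarrow>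
     planar_drawing G p (\<lambda>e. convex hull (p ` e)) \<and>
     (\<forall>u v. {u, v} \<in> edges G \<longrightarrow> dist (p u) (p v) = len G {u, v})"

definition num_lengths :: "'a wgraph \<Rightarrow> nat" where
  "num_lengths G = card (len G ` edges G)"


section \<open>Encoding of instances\<close>

text \<open>
  An instance is given by its number \<open>n\<close> of vertices and a list of entries \<open>(u, v, a, b)\<close>, each
  describing an edge between vertices \<open>u, v < n\<close> of rational length \<open>a / b\<close>.
\<close>

type_synonym code = "nat \<times> (nat \<times> nat \<times> nat \<times> nat) list"

definition edge_lengths :: "code \<Rightarrow> (nat set \<times> real) list" where
  "edge_lengths c = map (\<lambda>(u, v, a, b). ({u, v}, real a / real b)) (snd c)"

definition valid_code :: "code \<Rightarrow> bool" where
  "valid_code c \<longleftrightarrow>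
     (\<forall>(u, v, a, b) \<in> set (snd c). u < fst c \<and> v < fst c \<and> u \<noteq> v \<and> 0 < a \<and> 0 < b) \<and>
     distinct (map fst (edge_lengths c))"

definition graph_of :: "code \<Rightarrow> nat wgraph" where
  "graph_of c =
     \<lparr>verts = {..<fst c}, edges = fst ` set (edge_lengths c),
      len = (\<lambda>e. the (map_of (edge_lengths c) e))\<rparr>"

text \<open>Binary representation, least significant bit first, without leading zeros.\<close>

fun nat_bits :: "nat \<Rightarrow> bool list" where
  "nat_bits n = (if n = 0 then [] else odd n # nat_bits (n div 2))"

declare nat_bits.simps [simp del]

text \<open>To be self-delimiting, each bit is preceded by \<^const>\<open>True\<close> and the end is marked by
  \<^const>\<open>False\<close>.\<close>

definition encode_nat :: "nat \<Rightarrow> bool list" where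
  "encode_nat n = concat (map (\<lambda>b. [True, b]) (nat_bits n)) @ [False]"

definition encode :: "code \<Rightarrow> bool list" where
  "encode c = encode_nat (fst c) @
     concat (map (\<lambda>(u, v, a, b). encode_nat u @ encode_nat v @ encode_nat a @ encode_nat b) (snd c))"

lemma nat_bits_inject: "nat_bits m = nat_bits n \<Longrightarrow> m = n"
proof (induction m arbitrary: n rule: less_induct)
  case (less m)
  show ?case
  proof (cases "m = 0")
    case True
    with less.prems have "nat_bits n = []"
      by (subst (asm) nat_bits.simps) simp
    then have "n = 0"
      by (subst (asm) nat_bits.simps) (simp split: if_splits)
    with True show ?thesis by simp
  next
    case False
    then have m: "nat_bits m = odd m # nat_bits (m div 2)"
      by (subst nat_bits.simps) simp
    have "n \<noteq> 0"
    proof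
      assume "n = 0"
      then have "nat_bits n = []" by (subst nat_bits.simps) simp
      with m less.prems show False by simp
    qed
    then have n: "nat_bits n = odd n # nat_bits (n div 2)"
      by (subst nat_bits.simps) simp
    from m n less.prems have "odd m = odd n" "nat_bits (m div 2) = nat_bits (n div 2)"
      by simp_all
    moreover from this less.IH[of "m div 2" "n div 2"] False have "m div 2 = n div 2" by simp
    ultimately show ?thesis
      by presburger
  qed
qed

lemma delimit_inject:
  "concat (map (\<lambda>b. [True, b]) xs) @ False # r = concat (map (\<lambda>b. [True, b]) ys) @ False # s
   \<Longrightarrow> xs = ys \<and> r = s"
proof (induction xs arbitrary: ys)
  case Nil
  then show ?case by (cases ys) auto
next
  case (Cons x xs)
  then show ?case by (cases ys) auto
qed

lemma encode_nat_append_inject: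
  "encode_nat m @ r = encode_nat n @ s \<longleftrightarrow> m = n \<and> r = s"
  using delimit_inject[of "nat_bits m" r "nat_bits n" s] nat_bits_inject[of m n]
  unfolding encode_nat_def append_assoc append_Cons append_Nil by blast

lemma encode_nat_not_Nil: "encode_nat n \<noteq> []"
  by (simp add: encode_nat_def)

lemma encode_inject: "encode c = encode d \<longleftrightarrow> c = d"
proof -
  let ?f = "\<lambda>(u, v, a, b). encode_nat u @ encode_nat v @ encode_nat a @ encode_nat b"
  have *: "concat (map ?f xs) = concat (map ?f ys) \<Longrightarrow> xs = ys" for xs ys
  proof (induction xs arbitrary: ys)
    case Nil
    then show ?case by (cases ys) (auto simp: encode_nat_not_Nil)
  next
    case (Cons x xs)
    then show ?case
      by (cases ys; cases x) (auto simp: encode_nat_not_Nil encode_nat_append_inject)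
  qed
  show ?thesis
    using * by (cases c; cases d) (auto simp: encode_def encode_nat_append_inject)
qed


section \<open>The realization problem\<close>

text \<open>Fixed Edge-Length Planar Realization, restricted to the weighted planar graphs in the
  class \<open>K\<close>.\<close>

definition FEPR_on :: "(nat wgraph \<Rightarrow> bool) \<Rightarrow> problem" where
  "FEPR_on K =
     \<lparr>instances = {encode c | c. valid_code c \<and> weighted_graph (graph_of c) \<and>
        planar (graph_of c) \<and> K (graph_of c)},
      yes_instances = {encode c | c. valid_code c \<and> weighted_graph (graph_of c) \<and>
        planar (graph_of c) \<and> K (graph_of c) \<and>
        (\<exists>p. planar_straight_line_realization (graph_of c) p)}\<rparr>"

end

(* Acceptance of a nondeterministic machine is first expressed by clauses, each purely negative or purely
   positive, over the cells of a computation table. The clauses and variables become the rows and columns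
   of a grid of strips of unit triangles. Up to a rigid motion the strips can be drawn in only one way,
   while every further vertex, a flag on an edge of a strip, is free to choose a side. Flags of length
   7/11 block the other sides of a triangle and so carry signals along the strips; flags of length 7/13
   can share a triangle and are read by choice units, in which a signal coming from two of the four
   directions leaves only some of the other directions free. The vertical signals of a column carry the
   value of a variable, and the row of a clause can only be drawn if the horizontal signals coming from
   its two ends meet at a true literal. *)

theory Submission imports Defs begin

text \<open>Both flag lengths come from 3^2 + 3*5 + 5^2 = 7^2: the apexes with barycentric
  coordinates (5,5,3)/13 and (3,3,5)/11 in a unit triangle have the rational distances 7/13 and 7/11
  from the ends of their edge. The first apex is nearest to its own edge, so a face holds one such
  flag per side; the second lies beyond the centroid, so its flag meets a flag on any other side of
  the face. Every signal is a one-way implication between sides of flags. This is why clauses are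
  purely negative or purely positive and why all negative rows come first: along a column a signal
  that is present once stays present, and the variable is read off where the positive rows begin. A
  choice unit only excludes that all four of its sensors point in, so a horizontal and a vertical
  signal can meet in it; this takes the place of a planar embedding of the clauses. Instances must
  be planar 2-trees whether or not they can be realized, hence a separate planar drawing that
  ignores the lengths. Polynomial time is obtained by writing the reduction in a language of bounded
  loops.\<close>

section \<open>A register language compiled to deterministic Turing machines\<close>

datatype cond = RegPos nat | InNonblank | InTrue

datatype cmd = Inc nat | Dec nat | Emit bool | InRight | InLeft | Skip
  | Seq cmd cmd | Cond cond cmd cmd | While cond cmd

type_synonym cstate = "int \<times> (nat \<Rightarrow> nat) \<times> bool list"

fun holds :: "bool list \<Rightarrow> cond \<Rightarrow> cstate \<Rightarrow> bool" where
  "holds x (RegPos r) (h, \<sigma>, out) \<longleftrightarrow> \<sigma> r \<noteq> 0"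
| "holds x InNonblank (h, \<sigma>, out) \<longleftrightarrow> string_contents x h \<noteq> 0"
| "holds x InTrue (h, \<sigma>, out) \<longleftrightarrow> string_contents x h = 2"

text \<open>The number is the exact count of machine steps of the compiled code: \<open>Inc\<close>
  has to move before it can write, the first branch of \<open>Cond\<close> pays for the test and for
  the jump over the second, and a round of \<open>While\<close> pays for the test and the jump
  back.\<close>

inductive exec :: "bool list \<Rightarrow> cmd \<Rightarrow> cstate \<Rightarrow> nat \<Rightarrow> cstate \<Rightarrow> bool" for x where
  exInc: "exec x (Inc r) (h, \<sigma>, out) 2 (h, \<sigma>(r := Suc (\<sigma> r)), out)"
| exDec: "exec x (Dec r) (h, \<sigma>, out) 1 (h, \<sigma>(r := \<sigma> r - 1), out)"
| exEmit: "exec x (Emit b) (h, \<sigma>, out) 1 (h, \<sigma>, out @ [b])"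
| exInRight: "exec x InRight (h, \<sigma>, out) 1 (h + 1, \<sigma>, out)"
| exInLeft: "exec x InLeft (h, \<sigma>, out) 1 (h - 1, \<sigma>, out)"
| exSkip: "exec x Skip s 0 s"
| exSeq: "exec x c1 s n1 s1 \<Longrightarrow> exec x c2 s1 n2 s2 \<Longrightarrow> exec x (Seq c1 c2) s (n1 + n2) s2"
| exCondT: "holds x b s \<Longrightarrow> exec x c1 s n s1 \<Longrightarrow> exec x (Cond b c1 c2) s (n + 2) s1"
| exCondF: "\<not> holds x b s \<Longrightarrow> exec x c2 s n s1 \<Longrightarrow> exec x (Cond b c1 c2) s (n + 1) s1"
| exWhileT: "holds x b s \<Longrightarrow> exec x c s n1 s1 \<Longrightarrow> exec x (While b c) s1 n2 s2
    \<Longrightarrow> exec x (While b c) s (n1 + n2 + 2) s2"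
| exWhileF: "\<not> holds x b s \<Longrightarrow> exec x (While b c) s 1 s"

text \<open>An instruction reads one tape; depending on the symbol it writes, moves and jumps.\<close>

type_synonym instr = "nat \<times> (nat \<Rightarrow> nat \<times> move \<times> nat)"

fun csize :: "cmd \<Rightarrow> nat" where
  "csize (Inc r) = 2"
| "csize Skip = 0"
| "csize (Seq c1 c2) = csize c1 + csize c2"
| "csize (Cond b c1 c2) = csize c1 + csize c2 + 2"
| "csize (While b c) = csize c + 2"
| "csize _ = 1"

fun cond_tape :: "cond \<Rightarrow> nat" where
  "cond_tape (RegPos r) = Suc r"
| "cond_tape _ = 0"

fun cond_sym :: "cond \<Rightarrow> nat \<Rightarrow> bool" where
  "cond_sym InTrue a \<longleftrightarrow> a = 2"
| "cond_sym _ a \<longleftrightarrow> a \<noteq> 0"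

text \<open>Jump targets are absolute, so the start address \<open>n\<close> is passed along. Tape 0
  is the input, tape \<open>Suc r\<close> the register \<open>r\<close>, and tape
  \<open>Suc k\<close> the output, which is the last one.\<close>

fun compile :: "nat \<Rightarrow> cmd \<Rightarrow> nat \<Rightarrow> instr list" where
  "compile k (Inc r) n = [(Suc r, \<lambda>a. (a, Move_Right, n + 1)), (Suc r, \<lambda>a. (1, Stay, n + 2))]"
| "compile k (Dec r) n = [(Suc r, \<lambda>a. if a = 0 then (0, Stay, n + 1) else (0, Move_Left, n + 1))]"
| "compile k (Emit b) n = [(Suc k, \<lambda>a. (if b then 2 else 1, Move_Right, n + 1))]"
| "compile k InRight n = [(0, \<lambda>a. (a, Move_Right, n + 1))]"
| "compile k InLeft n = [(0, \<lambda>a. (a, Move_Left, n + 1))]"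
| "compile k Skip n = []"
| "compile k (Seq c1 c2) n = compile k c1 n @ compile k c2 (n + csize c1)"
| "compile k (Cond b c1 c2) n =
     (cond_tape b, \<lambda>a. (a, Stay, if cond_sym b a then n + 1 else n + 2 + csize c1))
     # compile k c1 (n + 1) @ (0, \<lambda>a. (a, Stay, n + 2 + csize c1 + csize c2))
     # compile k c2 (n + 2 + csize c1)"
| "compile k (While b c) n =
     (cond_tape b, \<lambda>a. (a, Stay, if cond_sym b a then n + 1 else n + 2 + csize c))
     # compile k c (n + 1) @ [(0, \<lambda>a. (a, Stay, n))]"

lemma length_compile [simp]: "length (compile k c n) = csize c"
  by (induction c arbitrary: n) auto

text \<open>Restricting the read symbols to the blank and the two bits keeps the transition set
  finite. No transition leaves the state \<open>length P\<close>, so running off the end of the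
  program halts.\<close>

definition machine :: "nat \<Rightarrow> instr list \<Rightarrow> tm" where
  "machine k P = \<lparr>tape_count = k + 2, transitions =
     {(q, rs, q', as). q < length P \<and> set rs \<subseteq> {..2} \<and> length rs = k + 2 \<and>
        (case P ! q of (i, f) \<Rightarrow> case f (rs ! i) of (w, m, r) \<Rightarrow>
           q' = r \<and> as = (map (\<lambda>a. (a, Stay)) rs)[i := (w, m)])}\<rparr>"

lemma deterministic_machine: "deterministic (machine k P)"
  by (auto simp: deterministic_def machine_def split: prod.splits)

lemma wf_machine: "wf_tm (machine k P)"
proof -
  let ?R = "{rs. set rs \<subseteq> {..2::nat} \<and> length rs = k + 2}"
  let ?h = "\<lambda>(q, rs). case P ! q of (i, f) \<Rightarrow> case f (rs ! i) of (w, m, r) \<Rightarrow>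
      (q, rs, r, (map (\<lambda>a. (a, Stay)) rs)[i := (w, m)])"
  have "transitions (machine k P) \<subseteq> ?h ` ({..<length P} \<times> ?R)"
    by (force simp: machine_def image_iff split: prod.splits)
  moreover have "finite ?R" by (rule finite_lists_length_eq) simp
  ultimately have "finite (transitions (machine k P))"
    by (meson finite_SigmaI finite_imageI finite_lessThan finite_subset)
  then show ?thesis by (auto simp: wf_tm_def machine_def split: prod.splits)
qed

text \<open>Unary notation with the head on the last mark. Cell 0 stays blank, so the head sees a
  blank exactly if the value is 0, and incrementing or decrementing touches only the cells at the
  head.\<close>

definition reg_tape :: "nat \<Rightarrow> tape" where
  "reg_tape v = (int v, \<lambda>i. if 1 \<le> i \<and> i \<le> int v then 1 else 0)"

fun rep :: "nat \<Rightarrow> bool list \<Rightarrow> cstate \<Rightarrow> tape list" where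
  "rep k x (h, \<sigma>, out) = (h, string_contents x) # map (\<lambda>r. reg_tape (\<sigma> r)) [0..<k]
     @ [(int (length out), string_contents out)]"

lemma length_rep [simp]: "length (rep k x s) = k + 2"
  by (cases s) auto

lemma string_contents_le: "string_contents x i \<le> 2"
  by (simp add: string_contents_def)

lemma read_rep_le: "set (map read_tape (rep k x s)) \<subseteq> {..2}"
  by (cases s) (auto simp: reg_tape_def string_contents_le)

lemma act_tape_id: "act_tape (read_tape t, Stay) t = t"
  by (cases t) auto

lemma machine_step:
  assumes "q < length P" "P ! q = (i, f)" "set (map read_tape ts) \<subseteq> {..2}" "length ts = k + 2"
    and "i < k + 2" "f (read_tape (ts ! i)) = (w, m, r)"
  shows "tm_step (machine k P) (q, ts) (r, ts[i := act_tape (w, m) (ts ! i)])"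
proof -
  let ?as = "(map (\<lambda>a. (a, Stay)) (map read_tape ts))[i := (w, m)]"
  have "(q, map read_tape ts, r, ?as) \<in> transitions (machine k P)"
    using assms by (simp add: machine_def)
  then have "tm_step (machine k P) (q, ts) (r, map2 act_tape ?as ts)"
    by (rule tm_step.intros)
  also have "map2 act_tape ?as ts = ts[i := act_tape (w, m) (ts ! i)]"
    by (rule nth_equalityI) (use assms in \<open>auto simp: nth_list_update act_tape_id\<close>)
  finally show ?thesis .
qed

fun regs_below :: "nat \<Rightarrow> cmd \<Rightarrow> bool" where
  "regs_below k (Inc r) \<longleftrightarrow> r < k"
| "regs_below k (Dec r) \<longleftrightarrow> r < k"
| "regs_below k (Seq c1 c2) \<longleftrightarrow> regs_below k c1 \<and> regs_below k c2"
| "regs_below k (Cond b c1 c2) \<longleftrightarrow> cond_tape b \<le> k \<and> regs_below k c1 \<and> regs_below k c2"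
| "regs_below k (While b c) \<longleftrightarrow> cond_tape b \<le> k \<and> regs_below k c"
| "regs_below k _ \<longleftrightarrow> True"

lemma read_rep_cond:
  assumes "cond_tape b \<le> k"
  shows "cond_sym b (read_tape (rep k x s ! cond_tape b)) \<longleftrightarrow> holds x b s"
  using assms by (cases s; cases b) (auto simp: nth_append reg_tape_def)

lemma relpowp_one_step:
  fixes R :: "'a \<Rightarrow> 'a \<Rightarrow> bool"
  shows "R a b \<Longrightarrow> (R ^^ 1) a b"
  using relpowp_Suc_I[OF relpowp_0_I, of R a b] by (simp only: One_nat_def)

lemma relpowp_trans:
  fixes R :: "'a \<Rightarrow> 'a \<Rightarrow> bool"
  shows "(R ^^ m) a b \<Longrightarrow> (R ^^ n) b c \<Longrightarrow> (R ^^ (m + n)) a c"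
  by (auto simp: relpowp_add)

definition code_at :: "instr list \<Rightarrow> nat \<Rightarrow> instr list \<Rightarrow> bool" where
  "code_at P n is \<longleftrightarrow> n + length is \<le> length P \<and> (\<forall>i<length is. P ! (n + i) = is ! i)"

lemma code_at_Cons: "code_at P n (i # is) \<longleftrightarrow> (n < length P \<and> P ! n = i) \<and> code_at P (Suc n) is"
  by (auto simp: code_at_def All_less_Suc2)

lemma code_at_append: "code_at P n (is1 @ is2) \<longleftrightarrow> code_at P n is1 \<and> code_at P (n + length is1) is2"
proof (induction is1 arbitrary: n)
  case Nil
  then show ?case by (auto simp: code_at_def)
next
  case (Cons i is1)
  then show ?case by (simp add: code_at_Cons conj_assoc)
qed

text \<open>The induction follows the derivation of \<open>exec\<close> and not the command, so that
  a loop is covered by the rule for one round followed by the remaining loop at the same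
  address.\<close>

lemma compile_exec:
  assumes "exec x c s t s'"
  shows "regs_below k c \<Longrightarrow> code_at P n (compile k c n) \<Longrightarrow>
    (tm_step (machine k P) ^^ t) (n, rep k x s) (n + csize c, rep k x s')"
  using assms
proof (induction arbitrary: n rule: exec.induct)
  case (exInc r h \<sigma> out)
  let ?ts = "rep k x (h, \<sigma>, out)"
  let ?ts1 = "?ts[Suc r := act_tape (read_tape (?ts ! Suc r), Move_Right) (?ts ! Suc r)]"
  have r: "r < k" and P: "n < length P" "P ! n = (Suc r, \<lambda>a. (a, Move_Right, n + 1))"
    "Suc n < length P" "P ! Suc n = (Suc r, \<lambda>a. (1, Stay, n + 2))"
    using exInc by (auto simp: code_at_Cons)
  have nth: "?ts ! Suc r = reg_tape (\<sigma> r)" using r by (simp add: nth_append)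
  have 1: "tm_step (machine k P) (n, ?ts) (n + 1, ?ts1)"
    by (rule machine_step[OF P(1,2) read_rep_le]) (use r in auto)
  \<comment> \<open>Between its two steps an increment leaves a tape that represents no register, so
    \<open>read_rep_le\<close> does not apply to it and the symbols have to be bounded by
    hand.\<close>
  have "set (map read_tape (us[i := u])) \<subseteq> {..2}"
    if "set (map read_tape us) \<subseteq> {..2}" "read_tape u \<le> 2" for us i u
    using that set_update_subset_insert[of "map read_tape us" i "read_tape u"] unfolding map_update by fastforce
  from this[OF read_rep_le] have "set (map read_tape ?ts1) \<subseteq> {..2}"
    unfolding nth by (auto simp: reg_tape_def simp del: rep.simps)
  then have 2: "tm_step (machine k P) (n + 1, ?ts1)
      (n + 2, ?ts1[Suc r := act_tape (1, Stay) (?ts1 ! Suc r)])"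
    by (intro machine_step) (use r P in auto)
  have 3: "act_tape (1, Stay) (?ts1 ! Suc r) = reg_tape (Suc (\<sigma> r))"
    unfolding nth using r by (auto simp: reg_tape_def fun_eq_iff)
  have "?ts1[Suc r := reg_tape (Suc (\<sigma> r))] = rep k x (h, \<sigma>(r := Suc (\<sigma> r)), out)"
    by (rule nth_equalityI) (use r in \<open>auto simp: nth_list_update nth_append nth_Cons split: nat.splits\<close>)
  with 1 2 3 show ?case
    by (auto simp: numeral_2_eq_2)
next
  case (exDec r h \<sigma> out)
  let ?ts = "rep k x (h, \<sigma>, out)"
  have r: "r < k" and P: "n < length P"
    "P ! n = (Suc r, \<lambda>a. if a = 0 then (0, Stay, n + 1) else (0, Move_Left, n + 1))"
    using exDec by (auto simp: code_at_Cons)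
  have nth: "?ts ! Suc r = reg_tape (\<sigma> r)" using r by (simp add: nth_append)
  have rd: "read_tape (?ts ! Suc r) = (if \<sigma> r = 0 then 0 else 1)"
    unfolding nth by (simp add: reg_tape_def)
  define mv where "mv = (if \<sigma> r = 0 then Stay else Move_Left)"
  have 1: "tm_step (machine k P) (n, ?ts) (n + 1, ?ts[Suc r := act_tape (0, mv) (?ts ! Suc r)])"
    by (rule machine_step[OF P(1,2) read_rep_le]) (use r rd in \<open>simp_all add: mv_def del: rep.simps\<close>)
  have 3: "act_tape (0, mv) (?ts ! Suc r) = reg_tape (\<sigma> r - 1)"
    unfolding nth by (auto simp: reg_tape_def fun_eq_iff mv_def of_nat_diff)
  have "?ts[Suc r := reg_tape (\<sigma> r - 1)] = rep k x (h, \<sigma>(r := \<sigma> r - 1), out)"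
    by (rule nth_equalityI) (use r in \<open>auto simp: nth_list_update nth_append nth_Cons split: nat.splits\<close>)
  with 1 3 show ?case by (auto intro: relpowp_one_step)
next
  case (exEmit b h \<sigma> out)
  let ?ts = "rep k x (h, \<sigma>, out)"
  have P: "n < length P" "P ! n = (Suc k, \<lambda>a. (if b then 2 else 1, Move_Right, n + 1))"
    using exEmit by (auto simp: code_at_Cons)
  have nth: "?ts ! Suc k = (int (length out), string_contents out)" by (simp add: nth_append)
  have 1: "tm_step (machine k P) (n, ?ts)
      (n + 1, ?ts[Suc k := act_tape (if b then 2 else 1, Move_Right) (?ts ! Suc k)])"
    by (rule machine_step[OF P(1,2) read_rep_le]) auto
  have 3: "act_tape (if b then 2 else 1, Move_Right) (?ts ! Suc k)
      = (int (length (out @ [b])), string_contents (out @ [b]))"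
    unfolding nth by (auto simp: string_contents_def fun_eq_iff nth_append)
  have "?ts[Suc k := (int (length (out @ [b])), string_contents (out @ [b]))] = rep k x (h, \<sigma>, out @ [b])"
    by (simp add: list_update_append)
  with 1 3 show ?case by (auto intro: relpowp_one_step)
next
  case (exInRight h \<sigma> out)
  have P: "n < length P" "P ! n = (0, \<lambda>a. (a, Move_Right, n + 1))"
    using exInRight by (auto simp: code_at_Cons)
  have "tm_step (machine k P) (n, rep k x (h, \<sigma>, out)) (n + 1, (rep k x (h, \<sigma>, out))
     [0 := act_tape (string_contents x h, Move_Right) (rep k x (h, \<sigma>, out) ! 0)])"
    by (rule machine_step[OF P read_rep_le]) auto
  then show ?case by (auto intro: relpowp_one_step)
next
  case (exInLeft h \<sigma> out)
  have P: "n < length P" "P ! n = (0, \<lambda>a. (a, Move_Left, n + 1))"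
    using exInLeft by (auto simp: code_at_Cons)
  have "tm_step (machine k P) (n, rep k x (h, \<sigma>, out)) (n + 1, (rep k x (h, \<sigma>, out))
     [0 := act_tape (string_contents x h, Move_Left) (rep k x (h, \<sigma>, out) ! 0)])"
    by (rule machine_step[OF P read_rep_le]) auto
  then show ?case by (auto intro: relpowp_one_step)
next
  case (exSkip s)
  then show ?case by auto
next
  case (exSeq c1 s n1 s1 c2 n2 s2)
  from exSeq.prems have c: "regs_below k c1" "regs_below k c2" "code_at P n (compile k c1 n)"
    "code_at P (n + csize c1) (compile k c2 (n + csize c1))"
    by (auto simp: code_at_append)
  from relpowp_trans[OF exSeq.IH(1)[OF c(1,3)] exSeq.IH(2)[OF c(2,4)]] show ?case
    by (simp add: add.assoc)
next
  case (exCondT b s c1 t s1 c2)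
  have P: "n < length P" "P ! n = (cond_tape b, \<lambda>a. (a, Stay, if cond_sym b a then n + 1 else n + 2 + csize c1))"
    "code_at P (n + 1) (compile k c1 (n + 1))"
    "n + 1 + csize c1 < length P" "P ! (n + 1 + csize c1) = (0, \<lambda>a. (a, Stay, n + 2 + csize c1 + csize c2))"
    using exCondT.prems by (auto simp: code_at_Cons code_at_append)
  have b: "cond_tape b \<le> k" using exCondT.prems by auto
  have "tm_step (machine k P) (n, rep k x s) (n + 1, (rep k x s)[cond_tape b := act_tape (read_tape (rep k x s ! cond_tape b), Stay) (rep k x s ! cond_tape b)])"
    by (rule machine_step[OF P(1,2) read_rep_le]) (use b exCondT.hyps in \<open>auto simp: read_rep_cond\<close>)
  then have 1: "tm_step (machine k P) (n, rep k x s) (n + 1, rep k x s)" by (simp add: act_tape_id)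
  have 2: "(tm_step (machine k P) ^^ t) (n + 1, rep k x s) (n + 1 + csize c1, rep k x s1)"
    using exCondT.IH[of "n + 1"] P(3) exCondT.prems(1) by simp
  have "tm_step (machine k P) (n + 1 + csize c1, rep k x s1) (n + 2 + csize c1 + csize c2, (rep k x s1)[0 := act_tape (read_tape (rep k x s1 ! 0), Stay) (rep k x s1 ! 0)])"
    by (rule machine_step[OF P(4,5) read_rep_le]) auto
  then have 3: "tm_step (machine k P) (n + 1 + csize c1, rep k x s1) (n + 2 + csize c1 + csize c2, rep k x s1)"
    by (simp add: act_tape_id)
  from relpowp_Suc_I[OF 2 3] have "(tm_step (machine k P) ^^ Suc t) (n + 1, rep k x s) (n + 2 + csize c1 + csize c2, rep k x s1)" .
  from relpowp_Suc_I2[OF 1 this] show ?case by (simp add: ac_simps)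
next
  case (exCondF b s c2 t s1 c1)
  have P: "n < length P" "P ! n = (cond_tape b, \<lambda>a. (a, Stay, if cond_sym b a then n + 1 else n + 2 + csize c1))"
    "code_at P (n + 2 + csize c1) (compile k c2 (n + 2 + csize c1))"
    using exCondF.prems by (auto simp: code_at_Cons code_at_append)
  have b: "cond_tape b \<le> k" using exCondF.prems by auto
  have "tm_step (machine k P) (n, rep k x s) (n + 2 + csize c1, (rep k x s)[cond_tape b := act_tape (read_tape (rep k x s ! cond_tape b), Stay) (rep k x s ! cond_tape b)])"
    by (rule machine_step[OF P(1,2) read_rep_le]) (use b exCondF.hyps in \<open>auto simp: read_rep_cond\<close>)
  then have 1: "tm_step (machine k P) (n, rep k x s) (n + 2 + csize c1, rep k x s)" by (simp add: act_tape_id)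
  have 2: "(tm_step (machine k P) ^^ t) (n + 2 + csize c1, rep k x s) (n + 2 + csize c1 + csize c2, rep k x s1)"
    using exCondF.IH[of "n + 2 + csize c1"] P(3) exCondF.prems(1) by simp
  from relpowp_Suc_I2[OF 1 2] show ?case by (simp add: ac_simps)
next
  case (exWhileT b s c n1 s1 n2 s2)
  have P: "n < length P" "P ! n = (cond_tape b, \<lambda>a. (a, Stay, if cond_sym b a then n + 1 else n + 2 + csize c))"
    "code_at P (n + 1) (compile k c (n + 1))"
    "n + 1 + csize c < length P" "P ! (n + 1 + csize c) = (0, \<lambda>a. (a, Stay, n))"
    using exWhileT.prems by (auto simp: code_at_Cons code_at_append)
  have b: "cond_tape b \<le> k" using exWhileT.prems by auto
  have "tm_step (machine k P) (n, rep k x s) (n + 1, (rep k x s)[cond_tape b := act_tape (read_tape (rep k x s ! cond_tape b), Stay) (rep k x s ! cond_tape b)])"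
    by (rule machine_step[OF P(1,2) read_rep_le]) (use b exWhileT.hyps in \<open>auto simp: read_rep_cond\<close>)
  then have 1: "tm_step (machine k P) (n, rep k x s) (n + 1, rep k x s)" by (simp add: act_tape_id)
  have 2: "(tm_step (machine k P) ^^ n1) (n + 1, rep k x s) (n + 1 + csize c, rep k x s1)"
    using exWhileT.IH(1)[of "n + 1"] P(3) exWhileT.prems(1) by simp
  have "tm_step (machine k P) (n + 1 + csize c, rep k x s1) (n, (rep k x s1)[0 := act_tape (read_tape (rep k x s1 ! 0), Stay) (rep k x s1 ! 0)])"
    by (rule machine_step[OF P(4,5) read_rep_le]) auto
  then have 3: "tm_step (machine k P) (n + 1 + csize c, rep k x s1) (n, rep k x s1)"
    by (simp add: act_tape_id)
  have 4: "(tm_step (machine k P) ^^ n2) (n, rep k x s1) (n + csize (While b c), rep k x s2)"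
    using exWhileT.IH(2) exWhileT.prems by blast
  from relpowp_trans[OF relpowp_Suc_I2[OF 1 relpowp_Suc_I[OF 2 3]] 4] show ?case by (simp add: ac_simps)
next
  case (exWhileF b s c)
  have P: "n < length P" "P ! n = (cond_tape b, \<lambda>a. (a, Stay, if cond_sym b a then n + 1 else n + 2 + csize c))"
    using exWhileF.prems by (auto simp: code_at_Cons code_at_append)
  have b: "cond_tape b \<le> k" using exWhileF.prems by auto
  have "tm_step (machine k P) (n, rep k x s) (n + 2 + csize c, (rep k x s)[cond_tape b := act_tape (read_tape (rep k x s ! cond_tape b), Stay) (rep k x s ! cond_tape b)])"
    by (rule machine_step[OF P(1,2) read_rep_le]) (use b exWhileF.hyps in \<open>auto simp: read_rep_cond\<close>)
  then have 1: "tm_step (machine k P) (n, rep k x s) (n + 2 + csize c, rep k x s)" by (simp add: act_tape_id)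
  then show ?case by (auto simp: ac_simps intro: relpowp_one_step)
qed

lemma deterministic_step:
  assumes "deterministic M" "tm_step M c c1" "tm_step M c c2" shows "c1 = c2"
proof -
  from assms(2) obtain q ts q1 as1 where 1: "c = (q, ts)" "c1 = (q1, map2 act_tape as1 ts)"
    "(q, map read_tape ts, q1, as1) \<in> transitions M" by (auto elim: tm_step.cases)
  with assms(3) obtain q2 as2 where 2: "c2 = (q2, map2 act_tape as2 ts)"
    "(q, map read_tape ts, q2, as2) \<in> transitions M" by (auto elim: tm_step.cases)
  from assms(1) 1(3) 2(2) have "q1 = q2 \<and> as1 = as2" unfolding deterministic_def by blast
  with 1 2 show ?thesis by simp
qed

text \<open>\<open>runs_in_time\<close> bounds every computation from the initial configuration. For
  a deterministic machine one halting computation is enough, because all others are prefixes of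
  it.\<close>

lemma deterministic_halting_time:
  assumes "deterministic M"
  shows "(tm_step M ^^ t0) c c0 \<Longrightarrow> halted M c0 \<Longrightarrow> (tm_step M ^^ t) c d \<Longrightarrow> t \<le> t0"
proof (induction t0 arbitrary: c t)
  case 0
  then have "halted M c" by simp
  show ?case
  proof (cases t)
    case (Suc t')
    with 0 obtain c1 where "tm_step M c c1" by (metis relpowp_Suc_E2)
    with \<open>halted M c\<close> show ?thesis unfolding halted_def by blast
  qed simp
next
  case (Suc t0)
  show ?case
  proof (cases t)
    case (Suc t')
    from Suc.prems(1) obtain c1 where c1: "tm_step M c c1" "(tm_step M ^^ t0) c1 c0"
      by (rule relpowp_Suc_E2)
    from Suc.prems(3) Suc obtain c2 where c2: "tm_step M c c2" "(tm_step M ^^ t') c2 d"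
      by (metis relpowp_Suc_E2)
    from deterministic_step[OF assms c1(1) c2(1)] Suc.IH[OF c1(2) Suc.prems(2)] c2(2) Suc
    show ?thesis by auto
  qed simp
qed

lemma string_contents_Nil: "string_contents [] = (\<lambda>_. 0)"
  by (auto simp: string_contents_def)

theorem polytime_computable_cmd:
  assumes "regs_below k c"
    and "\<And>x. \<exists>t h \<sigma>. t \<le> poly p (length x) \<and> exec x c (0, \<lambda>_. 0, []) t (h, \<sigma>, f x)"
  shows "polytime_computable f"
proof -
  define P where "P = compile k c 0"
  define M where "M = machine k P"
  have init: "initial_config M x = (0, rep k x (0, \<lambda>_. 0, []))" for x
  proof -
    have "reg_tape 0 = (0, \<lambda>_. 0)" by (auto simp: reg_tape_def)
    then show ?thesis
      by (simp add: initial_config_def M_def machine_def string_contents_Nil map_replicate_const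
          replicate_append_same)
  qed
  have halt: "halted M (length P, ts)" for ts
    by (auto simp: halted_def M_def machine_def elim!: tm_step.cases)
  have run: "\<exists>t c'. t \<le> poly p (length x) \<and> (tm_step M ^^ t) (initial_config M x) c' \<and> halted M c' \<and>
      snd (last (snd c')) = string_contents (f x)" for x
  proof -
    obtain t h \<sigma> where t: "t \<le> poly p (length x)" "exec x c (0, \<lambda>_. 0, []) t (h, \<sigma>, f x)"
      using assms(2) by blast
    have "(tm_step M ^^ t) (0, rep k x (0, \<lambda>_. 0, [])) (0 + csize c, rep k x (h, \<sigma>, f x))"
      unfolding M_def by (rule compile_exec[OF t(2) assms(1)]) (auto simp: P_def code_at_def)
    moreover have "csize c = length P" by (simp add: P_def)
    ultimately show ?thesis using t(1) halt unfolding init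
      by (intro exI[of _ t] exI[of _ "(length P, rep k x (h, \<sigma>, f x))"]) auto
  qed
  have det: "deterministic M" by (simp add: M_def deterministic_machine)
  have "runs_in_time M p"
    unfolding runs_in_time_def
    by (meson deterministic_halting_time[OF det] le_trans run)
  moreover have "wf_tm M" by (simp add: M_def wf_machine)
  ultimately show ?thesis using det run unfolding polytime_computable_def by blast
qed

section \<open>Arithmetic expressions over the input and their evaluation in polynomial time\<close>

datatype ex = Cn nat | Vr nat | Len | Inp ex | Add ex ex | Mul ex ex | Sub ex ex

fun ev :: "bool list \<Rightarrow> (nat \<Rightarrow> nat) \<Rightarrow> ex \<Rightarrow> nat" where
  "ev x \<sigma> (Cn n) = n"
| "ev x \<sigma> (Vr i) = \<sigma> i"
| "ev x \<sigma> Len = length x"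
| "ev x \<sigma> (Inp e) = string_contents x (int (ev x \<sigma> e))"
| "ev x \<sigma> (Add a b) = ev x \<sigma> a + ev x \<sigma> b"
| "ev x \<sigma> (Mul a b) = ev x \<sigma> a * ev x \<sigma> b"
| "ev x \<sigma> (Sub a b) = ev x \<sigma> a - ev x \<sigma> b"

fun vars_below :: "nat \<Rightarrow> ex \<Rightarrow> bool" where
  "vars_below n (Vr i) \<longleftrightarrow> i < n"
| "vars_below n (Inp e) \<longleftrightarrow> vars_below n e"
| "vars_below n (Add a b) \<longleftrightarrow> vars_below n a \<and> vars_below n b"
| "vars_below n (Mul a b) \<longleftrightarrow> vars_below n a \<and> vars_below n b"
| "vars_below n (Sub a b) \<longleftrightarrow> vars_below n a \<and> vars_below n b"
| "vars_below n _ \<longleftrightarrow> True"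

lemma ev_cong: "vars_below n e \<Longrightarrow> (\<And>r. r < n \<Longrightarrow> \<sigma> r = \<tau> r) \<Longrightarrow> ev x \<sigma> e = ev x \<tau> e"
  by (induction e) auto

text \<open>Adds the value to register \<open>d\<close>. The registers from \<open>t\<close> on are
  scratch space, zero before and after, and the input head returns to cell 0. Reading a variable
  empties its register, so the value is copied to \<open>t\<close> as well and then restored;
  reading the input length or an input symbol records the distance walked in order to walk
  back.\<close>

fun cmd_ex :: "ex \<Rightarrow> nat \<Rightarrow> nat \<Rightarrow> cmd" where
  "cmd_ex (Cn n) d t = (Seq (Inc d) ^^ n) Skip"
| "cmd_ex (Vr i) d t = Seq (While (RegPos i) (Seq (Dec i) (Seq (Inc d) (Inc t))))
     (While (RegPos t) (Seq (Dec t) (Inc i)))"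
| "cmd_ex Len d t = Seq (While InNonblank (Seq InRight (Seq (Inc d) (Inc t))))
     (While (RegPos t) (Seq (Dec t) InLeft))"
| "cmd_ex (Inp e) d t = Seq (cmd_ex e t (t + 1))
     (Seq (While (RegPos t) (Seq (Dec t) (Seq InRight (Inc (t + 1)))))
     (Seq (Cond InTrue (Seq (Inc d) (Inc d)) (Cond InNonblank (Inc d) Skip))
     (While (RegPos (t + 1)) (Seq (Dec (t + 1)) InLeft))))"
| "cmd_ex (Add a b) d t = Seq (cmd_ex a d t) (cmd_ex b d t)"
| "cmd_ex (Mul a b) d t = Seq (cmd_ex a t (t + 1))
     (While (RegPos t) (Seq (Dec t) (cmd_ex b d (t + 1))))"
| "cmd_ex (Sub a b) d t = Seq (cmd_ex a t (t + 1)) (Seq (cmd_ex b (t + 1) (t + 2))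
     (Seq (While (RegPos (t + 1)) (Seq (Dec (t + 1)) (Dec t)))
     (While (RegPos t) (Seq (Dec t) (Inc d)))))"

definition exec_within :: "bool list \<Rightarrow> cmd \<Rightarrow> cstate \<Rightarrow> nat \<Rightarrow> cstate \<Rightarrow> bool" where
  "exec_within x c s n s' \<longleftrightarrow> (\<exists>m\<le>n. exec x c s m s')"

lemma within_mono: "exec_within x c s n s' \<Longrightarrow> n \<le> n' \<Longrightarrow> exec_within x c s n' s'"
  unfolding exec_within_def by (meson le_trans)

lemma within_Seq: "exec_within x c1 s n1 s1 \<Longrightarrow> exec_within x c2 s1 n2 s2 \<Longrightarrow>
    exec_within x (Seq c1 c2) s (n1 + n2) s2"
  unfolding exec_within_def by (meson add_mono exSeq)

lemma within_CondT: "holds x b s \<Longrightarrow> exec_within x c1 s n s1 \<Longrightarrow> exec_within x (Cond b c1 c2) s (n + 2) s1"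
  unfolding exec_within_def by (meson add_le_mono1 exCondT)

lemma within_CondF: "\<not> holds x b s \<Longrightarrow> exec_within x c2 s n s1 \<Longrightarrow> exec_within x (Cond b c1 c2) s (n + 1) s1"
  unfolding exec_within_def by (meson add_le_mono1 exCondF)

lemma within_prim:
  "s' = (h, \<sigma>(r := Suc (\<sigma> r)), out) \<Longrightarrow> exec_within x (Inc r) (h, \<sigma>, out) 2 s'"
  "s' = (h, \<sigma>(r := \<sigma> r - 1), out) \<Longrightarrow> exec_within x (Dec r) (h, \<sigma>, out) 1 s'"
  "s' = (h, \<sigma>, out @ [b]) \<Longrightarrow> exec_within x (Emit b) (h, \<sigma>, out) 1 s'"
  "s' = (h + 1, \<sigma>, out) \<Longrightarrow> exec_within x InRight (h, \<sigma>, out) 1 s'"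
  "s' = (h - 1, \<sigma>, out) \<Longrightarrow> exec_within x InLeft (h, \<sigma>, out) 1 s'"
  "s' = s \<Longrightarrow> exec_within x Skip s 0 s'"
  unfolding exec_within_def by (auto simp del: One_nat_def intro: exec.intros)

text \<open>\<open>S k\<close> is the state with \<open>k\<close> rounds left, so a loop is verified
  by exhibiting the states as a function of the remaining rounds.\<close>

lemma within_While:
  assumes "\<And>k. k \<le> N \<Longrightarrow> holds x b (S k) \<longleftrightarrow> k > 0"
    and "\<And>k. k < N \<Longrightarrow> exec_within x c (S (Suc k)) n (S k)"
  shows "exec_within x (While b c) (S N) (N * (n + 2) + 1) (S 0)"
  using assms
proof (induction N)
  case 0
  then show ?case unfolding exec_within_def by (intro exI[of _ 1]) (auto simp del: One_nat_def intro: exWhileF)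
next
  case (Suc N)
  then have "exec_within x (While b c) (S N) (N * (n + 2) + 1) (S 0)"
    by (meson le_SucI less_SucI)
  then obtain m where m: "m \<le> N * (n + 2) + 1" "exec x (While b c) (S N) m (S 0)"
    by (auto simp: exec_within_def)
  from Suc.prems(2)[of N] obtain l where l: "l \<le> n" "exec x c (S (Suc N)) l (S N)"
    by (auto simp: exec_within_def)
  have "exec x (While b c) (S (Suc N)) (l + m + 2) (S 0)"
    by (rule exWhileT[OF _ l(2) m(2)]) (use Suc.prems(1)[of "Suc N"] in simp)
  with l m show ?case unfolding exec_within_def by (intro exI[of _ "l + m + 2"]) auto
qed

text \<open>Bounds of the form (B + 2) ^ K are closed under all the operations that occur.\<close>

lemma pow_const: "c \<le> (B + 2) ^ c" for B :: nat
proof -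
  have "c < 2 ^ c" by (rule less_exp)
  also have "2 ^ c \<le> (B + 2) ^ c" by (rule power_mono) auto
  finally show ?thesis by simp
qed

lemma pow_add: "a \<le> (B + 2) ^ K \<Longrightarrow> b \<le> (B + 2) ^ L \<Longrightarrow> a + b \<le> (B + 2) ^ (K + L + 1)" for B :: nat
proof -
  assume *: "a \<le> (B + 2) ^ K" "b \<le> (B + 2) ^ L"
  have "(B + 2) ^ K \<le> (B + 2) ^ (K + L)" "(B + 2) ^ L \<le> (B + 2) ^ (K + L)"
    by (auto intro: power_increasing)
  with * have "a + b \<le> 2 * (B + 2) ^ (K + L)" by linarith
  also have "\<dots> \<le> (B + 2) ^ (K + L + 1)" by simp
  finally show ?thesis .
qed

lemma pow_mult: "a \<le> (B + 2) ^ K \<Longrightarrow> b \<le> (B + 2) ^ L \<Longrightarrow> a * b \<le> (B + 2) ^ (K + L)" for B :: nat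
  by (simp add: power_add mult_le_mono)

lemma pow_var: "B \<le> (B + 2) ^ 1" for B :: nat
  by simp

lemma pow_le: "a \<le> (B + 2) ^ K \<Longrightarrow> K \<le> L \<Longrightarrow> a \<le> (B + 2) ^ L" for B :: nat
  by (meson le_add2 le_trans one_le_numeral power_increasing)

lemma ev_bound:
  assumes "vars_below n e"
  shows "\<exists>K. \<forall>x \<sigma> B. (\<forall>r<n. \<sigma> r \<le> B) \<longrightarrow> length x \<le> B \<longrightarrow> ev x \<sigma> e \<le> (B + 2) ^ K"
  using assms
proof (induction e)
  case (Cn c)
  then show ?case using pow_const by (intro exI[of _ c]) auto
next
  case (Vr i)
  then show ?case using le_trans[OF _ pow_var] by (intro exI[of _ 1]) auto
next
  case Len
  then show ?case using le_trans[OF _ pow_var] by (intro exI[of _ 1]) auto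
next
  case (Inp e)
  have "string_contents x i \<le> (B + 2) ^ 1" for x i and B :: nat
    using string_contents_le[of x i] by simp
  then show ?case by (intro exI[of _ 1]) auto
next
  case (Add a b)
  from Add obtain K where K: "\<forall>x \<sigma> B. (\<forall>r<n. \<sigma> r \<le> B) \<longrightarrow> length x \<le> B \<longrightarrow> ev x \<sigma> a \<le> (B + 2) ^ K" by auto
  from Add obtain L where L: "\<forall>x \<sigma> B. (\<forall>r<n. \<sigma> r \<le> B) \<longrightarrow> length x \<le> B \<longrightarrow> ev x \<sigma> b \<le> (B + 2) ^ L" by auto
  have "ev x \<sigma> (Add a b) \<le> (B + 2) ^ (K + L + 1)" if "\<forall>r<n. \<sigma> r \<le> B" "length x \<le> B" for x \<sigma> B
    using pow_add[of _ B K _ L] K L that by (simp del: power_Suc)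
  then show ?case by blast
next
  case (Mul a b)
  from Mul obtain K where K: "\<forall>x \<sigma> B. (\<forall>r<n. \<sigma> r \<le> B) \<longrightarrow> length x \<le> B \<longrightarrow> ev x \<sigma> a \<le> (B + 2) ^ K" by auto
  from Mul obtain L where L: "\<forall>x \<sigma> B. (\<forall>r<n. \<sigma> r \<le> B) \<longrightarrow> length x \<le> B \<longrightarrow> ev x \<sigma> b \<le> (B + 2) ^ L" by auto
  have "ev x \<sigma> (Mul a b) \<le> (B + 2) ^ (K + L)" if "\<forall>r<n. \<sigma> r \<le> B" "length x \<le> B" for x \<sigma> B
    using pow_mult[of _ B K _ L] K L that by simp
  then show ?case by blast
next
  case (Sub a b)
  from Sub obtain K where K: "\<forall>x \<sigma> B. (\<forall>r<n. \<sigma> r \<le> B) \<longrightarrow> length x \<le> B \<longrightarrow> ev x \<sigma> a \<le> (B + 2) ^ K" by auto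
  have "ev x \<sigma> (Sub a b) \<le> (B + 2) ^ K" if "\<forall>r<n. \<sigma> r \<le> B" "length x \<le> B" for x \<sigma> B
    using K that by (auto intro: le_trans[OF diff_le_self])
  then show ?case by blast
qed

text \<open>The exponent depends on the expression alone: it is uniform in the input, the register
  contents and the choice of scratch registers. Variables are the registers below \<open>n\<close>;
  their common bound \<open>B\<close> also bounds the input length.\<close>

definition ex_ok :: "nat \<Rightarrow> ex \<Rightarrow> nat \<Rightarrow> bool" where
  "ex_ok n e K \<longleftrightarrow> (\<forall>x \<sigma> out B d t. n \<le> d \<longrightarrow> d < t \<longrightarrow> (\<forall>r\<ge>t. \<sigma> r = 0) \<longrightarrow> (\<forall>r<n. \<sigma> r \<le> B) \<longrightarrow>
     length x \<le> B \<longrightarrow>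
     exec_within x (cmd_ex e d t) (0, \<sigma>, out) ((B + 2) ^ K) (0, \<sigma>(d := \<sigma> d + ev x \<sigma> e), out))"

lemma ex_okD:
  assumes "ex_ok n e K" "n \<le> d" "d < t" "\<And>r. r \<ge> t \<Longrightarrow> \<sigma> r = 0" "\<And>r. r < n \<Longrightarrow> \<sigma> r \<le> B" "length x \<le> B"
    and "s' = (0, \<sigma>(d := \<sigma> d + ev x \<sigma> e), out)"
  shows "exec_within x (cmd_ex e d t) (0, \<sigma>, out) ((B + 2) ^ K) s'"
  using assms unfolding ex_ok_def by blast

lemma ex_okI:
  assumes 1: "\<And>x \<sigma> out B d t. n \<le> d \<Longrightarrow> d < t \<Longrightarrow> \<forall>r\<ge>t. \<sigma> r = 0 \<Longrightarrow> \<forall>r<n. \<sigma> r \<le> B \<Longrightarrow> length x \<le> B \<Longrightarrow>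
     exec_within x (cmd_ex e d t) (0, \<sigma>, out) (m x \<sigma> B) (0, \<sigma>(d := \<sigma> d + ev x \<sigma> e), out)"
    and 2: "\<And>x \<sigma> B. \<forall>r<n. \<sigma> r \<le> B \<Longrightarrow> length x \<le> B \<Longrightarrow> m x \<sigma> B \<le> (B + 2) ^ K"
  shows "ex_ok n e K"
  unfolding ex_ok_def
proof (intro allI impI)
  fix x :: "bool list" and \<sigma> :: "nat \<Rightarrow> nat" and out B d t
  assume *: "n \<le> d" "d < t" "\<forall>r\<ge>t. \<sigma> r = 0" "\<forall>r<n. \<sigma> r \<le> B" "length x \<le> B"
  show "exec_within x (cmd_ex e d t) (0, \<sigma>, out) ((B + 2) ^ K) (0, \<sigma>(d := \<sigma> d + ev x \<sigma> e), out)"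
    by (rule within_mono[OF 1[OF *] 2[OF *(4,5)]])
qed

lemma within_subst: "exec_within x c s n s' \<Longrightarrow> s = t \<Longrightarrow> s' = t' \<Longrightarrow> exec_within x c t n t'"
  by simp

lemma ex_ok_Cn: "\<exists>K. ex_ok n (Cn c) K"
proof -
  have *: "exec_within x ((Seq (Inc d) ^^ c) Skip) (0, \<sigma>, out) (2 * c) (0, \<sigma>(d := \<sigma> d + c), out)"
    for x \<sigma> out d
  proof (induction c arbitrary: \<sigma>)
    case 0
    then show ?case by (auto intro: within_prim)
  next
    case (Suc c)
    have "exec_within x (Seq (Inc d) ((Seq (Inc d) ^^ c) Skip)) (0, \<sigma>, out) (2 + 2 * c)
      (0, (\<sigma>(d := Suc (\<sigma> d)))(d := (\<sigma>(d := Suc (\<sigma> d))) d + c), out)"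
      by (rule within_Seq[OF within_prim(1)[OF refl] Suc.IH])
    moreover have "(\<sigma>(d := Suc (\<sigma> d)))(d := (\<sigma>(d := Suc (\<sigma> d))) d + c) = \<sigma>(d := \<sigma> d + Suc c)"
      by (auto simp: fun_eq_iff)
    ultimately show ?case by (simp only: funpow.simps o_apply mult_Suc_right)
  qed
  have "2 * c \<le> (B + 2) ^ (2 * c)" for B :: nat by (rule pow_const)
  with * show ?thesis
    by (intro exI[of _ "2 * c"] ex_okI[where m = "\<lambda>_ _ _. 2 * c"]) simp_all
qed

lemma ex_ok_Vr: assumes "i < n" shows "\<exists>K. ex_ok n (Vr i) K"
proof -
  have *: "exec_within x (cmd_ex (Vr i) d t) (0, \<sigma>, out) ((\<sigma> i * (1 + (2 + 2) + 2) + 1) + (\<sigma> i * (1 + 2 + 2) + 1))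
     (0, \<sigma>(d := \<sigma> d + \<sigma> i), out)" if "n \<le> d" "d < t" "\<forall>r\<ge>t. \<sigma> r = 0" for x \<sigma> out d t
  proof -
    \<comment> \<open>In the first loop \<open>k\<close> units are left in register \<open>i\<close>
      and the others have been added to both \<open>d\<close> and \<open>t\<close>. In the second
      loop \<open>k\<close> units are left in \<open>t\<close> and the others have returned to
      \<open>i\<close>.\<close>
    define S where "S k = ((0::int), \<sigma>(i := k, d := \<sigma> d + (\<sigma> i - k), t := \<sigma> i - k), out)" for k
    define T where "T k = ((0::int), \<sigma>(i := \<sigma> i - k, d := \<sigma> d + \<sigma> i, t := k), out)" for k
    have d: "i \<noteq> d" "i \<noteq> t" "d \<noteq> t" using assms that by auto
    have 1: "exec_within x (While (RegPos i) (Seq (Dec i) (Seq (Inc d) (Inc t)))) (S (\<sigma> i))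
      (\<sigma> i * (1 + (2 + 2) + 2) + 1) (S 0)"
    proof (rule within_While)
      fix k assume k: "k < \<sigma> i"
      show "exec_within x (Seq (Dec i) (Seq (Inc d) (Inc t))) (S (Suc k)) (1 + (2 + 2)) (S k)"
        unfolding S_def by (rule within_Seq[OF within_prim(2)[OF refl] within_Seq[OF within_prim(1)[OF refl] within_prim(1)]]) (use k d in \<open>auto simp: fun_eq_iff\<close>)
    qed (use d in \<open>auto simp: S_def\<close>)
    have 2: "exec_within x (While (RegPos t) (Seq (Dec t) (Inc i))) (T (\<sigma> i))
      (\<sigma> i * (1 + 2 + 2) + 1) (T 0)"
    proof (rule within_While)
      fix k assume k: "k < \<sigma> i"
      show "exec_within x (Seq (Dec t) (Inc i)) (T (Suc k)) (1 + 2) (T k)"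
        unfolding T_def by (rule within_Seq[OF within_prim(2)[OF refl] within_prim(1)]) (use k d in \<open>auto simp: fun_eq_iff\<close>)
    qed (use d in \<open>auto simp: T_def\<close>)
    have "S 0 = T (\<sigma> i)" "S (\<sigma> i) = (0, \<sigma>, out)" "T 0 = (0, \<sigma>(d := \<sigma> d + \<sigma> i), out)"
      using d that by (auto simp: S_def T_def fun_eq_iff)
    with within_Seq[OF 1[unfolded \<open>S 0 = T (\<sigma> i)\<close>] 2] show ?thesis by simp
  qed
  have "(v * (1 + (2 + 2) + 2) + 1) + (v * (1 + 2 + 2) + 1) \<le> (B + 2) ^ (12 + 1)" if "v \<le> B" for v B :: nat
  proof -
    have "(v * (1 + (2 + 2) + 2) + 1) + (v * (1 + 2 + 2) + 1) \<le> 12 * (B + 2)" using that by simp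
    also have "\<dots> \<le> (B + 2) ^ (12 + 1)" by (rule pow_mult[OF pow_const]) simp
    finally show ?thesis .
  qed
  then have bound: "\<sigma> i * (1 + (2 + 2) + 2) + 1 + (\<sigma> i * (1 + 2 + 2) + 1) \<le> (B + 2) ^ (12 + 1)"
    if "\<forall>r<n. \<sigma> r \<le> B" for \<sigma> and B :: nat using that assms by blast
  have "ex_ok n (Vr i) (12 + 1)"
    by (rule ex_okI[where m = "\<lambda>x \<sigma> B. (\<sigma> i * (1 + (2 + 2) + 2) + 1) + (\<sigma> i * (1 + 2 + 2) + 1)"],
        unfold ev.simps, intro *, assumption+, rule bound)
  then show ?thesis by blast
qed

lemma ex_ok_Len: "\<exists>K. ex_ok n Len K"
proof -
  have *: "exec_within x (cmd_ex Len d t) (0, \<sigma>, out) ((length x * (1 + (2 + 2) + 2) + 1) + (length x * (1 + 1 + 2) + 1))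
     (0, \<sigma>(d := \<sigma> d + length x), out)" if "n \<le> d" "d < t" "\<forall>r\<ge>t. \<sigma> r = 0" for x \<sigma> out d t
  proof -
    define S where "S k = (int (length x - k), \<sigma>(d := \<sigma> d + (length x - k), t := length x - k), out)" for k
    define T where "T k = (int k, \<sigma>(d := \<sigma> d + length x, t := k), out)" for k
    have d: "d \<noteq> t" using that by auto
    have 1: "exec_within x (While InNonblank (Seq InRight (Seq (Inc d) (Inc t)))) (S (length x))
      (length x * (1 + (2 + 2) + 2) + 1) (S 0)"
    proof (rule within_While)
      fix k assume k: "k < length x"
      show "exec_within x (Seq InRight (Seq (Inc d) (Inc t))) (S (Suc k)) (1 + (2 + 2)) (S k)"
        unfolding S_def by (rule within_Seq[OF within_prim(4)[OF refl] within_Seq[OF within_prim(1)[OF refl] within_prim(1)]]) (use k d in \<open>auto simp: fun_eq_iff\<close>)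
    qed (use d in \<open>auto simp: S_def string_contents_def\<close>)
    have 2: "exec_within x (While (RegPos t) (Seq (Dec t) InLeft)) (T (length x))
      (length x * (1 + 1 + 2) + 1) (T 0)"
    proof (rule within_While)
      fix k assume k: "k < length x"
      show "exec_within x (Seq (Dec t) InLeft) (T (Suc k)) (1 + 1) (T k)"
        unfolding T_def by (rule within_Seq[OF within_prim(2)[OF refl] within_prim(5)]) (use k d in \<open>auto simp: fun_eq_iff\<close>)
    qed (use d in \<open>auto simp: T_def\<close>)
    have "S 0 = T (length x)" "S (length x) = (0, \<sigma>, out)" "T 0 = (0, \<sigma>(d := \<sigma> d + length x), out)"
      using d that by (auto simp: S_def T_def fun_eq_iff)
    with within_Seq[OF 1[unfolded \<open>S 0 = T (length x)\<close>] 2] show ?thesis by simp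
  qed
  have "(v * (1 + (2 + 2) + 2) + 1) + (v * (1 + 1 + 2) + 1) \<le> (B + 2) ^ (12 + 1)" if "v \<le> B" for v B :: nat
  proof -
    have "(v * (1 + (2 + 2) + 2) + 1) + (v * (1 + 1 + 2) + 1) \<le> 12 * (B + 2)" using that by simp
    also have "\<dots> \<le> (B + 2) ^ (12 + 1)" by (rule pow_mult[OF pow_const]) simp
    finally show ?thesis .
  qed
  then have "ex_ok n Len (12 + 1)"
    by (intro ex_okI[where m = "\<lambda>x \<sigma> B. (length x * (1 + (2 + 2) + 2) + 1) + (length x * (1 + 1 + 2) + 1)"])
      (use * in \<open>simp_all only: ev.simps\<close>)
  then show ?thesis by blast
qed

lemma ex_ok_Inp: assumes "vars_below n e" "ex_ok n e K" shows "\<exists>K. ex_ok n (Inp e) K"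
proof -
  obtain L where L: "\<And>x \<sigma> B. (\<forall>r<n. \<sigma> r \<le> B) \<Longrightarrow> length x \<le> B \<Longrightarrow> ev x \<sigma> e \<le> (B + 2) ^ L"
    using ev_bound[OF assms(1)] by blast
  have *: "exec_within x (cmd_ex (Inp e) d t) (0, \<sigma>, out)
      ((B + 2) ^ K + ((ev x \<sigma> e * (1 + (1 + 2) + 2) + 1) + (6 + (ev x \<sigma> e * (1 + 1 + 2) + 1))))
     (0, \<sigma>(d := \<sigma> d + ev x \<sigma> (Inp e)), out)"
    if t: "n \<le> d" "d < t" "\<forall>r\<ge>t. \<sigma> r = 0" "\<forall>r<n. \<sigma> r \<le> B" "length x \<le> B" for x \<sigma> out d t B
  proof -
    define v where "v = ev x \<sigma> e"
    define S where "S k = (int (v - k), \<sigma>(t := k, t + 1 := v - k), out)" for k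
    define w where "w = string_contents x (int v)"
    define T where "T k = (int k, \<sigma>(d := \<sigma> d + w, t + 1 := k), out)" for k
    have d: "d \<noteq> t" "d \<noteq> t + 1" using that by auto
    have 0: "exec_within x (cmd_ex e t (t + 1)) (0, \<sigma>, out) ((B + 2) ^ K) (S v)"
      by (rule ex_okD[OF assms(2)]) (use t in \<open>auto simp: S_def v_def fun_eq_iff\<close>)
    have 1: "exec_within x (While (RegPos t) (Seq (Dec t) (Seq InRight (Inc (t + 1))))) (S v)
      (v * (1 + (1 + 2) + 2) + 1) (S 0)"
    proof (rule within_While)
      fix k assume k: "k < v"
      show "exec_within x (Seq (Dec t) (Seq InRight (Inc (t + 1)))) (S (Suc k)) (1 + (1 + 2)) (S k)"
        unfolding S_def by (rule within_Seq[OF within_prim(2)[OF refl] within_Seq[OF within_prim(4)[OF refl] within_prim(1)]]) (use k d in \<open>auto simp: fun_eq_iff\<close>)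
    qed (use d in \<open>auto simp: S_def\<close>)
    have S0: "S 0 = (int v, \<sigma>(t + 1 := v), out)" using t by (auto simp: S_def fun_eq_iff)
    have Tv: "T v = (int v, \<sigma>(d := \<sigma> d + w, t + 1 := v), out)" by (simp add: T_def)
    have 2: "exec_within x (Cond InTrue (Seq (Inc d) (Inc d)) (Cond InNonblank (Inc d) Skip)) (S 0) 6 (T v)"
    proof -
      consider "w = 2" | "w = 1" | "w = 0" using string_contents_le[of x "int v"] unfolding w_def by linarith
      then show ?thesis
      proof cases
        case 1
        have "exec_within x (Cond InTrue (Seq (Inc d) (Inc d)) (Cond InNonblank (Inc d) Skip)) (S 0) (2 + 2 + 2) (T v)"
          unfolding S0 Tv
          by (rule within_CondT, use 1 in \<open>simp add: w_def\<close>, rule within_Seq[OF within_prim(1)[OF refl] within_prim(1)])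
            (use d 1 in \<open>auto simp: fun_eq_iff\<close>)
        then show ?thesis by simp
      next
        case 2
        have "exec_within x (Cond InTrue (Seq (Inc d) (Inc d)) (Cond InNonblank (Inc d) Skip)) (S 0) (2 + 2 + 1) (T v)"
          unfolding S0 Tv
          by (rule within_CondF, use 2 in \<open>simp add: w_def\<close>, rule within_CondT,
              use 2 in \<open>simp add: w_def\<close>, intro within_prim)
            (use d 2 in \<open>auto simp: fun_eq_iff\<close>)
        then show ?thesis by (rule within_mono) simp
      next
        case 3
        have "exec_within x (Cond InTrue (Seq (Inc d) (Inc d)) (Cond InNonblank (Inc d) Skip)) (S 0) (0 + 1 + 1) (T v)"
          unfolding S0 Tv
          by (rule within_CondF, use 3 in \<open>simp add: w_def\<close>, rule within_CondF,
              use 3 in \<open>simp add: w_def\<close>, intro within_prim)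
            (use d 3 in \<open>auto simp: fun_eq_iff\<close>)
        then show ?thesis by (rule within_mono) simp
      qed
    qed
    have 3: "exec_within x (While (RegPos (t + 1)) (Seq (Dec (t + 1)) InLeft)) (T v)
      (v * (1 + 1 + 2) + 1) (T 0)"
    proof (rule within_While)
      fix k assume k: "k < v"
      show "exec_within x (Seq (Dec (t + 1)) InLeft) (T (Suc k)) (1 + 1) (T k)"
        unfolding T_def by (rule within_Seq[OF within_prim(2)[OF refl] within_prim(5)]) (use k d in \<open>auto simp: fun_eq_iff\<close>)
    qed (use d in \<open>auto simp: T_def\<close>)
    have "T 0 = (0, \<sigma>(d := \<sigma> d + ev x \<sigma> (Inp e)), out)"
      using d t by (auto simp: T_def w_def v_def fun_eq_iff)
    with within_Seq[OF 0 within_Seq[OF 1 within_Seq[OF 2 3]]] show ?thesis by (simp add: v_def)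
  qed
  have arith: "v \<le> X \<Longrightarrow> 1 \<le> X \<Longrightarrow> (v * (1 + (1 + 2) + 2) + 1) + (6 + (v * (1 + 1 + 2) + 1)) \<le> 18 * X" for v X :: nat
    by simp
  have "a + ((v * (1 + (1 + 2) + 2) + 1) + (6 + (v * (1 + 1 + 2) + 1))) \<le> (B + 2) ^ (K + (L + 18) + 1)"
    if "v \<le> (B + 2) ^ L" "a \<le> (B + 2) ^ K" for v a B :: nat
  proof (rule pow_add[OF that(2)])
    have "1 \<le> (B + 2) ^ L" by (rule one_le_power) simp
    then have "(v * (1 + (1 + 2) + 2) + 1) + (6 + (v * (1 + 1 + 2) + 1)) \<le> 18 * (B + 2) ^ L"
      using that arith[of v "(B + 2) ^ L"] by blast
    also have "\<dots> \<le> (B + 2) ^ 18 * (B + 2) ^ L" by (intro mult_le_mono pow_const) auto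
    finally show "(v * (1 + (1 + 2) + 2) + 1) + (6 + (v * (1 + 1 + 2) + 1)) \<le> (B + 2) ^ (L + 18)"
      by (simp add: power_add ac_simps)
  qed
  then have "ex_ok n (Inp e) (K + (L + 18) + 1)"
    by (intro ex_okI[where m = "\<lambda>x \<sigma> B. (B + 2) ^ K + ((ev x \<sigma> e * (1 + (1 + 2) + 2) + 1) + (6 + (ev x \<sigma> e * (1 + 1 + 2) + 1)))"] *) (use L order_refl in \<open>blast+\<close>)
  then show ?thesis by blast
qed

lemma ex_ok_Add: assumes "vars_below n b" "ex_ok n a K" "ex_ok n b L" shows "\<exists>K. ex_ok n (Add a b) K"
proof -
  have *: "exec_within x (cmd_ex (Add a b) d t) (0, \<sigma>, out) ((B + 2) ^ K + (B + 2) ^ L)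
     (0, \<sigma>(d := \<sigma> d + ev x \<sigma> (Add a b)), out)"
    if t: "n \<le> d" "d < t" "\<forall>r\<ge>t. \<sigma> r = 0" "\<forall>r<n. \<sigma> r \<le> B" "length x \<le> B" for x \<sigma> out d t B
  proof -
    have "ev x (\<sigma>(d := \<sigma> d + ev x \<sigma> a)) b = ev x \<sigma> b"
      by (rule ev_cong[OF assms(1)]) (use t in auto)
    then show ?thesis using t unfolding cmd_ex.simps
      by (intro within_Seq[OF ex_okD[OF assms(2) _ _ _ _ _ refl] ex_okD[OF assms(3)]])
        (auto simp: fun_eq_iff)
  qed
  have "ex_ok n (Add a b) (K + L + 1)"
    by (intro ex_okI[where m = "\<lambda>x \<sigma> B. (B + 2) ^ K + (B + 2) ^ L"] * pow_add order_refl)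
  then show ?thesis by blast
qed

lemma ex_ok_Mul: assumes "vars_below n a" "vars_below n b" "ex_ok n a K" "ex_ok n b L"
  shows "\<exists>K. ex_ok n (Mul a b) K"
proof -
  obtain M where M: "\<And>x \<sigma> B. (\<forall>r<n. \<sigma> r \<le> B) \<Longrightarrow> length x \<le> B \<Longrightarrow> ev x \<sigma> a \<le> (B + 2) ^ M"
    using ev_bound[OF assms(1)] by blast
  have *: "exec_within x (cmd_ex (Mul a b) d t) (0, \<sigma>, out)
      ((B + 2) ^ K + (ev x \<sigma> a * (1 + (B + 2) ^ L + 2) + 1))
     (0, \<sigma>(d := \<sigma> d + ev x \<sigma> (Mul a b)), out)"
    if t: "n \<le> d" "d < t" "\<forall>r\<ge>t. \<sigma> r = 0" "\<forall>r<n. \<sigma> r \<le> B" "length x \<le> B" for x \<sigma> out d t B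
  proof -
    define v where "v = ev x \<sigma> a"
    define S where "S k = ((0::int), \<sigma>(d := \<sigma> d + (v - k) * ev x \<sigma> b, t := k), out)" for k
    have d: "d \<noteq> t" using that by auto
    have 0: "exec_within x (cmd_ex a t (t + 1)) (0, \<sigma>, out) ((B + 2) ^ K) (S v)"
      by (rule ex_okD[OF assms(3)]) (use t in \<open>auto simp: S_def v_def fun_eq_iff\<close>)
    have 1: "exec_within x (While (RegPos t) (Seq (Dec t) (cmd_ex b d (t + 1)))) (S v)
      (v * (1 + (B + 2) ^ L + 2) + 1) (S 0)"
    proof (rule within_While)
      fix k assume k: "k < v"
      let ?\<tau> = "\<sigma>(d := \<sigma> d + (v - Suc k) * ev x \<sigma> b, t := k)"
      have "ev x ?\<tau> b = ev x \<sigma> b" by (rule ev_cong[OF assms(2)]) (use t in auto)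
      moreover have "v - k = Suc (v - Suc k)" using k by simp
      ultimately show "exec_within x (Seq (Dec t) (cmd_ex b d (t + 1))) (S (Suc k)) (1 + (B + 2) ^ L) (S k)"
        unfolding S_def using d t
        by (intro within_Seq[OF within_prim(2)[OF refl]] ex_okD[OF assms(4)])
          (auto simp: fun_eq_iff algebra_simps)
    qed (use d in \<open>auto simp: S_def\<close>)
    have "S 0 = (0, \<sigma>(d := \<sigma> d + ev x \<sigma> (Mul a b)), out)"
      using d t by (auto simp: S_def v_def fun_eq_iff)
    with within_Seq[OF 0 1] show ?thesis by (simp add: v_def)
  qed
  have "(B + 2) ^ K + (v * (1 + (B + 2) ^ L + 2) + 1) \<le> (B + 2) ^ (K + (M + (1 + L + 1 + 2 + 1) + 1 + 1) + 1)"
    if "v \<le> (B + 2) ^ M" for v B :: nat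
    using pow_const[of 1 B] pow_const[of 2 B]
    by (intro pow_add pow_mult that order_refl)
  then have "ex_ok n (Mul a b) (K + (M + (1 + L + 1 + 2 + 1) + 1 + 1) + 1)"
    by (intro ex_okI[where m = "\<lambda>x \<sigma> B. (B + 2) ^ K + (ev x \<sigma> a * (1 + (B + 2) ^ L + 2) + 1)"] *) (use M in \<open>blast+\<close>)
  then show ?thesis by blast
qed

lemma ex_ok_Sub: assumes "vars_below n a" "vars_below n b" "ex_ok n a K" "ex_ok n b L"
  shows "\<exists>K. ex_ok n (Sub a b) K"
proof -
  obtain M where M: "\<And>x \<sigma> B. (\<forall>r<n. \<sigma> r \<le> B) \<Longrightarrow> length x \<le> B \<Longrightarrow> ev x \<sigma> a \<le> (B + 2) ^ M"
    using ev_bound[OF assms(1)] by blast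
  obtain N where N: "\<And>x \<sigma> B. (\<forall>r<n. \<sigma> r \<le> B) \<Longrightarrow> length x \<le> B \<Longrightarrow> ev x \<sigma> b \<le> (B + 2) ^ N"
    using ev_bound[OF assms(2)] by blast
  have *: "exec_within x (cmd_ex (Sub a b) d t) (0, \<sigma>, out)
      ((B + 2) ^ K + ((B + 2) ^ L + ((ev x \<sigma> b * (1 + 1 + 2) + 1) + ((ev x \<sigma> a - ev x \<sigma> b) * (1 + 2 + 2) + 1))))
     (0, \<sigma>(d := \<sigma> d + ev x \<sigma> (Sub a b)), out)"
    if t: "n \<le> d" "d < t" "\<forall>r\<ge>t. \<sigma> r = 0" "\<forall>r<n. \<sigma> r \<le> B" "length x \<le> B" for x \<sigma> out d t B
  proof -
    define v where "v = ev x \<sigma> a"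
    define w where "w = ev x \<sigma> b"
    define S where "S k = ((0::int), \<sigma>(t := v - (w - k), t + 1 := k), out)" for k
    define T where "T k = ((0::int), \<sigma>(d := \<sigma> d + (v - w - k), t := k), out)" for k
    have d: "d \<noteq> t" "d \<noteq> t + 1" using that by auto
    have 0: "exec_within x (cmd_ex a t (t + 1)) (0, \<sigma>, out) ((B + 2) ^ K) (0, \<sigma>(t := v), out)"
      by (rule ex_okD[OF assms(3)]) (use t in \<open>auto simp: v_def fun_eq_iff\<close>)
    have "ev x (\<sigma>(t := v)) b = w" unfolding w_def by (rule ev_cong[OF assms(2)]) (use t in auto)
    then have 1: "exec_within x (cmd_ex b (t + 1) (t + 2)) (0, \<sigma>(t := v), out) ((B + 2) ^ L) (S w)"
      by (intro ex_okD[OF assms(4)]) (use t in \<open>auto simp: S_def fun_eq_iff\<close>)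
    have 2: "exec_within x (While (RegPos (t + 1)) (Seq (Dec (t + 1)) (Dec t))) (S w)
      (w * (1 + 1 + 2) + 1) (S 0)"
    proof (rule within_While)
      fix k assume k: "k < w"
      show "exec_within x (Seq (Dec (t + 1)) (Dec t)) (S (Suc k)) (1 + 1) (S k)"
        unfolding S_def by (rule within_Seq[OF within_prim(2)[OF refl] within_prim(2)]) (use k d in \<open>auto simp: fun_eq_iff\<close>)
    qed (use d in \<open>auto simp: S_def\<close>)
    have 3: "exec_within x (While (RegPos t) (Seq (Dec t) (Inc d))) (T (v - w))
      ((v - w) * (1 + 2 + 2) + 1) (T 0)"
    proof (rule within_While)
      fix k assume k: "k < v - w"
      show "exec_within x (Seq (Dec t) (Inc d)) (T (Suc k)) (1 + 2) (T k)"
        unfolding T_def by (rule within_Seq[OF within_prim(2)[OF refl] within_prim(1)]) (use k d in \<open>auto simp: fun_eq_iff\<close>)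
    qed (use d in \<open>auto simp: T_def\<close>)
    have "S 0 = T (v - w)" "T 0 = (0, \<sigma>(d := \<sigma> d + ev x \<sigma> (Sub a b)), out)"
      using d t by (auto simp: S_def T_def w_def v_def fun_eq_iff)
    with within_Seq[OF 0 within_Seq[OF 1 within_Seq[OF 2 3[folded \<open>S 0 = T (v - w)\<close>]]]]
    show ?thesis by (simp add: v_def w_def)
  qed
  have "(B + 2) ^ K + ((B + 2) ^ L + ((w * (1 + 1 + 2) + 1) + ((v - w) * (1 + 2 + 2) + 1)))
      \<le> (B + 2) ^ (K + (L + ((N + 4 + 1 + 1) + (M + 5 + 1 + 1) + 1) + 1) + 1)"
    if "v \<le> (B + 2) ^ M" "w \<le> (B + 2) ^ N" for v w B :: nat
  proof -
    have "1 + 1 + 2 \<le> (B + 2) ^ 4" "1 + 2 + 2 \<le> (B + 2) ^ 5" "1 \<le> (B + 2) ^ 1"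
      using pow_const[of 4 B] pow_const[of 5 B] by (linarith, linarith, simp)
    then show ?thesis by (intro pow_add pow_mult that order_refl le_trans[OF diff_le_self that(1)])
  qed
  then have "ex_ok n (Sub a b) (K + (L + ((N + 4 + 1 + 1) + (M + 5 + 1 + 1) + 1) + 1) + 1)"
    by (intro ex_okI[where m = "\<lambda>x \<sigma> B. (B + 2) ^ K + ((B + 2) ^ L + ((ev x \<sigma> b * (1 + 1 + 2) + 1) + ((ev x \<sigma> a - ev x \<sigma> b) * (1 + 2 + 2) + 1)))"] *) (use M N in \<open>blast+\<close>)
  then show ?thesis by blast
qed

lemma ex_ok: "vars_below n e \<Longrightarrow> \<exists>K. ex_ok n e K"
proof (induction e)
  case (Cn c) show ?case by (rule ex_ok_Cn)
next
  case (Vr i) then show ?case by (simp add: ex_ok_Vr)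
next
  case Len show ?case by (rule ex_ok_Len)
next
  case (Inp e) then show ?case using ex_ok_Inp[of n e] by auto
next
  case (Add a b) then show ?case using ex_ok_Add[of n b a] by auto
next
  case (Mul a b) then show ?case using ex_ok_Mul[of n a b] by auto
next
  case (Sub a b) then show ?case using ex_ok_Sub[of n a b] by auto
qed

section \<open>Loop programs that emit encoded numbers\<close>

datatype gn = Em ex | Nop | Sq gn gn | Fr nat ex gn

fun gsem :: "bool list \<Rightarrow> (nat \<Rightarrow> nat) \<Rightarrow> gn \<Rightarrow> bool list" where
  "gsem x \<sigma> (Em e) = encode_nat (ev x \<sigma> e)"
| "gsem x \<sigma> Nop = []"
| "gsem x \<sigma> (Sq a b) = gsem x \<sigma> a @ gsem x \<sigma> b"
| "gsem x \<sigma> (Fr i e g) = concat (map (\<lambda>j. gsem x (\<sigma>(i := j)) g) [0..<ev x \<sigma> e])"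

fun bound_vars :: "gn \<Rightarrow> nat set" where
  "bound_vars (Sq a b) = bound_vars a \<union> bound_vars b"
| "bound_vars (Fr i e g) = insert i (bound_vars g)"
| "bound_vars _ = {}"

text \<open>A loop variable may not be bound again inside its body: a loop starts from a zero
  register and resets it at the end, which would destroy the counter of an enclosing loop using the
  same register.\<close>

fun wf_gn :: "nat \<Rightarrow> gn \<Rightarrow> bool" where
  "wf_gn n (Em e) \<longleftrightarrow> vars_below n e"
| "wf_gn n Nop \<longleftrightarrow> True"
| "wf_gn n (Sq a b) \<longleftrightarrow> wf_gn n a \<and> wf_gn n b"
| "wf_gn n (Fr i e g) \<longleftrightarrow> i < n \<and> vars_below n e \<and> i \<notin> bound_vars g \<and> wf_gn n g"

lemma bound_vars_below: "wf_gn n g \<Longrightarrow> i \<in> bound_vars g \<Longrightarrow> i < n"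
  by (induction g) auto

lemma gsem_cong: "wf_gn n g \<Longrightarrow> (\<And>r. r < n \<Longrightarrow> \<sigma> r = \<tau> r) \<Longrightarrow> gsem x \<sigma> g = gsem x \<tau> g"
proof (induction g arbitrary: \<sigma> \<tau>)
  case (Em e)
  then show ?case using ev_cong[of n e \<sigma> \<tau>] by simp
next
  case (Sq a b)
  then show ?case by (metis gsem.simps(3) wf_gn.simps(3))
next
  case (Fr i e g)
  have "ev x \<sigma> e = ev x \<tau> e" using Fr.prems by (intro ev_cong[of n]) auto
  moreover have "gsem x (\<sigma>(i := j)) g = gsem x (\<tau>(i := j)) g" for j
    by (rule Fr.IH) (use Fr.prems in auto)
  ultimately show ?case by simp
qed simp

text \<open>Two units at a time are traded for one unit in \<open>t + 1\<close>; an odd unit ends up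
  in \<open>t + 2\<close>. These two registers then hold quotient and remainder.\<close>

definition cmd_halve :: "nat \<Rightarrow> cmd" where
  "cmd_halve t = While (RegPos t)
     (Seq (Dec t) (Cond (RegPos t) (Seq (Dec t) (Inc (t + 1))) (Inc (t + 2))))"

definition cmd_bit :: "nat \<Rightarrow> cmd" where
  "cmd_bit t = Seq (cmd_halve t) (Seq (Emit True)
     (Seq (Cond (RegPos (t + 2)) (Seq (Dec (t + 2)) (Emit True)) (Emit False))
     (While (RegPos (t + 1)) (Seq (Dec (t + 1)) (Inc t)))))"

definition cmd_nat :: "nat \<Rightarrow> cmd" where
  "cmd_nat t = Seq (While (RegPos t) (cmd_bit t)) (Emit False)"

lemma cmd_halve:
  assumes "\<forall>r>t. \<sigma> r = 0"
  shows "exec_within x (cmd_halve t) (0, \<sigma>, out) (((\<sigma> t + 1) div 2) * (6 + 2) + 1)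
    (0, \<sigma>(t := 0, t + 1 := \<sigma> t div 2, t + 2 := \<sigma> t mod 2), out)"
proof -
  define v where "v = \<sigma> t"
  \<comment> \<open>Again \<open>k\<close> rounds are left. For odd \<open>v\<close> the last round
    removes a single unit, which explains the offset by one and the special case
    \<open>k = 0\<close>.\<close>
  define S where "S k = ((0::int), if even v then \<sigma>(t := 2 * k, t + 1 := v div 2 - k, t + 2 := 0)
    else \<sigma>(t := 2 * k - 1, t + 1 := (if k = 0 then v div 2 else v div 2 - (k - 1)), t + 2 := (if k = 0 then 1 else 0)), out)" for k
  have "exec_within x (cmd_halve t) (S ((v + 1) div 2)) (((v + 1) div 2) * (6 + 2) + 1) (S 0)"
    unfolding cmd_halve_def
  proof (rule within_While)
    fix k assume k: "k < (v + 1) div 2"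
    show "exec_within x (Seq (Dec t) (Cond (RegPos t) (Seq (Dec t) (Inc (t + 1))) (Inc (t + 2)))) (S (Suc k)) 6 (S k)"
    proof (cases "odd v \<and> k = 0")
      case True
      have "exec_within x (Seq (Dec t) (Cond (RegPos t) (Seq (Dec t) (Inc (t + 1))) (Inc (t + 2)))) (S (Suc k)) (1 + (2 + 1)) (S k)"
        unfolding S_def using True
        by (simp only: if_False, intro within_Seq[OF within_prim(2)[OF refl] within_CondF[OF _ within_prim(1)]])
          (auto simp: fun_eq_iff)
      then show ?thesis by (rule within_mono) simp
    next
      case False
      have "exec_within x (Seq (Dec t) (Cond (RegPos t) (Seq (Dec t) (Inc (t + 1))) (Inc (t + 2)))) (S (Suc k)) (1 + ((1 + 2) + 2)) (S k)"
      proof (cases "even v")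
        case True
        show ?thesis unfolding S_def using True k
          by (simp only: if_True, intro within_Seq[OF within_prim(2)[OF refl] within_CondT[OF _ within_Seq[OF within_prim(2)[OF refl] within_prim(1)]]])
            (auto simp: fun_eq_iff)
      next
        case odd: False
        show ?thesis unfolding S_def using odd False k
          by (simp only: if_False, intro within_Seq[OF within_prim(2)[OF refl] within_CondT[OF _ within_Seq[OF within_prim(2)[OF refl] within_prim(1)]]])
            (auto simp: fun_eq_iff)
      qed
      then show ?thesis by (rule within_mono) simp
    qed
  qed (auto simp: S_def)
  moreover have "S ((v + 1) div 2) = (0, \<sigma>, out)"
    using assms by (auto simp: S_def v_def fun_eq_iff elim!: oddE)
  moreover have "S 0 = (0, \<sigma>(t := 0, t + 1 := v div 2, t + 2 := v mod 2), out)"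
    by (auto simp: S_def fun_eq_iff odd_iff_mod_2_eq_one even_iff_mod_2_eq_zero)
  ultimately show ?thesis by (simp add: v_def)
qed

text \<open>The bound is reduced by 2 in order to leave room for the overhead of one round of the
  surrounding loop.\<close>

lemma cmd_bit:
  assumes "\<forall>r>t. \<sigma> r = 0"
  shows "exec_within x (cmd_bit t) (0, \<sigma>, out) (20 * (\<sigma> t + 1) - 2)
    (0, \<sigma>(t := \<sigma> t div 2), out @ [True, odd (\<sigma> t)])"
proof -
  define v where "v = \<sigma> t"
  define S where "S k = ((0::int), \<sigma>(t := v div 2 - k, t + 1 := k), out @ [True, odd v])" for k
  have 1: "exec_within x (cmd_halve t) (0, \<sigma>, out) (((v + 1) div 2) * (6 + 2) + 1)
    (0, \<sigma>(t := 0, t + 1 := v div 2, t + 2 := v mod 2), out)"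
    using cmd_halve[OF assms] by (simp add: v_def)
  have 2: "exec_within x (Cond (RegPos (t + 2)) (Seq (Dec (t + 2)) (Emit True)) (Emit False))
     (0, \<sigma>(t := 0, t + 1 := v div 2, t + 2 := v mod 2), out @ [True]) 4 (S (v div 2))"
  proof (cases "odd v")
    case True
    have "exec_within x (Cond (RegPos (t + 2)) (Seq (Dec (t + 2)) (Emit True)) (Emit False))
     (0, \<sigma>(t := 0, t + 1 := v div 2, t + 2 := v mod 2), out @ [True]) ((1 + 1) + 2) (S (v div 2))"
      by (rule within_CondT[OF _ within_Seq[OF within_prim(2)[OF refl] within_prim(3)]])
        (use True assms in \<open>auto simp: S_def fun_eq_iff odd_iff_mod_2_eq_one\<close>)
    then show ?thesis by (rule within_mono) simp
  next
    case False
    have "exec_within x (Cond (RegPos (t + 2)) (Seq (Dec (t + 2)) (Emit True)) (Emit False))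
     (0, \<sigma>(t := 0, t + 1 := v div 2, t + 2 := v mod 2), out @ [True]) (1 + 1) (S (v div 2))"
      by (rule within_CondF[OF _ within_prim(3)])
        (use False assms in \<open>auto simp: S_def fun_eq_iff even_iff_mod_2_eq_zero\<close>)
    then show ?thesis by (rule within_mono) simp
  qed
  have 3: "exec_within x (While (RegPos (t + 1)) (Seq (Dec (t + 1)) (Inc t))) (S (v div 2))
    (v div 2 * (1 + 2 + 2) + 1) (S 0)"
  proof (rule within_While)
    fix k assume k: "k < v div 2"
    show "exec_within x (Seq (Dec (t + 1)) (Inc t)) (S (Suc k)) (1 + 2) (S k)"
      unfolding S_def by (rule within_Seq[OF within_prim(2)[OF refl] within_prim(1)])
        (use k in \<open>auto simp: fun_eq_iff\<close>)
  qed (auto simp: S_def)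
  have "S 0 = (0, \<sigma>(t := v div 2), out @ [True, odd v])" using assms by (auto simp: S_def fun_eq_iff)
  moreover have "exec_within x (cmd_bit t) (0, \<sigma>, out)
     ((((v + 1) div 2) * (6 + 2) + 1) + (1 + (4 + (v div 2 * (1 + 2 + 2) + 1)))) (S 0)"
    unfolding cmd_bit_def by (intro within_Seq[OF 1 within_Seq[OF within_prim(3)[OF refl] within_Seq[OF 2 3]]])
  ultimately have "exec_within x (cmd_bit t) (0, \<sigma>, out)
     ((((v + 1) div 2) * (6 + 2) + 1) + (1 + (4 + (v div 2 * (1 + 2 + 2) + 1))))
     (0, \<sigma>(t := v div 2), out @ [True, odd v])" by (simp only:)
  then have "exec_within x (cmd_bit t) (0, \<sigma>, out) (20 * (v + 1) - 2) (0, \<sigma>(t := v div 2), out @ [True, odd v])"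
    by (rule within_mono) simp
  then show ?thesis by (simp only: v_def)
qed

text \<open>A bound polynomial in the value, and not in its number of digits, is good enough: by
  \<open>ev_bound\<close> all emitted values are polynomial in the input length.\<close>

lemma cmd_bits:
  assumes "\<forall>r>t. \<sigma> r = 0"
  shows "exec_within x (While (RegPos t) (cmd_bit t)) (0, \<sigma>, out) (\<sigma> t * (20 * (\<sigma> t + 1)) + 1)
    (0, \<sigma>(t := 0), out @ concat (map (\<lambda>b. [True, b]) (nat_bits (\<sigma> t))))"
  using assms
proof (induction "\<sigma> t" arbitrary: \<sigma> out rule: less_induct)
  case less
  show ?case
  proof (cases "\<sigma> t = 0")
    case True
    then have "\<sigma>(t := 0) = \<sigma>" by auto
    moreover have "nat_bits 0 = []" by (subst nat_bits.simps) simp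
    ultimately show ?thesis using True unfolding exec_within_def
      by (intro exI[of _ 1]) (auto simp del: One_nat_def intro!: exWhileF)
  next
    case False
    let ?\<tau> = "\<sigma>(t := \<sigma> t div 2)"
    have bits: "nat_bits (\<sigma> t) = odd (\<sigma> t) # nat_bits (\<sigma> t div 2)"
      using False by (subst nat_bits.simps) simp
    obtain m1 where m1: "m1 \<le> 20 * (\<sigma> t + 1) - 2" "exec x (cmd_bit t) (0, \<sigma>, out) m1 (0, ?\<tau>, out @ [True, odd (\<sigma> t)])"
      using cmd_bit[OF less.prems] by (auto simp: exec_within_def)
    have "exec_within x (While (RegPos t) (cmd_bit t)) (0, ?\<tau>, out @ [True, odd (\<sigma> t)]) (?\<tau> t * (20 * (?\<tau> t + 1)) + 1)
      (0, ?\<tau>(t := 0), (out @ [True, odd (\<sigma> t)]) @ concat (map (\<lambda>b. [True, b]) (nat_bits (?\<tau> t))))"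
      by (rule less.hyps) (use False less.prems in auto)
    then obtain m2 where m2: "m2 \<le> (\<sigma> t div 2) * (20 * (\<sigma> t div 2 + 1)) + 1"
      "exec x (While (RegPos t) (cmd_bit t)) (0, ?\<tau>, out @ [True, odd (\<sigma> t)]) m2
        (0, \<sigma>(t := 0), out @ concat (map (\<lambda>b. [True, b]) (nat_bits (\<sigma> t))))"
      by (auto simp: exec_within_def bits)
    have "(\<sigma> t div 2) * (20 * (\<sigma> t div 2 + 1)) \<le> (\<sigma> t - 1) * (20 * (\<sigma> t + 1))"
      using False by (intro mult_le_mono) auto
    moreover have "(\<sigma> t - 1) * (20 * (\<sigma> t + 1)) + 20 * (\<sigma> t + 1) = \<sigma> t * (20 * (\<sigma> t + 1))"
      using False by (cases "\<sigma> t") auto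
    moreover have "a \<le> b \<Longrightarrow> b + c = d \<Longrightarrow> l \<le> c - 2 \<Longrightarrow> l' \<le> a + 1 \<Longrightarrow> 2 \<le> c \<Longrightarrow> l + l' + 2 \<le> d + 1"
      for a b c d l l' :: nat by linarith
    moreover have "2 \<le> 20 * (\<sigma> t + 1)" by simp
    ultimately have "m1 + m2 + 2 \<le> \<sigma> t * (20 * (\<sigma> t + 1)) + 1" using m1(1) m2(1) by blast
    moreover have "exec x (While (RegPos t) (cmd_bit t)) (0, \<sigma>, out) (m1 + m2 + 2)
        (0, \<sigma>(t := 0), out @ concat (map (\<lambda>b. [True, b]) (nat_bits (\<sigma> t))))"
      by (rule exWhileT[OF _ m1(2) m2(2)]) (use False in simp)
    ultimately show ?thesis unfolding exec_within_def by blast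
  qed
qed

lemma cmd_nat:
  assumes "\<forall>r>t. \<sigma> r = 0"
  shows "exec_within x (cmd_nat t) (0, \<sigma>, out) ((\<sigma> t * (20 * (\<sigma> t + 1)) + 1) + 1)
    (0, \<sigma>(t := 0), out @ encode_nat (\<sigma> t))"
  unfolding cmd_nat_def encode_nat_def
  by (rule within_Seq[OF cmd_bits[OF assms] within_prim(3)]) simp

fun cmd_gn :: "gn \<Rightarrow> nat \<Rightarrow> cmd" where
  "cmd_gn (Em e) t = Seq (cmd_ex e t (t + 1)) (cmd_nat t)"
| "cmd_gn Nop t = Skip"
| "cmd_gn (Sq a b) t = Seq (cmd_gn a t) (cmd_gn b t)"
| "cmd_gn (Fr i e g) t = Seq (cmd_ex e t (t + 1))
     (Seq (While (RegPos t) (Seq (Dec t) (Seq (cmd_gn g (t + 1)) (Inc i)))) (While (RegPos i) (Dec i)))"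

text \<open>As for expressions, but on entry the registers of all loop variables of the program must
  be zero, and on exit all registers have their old values.\<close>

definition gn_ok :: "nat \<Rightarrow> gn \<Rightarrow> nat \<Rightarrow> bool" where
  "gn_ok n g K \<longleftrightarrow> (\<forall>x \<sigma> out B t. n \<le> t \<longrightarrow> (\<forall>r\<ge>t. \<sigma> r = 0) \<longrightarrow> (\<forall>r<n. \<sigma> r \<le> B) \<longrightarrow> length x \<le> B \<longrightarrow>
     (\<forall>i\<in>bound_vars g. \<sigma> i = 0) \<longrightarrow>
     exec_within x (cmd_gn g t) (0, \<sigma>, out) ((B + 2) ^ K) (0, \<sigma>, out @ gsem x \<sigma> g))"

lemma gn_okI:
  assumes 1: "\<And>x \<sigma> out B t. n \<le> t \<Longrightarrow> \<forall>r\<ge>t. \<sigma> r = 0 \<Longrightarrow> \<forall>r<n. \<sigma> r \<le> B \<Longrightarrow> length x \<le> B \<Longrightarrow>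
     \<forall>i\<in>bound_vars g. \<sigma> i = 0 \<Longrightarrow>
     exec_within x (cmd_gn g t) (0, \<sigma>, out) (m x \<sigma> B) (0, \<sigma>, out @ gsem x \<sigma> g)"
    and 2: "\<And>x \<sigma> B. \<forall>r<n. \<sigma> r \<le> B \<Longrightarrow> length x \<le> B \<Longrightarrow> m x \<sigma> B \<le> (B + 2) ^ K"
  shows "gn_ok n g K"
  unfolding gn_ok_def
proof (intro allI impI)
  fix x :: "bool list" and \<sigma> :: "nat \<Rightarrow> nat" and out B t
  assume *: "n \<le> t" "\<forall>r\<ge>t. \<sigma> r = 0" "\<forall>r<n. \<sigma> r \<le> B" "length x \<le> B" "\<forall>i\<in>bound_vars g. \<sigma> i = 0"
  show "exec_within x (cmd_gn g t) (0, \<sigma>, out) ((B + 2) ^ K) (0, \<sigma>, out @ gsem x \<sigma> g)"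
    by (rule within_mono[OF 1[OF *] 2[OF *(3,4)]])
qed

lemma gn_okD:
  assumes "gn_ok n g K" "n \<le> t" "\<And>r. r \<ge> t \<Longrightarrow> \<sigma> r = 0" "\<And>r. r < n \<Longrightarrow> \<sigma> r \<le> B" "length x \<le> B"
    and "\<And>i. i \<in> bound_vars g \<Longrightarrow> \<sigma> i = 0" "s' = (0, \<sigma>, out @ gsem x \<sigma> g)"
  shows "exec_within x (cmd_gn g t) (0, \<sigma>, out) ((B + 2) ^ K) s'"
  using assms unfolding gn_ok_def by blast

lemma gn_ok: "wf_gn n g \<Longrightarrow> \<exists>K. gn_ok n g K"
proof (induction g)
  case (Em e)
  then obtain K where K: "ex_ok n e K" using ex_ok by auto
  obtain L where L: "\<And>x \<sigma> B. (\<forall>r<n. \<sigma> r \<le> B) \<Longrightarrow> length x \<le> B \<Longrightarrow> ev x \<sigma> e \<le> (B + 2) ^ L"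
    using ev_bound[of n e] Em by auto
  have *: "exec_within x (cmd_gn (Em e) t) (0, \<sigma>, out) ((B + 2) ^ K + ((ev x \<sigma> e * (20 * (ev x \<sigma> e + 1)) + 1) + 1))
    (0, \<sigma>, out @ gsem x \<sigma> (Em e))"
    if t: "n \<le> t" "\<forall>r\<ge>t. \<sigma> r = 0" "\<forall>r<n. \<sigma> r \<le> B" "length x \<le> B" for x \<sigma> out B t
  proof -
    let ?\<tau> = "\<sigma>(t := ev x \<sigma> e)"
    have 1: "exec_within x (cmd_ex e t (t + 1)) (0, \<sigma>, out) ((B + 2) ^ K) (0, ?\<tau>, out)"
      by (rule ex_okD[OF K]) (use t in \<open>auto simp: fun_eq_iff\<close>)
    have 2: "exec_within x (cmd_nat t) (0, ?\<tau>, out) ((?\<tau> t * (20 * (?\<tau> t + 1)) + 1) + 1)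
      (0, ?\<tau>(t := 0), out @ encode_nat (?\<tau> t))"
      by (rule cmd_nat) (use t in auto)
    have "?\<tau>(t := 0) = \<sigma>" using t by (auto simp: fun_eq_iff)
    then show ?thesis using within_Seq[OF 1 2] by simp
  qed
  have "gn_ok n (Em e) (K + ((L + (20 + (L + 1 + 1)) + 1 + 1) + 1 + 1) + 1)"
  proof (rule gn_okI[OF *], assumption+)
    fix x :: "bool list" and \<sigma> :: "nat \<Rightarrow> nat" and B
    assume "\<forall>r<n. \<sigma> r \<le> B" "length x \<le> B"
    then show "(B + 2) ^ K + ((ev x \<sigma> e * (20 * (ev x \<sigma> e + 1)) + 1) + 1)
      \<le> (B + 2) ^ (K + ((L + (20 + (L + 1 + 1)) + 1 + 1) + 1 + 1) + 1)"
      by (intro pow_add pow_mult L pow_const order_refl)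
  qed
  then show ?case by blast
next
  case Nop
  have "gn_ok n Nop 0" unfolding gn_ok_def by (auto intro: within_mono[OF within_prim(6)])
  then show ?case by blast
next
  case (Sq a b)
  then obtain K L where K: "gn_ok n a K" and L: "gn_ok n b L" by auto
  have "gn_ok n (Sq a b) (K + L + 1)"
  proof (rule gn_okI[where m = "\<lambda>x \<sigma> B. (B + 2) ^ K + (B + 2) ^ L"])
    fix x :: "bool list" and \<sigma> :: "nat \<Rightarrow> nat" and out B t
    assume t: "n \<le> t" "\<forall>r\<ge>t. \<sigma> r = 0" "\<forall>r<n. \<sigma> r \<le> B" "length x \<le> B" "\<forall>i\<in>bound_vars (Sq a b). \<sigma> i = 0"
    show "exec_within x (cmd_gn (Sq a b) t) (0, \<sigma>, out) ((B + 2) ^ K + (B + 2) ^ L) (0, \<sigma>, out @ gsem x \<sigma> (Sq a b))"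
      unfolding cmd_gn.simps
      by (rule within_Seq[OF gn_okD[OF K _ _ _ _ _ refl] gn_okD[OF L]]) (use t in auto)
  qed (intro pow_add order_refl)
  then show ?case by blast
next
  case (Fr i e g)
  then have "vars_below n e" "\<exists>G. gn_ok n g G" by auto
  with ex_ok obtain K G where K: "ex_ok n e K" and G: "gn_ok n g G" by blast
  obtain L where L: "\<And>x \<sigma> B. (\<forall>r<n. \<sigma> r \<le> B) \<Longrightarrow> length x \<le> B \<Longrightarrow> ev x \<sigma> e \<le> (B + 2) ^ L"
    using ev_bound[of n e] Fr.prems by auto
  let ?c = "\<lambda>x \<sigma> B. (B + 2) ^ K + ((ev x \<sigma> e * ((1 + ((ev x \<sigma> e + (B + 2)) ^ G + 2)) + 2) + 1) + (ev x \<sigma> e * (1 + 2) + 1))"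
  have *: "exec_within x (cmd_gn (Fr i e g) t) (0, \<sigma>, out) (?c x \<sigma> B)
    (0, \<sigma>, out @ gsem x \<sigma> (Fr i e g))"
    if t: "n \<le> t" "\<forall>r\<ge>t. \<sigma> r = 0" "\<forall>r<n. \<sigma> r \<le> B" "length x \<le> B" "\<forall>i\<in>bound_vars (Fr i e g). \<sigma> i = 0"
    for x \<sigma> out B t
  proof -
    have i: "i < n" "i \<notin> bound_vars g" "wf_gn n g" "\<sigma> i = 0" using Fr.prems t by auto
    have tb: "t \<notin> bound_vars g" using bound_vars_below[OF i(3)] t(1) by fastforce
    define v where "v = ev x \<sigma> e"
    define S where "S k = ((0::int), \<sigma>(i := v - k, t := k), out @ concat (map (\<lambda>j. gsem x (\<sigma>(i := j)) g) [0..<v - k]))" for k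
    define T where "T k = ((0::int), \<sigma>(i := k), out @ concat (map (\<lambda>j. gsem x (\<sigma>(i := j)) g) [0..<v]))" for k
    have 1: "exec_within x (cmd_ex e t (t + 1)) (0, \<sigma>, out) ((B + 2) ^ K) (S v)"
      by (rule ex_okD[OF K]) (use t i in \<open>auto simp: fun_eq_iff S_def v_def\<close>)
    have 2: "exec_within x (While (RegPos t) (Seq (Dec t) (Seq (cmd_gn g (t + 1)) (Inc i)))) (S v)
      (v * ((1 + ((v + B + 2) ^ G + 2)) + 2) + 1) (S 0)"
    proof (rule within_While)
      fix k assume k: "k < v"
      let ?\<tau> = "\<sigma>(i := v - Suc k, t := k)"
      let ?o = "out @ concat (map (\<lambda>j. gsem x (\<sigma>(i := j)) g) [0..<v - Suc k])"
      \<comment> \<open>The loop counter is a variable of the body and can exceed \<open>B\<close>,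
        so the body is run with the bound \<open>v + B\<close>. As \<open>v\<close> is itself at
        most a power of \<open>B + 2\<close>, the result is still such a power.\<close>
      have "exec_within x (cmd_gn g (t + 1)) (0, ?\<tau>, ?o) ((v + B + 2) ^ G) (0, ?\<tau>, ?o @ gsem x ?\<tau> g)"
        by (rule gn_okD[OF G]) (use t i k tb in \<open>auto simp: trans_le_add2\<close>)
      moreover have "gsem x ?\<tau> g = gsem x (\<sigma>(i := v - Suc k)) g"
        by (rule gsem_cong[OF i(3)]) (use t in auto)
      moreover have "v - k = Suc (v - Suc k)" using k by simp
      ultimately have 3: "exec_within x (cmd_gn g (t + 1)) (0, ?\<tau>, ?o) ((v + B + 2) ^ G)
         (0, ?\<tau>, out @ concat (map (\<lambda>j. gsem x (\<sigma>(i := j)) g) [0..<v - k]))"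
        by simp
      have "exec_within x (Dec t) (S (Suc k)) 1 (0, ?\<tau>, ?o)"
        unfolding S_def by (rule within_prim) (use t i k in \<open>auto simp: fun_eq_iff\<close>)
      from within_Seq[OF this within_Seq[OF 3 within_prim(1)]]
      show "exec_within x (Seq (Dec t) (Seq (cmd_gn g (t + 1)) (Inc i))) (S (Suc k)) (1 + ((v + B + 2) ^ G + 2)) (S k)"
        by (rule meta_mp) (use t i k in \<open>auto simp: S_def fun_eq_iff\<close>)
    qed (use t i in \<open>auto simp: S_def\<close>)
    have "S 0 = T v" using t i by (auto simp: S_def T_def fun_eq_iff)
    have 3: "exec_within x (While (RegPos i) (Dec i)) (T v) (v * (1 + 2) + 1) (T 0)"
    proof (rule within_While)
      fix k assume k: "k < v"
      show "exec_within x (Dec i) (T (Suc k)) 1 (T k)"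
        unfolding T_def by (rule within_prim) (auto simp: fun_eq_iff)
    qed (auto simp: T_def)
    have "T 0 = (0, \<sigma>, out @ gsem x \<sigma> (Fr i e g))" using i by (auto simp: T_def v_def fun_eq_iff)
    then show ?thesis using within_Seq[OF 1 within_Seq[OF 2 3[folded \<open>S 0 = T v\<close>]]]
      by (simp add: v_def add.assoc)
  qed
  let ?K = "K + (((L + (((1 + ((L + 1 + 1) * G + 2 + 1) + 1) + 2 + 1)) + 1 + 1) + ((L + 3) + 1 + 1) + 1)) + 1"
  have "gn_ok n (Fr i e g) ?K"
  proof (rule gn_okI[OF *], assumption+)
    fix x :: "bool list" and \<sigma> :: "nat \<Rightarrow> nat" and B
    assume a: "\<forall>r<n. \<sigma> r \<le> B" "length x \<le> B"
    have "ev x \<sigma> e + (B + 2) \<le> (B + 2) ^ (L + 1 + 1)" by (intro pow_add L a) simp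
    then have "(ev x \<sigma> e + (B + 2)) ^ G \<le> (B + 2) ^ ((L + 1 + 1) * G)"
      unfolding power_mult by (rule power_mono) simp
    moreover have "1 + 2 \<le> (B + 2) ^ 3" using pow_const[of 3 B] by linarith
    ultimately show "?c x \<sigma> B \<le> (B + 2) ^ ?K"
      by (intro pow_add pow_mult L a pow_const order_refl)
  qed
  then show ?case by blast
qed

lemma regs_below_mono: "regs_below k c \<Longrightarrow> k \<le> k' \<Longrightarrow> regs_below k' c"
  by (induction c) auto

lemma ex_regs_below: "\<exists>k. regs_below k c"
proof (induction c)
  case (Seq c1 c2)
  then obtain k1 k2 where "regs_below k1 c1" "regs_below k2 c2" by blast
  then have "regs_below (max k1 k2) (Seq c1 c2)" by (auto intro: regs_below_mono)
  then show ?case by blast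
next
  case (Cond b c1 c2)
  then obtain k1 k2 where "regs_below k1 c1" "regs_below k2 c2" by blast
  then have "regs_below (max (cond_tape b) (max k1 k2)) (Cond b c1 c2)" by (auto intro: regs_below_mono)
  then show ?case by blast
next
  case (While b c)
  then obtain k where "regs_below k c" by blast
  then have "regs_below (max (cond_tape b) k) (While b c)" by (auto intro: regs_below_mono)
  then show ?case by blast
qed (auto intro: exI[of _ "Suc _"])

theorem polytime_computable_gsem:
  assumes "wf_gn n g"
  shows "polytime_computable (\<lambda>x. gsem x (\<lambda>_. 0) g)"
proof -
  obtain K where K: "gn_ok n g K" using gn_ok[OF assms] by blast
  obtain k where k: "regs_below k (cmd_gn g n)" using ex_regs_below by blast
  show ?thesis
  proof (rule polytime_computable_cmd[OF k, where p = "[:2, 1:] ^ K"])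
    fix x :: "bool list"
    have "exec_within x (cmd_gn g n) (0, \<lambda>_. 0, []) ((length x + 2) ^ K) (0, \<lambda>_. 0, [] @ gsem x (\<lambda>_. 0) g)"
      by (rule gn_okD[OF K]) auto
    then show "\<exists>t h \<sigma>. t \<le> poly ([:2, 1:] ^ K) (length x) \<and>
        exec x (cmd_gn g n) (0, \<lambda>_. 0, []) t (h, \<sigma>, gsem x (\<lambda>_. 0) g)"
      unfolding exec_within_def poly_power by (auto simp: add.commute)
  qed
qed

section \<open>Accepting computations as constraint satisfaction\<close>

definition stay :: "nat list \<Rightarrow> (nat \<times> move) list" where
  "stay rs = map (\<lambda>a. (a, Stay)) rs"

text \<open>Replaces halting in state 1 after an unknown number of steps by being in a fresh state
  \<open>Q\<close> after a fixed number of steps: \<open>Q\<close> is entered exactly where state 1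
  has no transition, and then the machine idles.\<close>

definition ext_trans :: "tm \<Rightarrow> nat \<Rightarrow> nat \<Rightarrow> transition set" where
  "ext_trans M S Q = transitions M
     \<union> {(1, rs, Q, stay rs) | rs. length rs = tape_count M \<and> set rs \<subseteq> {..<S} \<and>
          (\<forall>q' as. (1, rs, q', as) \<notin> transitions M)}
     \<union> {(Q, rs, Q, stay rs) | rs. length rs = tape_count M \<and> set rs \<subseteq> {..<S}}"

definition ext_tm :: "tm \<Rightarrow> nat \<Rightarrow> nat \<Rightarrow> tm" where
  "ext_tm M S Q = \<lparr>tape_count = tape_count M, transitions = ext_trans M S Q\<rparr>"

locale ntm =
  fixes M :: tm and p :: "nat poly" and S Q :: nat
  assumes wf: "wf_tm M" and time: "runs_in_time M p"
    and S: "3 \<le> S" and Q: "1 < Q"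
    and bounds: "(q, rs, q', as) \<in> transitions M \<Longrightarrow>
       q < Q \<and> q' < Q \<and> set rs \<subseteq> {..<S} \<and> fst ` set as \<subseteq> {..<S}"
begin

lemma map2_stay: "length ts = length rs \<Longrightarrow> rs = map read_tape ts \<Longrightarrow> map2 act_tape (stay rs) ts = ts"
  by (rule nth_equalityI) (auto simp: stay_def act_tape_id)

text \<open>The added transitions exist only for symbols below \<open>S\<close>, so all tapes have
  to stay within this alphabet for the machine to idle.\<close>

definition tidy :: "config \<Rightarrow> bool" where
  "tidy c \<longleftrightarrow> length (snd c) = tape_count M \<and> (\<forall>(h, f) \<in> set (snd c). range f \<subseteq> {..<S})"

lemma tidy_init: "tidy (initial_config M x)"
  using wf S by (auto simp: tidy_def initial_config_def wf_tm_def string_contents_def)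

lemma tidy_read: "tidy (q, ts) \<Longrightarrow> set (map read_tape ts) \<subseteq> {..<S}"
  by (fastforce simp: tidy_def)

lemma ext_trans_wf:
  assumes "(q, rs, q', as) \<in> ext_trans M S Q"
  shows "length rs = tape_count M" "length as = tape_count M" "fst ` set as \<subseteq> {..<S}" "set rs \<subseteq> {..<S}"
    "q \<le> Q" "q' \<le> Q"
proof -
  have *: "fst ` set (stay us) = set us" "length (stay us) = length us" for us
    by (auto simp: stay_def image_iff)
  consider "(q, rs, q', as) \<in> transitions M"
    | "q = 1 \<or> q = Q" "q' = Q" "as = stay rs" "length rs = tape_count M" "set rs \<subseteq> {..<S}"
    using assms unfolding ext_trans_def by blast
  then have "length rs = tape_count M \<and> length as = tape_count M \<and> fst ` set as \<subseteq> {..<S} \<and> set rs \<subseteq> {..<S} \<and> q \<le> Q \<and> q' \<le> Q"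
  proof cases
    case 1
    with wf have "length rs = tape_count M \<and> length as = tape_count M" unfolding wf_tm_def by blast
    with bounds[OF 1] show ?thesis by simp
  next
    case 2
    then show ?thesis using Q by (auto simp: *)
  qed
  then show "length rs = tape_count M" "length as = tape_count M" "fst ` set as \<subseteq> {..<S}" "set rs \<subseteq> {..<S}"
    "q \<le> Q" "q' \<le> Q" by blast+
qed

lemma tidy_step:
  assumes "tm_step (ext_tm M S Q) c c'" "tidy c"
  shows "tidy c'"
  using assms(1)
proof cases
  case (1 q ts q' as)
  have as: "length as = tape_count M" "fst ` set as \<subseteq> {..<S}"
    using ext_trans_wf 1(3) by (auto simp: ext_tm_def)
  have ts: "length ts = tape_count M" "\<And>h f. (h, f) \<in> set ts \<Longrightarrow> range f \<subseteq> {..<S}"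
    using assms(2) 1(1) by (simp add: tidy_def) (use assms(2) 1(1) in \<open>fastforce simp: tidy_def\<close>)
  have "range f \<subseteq> {..<S}" if hf: "(h, f) \<in> set (map2 act_tape as ts)" for h f
  proof -
    from hf obtain s m h' f' where *: "(s, m) \<in> set as" "(h', f') \<in> set ts" "f = f'(h' := s)"
    proof -
      from hf obtain a t where at: "(a, t) \<in> set (zip as ts)" "(h, f) = act_tape a t" by auto
      obtain s m where a: "a = (s, m)" by (rule prod.exhaust)
      obtain h' f' where t: "t = (h', f')" by (rule prod.exhaust)
      show ?thesis
        by (rule that[of s m h' f']) (use set_zip_leftD[OF at(1)] set_zip_rightD[OF at(1)] at(2) a t in auto)
    qed
    from * ts(2) as(2) have "range f' \<subseteq> {..<S}" "s < S" by fastforce+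
    with * show ?thesis by auto
  qed
  then have "\<forall>(h, f) \<in> set (map2 act_tape as ts). range f \<subseteq> {..<S}" by blast
  then show ?thesis unfolding tidy_def using 1 as ts by simp
qed

lemma step_ext:
  assumes "tm_step M c c'" shows "tm_step (ext_tm M S Q) c c'"
  using assms
proof cases
  case (1 q ts q' as)
  then show ?thesis using tm_step.intros[of q ts q' as "ext_tm M S Q"]
    by (simp add: ext_tm_def ext_trans_def)
qed

lemma steps_ext: "(tm_step M ^^ t) c c' \<Longrightarrow> (tm_step (ext_tm M S Q) ^^ t) c c'"
  by (induction t arbitrary: c') (auto intro: step_ext)

lemma tidy_steps: "(tm_step (ext_tm M S Q) ^^ t) c c' \<Longrightarrow> tidy c \<Longrightarrow> tidy c'"
  by (induction t arbitrary: c') (auto intro: tidy_step)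

lemma idle_steps:
  assumes "tidy (Q, ts)"
  shows "(tm_step (ext_tm M S Q) ^^ t) (Q, ts) (Q, ts)"
proof (induction t)
  case (Suc t)
  have "tm_step (ext_tm M S Q) (Q, ts) (Q, map2 act_tape (stay (map read_tape ts)) ts)"
    using assms tidy_read[OF assms]
    by (intro tm_step.intros) (auto simp: ext_tm_def ext_trans_def tidy_def)
  then have "tm_step (ext_tm M S Q) (Q, ts) (Q, ts)" by (simp add: map2_stay)
  with Suc show ?case by (rule relpowp_Suc_I)
qed simp

text \<open>\<open>P\<close> strictly exceeds the time bound, which leaves one step for entering
  \<open>Q\<close>; the remaining steps are spent idling.\<close>

lemma accepts_ext_run:
  assumes "poly p (length x) < P"
  shows "accepts M x \<longleftrightarrow> (\<exists>ts. (tm_step (ext_tm M S Q) ^^ P) (initial_config M x) (Q, ts))"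
proof
  assume "accepts M x"
  then obtain t ts where t: "(tm_step M ^^ t) (initial_config M x) (1, ts)" "halted M (1, ts)"
    by (auto simp: accepts_def)
  have "t \<le> poly p (length x)" using time t(1) by (auto simp: runs_in_time_def)
  then obtain u where P: "P = t + Suc u" using assms less_iff_Suc_add[of t P] by auto
  have 1: "(tm_step (ext_tm M S Q) ^^ t) (initial_config M x) (1, ts)" by (rule steps_ext[OF t(1)])
  have tidy: "tidy (1, ts)" by (rule tidy_steps[OF 1 tidy_init])
  have "\<forall>q' as. (1, map read_tape ts, q', as) \<notin> transitions M"
    using t(2) tm_step.intros[of 1 ts _ _ M] unfolding halted_def by blast
  then have "tm_step (ext_tm M S Q) (1, ts) (Q, map2 act_tape (stay (map read_tape ts)) ts)"
    using tidy tidy_read[OF tidy]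
    by (intro tm_step.intros) (auto simp: ext_tm_def ext_trans_def tidy_def)
  then have 2: "tm_step (ext_tm M S Q) (1, ts) (Q, ts)" by (simp add: map2_stay)
  have "(tm_step (ext_tm M S Q) ^^ u) (Q, ts) (Q, ts)"
    by (rule idle_steps) (use tidy in \<open>auto simp: tidy_def\<close>)
  from relpowp_trans[OF 1 relpowp_Suc_I2[OF 2 this]]
  show "\<exists>ts. (tm_step (ext_tm M S Q) ^^ P) (initial_config M x) (Q, ts)" unfolding P by blast
next
  assume "\<exists>ts. (tm_step (ext_tm M S Q) ^^ P) (initial_config M x) (Q, ts)"
  then obtain ts where run: "(tm_step (ext_tm M S Q) ^^ P) (initial_config M x) (Q, ts)" by blast
  \<comment> \<open>Generalized to every start outside \<open>Q\<close>. Until \<open>Q\<close> is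
    entered the run is one of \<open>M\<close>, and \<open>Q\<close> can only be entered from a
    configuration in state 1 where \<open>M\<close> has halted.\<close>
  have "\<exists>t' c'. (tm_step M ^^ t') c c' \<and> halted M c' \<and> fst c' = 1"
    if "(tm_step (ext_tm M S Q) ^^ t) c (Q, ts)" "fst c \<noteq> Q" for t c
    using that
  proof (induction t arbitrary: c)
    case (Suc t)
    obtain d where d: "tm_step (ext_tm M S Q) c d" "(tm_step (ext_tm M S Q) ^^ t) d (Q, ts)"
      using Suc.prems(1) by (rule relpowp_Suc_E2)
    from d(1) show ?case
    proof cases
      case (1 q us q' as)
      consider "(q, map read_tape us, q', as) \<in> transitions M"
        | "q = 1" "\<forall>q' as. (1, map read_tape us, q', as) \<notin> transitions M"
        using 1 Suc.prems(2) by (auto simp: ext_tm_def ext_trans_def)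
      then show ?thesis
      proof cases
        case a: 1
        then have "tm_step M c d" using 1 tm_step.intros[OF a] by simp
        moreover have "fst d \<noteq> Q" using bounds[OF a] 1 by auto
        ultimately show ?thesis using Suc.IH[OF d(2)] by (meson relpowp_Suc_I2)
      next
        case 2
        then have "halted M c" unfolding halted_def 1 by (metis tm_step.cases prod.inject)
        with 2 1 show ?thesis by (intro exI[of _ 0] exI[of _ c]) auto
      qed
    qed
  qed auto
  from this[OF run] show "accepts M x"
    using Q by (auto simp: accepts_def initial_config_def)
qed

end

lemma ntm_exists:
  assumes "wf_tm M" "runs_in_time M p"
  shows "\<exists>S Q. ntm M p S Q"
proof -
  have fin: "finite (transitions M)" using assms(1) by (simp add: wf_tm_def)
  define U where "U = (\<Union>(q, rs, q', as) \<in> transitions M. {q, q'} \<union> set rs \<union> fst ` set as)"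
  have "finite U" unfolding U_def using fin by auto
  then obtain n where n: "\<forall>u\<in>U. u < n" by (meson finite_nat_set_iff_bounded)
  have "ntm M p (n + 3) (n + 2)"
  proof (unfold_locales, goal_cases)
    case (5 q rs q' as)
    have "(\<lambda>(q, rs, q', as). {q, q'} \<union> set rs \<union> fst ` set as) (q, rs, q', as) \<subseteq> U"
      unfolding U_def by (rule UN_upper[OF 5])
    then have *: "{q, q'} \<union> set rs \<union> fst ` set as \<subseteq> U" by simp
    have u: "u < n" if "u \<in> {q, q'} \<union> set rs \<union> fst ` set as" for u using n * that by blast
    have "q < n" "q' < n" "set rs \<subseteq> {..<n}" "fst ` set as \<subseteq> {..<n}" using u by blast+
    moreover have "{..<n} \<subseteq> {..<n + 3}" by auto
    ultimately show ?case by (meson less_SucI order_trans trans_less_add1)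
  qed (use assms in auto)
  then show ?thesis by blast
qed

section \<open>Clause schemes for the computation table\<close>

text \<open>Tests are expressions with value 0 or 1; truncated subtraction supplies comparison and
  negation.\<close>

definition eqx :: "ex \<Rightarrow> ex \<Rightarrow> ex" where
  "eqx a b = Sub (Cn 1) (Add (Sub a b) (Sub b a))"

definition ltx :: "ex \<Rightarrow> ex \<Rightarrow> ex" where
  "ltx a b = Sub (Cn 1) (Sub (Add a (Cn 1)) b)"

definition notx :: "ex \<Rightarrow> ex" where
  "notx a = Sub (Cn 1) a"

lemma ev_tests [simp]:
  "ev x \<sigma> (eqx a b) = (if ev x \<sigma> a = ev x \<sigma> b then 1 else 0)"
  "ev x \<sigma> (ltx a b) = (if ev x \<sigma> a < ev x \<sigma> b then 1 else 0)"
  "ev x \<sigma> (notx a) = 1 - ev x \<sigma> a"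
  by (auto simp: eqx_def ltx_def notx_def)

lemma vars_below_tests [simp]:
  "vars_below n (eqx a b) \<longleftrightarrow> vars_below n a \<and> vars_below n b"
  "vars_below n (ltx a b) \<longleftrightarrow> vars_below n a \<and> vars_below n b"
  "vars_below n (notx a) \<longleftrightarrow> vars_below n a"
  by (auto simp: eqx_def ltx_def notx_def)

fun poly_ex :: "nat list \<Rightarrow> ex" where
  "poly_ex [] = Cn 0"
| "poly_ex (a # as) = Add (Cn a) (Mul Len (poly_ex as))"

lemma ev_poly_ex: "ev x \<sigma> (poly_ex as) = poly (Poly as) (length x)"
  by (induction as) auto

lemma vars_below_poly_ex [simp]: "vars_below n (poly_ex as)"
  by (induction as) auto

text \<open>A clause scheme is an activity condition together with literals \<open>(\<kappa>, d, e)\<close>, denoting the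
  variable \<open>\<kappa>\<close> at time \<open>t + d\<close> and position \<open>e\<close>, where \<open>Vr 1\<close> and \<open>Vr 2\<close> are the time \<open>t\<close> and the
  position \<open>i\<close> at which the scheme is instantiated.\<close>

type_synonym scheme = "ex \<times> (nat \<times> nat \<times> ex) list"

definition at_pos :: "nat \<Rightarrow> nat \<Rightarrow> nat \<Rightarrow> nat" where
  "at_pos t i = (\<lambda>_. 0)(1 := t, 2 := i)"

lemma at_pos [simp]: "at_pos t i (Suc 0) = t" "at_pos t i 2 = i"
  by (auto simp: at_pos_def)

definition scheme_sat :: "bool list \<Rightarrow> nat \<Rightarrow> nat \<Rightarrow> (nat \<Rightarrow> nat \<Rightarrow> nat \<Rightarrow> bool) \<Rightarrow> scheme \<Rightarrow> bool" where
  "scheme_sat x P W X f \<longleftrightarrow> (\<forall>t<P. \<forall>i<W. ev x (at_pos t i) (fst f) \<noteq> 0 \<longrightarrow>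
     (\<exists>(\<kappa>, d, e) \<in> set (snd f). X \<kappa> (t + d) (ev x (at_pos t i) e)))"

fun move_code :: "move \<Rightarrow> nat" where
  "move_code Move_Left = 0" | "move_code Stay = 1" | "move_code Move_Right = 2"

text \<open>Cells are addressed relative to the head. The symbol read always has offset 0, so head
  positions need no variables and the contents move instead.\<close>

definition sym_at :: "config \<Rightarrow> nat \<Rightarrow> int \<Rightarrow> nat" where
  "sym_at c j i = (case snd c ! j of (h, f) \<Rightarrow> f (h + i))"

locale ntm_list = ntm +
  fixes trs :: "transition list"
  assumes trs: "set trs = ext_trans M S Q"
begin

text \<open>Variables come in \<open>m + k * S\<close> kinds. Kind \<open>a < m\<close> at time
  \<open>t\<close> and position 0 says that transition \<open>a\<close> is taken at time
  \<open>t\<close>. Kind \<open>cv j s\<close> at position \<open>i\<close> says that tape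
  \<open>j\<close> carries \<open>s\<close> at offset \<open>i\<close> minus the time bound from its
  head.\<close>

definition "m = length trs"
definition "k = tape_count M"
definition "src a = fst (trs ! a)"
definition "rd a = fst (snd (trs ! a))"
definition "tgt a = fst (snd (snd (trs ! a)))"
definition "wr a j = fst (snd (snd (snd (trs ! a))) ! j)"
definition "mv a j = move_code (snd (snd (snd (snd (trs ! a))) ! j))"
definition "cv j s = m + j * S + s"
definition "Pe = Add (Cn 1) (poly_ex (coeffs p))"
text \<open>The window has the time bound as its radius and the head in its middle, so every cell
  that can be read is inside.\<close>

definition "We = Add (Cn 1) (Mul (Cn 2) Pe)"
definition "tp x = poly p (length x) + 1"
text \<open>The codes 0, 1, 2 of left, stay, right are chosen so that a head move shifts the
  relative index of every cell by one minus the code, without negative numbers.\<close>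

definition "nextp a j = Sub (Add (Vr 2) (Cn 1)) (Cn (mv a j))"
definition "sucx = ltx (Add (Vr 1) (Cn 1)) Pe"

definition "initx j = (if j = 0 then Mul (notx (ltx (Vr 2) Pe)) (Inp (Sub (Vr 2) Pe)) else Cn 0)"

text \<open>\<open>neg1\<close> to \<open>neg3\<close> make the chosen transitions a path of states
  from 0 to \<open>Q\<close>. \<open>neg4\<close> ties them to the symbols under the heads,
  \<open>neg5\<close> to the symbols written, found one step later at the shifted middle of the
  window. \<open>neg6\<close> copies the cells away from the heads, and \<open>neg7\<close> fixes
  the initial tapes, the input starting in the middle.\<close>

definition neg1 :: "scheme list" where
  "neg1 = [(eqx (Vr 1) (Cn 0), [(a, 0, Cn 0)]). a \<leftarrow> [0..<m], src a \<noteq> 0]"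
definition neg2 :: "scheme list" where
  "neg2 = [(sucx, [(a, 0, Cn 0), (b, 1, Cn 0)]). a \<leftarrow> [0..<m], b \<leftarrow> [0..<m], tgt a \<noteq> src b]"
definition neg3 :: "scheme list" where
  "neg3 = [(eqx (Add (Vr 1) (Cn 1)) Pe, [(a, 0, Cn 0)]). a \<leftarrow> [0..<m], tgt a \<noteq> Q]"
definition neg4 :: "scheme list" where
  "neg4 = [(Cn 1, [(a, 0, Cn 0), (cv j s, 0, Pe)]).
     a \<leftarrow> [0..<m], j \<leftarrow> [0..<k], s \<leftarrow> [0..<S], s \<noteq> rd a ! j]"
definition neg5 :: "scheme list" where
  "neg5 = [(sucx, [(a, 0, Cn 0), (cv j s, 1, Sub (Add Pe (Cn 1)) (Cn (mv a j)))]).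
     a \<leftarrow> [0..<m], j \<leftarrow> [0..<k], s \<leftarrow> [0..<S], s \<noteq> wr a j]"
definition neg6 :: "scheme list" where
  "neg6 = [(Mul (Mul sucx (notx (eqx (Vr 2) Pe)))
       (Mul (notx (ltx (Add (Vr 2) (Cn 1)) (Cn (mv a j)))) (ltx (nextp a j) We)),
      [(a, 0, Cn 0), (cv j s, 0, Vr 2), (cv j s', 1, nextp a j)]).
     a \<leftarrow> [0..<m], j \<leftarrow> [0..<k], s \<leftarrow> [0..<S], s' \<leftarrow> [0..<S], s \<noteq> s']"
definition neg7 :: "scheme list" where
  "neg7 = [(Mul (eqx (Vr 1) (Cn 0)) (notx (eqx (initx j) (Cn s))), [(cv j s, 0, Vr 2)]).
     j \<leftarrow> [0..<k], s \<leftarrow> [0..<S]]"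

definition neg :: "scheme list" where
  "neg = neg1 @ neg2 @ neg3 @ neg4 @ neg5 @ neg6 @ neg7"

text \<open>Positive clauses only assert existence. The negative clauses bind every true variable,
  so any selection of a true transition and a true symbol describes the run.\<close>

definition pos :: "scheme list" where
  "pos = (Cn 1, [(a, 0, Cn 0). a \<leftarrow> [0..<m]]) #
     [(Cn 1, [(cv j s, 0, Vr 2). s \<leftarrow> [0..<S]]). j \<leftarrow> [0..<k]]"

lemma ev_Pe [simp]: "ev x \<sigma> Pe = tp x"
  by (simp add: Pe_def tp_def ev_poly_ex)

lemma ev_We [simp]: "ev x \<sigma> We = Suc (2 * tp x)"
  by (simp add: We_def)

lemma ev_sucx [simp]: "ev x \<sigma> sucx = (if Suc (\<sigma> 1) < tp x then 1 else 0)"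
  by (simp add: sucx_def)

lemma ev_nextp [simp]: "ev x \<sigma> (nextp a j) = Suc (\<sigma> 2) - mv a j"
  by (simp add: nextp_def)

lemma cv_less: "j < k \<Longrightarrow> s < S \<Longrightarrow> cv j s < m + k * S"
proof -
  assume "j < k" "s < S"
  then have "j * S + s < Suc j * S" by simp
  also have "\<dots> \<le> k * S" using \<open>j < k\<close> by (intro mult_le_mono1) simp
  finally show ?thesis by (simp add: cv_def)
qed

lemma k_pos: "0 < k"
  using wf by (simp add: k_def wf_tm_def)

lemma trs_nth: "a < m \<Longrightarrow> trs ! a \<in> ext_trans M S Q"
  using trs by (metis m_def nth_mem)

lemma trs_eq: "trs ! a = (src a, rd a, tgt a, snd (snd (snd (trs ! a))))"
  by (simp add: src_def rd_def tgt_def)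

lemma wr_less: "a < m \<Longrightarrow> j < k \<Longrightarrow> wr a j < S"
proof -
  assume "a < m" "j < k"
  with ext_trans_wf trs_nth trs_eq have "length (snd (snd (snd (trs ! a)))) = k"
    "fst ` set (snd (snd (snd (trs ! a)))) \<subseteq> {..<S}" unfolding k_def by metis+
  with \<open>j < k\<close> show ?thesis unfolding wr_def by (metis image_subset_iff lessThan_iff nth_mem)
qed

lemma sym_init:
  assumes "j < k" "i < Suc (2 * tp x)"
  shows "sym_at (initial_config M x) j (int i - int (tp x)) = ev x (at_pos t i) (initx j)"
proof (cases j)
  case 0
  have "string_contents x (int i - int (tp x)) = (1 - (if i < tp x then 1 else 0)) * string_contents x (int (i - tp x))"
    by (auto simp: string_contents_def of_nat_diff)
  with 0 show ?thesis by (simp add: sym_at_def initial_config_def initx_def)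
next
  case (Suc j')
  then show ?thesis using assms
    by (simp add: sym_at_def initial_config_def initx_def k_def string_contents_Nil)
qed

lemma sym_step:
  assumes "length as = k" "length ts = k" "j < k"
  shows "sym_at (q', map2 act_tape as ts) j i =
    (let o' = i + int (move_code (snd (as ! j))) - 1 in
       if o' = 0 then fst (as ! j) else sym_at (q, ts) j o')"
proof -
  obtain w mo where as: "as ! j = (w, mo)" by (rule prod.exhaust)
  obtain h f where ts: "ts ! j = (h, f)" by (rule prod.exhaust)
  show ?thesis using assms as ts by (cases mo) (auto simp: sym_at_def Let_def algebra_simps)
qed

lemma step_trs:
  assumes "tm_step (ext_tm M S Q) c c'" "tidy c"
  obtains a where "a < m" "fst c = src a" "fst c' = tgt a"
    "\<And>j. j < k \<Longrightarrow> rd a ! j = sym_at c j 0"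
    "\<And>j i. j < k \<Longrightarrow> sym_at c' j i = (let o' = i + int (mv a j) - 1 in
        if o' = 0 then wr a j else sym_at c j o')"
  using assms(1)
proof cases
  case (1 q ts q' as)
  then have "(q, map read_tape ts, q', as) \<in> set trs" by (simp add: trs ext_tm_def)
  then obtain a where a: "a < m" "trs ! a = (q, map read_tape ts, q', as)"
    by (metis in_set_conv_nth m_def)
  have len: "length ts = k" "length as = k"
    using assms(2) 1 ext_trans_wf by (auto simp: tidy_def k_def ext_tm_def)
  show ?thesis
  proof (rule that[OF a(1)])
    fix j assume "j < k"
    then show "rd a ! j = sym_at c j 0"
      using len a 1 by (cases "ts ! j") (auto simp: rd_def sym_at_def)
  next
    fix j i assume "j < k"
    then show "sym_at c' j i = (let o' = i + int (mv a j) - 1 in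
        if o' = 0 then wr a j else sym_at c j o')"
      using sym_step[OF len(2,1), of j q' i q] a 1 by (simp add: mv_def wr_def)
  qed (use a 1 in \<open>auto simp: src_def tgt_def\<close>)
qed

lemma step_trsI:
  assumes "tidy c" "a < m" "fst c = src a" "\<And>j. j < k \<Longrightarrow> rd a ! j = sym_at c j 0"
  obtains c' where "tm_step (ext_tm M S Q) c c'" "fst c' = tgt a"
    "\<And>j i. j < k \<Longrightarrow> sym_at c' j i = (let o' = i + int (mv a j) - 1 in
        if o' = 0 then wr a j else sym_at c j o')"
proof -
  obtain q ts where c: "c = (q, ts)" by (rule prod.exhaust)
  define as where "as = snd (snd (snd (trs ! a)))"
  have mem: "(src a, rd a, tgt a, as) \<in> ext_trans M S Q"
    using trs_nth[OF assms(2)] trs_eq[of a] by (simp add: as_def)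
  have len: "length ts = k" "length as = k" "length (rd a) = k"
    using assms(1) ext_trans_wf[OF mem] by (auto simp: tidy_def k_def c)
  have "rd a = map read_tape ts"
  proof (rule nth_equalityI)
    fix j assume "j < length (rd a)"
    then show "rd a ! j = map read_tape ts ! j"
      using assms(4)[of j] len by (cases "ts ! j") (auto simp: sym_at_def c)
  qed (use len in simp)
  with mem assms(3) have "tm_step (ext_tm M S Q) c (tgt a, map2 act_tape as ts)"
    unfolding c by (intro tm_step.intros) (simp add: ext_tm_def)
  then show ?thesis
  proof (rule that)
    fix j i assume "j < k"
    then show "sym_at (tgt a, map2 act_tape as ts) j i = (let o' = i + int (mv a j) - 1 in
        if o' = 0 then wr a j else sym_at c j o')"
      using sym_step[OF len(2,1), of j "tgt a" i q] by (simp add: mv_def wr_def as_def c)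
  qed simp
qed

lemma mv_le: "mv a j \<le> 2"
  by (cases "snd (snd (snd (snd (trs ! a))) ! j)") (auto simp: mv_def)

text \<open>The intended assignment for a run \<open>c\<close> with transitions \<open>a\<close>; a
  kind from \<open>m\<close> on is decoded into its tape and its symbol by division with
  remainder.\<close>

definition asg :: "nat \<Rightarrow> (nat \<Rightarrow> nat) \<Rightarrow> (nat \<Rightarrow> config) \<Rightarrow> nat \<Rightarrow> nat \<Rightarrow> nat \<Rightarrow> bool" where
  "asg P a c \<kappa> t i \<longleftrightarrow> (if \<kappa> < m then \<kappa> = a t
     else (\<kappa> - m) mod S = sym_at (c t) ((\<kappa> - m) div S) (int i - int P))"

lemma asg_simps:
  "b < m \<Longrightarrow> asg P a c b t i \<longleftrightarrow> b = a t"
  "s < S \<Longrightarrow> asg P a c (cv j s) t i \<longleftrightarrow> s = sym_at (c t) j (int i - int P)"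
  using S by (auto simp: asg_def cv_def div_mult_self3 add.commute[of "_ * S"])

lemma tidy_sym: "tidy c \<Longrightarrow> j < k \<Longrightarrow> sym_at c j i < S"
proof -
  assume *: "tidy c" "j < k"
  obtain h f where hf: "snd c ! j = (h, f)" by (rule prod.exhaust)
  have "(h, f) \<in> set (snd c)" using * hf by (metis k_def nth_mem tidy_def)
  with *(1) hf show ?thesis by (fastforce simp: tidy_def sym_at_def)
qed

lemma accepts_scheme_sat:
  assumes "accepts M x"
  shows "\<exists>X. (\<forall>f\<in>set neg. scheme_sat x (tp x) (Suc (2 * tp x)) (\<lambda>\<kappa> t i. \<not> X \<kappa> t i) f) \<and>
             (\<forall>f\<in>set pos. scheme_sat x (tp x) (Suc (2 * tp x)) X f)"
proof -
  obtain ts where "(tm_step (ext_tm M S Q) ^^ tp x) (initial_config M x) (Q, ts)"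
    using assms accepts_ext_run[of x "tp x"] by (auto simp: tp_def)
  then obtain c where c: "c 0 = initial_config M x" "c (tp x) = (Q, ts)"
    "\<And>t. t < tp x \<Longrightarrow> tm_step (ext_tm M S Q) (c t) (c (Suc t))"
    unfolding relpowp_fun_conv by blast
  have tidy: "tidy (c t)" if "t \<le> tp x" for t
    using that
  proof (induction t)
    case (Suc t)
    then show ?case using tidy_step[OF c(3)[of t]] by simp
  qed (simp add: c(1) tidy_init)
  have "\<exists>a. a < m \<and> fst (c t) = src a \<and> fst (c (Suc t)) = tgt a \<and>
      (\<forall>j<k. rd a ! j = sym_at (c t) j 0) \<and>
      (\<forall>j i. j < k \<longrightarrow> sym_at (c (Suc t)) j i = (let o' = i + int (mv a j) - 1 in
        if o' = 0 then wr a j else sym_at (c t) j o'))" if "t < tp x" for t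
    by (rule step_trs[OF c(3)[OF that] tidy]) (use that in auto)
  then obtain a where a: "\<And>t. t < tp x \<Longrightarrow> a t < m \<and> fst (c t) = src (a t) \<and> fst (c (Suc t)) = tgt (a t) \<and>
      (\<forall>j<k. rd (a t) ! j = sym_at (c t) j 0) \<and>
      (\<forall>j i. j < k \<longrightarrow> sym_at (c (Suc t)) j i = (let o' = i + int (mv (a t) j) - 1 in
        if o' = 0 then wr (a t) j else sym_at (c t) j o'))"
    by metis
  let ?X = "asg (tp x) a c"
  have next_o: "int (Suc i - mv b j) - int (tp x) + int (mv b j) - 1 = int i - int (tp x)"
    if "mv b j \<le> Suc i" for i b j using that by (simp add: of_nat_diff)
  have tp: "0 < tp x" by (simp add: tp_def)
  have n1: "scheme_sat x (tp x) (Suc (2 * tp x)) (\<lambda>\<kappa> t i. \<not> ?X \<kappa> t i) f" if "f \<in> set neg1" for f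
  proof -
    have "src (a 0) = 0" using a[OF tp] c(1) by (simp add: initial_config_def)
    then show ?thesis using that by (auto simp: neg1_def scheme_sat_def asg_simps split: if_splits)
  qed
  have n2: "scheme_sat x (tp x) (Suc (2 * tp x)) (\<lambda>\<kappa> t i. \<not> ?X \<kappa> t i) f" if "f \<in> set neg2" for f
  proof -
    have "tgt (a t) = src (a (Suc t))" if "Suc t < tp x" for t using a[of t] a[OF that] that by simp
    then show ?thesis using that by (auto simp: neg2_def scheme_sat_def asg_simps split: if_splits)
  qed
  have n3: "scheme_sat x (tp x) (Suc (2 * tp x)) (\<lambda>\<kappa> t i. \<not> ?X \<kappa> t i) f" if "f \<in> set neg3" for f
  proof -
    have "tgt (a t) = Q" if "Suc t = tp x" for t using a[of t] that c(2) by (metis fst_conv lessI)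
    then show ?thesis using that by (auto simp: neg3_def scheme_sat_def asg_simps split: if_splits)
  qed
  have n4: "scheme_sat x (tp x) (Suc (2 * tp x)) (\<lambda>\<kappa> t i. \<not> ?X \<kappa> t i) f" if "f \<in> set neg4" for f
  proof -
    have "rd (a t) ! j = sym_at (c t) j 0" if "t < tp x" "j < k" for t j using a[OF that(1)] that by simp
    then show ?thesis using that by (auto simp: neg4_def scheme_sat_def asg_simps)
  qed
  have n5: "scheme_sat x (tp x) (Suc (2 * tp x)) (\<lambda>\<kappa> t i. \<not> ?X \<kappa> t i) f" if "f \<in> set neg5" for f
  proof -
    have "sym_at (c (Suc t)) j (int (Suc (tp x) - mv (a t) j) - int (tp x)) = wr (a t) j" if "t < tp x" "j < k" for t j
      using a[OF that(1)] that(2) next_o[of "a t" j "tp x"] mv_le[of "a t" j] tp by (simp add: Let_def)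
    then show ?thesis using \<open>f \<in> set neg5\<close>
      by (fastforce simp: neg5_def scheme_sat_def asg_simps split: if_splits)
  qed
  have n6: "scheme_sat x (tp x) (Suc (2 * tp x)) (\<lambda>\<kappa> t i. \<not> ?X \<kappa> t i) f" if "f \<in> set neg6" for f
  proof -
    have "sym_at (c (Suc t)) j (int (Suc i - mv (a t) j) - int (tp x)) = sym_at (c t) j (int i - int (tp x))"
      if "t < tp x" "j < k" "i \<noteq> tp x" "mv (a t) j \<le> Suc i" for t j i
      using a[OF that(1)] that(2,3) next_o[OF that(4)] by (simp add: Let_def)
    then show ?thesis using \<open>f \<in> set neg6\<close>
      by (fastforce simp: neg6_def scheme_sat_def asg_simps split: if_splits)
  qed
  have n7: "scheme_sat x (tp x) (Suc (2 * tp x)) (\<lambda>\<kappa> t i. \<not> ?X \<kappa> t i) f" if "f \<in> set neg7" for f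
    using that sym_init by (auto simp: neg7_def scheme_sat_def asg_simps c(1) split: if_splits)
  have p: "scheme_sat x (tp x) (Suc (2 * tp x)) ?X f" if "f \<in> set pos" for f
  proof -
    have "\<exists>s<S. s = sym_at (c t) j (int i - int (tp x))" if "t < tp x" "j < k" for t j i
      using tidy_sym[OF tidy[of t] that(2)] that by auto
    moreover have "a t < m" if "t < tp x" for t using a[OF that] by simp
    ultimately show ?thesis using \<open>f \<in> set pos\<close>
      by (fastforce simp: pos_def scheme_sat_def asg_simps)
  qed
  show ?thesis
    by (rule exI[of _ ?X]) (use n1 n2 n3 n4 n5 n6 n7 p in \<open>auto simp: neg_def\<close>)
qed

text \<open>The run is rebuilt step by step: the selected transition applies because the table
  agrees with the true configuration in the part of the window that matters.\<close>

lemma scheme_sat_accepts: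
  assumes neg: "\<And>f. f \<in> set neg \<Longrightarrow> scheme_sat x (tp x) (Suc (2 * tp x)) (\<lambda>\<kappa> t i. \<not> X \<kappa> t i) f"
    and pos: "\<And>f. f \<in> set pos \<Longrightarrow> scheme_sat x (tp x) (Suc (2 * tp x)) X f"
  shows "accepts M x"
proof -
  let ?P = "tp x" let ?W = "Suc (2 * tp x)"
  have tp: "0 < ?P" by (simp add: tp_def)
  have "\<exists>a<m. X a t 0" if "t < ?P" for t
    using pos[of "(Cn 1, [(a, 0, Cn 0). a \<leftarrow> [0..<m]])"] that by (force simp: pos_def scheme_sat_def)
  then obtain a where a: "\<And>t. t < ?P \<Longrightarrow> a t < m \<and> X (a t) t 0" by metis
  have C: "\<exists>s<S. X (cv j s) t i" if "t < ?P" "i < ?W" "j < k" for t i j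
  proof -
    have "(Cn 1, [(cv j s, 0, Vr 2). s \<leftarrow> [0..<S]]) \<in> set pos" using that by (auto simp: pos_def)
    from pos[OF this] that show ?thesis by (force simp: scheme_sat_def)
  qed
  have negD: "(act, ls) \<in> set neg \<Longrightarrow> t < ?P \<Longrightarrow> i < ?W \<Longrightarrow> ev x (at_pos t i) act \<noteq> 0 \<Longrightarrow>
      \<exists>(\<kappa>, d, e) \<in> set ls. \<not> X \<kappa> (t + d) (ev x (at_pos t i) e)" for act ls t i
    using neg[of "(act, ls)"] by (auto simp: scheme_sat_def)
  have 1: "src (a 0) = 0"
  proof (rule ccontr)
    assume "src (a 0) \<noteq> 0"
    then have "(eqx (Vr 1) (Cn 0), [(a 0, 0, Cn 0)]) \<in> set neg"
      using a[OF tp] by (auto simp: neg_def neg1_def)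
    from negD[OF this tp, of 0] show False using a[OF tp] by auto
  qed
  have 2: "tgt (a t) = src (a (Suc t))" if "Suc t < ?P" for t
  proof (rule ccontr)
    have t: "t < ?P" using that by simp
    assume "tgt (a t) \<noteq> src (a (Suc t))"
    then have "(sucx, [(a t, 0, Cn 0), (a (Suc t), 1, Cn 0)]) \<in> set neg"
      using a[OF t] a[OF that] by (auto simp: neg_def neg2_def)
    from negD[OF this t, of 0] show False using a[OF t] a[OF that] that by auto
  qed
  have 3: "tgt (a (?P - 1)) = Q"
  proof (rule ccontr)
    have t: "?P - 1 < ?P" using tp by simp
    assume "tgt (a (?P - 1)) \<noteq> Q"
    then have "(eqx (Add (Vr 1) (Cn 1)) Pe, [(a (?P - 1), 0, Cn 0)]) \<in> set neg"
      using a[OF t] by (auto simp: neg_def neg3_def)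
    from negD[OF this t, of 0] show False using a[OF t] tp by auto
  qed
  have 4: "s = rd (a t) ! j" if "t < ?P" "j < k" "s < S" "X (cv j s) t ?P" for t j s
  proof (rule ccontr)
    assume "s \<noteq> rd (a t) ! j"
    then have "(Cn 1, [(a t, 0, Cn 0), (cv j s, 0, Pe)]) \<in> set neg"
      using a[OF that(1)] that unfolding neg_def neg4_def by fastforce
    from negD[OF this that(1), of 0] show False using a[OF that(1)] that by auto
  qed
  have 5: "s = wr (a t) j" if "Suc t < ?P" "j < k" "s < S" "X (cv j s) (Suc t) (Suc ?P - mv (a t) j)" for t j s
  proof (rule ccontr)
    have t: "t < ?P" using that by simp
    assume "s \<noteq> wr (a t) j"
    then have "(sucx, [(a t, 0, Cn 0), (cv j s, 1, Sub (Add Pe (Cn 1)) (Cn (mv (a t) j)))]) \<in> set neg"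
      using a[OF t] that unfolding neg_def neg5_def by fastforce
    from negD[OF this t, of 0] show False using a[OF t] that by auto
  qed
  have 6: "s = s'" if "Suc t < ?P" "j < k" "s < S" "s' < S" "i < ?W" "i \<noteq> ?P" "mv (a t) j \<le> Suc i"
    "Suc i - mv (a t) j < ?W" "X (cv j s) t i" "X (cv j s') (Suc t) (Suc i - mv (a t) j)" for t j s s' i
  proof (rule ccontr)
    have t: "t < ?P" using that by simp
    assume "s \<noteq> s'"
    then have "(Mul (Mul sucx (notx (eqx (Vr 2) Pe)))
       (Mul (notx (ltx (Add (Vr 2) (Cn 1)) (Cn (mv (a t) j)))) (ltx (nextp (a t) j) We)),
      [(a t, 0, Cn 0), (cv j s, 0, Vr 2), (cv j s', 1, nextp (a t) j)]) \<in> set neg"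
      using a[OF t] that unfolding neg_def neg6_def by fastforce
    from negD[OF this t that(5)] show False using a[OF t] that by auto
  qed
  have 7: "s = ev x (at_pos 0 i) (initx j)" if "j < k" "s < S" "i < ?W" "X (cv j s) 0 i" for j s i
  proof (rule ccontr)
    assume "s \<noteq> ev x (at_pos 0 i) (initx j)"
    moreover have "(Mul (eqx (Vr 1) (Cn 0)) (notx (eqx (initx j) (Cn s))), [(cv j s, 0, Vr 2)]) \<in> set neg"
      using that unfolding neg_def neg7_def by fastforce
    ultimately show False using negD[OF _ tp that(3)] that by fastforce
  qed
  \<comment> \<open>Agreement is claimed only within distance \<open>?P - t\<close> of the head.
    Symbols entering at the border of the window are unconstrained, but their influence advances by
    at most one cell per step.\<close>
  have run: "\<exists>c. (tm_step (ext_tm M S Q) ^^ t) (initial_config M x) c \<and> fst c = src (a t) \<and>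
      (\<forall>j<k. \<forall>i<?W. \<forall>s<S. \<bar>int i - int ?P\<bar> \<le> int ?P - int t \<longrightarrow> X (cv j s) t i \<longrightarrow>
         s = sym_at c j (int i - int ?P))" if "t < ?P" for t
    using that
  proof (induction t)
    case 0
    show ?case using 1 7 sym_init[of _ _ x 0]
      by (intro exI[of _ "initial_config M x"]) (auto simp: initial_config_def)
  next
    case (Suc t)
    then obtain c where c: "(tm_step (ext_tm M S Q) ^^ t) (initial_config M x) c" "fst c = src (a t)"
      "\<And>j i s. j < k \<Longrightarrow> i < ?W \<Longrightarrow> s < S \<Longrightarrow> \<bar>int i - int ?P\<bar> \<le> int ?P - int t \<Longrightarrow> X (cv j s) t i \<Longrightarrow>
         s = sym_at c j (int i - int ?P)" by auto
    have t: "t < ?P" using Suc.prems by simp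
    have tidy: "tidy c" by (rule tidy_steps[OF c(1) tidy_init])
    have rd: "rd (a t) ! j = sym_at c j 0" if j: "j < k" for j
    proof -
      obtain s where s: "s < S" "X (cv j s) t ?P" using C[OF t, of ?P j] j by auto
      with 4[OF t j] c(3)[OF j, of ?P s] t show ?thesis by auto
    qed
    obtain c' where c': "tm_step (ext_tm M S Q) c c'" "fst c' = tgt (a t)"
      "\<And>j i. j < k \<Longrightarrow> sym_at c' j i = (let o' = i + int (mv (a t) j) - 1 in
        if o' = 0 then wr (a t) j else sym_at c j o')"
      using step_trsI[OF tidy _ c(2) rd] a[OF t] by auto
    have "s = sym_at c' j (int i - int ?P)"
      if *: "j < k" "i < ?W" "s < S" "\<bar>int i - int ?P\<bar> \<le> int ?P - int (Suc t)" "X (cv j s) (Suc t) i" for j i s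
    proof -
      \<comment> \<open>The index of the same cell before the head moved.\<close>
      define i0 where "i0 = i + mv (a t) j - 1"
      have i: "1 \<le> i + mv (a t) j" "i0 < ?W" "i = Suc i0 - mv (a t) j" "mv (a t) j \<le> Suc i0"
        "\<bar>int i0 - int ?P\<bar> \<le> int ?P - int t" "int i - int ?P + int (mv (a t) j) - 1 = int i0 - int ?P"
        using * mv_le[of "a t" j] Suc.prems unfolding i0_def by (linarith | simp)+
      have c'eq: "sym_at c' j (int i - int ?P) =
          (if int i0 - int ?P = 0 then wr (a t) j else sym_at c j (int i0 - int ?P))"
        unfolding c'(3)[OF *(1)] Let_def i(6) by (rule refl)
      show ?thesis
      proof (cases "i0 = ?P")
        case True
        then have "s = wr (a t) j" using 5[OF Suc.prems *(1,3)] *(5) i(3) by simp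
        then show ?thesis using c'eq True by simp
      next
        case False
        obtain s0 where s0: "s0 < S" "X (cv j s0) t i0" using C[OF t i(2) *(1)] by blast
        have "s0 = sym_at c j (int i0 - int ?P)" by (rule c(3)[OF *(1) i(2) s0(1) i(5) s0(2)])
        moreover have "s0 = s" by (rule 6[OF Suc.prems *(1) s0(1) *(3) i(2) False i(4)])
          (use * i s0 in auto)
        ultimately show ?thesis using c'eq False by simp
      qed
    qed
    moreover have "fst c' = src (a (Suc t))" using c'(2) 2[OF Suc.prems] by simp
    ultimately show ?case
      by (intro exI[of _ c'] conjI relpowp_Suc_I[OF c(1) c'(1)]) blast+
  qed
  \<comment> \<open>The table has no row for the time \<open>?P\<close>, so the last step is made
    separately; it needs only the symbols read and the target state.\<close>
  define t where "t = ?P - 1"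
  have t: "t < ?P" "?P = Suc t" using tp by (auto simp: t_def)
  obtain c where c: "(tm_step (ext_tm M S Q) ^^ t) (initial_config M x) c" "fst c = src (a t)"
      "\<And>j i s. j < k \<Longrightarrow> i < ?W \<Longrightarrow> s < S \<Longrightarrow> \<bar>int i - int ?P\<bar> \<le> int ?P - int t \<Longrightarrow> X (cv j s) t i \<Longrightarrow>
         s = sym_at c j (int i - int ?P)" using run[OF t(1)] by auto
  have tidy: "tidy c" by (rule tidy_steps[OF c(1) tidy_init])
  have rd: "rd (a t) ! j = sym_at c j 0" if j: "j < k" for j
  proof -
    obtain s where s: "s < S" "X (cv j s) t ?P" using C[OF t(1), of ?P j] j by auto
    with 4[OF t(1) j] c(3)[OF j, of ?P s] t show ?thesis by auto
  qed
  obtain c' where c': "tm_step (ext_tm M S Q) c c'" "fst c' = tgt (a t)"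
    using step_trsI[OF tidy conjunct1[OF a[OF t(1)]] c(2) rd] by metis
  have "fst c' = Q" using c'(2) 3 by (simp add: t_def)
  then have "(tm_step (ext_tm M S Q) ^^ ?P) (initial_config M x) (Q, snd c')"
    using relpowp_Suc_I[OF c(1) c'(1)] unfolding t(2) by (metis prod.collapse)
  then show ?thesis using accepts_ext_run[of x ?P] by (auto simp: tp_def)
qed

end

section \<open>Straight-line realizations\<close>

text \<open>Edges with a common end are governed by the second conjunct: if they met in another
  point, an end of one would lie on the other, by \<open>segments_common_end\<close>.\<close>

definition straight :: "'a set \<Rightarrow> 'a set set \<Rightarrow> ('a \<Rightarrow> complex) \<Rightarrow> bool" where
  "straight V E p \<longleftrightarrow> inj_on p V \<and>
     (\<forall>a b v. {a, b} \<in> E \<longrightarrow> v \<in> V \<longrightarrow> p v \<in> closed_segment (p a) (p b) \<longrightarrow> v = a \<or> v = b) \<and>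
     (\<forall>a b c d. {a, b} \<in> E \<longrightarrow> {c, d} \<in> E \<longrightarrow> {a, b} \<inter> {c, d} = {} \<longrightarrow>
        closed_segment (p a) (p b) \<inter> closed_segment (p c) (p d) = {})"

lemma segments_common_end:
  fixes a b c :: complex
  assumes "x \<in> closed_segment a b" "x \<in> closed_segment a c" "x \<noteq> a"
  shows "b \<in> closed_segment a c \<or> c \<in> closed_segment a b"
proof -
  obtain s where s: "0 \<le> s" "s \<le> 1" "x - a = s *\<^sub>R (b - a)"
    using assms(1) by (auto simp: in_segment algebra_simps)
  obtain t where t: "0 \<le> t" "t \<le> 1" "x - a = t *\<^sub>R (c - a)"
    using assms(2) by (auto simp: in_segment algebra_simps)
  have pos: "0 < s" "0 < t" using s t assms(3) by (auto simp: less_le)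
  show ?thesis
  proof (cases "s \<le> t")
    case True
    have "c - a = (1 / t) *\<^sub>R (x - a)" using t pos by simp
    also have "\<dots> = (s / t) *\<^sub>R (b - a)" using s by simp
    finally have "c = (1 - s / t) *\<^sub>R a + (s / t) *\<^sub>R b" by (simp add: algebra_simps)
    moreover have "0 \<le> s / t" "s / t \<le> 1" using True pos by auto
    ultimately show ?thesis unfolding in_segment by blast
  next
    case False
    have "b - a = (1 / s) *\<^sub>R (x - a)" using s pos by simp
    also have "\<dots> = (t / s) *\<^sub>R (c - a)" using t by simp
    finally have "b = (1 - t / s) *\<^sub>R a + (t / s) *\<^sub>R c" by (simp add: algebra_simps)
    moreover have "0 \<le> t / s" "t / s \<le> 1" using False pos by auto
    ultimately show ?thesis unfolding in_segment by blast
  qed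
qed

lemma hull_image_edge: "convex hull (p ` {a, b}) = closed_segment (p a) (p b)"
  by (simp add: segment_convex_hull)

lemma planar_drawing_straight:
  assumes E: "\<And>e. e \<in> edges G \<Longrightarrow> e \<subseteq> verts G \<and> card e = 2"
  shows "planar_drawing G p (\<lambda>e. convex hull (p ` e)) \<longleftrightarrow> straight (verts G) (edges G) p"
proof
  assume d: "planar_drawing G p (\<lambda>e. convex hull (p ` e))"
  have inj: "inj_on p (verts G)" using d by (simp add: planar_drawing_def)
  have d2: "\<And>e. e \<in> edges G \<Longrightarrow> convex hull (p ` e) \<inter> p ` verts G \<subseteq> p ` e"
    and d3: "\<And>e e'. e \<in> edges G \<Longrightarrow> e' \<in> edges G \<Longrightarrow> e \<noteq> e' \<Longrightarrow>
      convex hull (p ` e) \<inter> convex hull (p ` e') \<subseteq> p ` (e \<inter> e')"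
    using d unfolding planar_drawing_def by simp_all
  have "v = a \<or> v = b"
    if "{a, b} \<in> edges G" "v \<in> verts G" "p v \<in> closed_segment (p a) (p b)" for a b v
  proof -
    have "p v \<in> convex hull (p ` {a, b}) \<inter> p ` verts G" using that by (simp add: hull_image_edge del: image_insert)
    then have "p v \<in> p ` {a, b}" by (rule subsetD[OF d2[OF that(1)]])
    then have "p v = p a \<or> p v = p b" by auto
    moreover have "a \<in> verts G" "b \<in> verts G" using E[OF that(1)] by auto
    ultimately show ?thesis using inj_onD[OF inj _ that(2)] by blast
  qed
  moreover have "closed_segment (p a) (p b) \<inter> closed_segment (p c) (p d) = {}"
    if "{a, b} \<in> edges G" "{c, d} \<in> edges G" "{a, b} \<inter> {c, d} = {}" for a b c d
  proof -
    have "{a, b} \<noteq> {c, d}" using that(3) by auto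
    then have "convex hull (p ` {a, b}) \<inter> convex hull (p ` {c, d}) \<subseteq> p ` ({a, b} \<inter> {c, d})"
      by (rule d3[OF that(1,2)])
    then show ?thesis unfolding that(3) hull_image_edge by simp
  qed
  ultimately show "straight (verts G) (edges G) p" unfolding straight_def using inj by blast
next
  assume s: "straight (verts G) (edges G) p"
  then have inj: "inj_on p (verts G)" by (simp add: straight_def)
  have s1: "\<And>a b v. {a, b} \<in> edges G \<Longrightarrow> v \<in> verts G \<Longrightarrow> p v \<in> closed_segment (p a) (p b) \<Longrightarrow> v = a \<or> v = b"
    and s2: "\<And>a b c d. {a, b} \<in> edges G \<Longrightarrow> {c, d} \<in> edges G \<Longrightarrow> {a, b} \<inter> {c, d} = {} \<Longrightarrow>
      closed_segment (p a) (p b) \<inter> closed_segment (p c) (p d) = {}"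
    using s unfolding straight_def by blast+
  have edge: "\<exists>a b. e = {a, b} \<and> a \<noteq> b \<and> a \<in> verts G \<and> b \<in> verts G" if "e \<in> edges G" for e
    using E[OF that] by (auto simp: card_2_iff)
  show "planar_drawing G p (\<lambda>e. convex hull (p ` e))"
    unfolding planar_drawing_def
  proof (intro conjI ballI impI)
    show "inj_on p (verts G)" by (rule inj)
  next
    fix e assume "e \<in> edges G"
    then obtain a b where e: "e = {a, b}" "a \<noteq> b" "a \<in> verts G" "b \<in> verts G" using edge by blast
    then have "p a \<noteq> p b" using inj by (auto dest: inj_onD)
    then show "\<exists>g. arc g \<and> path_image g = convex hull (p ` e) \<and> {pathstart g, pathfinish g} = p ` e"
      unfolding e hull_image_edge by (intro exI[of _ "linepath (p a) (p b)"]) auto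
  next
    fix e assume e: "e \<in> edges G"
    then obtain a b where ab: "e = {a, b}" using edge by blast
    show "convex hull (p ` e) \<inter> p ` verts G \<subseteq> p ` e"
      using s1 e unfolding ab hull_image_edge by blast
  next
    fix e e' assume ee: "e \<in> edges G" "e' \<in> edges G" "e \<noteq> e'"
    obtain a b where ab: "e = {a, b}" "a \<noteq> b" "a \<in> verts G" "b \<in> verts G" using edge[OF ee(1)] by blast
    obtain c d where cd: "e' = {c, d}" "c \<noteq> d" "c \<in> verts G" "d \<in> verts G" using edge[OF ee(2)] by blast
    show "convex hull (p ` e) \<inter> convex hull (p ` e') \<subseteq> p ` (e \<inter> e')"
    proof (cases "e \<inter> e' = {}")
      case True
      then show ?thesis using s2 ee unfolding ab(1) cd(1) hull_image_edge by blast
    next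
      case False
      then obtain z where z: "z \<in> e" "z \<in> e'" by blast
      obtain b' where b': "e = {z, b'}" "b' \<in> verts G" using z(1) ab by (auto simp: insert_commute)
      obtain d' where d': "e' = {z, d'}" "d' \<in> verts G" using z(2) cd by (auto simp: insert_commute)
      have "x = p z" if x: "x \<in> closed_segment (p z) (p b')" "x \<in> closed_segment (p z) (p d')" for x
      proof (rule ccontr)
        assume "x \<noteq> p z"
        from segments_common_end[OF x this]
        have "b' = z \<or> b' = d' \<or> d' = z"
        proof
          assume "p b' \<in> closed_segment (p z) (p d')"
          then show ?thesis using s1[of z d' b'] ee(2) b'(2) unfolding d'(1) by blast
        next
          assume "p d' \<in> closed_segment (p z) (p b')"
          then show ?thesis using s1[of z b' d'] ee(1) d'(2) unfolding b'(1) by blast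
        qed
        then show False
        proof (elim disjE)
          assume "b' = z" then show False using b'(1) ab(1,2) by (metis doubleton_eq_iff insert_absorb2)
        next
          assume "b' = d'" then show False using b'(1) d'(1) ee(3) by simp
        next
          assume "d' = z" then show False using d'(1) cd(1,2) by (metis doubleton_eq_iff insert_absorb2)
        qed
      qed
      then show ?thesis unfolding b'(1) d'(1) hull_image_edge by blast
    qed
  qed
qed

lemma straight_image:
  assumes "inj_on f V" "\<And>e. e \<in> E \<Longrightarrow> e \<subseteq> V"
  shows "straight (f ` V) ((`) f ` E) p \<longleftrightarrow> straight V E (p \<circ> f)"
proof -
  have pre: "\<exists>a' b'. a = f a' \<and> b = f b' \<and> {a', b'} \<in> E \<and> a' \<in> V \<and> b' \<in> V" if "{a, b} \<in> (`) f ` E" for a b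
  proof -
    obtain e where e: "e \<in> E" "{a, b} = f ` e" using \<open>{a, b} \<in> (`) f ` E\<close> by blast
    obtain a' b' where ab: "a' \<in> e" "b' \<in> e" "a = f a'" "b = f b'" using e(2) by (metis image_iff insertCI)
    have "f ` {a', b'} = f ` e" using e(2) ab by auto
    then have "{a', b'} = e" using assms(1) assms(2)[OF e(1)] ab inj_on_image_eq_iff[of f V "{a', b'}" e] by auto
    then show ?thesis using e(1) ab assms(2)[OF e(1)] by blast
  qed
  have 1: "inj_on p (f ` V) \<longleftrightarrow> inj_on (p \<circ> f) V"
    using comp_inj_on_iff[OF assms(1)] by blast
  have eqs: "f v = f a \<longleftrightarrow> v = a" if "v \<in> V" "a \<in> V" for v a using assms(1) that by (auto dest: inj_onD)
  show ?thesis
  proof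
    assume s: "straight (f ` V) ((`) f ` E) p"
    have t2: "\<And>a b c d. {a, b} \<in> (`) f ` E \<Longrightarrow> {c, d} \<in> (`) f ` E \<Longrightarrow> {a, b} \<inter> {c, d} = {} \<Longrightarrow>
        closed_segment (p a) (p b) \<inter> closed_segment (p c) (p d) = {}"
      using s unfolding straight_def by blast
    have img: "{f a, f b} \<in> (`) f ` E" if "{a, b} \<in> E" for a b
      using imageI[OF that, of "(`) f"] by simp
    have inV: "a \<in> V" "b \<in> V" if "{a, b} \<in> E" for a b using assms(2)[OF that] by auto
    show "straight V E (p \<circ> f)"
      unfolding straight_def
    proof (intro conjI allI impI)
      show "inj_on (p \<circ> f) V" using s 1 by (simp add: straight_def)
    next
      fix a b v assume "{a, b} \<in> E" "v \<in> V" "(p \<circ> f) v \<in> closed_segment ((p \<circ> f) a) ((p \<circ> f) b)"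
      then have "f v = f a \<or> f v = f b" using s img unfolding straight_def by simp
      then show "v = a \<or> v = b" using eqs \<open>v \<in> V\<close> inV[OF \<open>{a, b} \<in> E\<close>] by blast
    next
      fix a b c d assume *: "{a, b} \<in> E" "{c, d} \<in> E" "{a, b} \<inter> {c, d} = {}"
      have "f a \<noteq> f c" "f a \<noteq> f d" "f b \<noteq> f c" "f b \<noteq> f d"
        using *(3) eqs inV[OF *(1)] inV[OF *(2)] by blast+
      then have "{f a, f b} \<inter> {f c, f d} = {}" by simp
      then show "closed_segment ((p \<circ> f) a) ((p \<circ> f) b) \<inter> closed_segment ((p \<circ> f) c) ((p \<circ> f) d) = {}"
        using t2[OF img[OF *(1)] img[OF *(2)]] unfolding o_apply by blast
    qed
  next
    assume s: "straight V E (p \<circ> f)"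
    then have s1: "\<And>a b v. {a, b} \<in> E \<Longrightarrow> v \<in> V \<Longrightarrow> p (f v) \<in> closed_segment (p (f a)) (p (f b)) \<Longrightarrow> v = a \<or> v = b"
      and s2: "\<And>a b c d. {a, b} \<in> E \<Longrightarrow> {c, d} \<in> E \<Longrightarrow> {a, b} \<inter> {c, d} = {} \<Longrightarrow>
        closed_segment (p (f a)) (p (f b)) \<inter> closed_segment (p (f c)) (p (f d)) = {}"
      unfolding straight_def o_apply by blast+
    show "straight (f ` V) ((`) f ` E) p"
      unfolding straight_def
    proof (intro conjI allI impI)
      show "inj_on p (f ` V)" using s 1 by (simp add: straight_def)
    next
      fix a b v assume *: "{a, b} \<in> (`) f ` E" "v \<in> f ` V" "p v \<in> closed_segment (p a) (p b)"
      obtain a' b' where ab: "a = f a'" "b = f b'" "{a', b'} \<in> E" using pre[OF *(1)] by blast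
      obtain v' where v: "v = f v'" "v' \<in> V" using *(2) by blast
      have "v' = a' \<or> v' = b'" by (rule s1[OF ab(3) v(2)]) (use *(3) in \<open>simp only: ab v\<close>)
      then show "v = a \<or> v = b" unfolding ab v by blast
    next
      fix a b c d assume *: "{a, b} \<in> (`) f ` E" "{c, d} \<in> (`) f ` E" "{a, b} \<inter> {c, d} = {}"
      obtain a' b' where ab: "a = f a'" "b = f b'" "{a', b'} \<in> E" using pre[OF *(1)] by blast
      obtain c' d' where cd: "c = f c'" "d = f d'" "{c', d'} \<in> E" using pre[OF *(2)] by blast
      have "{a', b'} \<inter> {c', d'} = {}" using *(3) unfolding ab(1,2) cd(1,2) by blast
      then show "closed_segment (p a) (p b) \<inter> closed_segment (p c) (p d) = {}"
        using s2[OF ab(3) cd(3)] unfolding ab(1,2) cd(1,2) by blast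
    qed
  qed
qed

lemma straight_affine:
  assumes "linear f" "inj f"
  shows "straight V E (\<lambda>v. c + f (p v)) \<longleftrightarrow> straight V E p"
proof -
  note inj_eq = inj_eq[OF assms(2)]
  have seg: "closed_segment (c + f x) (c + f y) = (\<lambda>z. c + f z) ` closed_segment x y" for x y
    using closed_segment_linear_image[OF assms(1), of x y] closed_segment_translation[of c "f x" "f y"]
    by (simp add: image_image)
  have inj: "inj (\<lambda>z. c + f z)" using assms(2) by (auto simp: inj_def)
  have 1: "inj_on (\<lambda>v. c + f (p v)) V \<longleftrightarrow> inj_on p V"
    using inj by (auto simp: inj_on_def inj_def)
  show ?thesis
    unfolding straight_def seg 1 image_Int[OF inj, symmetric] image_is_empty inj_image_mem_iff[OF inj] ..
qed

text \<open>After mapping the centres to 0 and 1, equal moduli of \<open>u\<close> and of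
  \<open>u - 1\<close> fix the real part and the square of the imaginary part. The second solution
  is thus the mirror image in the line through the centres.\<close>

lemma two_circles:
  fixes a b p q :: complex
  assumes "a \<noteq> b" "dist p a = dist q a" "dist p b = dist q b"
  shows "p = q \<or> p = a + (b - a) * cnj ((q - a) / (b - a))"
proof -
  define u where "u = (p - a) / (b - a)"
  define w where "w = (q - a) / (b - a)"
  have n: "b - a \<noteq> 0" using assms(1) by simp
  have "cmod u = cmod w" using assms(2) n by (simp add: u_def w_def norm_divide dist_norm)
  moreover have "cmod (u - 1) = cmod (w - 1)"
  proof -
    have "u - 1 = (p - b) / (b - a)" "w - 1 = (q - b) / (b - a)" using n by (simp_all add: u_def w_def field_simps)
    then show ?thesis using assms(3) by (simp add: norm_divide dist_norm)
  qed
  ultimately have sq: "(cmod u)\<^sup>2 = (cmod w)\<^sup>2" "(cmod (u - 1))\<^sup>2 = (cmod (w - 1))\<^sup>2" by simp_all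
  have "(t - 1)\<^sup>2 = t\<^sup>2 - 2 * t + 1" for t :: real
    by (simp add: power2_eq_square algebra_simps)
  with sq(2) have "(Re u)\<^sup>2 - 2 * Re u + 1 + (Im u)\<^sup>2 = (Re w)\<^sup>2 - 2 * Re w + 1 + (Im w)\<^sup>2"
    unfolding cmod_power2 by (simp only: minus_complex.sel one_complex.sel diff_zero)
  moreover have eq: "(Re u)\<^sup>2 + (Im u)\<^sup>2 = (Re w)\<^sup>2 + (Im w)\<^sup>2"
    using sq(1) unfolding cmod_power2 .
  ultimately have "Re u = Re w" by linarith
  moreover from this eq have "(Im u)\<^sup>2 = (Im w)\<^sup>2" by simp
  ultimately have "Re u = Re w \<and> (Im u)\<^sup>2 = (Im w)\<^sup>2" by blast
  then have uw: "u = w \<or> u = cnj w" by (simp add: complex_eq_iff power2_eq_iff)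
  have p: "p = a + (b - a) * u" using n by (simp add: u_def)
  have q: "q = a + (b - a) * w" using n by (simp add: w_def)
  show ?thesis using uw p q unfolding w_def[symmetric] by blast
qed

section \<open>The layout\<close>

text \<open>\<open>Bd j m\<close> is vertex \<open>m\<close> of strip \<open>j\<close>,
  \<open>Fl r c i\<close> is vertex \<open>i\<close> of the cell of row \<open>r\<close> and column
  \<open>c\<close>, and \<open>En r e\<close> is an extra flag at an end of row
  \<open>r\<close>.\<close>

datatype vtx = Bd nat nat | Fl nat nat nat | En nat nat

definition hgt :: real where "hgt = sqrt 3 / 2"
text \<open>\<open>Complex shf gap\<close> has distance 7/13 from 0 and 1 from the point 1.
  Subtracting the two equations gives \<open>shf\<close> as half the square of 7/13. Consecutive
  strips can therefore be joined with edges of lengths 1 and 7/13 only.\<close>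

definition shf :: real where "shf = 49 / 338"
definition gap :: real where "gap = sqrt (2 * shf - shf\<^sup>2)"

lemma hgt_sq: "hgt * hgt = 3 / 4" by (simp add: hgt_def)
lemma hgt_pos: "0 < hgt" by (simp add: hgt_def)
lemma hgt_bounds: "866 / 1000 < hgt" "hgt < 867 / 1000"
proof -
  have "1732 / 1000 < sqrt 3" by (rule real_less_rsqrt) (simp add: power2_eq_square)
  moreover have "sqrt 3 < 1734 / 1000" by (rule real_less_lsqrt) (simp_all add: power2_eq_square)
  ultimately show "866 / 1000 < hgt" "hgt < 867 / 1000" by (simp_all add: hgt_def)
qed
lemma gap_sq: "gap * gap = 2 * shf - shf * shf"
  unfolding gap_def by (simp add: shf_def power2_eq_square)
lemma gap_bounds: "518 / 1000 < gap" "gap < 519 / 1000"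
proof -
  show "518 / 1000 < gap" unfolding gap_def shf_def by (rule real_less_rsqrt) (simp add: power2_eq_square)
  show "gap < 519 / 1000" unfolding gap_def shf_def by (rule real_less_lsqrt) (simp_all add: power2_eq_square)
qed

text \<open>Even indices lie on the lower line of a strip and odd ones on the upper line; three
  consecutive indices span a unit triangle.\<close>

definition Z :: "nat \<Rightarrow> nat \<Rightarrow> complex" where
  "Z j m = Complex (real j * (1/2 + shf) + real m / 2) (real j * (gap + hgt) + (if odd m then hgt else 0))"

lemma Z_par: "Z j m + Z j (m + 3) = Z j (m + 1) + Z j (m + 2)"
  by (simp add: Z_def complex_eq_iff field_simps)

text \<open>2/13 is the distance between the apexes of two flags of length 7/13 that sit on two
  sides of a face and point into it.\<close>

definition len_of :: "nat \<Rightarrow> real" where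
  "len_of i = (if i = 0 then 1 else if i = 1 then 7 / 13 else if i = 2 then 7 / 11 else 2 / 13)"

text \<open>An entry \<open>(\<sigma>, \<kappa>, \<mu>, ty)\<close> puts a flag of type
  \<open>ty\<close> on the edge from \<open>8 * c + \<mu>\<close> to
  \<open>8 * c + \<mu> + \<kappa>\<close> of strip \<open>4 * r + \<sigma>\<close>. Strip 1 holds
  the horizontal tap 0 and, around the choice unit, the sensors 5 to 8. Strips 0 and 2 hold the
  detours below and above the unit, strip 3 the wire that leads to the next row.\<close>

definition base_tab :: "(nat \<times> nat \<times> nat \<times> nat) list" where
  "base_tab = [
    (1,1,3,2), (1,1,4,2), (1,2,3,2), (1,2,4,2), (1,2,5,2), (1,1,6,1), (1,2,6,1), (1,2,7,1), (1,1,8,1),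
    (1,2,8,2), (1,2,9,2), (1,1,10,2), (1,2,10,2),
    (2,2,2,2), (2,1,3,2), (2,1,4,1), (2,2,4,2), (2,1,5,1), (2,2,5,2), (2,1,6,1), (2,2,6,2), (2,1,7,1),
    (2,1,8,2), (2,2,8,2),
    (0,2,5,2), (0,1,6,2), (0,1,7,1), (0,2,7,2), (0,1,8,1), (0,2,8,2), (0,1,9,1), (0,2,9,2), (0,1,10,1),
    (0,1,11,2), (0,2,11,2),
    (3,2,4,2), (3,1,5,2), (3,1,6,2), (3,1,7,2), (3,1,8,2), (3,1,9,2), (3,2,9,2)]"

lemma length_base_tab: "length base_tab = 42"
  by (simp add: base_tab_def)

locale layout =
  fixes R C R0 :: nat and lit :: "nat \<Rightarrow> nat \<Rightarrow> bool"
begin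

text \<open>A cell uses the offsets up to 13, so the last one ends at vertex
  \<open>8 * (C - 1) + 13\<close>, which is the last vertex of the strip.\<close>

definition "Mt = 8 * C + 6"

text \<open>A literal cuts a wire coming from the east by moving one of its links: flag 21 on the
  way to sensor 7 in a negative row, flag 32 on the way to sensor 8 in a positive row. Moving a flag
  keeps the vertex set independent of the literals.\<close>

definition entry :: "nat \<Rightarrow> nat \<Rightarrow> nat \<Rightarrow> nat \<times> nat \<times> nat \<times> nat" where
  "entry r c i = (if i = 21 \<and> lit r c \<and> r < R0 then (2,1,9,1)
     else if i = 32 \<and> lit r c \<and> R0 \<le> r then (0,1,4,1) else base_tab ! i)"

text \<open>An item \<open>(v, a, b, k, l)\<close> adds the vertex \<open>v\<close> on the edge \<open>{a, b}\<close>; \<open>k\<close> and \<open>l\<close> give the lengths.\<close>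

type_synonym item = "vtx \<times> vtx \<times> vtx \<times> nat \<times> nat"

definition strip0 :: "item list" where
  "strip0 = map (\<lambda>m. (Bd 0 (m + 2), Bd 0 (m + 1), Bd 0 m, 0, 0)) [0..<Mt - 2]"

text \<open>The first vertex hangs on two upper vertices of the strip below and the next on one of
  these and the first, so the pair bridges the gap. The triangle built on this pair starts the usual
  zigzag, hence the order 0, 2, 1.\<close>

definition strip :: "nat \<Rightarrow> item list" where
  "strip j = [(Bd (j + 1) 0, Bd j 1, Bd j 3, 1, 0), (Bd (j + 1) 2, Bd j 3, Bd (j + 1) 0, 1, 0),
      (Bd (j + 1) 1, Bd (j + 1) 0, Bd (j + 1) 2, 0, 0)]
    @ map (\<lambda>m. (Bd (j + 1) (m + 3), Bd (j + 1) (m + 2), Bd (j + 1) (m + 1), 0, 0)) [0..<Mt - 3]"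

definition flag_item :: "nat \<Rightarrow> nat \<Rightarrow> nat \<Rightarrow> item" where
  "flag_item r c i = (case entry r c i of (\<sigma>, \<kappa>, \<mu>, ty) \<Rightarrow>
     (Fl r c i, Bd (4 * r + \<sigma>) (8 * c + \<mu>), Bd (4 * r + \<sigma>) (8 * c + \<mu> + \<kappa>), ty, ty))"

text \<open>The choice unit consists of a flag on the common side of two faces and of two small
  triangles on the edges of this flag. The two faces contain the places of the four sensors.\<close>

definition cell :: "nat \<Rightarrow> nat \<Rightarrow> item list" where
  "cell r c = map (flag_item r c) [0..<42] @
     [(Fl r c 42, Bd (4 * r + 1) (8 * c + 7), Bd (4 * r + 1) (8 * c + 8), 1, 1),
      (Fl r c 43, Bd (4 * r + 1) (8 * c + 7), Fl r c 42, 1, 3),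
      (Fl r c 44, Bd (4 * r + 1) (8 * c + 8), Fl r c 42, 1, 3)]"

text \<open>Flags with the same edge and the same lengths must take opposite sides. The tap of the
  first column gets a twin, and two twins are put where the tap after the last column would be, so
  both ends send a signal into the row.\<close>

definition row_ends :: "nat \<Rightarrow> item list" where
  "row_ends r = [(En r 0, Bd (4 * r + 1) 3, Bd (4 * r + 1) 4, 2, 2),
     (En r 1, Bd (4 * r + 1) (8 * C + 3), Bd (4 * r + 1) (8 * C + 4), 2, 2),
     (En r 2, Bd (4 * r + 1) (8 * C + 3), Bd (4 * r + 1) (8 * C + 4), 2, 2)]"

definition items :: "item list" where
  "items = strip0 @ concat (map strip [0..<4 * R - 1])
     @ concat (map (\<lambda>r. concat (map (cell r) [0..<C]) @ row_ends r) [0..<R])"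

definition V :: "vtx set" where
  "V = {Bd 0 0, Bd 0 1} \<union> fst ` set items"

definition E :: "vtx set set" where
  "E = {{Bd 0 0, Bd 0 1}} \<union> (\<Union>(v, a, b, k, l) \<in> set items. {{v, a}, {v, b}})"

definition realizes :: "(vtx \<Rightarrow> complex) \<Rightarrow> bool" where
  "realizes p \<longleftrightarrow> straight V E p \<and> dist (p (Bd 0 0)) (p (Bd 0 1)) = 1 \<and>
     (\<forall>(v, a, b, k, l) \<in> set items. dist (p v) (p a) = len_of k \<and> dist (p v) (p b) = len_of l)"

lemma item_edges:
  "(v, a, b, k, l) \<in> set items \<Longrightarrow> v \<in> V \<and> {v, a} \<in> E \<and> {v, b} \<in> E"
  unfolding V_def E_def by force

lemma body_items:
  assumes "j + 1 < 4 * R"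
  shows "(Bd (j + 1) 0, Bd j 1, Bd j 3, 1, 0) \<in> set items" "(Bd (j + 1) 2, Bd j 3, Bd (j + 1) 0, 1, 0) \<in> set items"
    "(Bd (j + 1) 1, Bd (j + 1) 0, Bd (j + 1) 2, 0, 0) \<in> set items"
    "m + 3 < Mt \<Longrightarrow> (Bd (j + 1) (m + 3), Bd (j + 1) (m + 2), Bd (j + 1) (m + 1), 0, 0) \<in> set items"
proof -
  have "set (strip j) \<subseteq> set items" using assms unfolding items_def by auto
  then show "(Bd (j + 1) 0, Bd j 1, Bd j 3, 1, 0) \<in> set items" "(Bd (j + 1) 2, Bd j 3, Bd (j + 1) 0, 1, 0) \<in> set items"
    "(Bd (j + 1) 1, Bd (j + 1) 0, Bd (j + 1) 2, 0, 0) \<in> set items"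
    "m + 3 < Mt \<Longrightarrow> (Bd (j + 1) (m + 3), Bd (j + 1) (m + 2), Bd (j + 1) (m + 1), 0, 0) \<in> set items"
    unfolding strip_def by (auto simp: subset_iff)
qed

lemma strip0_items: "m + 2 < Mt \<Longrightarrow> (Bd 0 (m + 2), Bd 0 (m + 1), Bd 0 m, 0, 0) \<in> set items"
  unfolding items_def strip0_def by auto

lemma cell_items: "r < R \<Longrightarrow> c < C \<Longrightarrow> set (cell r c) \<subseteq> set items"
  unfolding items_def by auto

lemma end_items: "r < R \<Longrightarrow> set (row_ends r) \<subseteq> set items"
  unfolding items_def by auto

end

section \<open>Possible positions of flags and the ways in which they collide\<close>

lemma two_points:
  fixes a b p q q' :: complex
  assumes "a \<noteq> b" "dist q a = dist q' a" "dist q b = dist q' b" "q \<noteq> q'"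
    and "dist p a = dist q a" "dist p b = dist q b"
  shows "p = q \<or> p = q'"
  using two_circles[OF assms(1,5,6)] two_circles[OF assms(1), of q' q] assms(2-4) by metis

text \<open>Apex of a flag of type \<open>ty\<close> on \<open>x y\<close> pointing to \<open>t\<close>, where \<open>x, y, t\<close> is equilateral.\<close>

definition apex :: "nat \<Rightarrow> complex \<Rightarrow> complex \<Rightarrow> complex \<Rightarrow> complex" where
  "apex ty x y t = (if ty = 1 then (5 * x + 5 * y + 3 * t) / 13 else (3 * x + 3 * y + 5 * t) / 11)"

lemma apex_commute: "apex ty x y t = apex ty y x t"
  by (simp add: apex_def algebra_simps)

definition equi :: "complex \<Rightarrow> complex \<Rightarrow> complex \<Rightarrow> bool" where
  "equi x y t \<longleftrightarrow> dist x y = 1 \<and> dist x t = 1 \<and> dist y t = 1"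

text \<open>The two directions have inner product 1/2, so lengths are given by the norm form of the
  triangular lattice. All distance computations reduce to this form.\<close>

lemma equi_norm:
  assumes "equi x y t"
  shows "cmod (of_real a * (y - x) + of_real b * (t - x)) = sqrt (a\<^sup>2 + a * b + b\<^sup>2)"
proof -
  define u where "u = y - x" define w where "w = t - x"
  have n: "cmod u = 1" "cmod w = 1" "cmod (u - w) = 1"
    using assms by (auto simp: equi_def u_def w_def dist_norm norm_minus_commute)
  have "(cmod (u - w))\<^sup>2 = (cmod u)\<^sup>2 + (cmod w)\<^sup>2 - 2 * (u \<bullet> w)"
    by (simp add: power2_norm_eq_inner inner_diff_left inner_diff_right inner_commute)
  then have uw: "u \<bullet> w = 1/2" using n by simp
  have "(cmod (a *\<^sub>R u + b *\<^sub>R w))\<^sup>2 = a\<^sup>2 * (cmod u)\<^sup>2 + 2 * a * b * (u \<bullet> w) + b\<^sup>2 * (cmod w)\<^sup>2"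
    unfolding power2_norm_eq_inner
    by (simp add: inner_add_left inner_add_right inner_commute power2_eq_square algebra_simps)
  then have "(cmod (a *\<^sub>R u + b *\<^sub>R w))\<^sup>2 = a\<^sup>2 + a * b + b\<^sup>2" using n uw by simp
  then show ?thesis
    by (metis u_def w_def norm_ge_zero real_sqrt_unique scaleR_conv_of_real)
qed

lemma equi_dist:
  assumes "equi x y t" "p - q = of_real a * (y - x) + of_real b * (t - x)" "a\<^sup>2 + a * b + b\<^sup>2 = c\<^sup>2" "0 \<le> c"
  shows "dist p q = c"
  unfolding dist_norm assms(2) equi_norm[OF assms(1)] assms(3) by (simp add: assms(4))

lemma equi_reflect: "equi x y t \<Longrightarrow> equi x y (x + y - t)"
  unfolding equi_def dist_norm by (simp add: algebra_simps norm_minus_commute)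

lemma equi_perm: "equi x y t \<Longrightarrow> equi y x t" "equi x y t \<Longrightarrow> equi x t y"
  by (auto simp: equi_def dist_commute)

lemma apex_dist:
  assumes "equi x y t" "ty = 1 \<or> ty = 2"
  shows "dist (apex ty x y t) x = len_of ty" "dist (apex ty x y t) y = len_of ty"
proof -
  have 1: "dist (apex ty x y t) x = len_of ty" if "equi x y t" for x y
  proof (cases "ty = 1")
    case True
    show ?thesis unfolding True
      by (rule equi_dist[OF that, of _ _ "5/13" "3/13"])
        (auto simp: apex_def len_of_def field_simps power2_eq_square)
  next
    case False
    with assms(2) have "ty = 2" by simp
    show ?thesis unfolding \<open>ty = 2\<close>
      by (rule equi_dist[OF that, of _ _ "3/11" "5/11"])
        (auto simp: apex_def len_of_def field_simps power2_eq_square)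
  qed
  show "dist (apex ty x y t) x = len_of ty" by (rule 1[OF assms(1)])
  show "dist (apex ty x y t) y = len_of ty" using 1[OF equi_perm(1)[OF assms(1)]] by (simp add: apex_commute)
qed

lemma apex_cases:
  assumes "equi x y t" "ty = 1 \<or> ty = 2" "dist p x = len_of ty" "dist p y = len_of ty"
  shows "p = apex ty x y t \<or> p = apex ty x y (x + y - t)"
proof (rule two_points)
  show "x \<noteq> y" using assms(1) by (auto simp: equi_def)
  have "x + y - t \<noteq> t"
  proof
    assume "x + y - t = t"
    then have "t - x = y - t" by (simp add: algebra_simps)
    then have "y - x = 2 * (t - x)" by (simp add: algebra_simps)
    then have "cmod (y - x) = cmod (2 * (t - x))" by (rule arg_cong)
    then have "cmod (y - x) = 2 * cmod (t - x)" by (simp only: norm_mult) simp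
    moreover have "cmod (y - x) = 1" "cmod (t - x) = 1"
      using assms(1) by (simp_all add: equi_def dist_norm norm_minus_commute)
    ultimately show False by simp
  qed
  moreover have "apex ty x y t = apex ty x y t' \<Longrightarrow> t = t'" for t'
    by (auto simp: apex_def split: if_splits)
  ultimately show "apex ty x y t \<noteq> apex ty x y (x + y - t)" by metis
qed (use assms apex_dist[OF assms(1,2)] apex_dist[OF equi_reflect[OF assms(1)] assms(2)] in simp_all)

text \<open>The first position is the apex of the flag on the neighbouring side; the second is its
  mirror image in the line through \<open>a\<close> and \<open>f\<close>.\<close>

lemma unit_cases:
  assumes "equi a b t" "f = apex 1 a b t" "dist p a = len_of 1" "dist p f = len_of 3"
  shows "p = apex 1 a t b \<or> p = (277 * a + 323 * b + 37 * t) / 637"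
proof (rule two_points)
  have n: "dist f a = 7 / 13" using apex_dist[OF assms(1), of 1] assms(2) by (simp add: len_of_def)
  show "a \<noteq> f" using n by auto
  have 1: "dist (apex 1 a t b) a = 7 / 13" using apex_dist[OF equi_perm(2)[OF assms(1)], of 1] by (simp add: len_of_def)
  have 2: "dist ((277 * a + 323 * b + 37 * t) / 637) a = 7 / 13"
    by (rule equi_dist[OF assms(1), of _ _ "323/637" "37/637"]) (auto simp: field_simps power2_eq_square)
  have 3: "dist (apex 1 a t b) f = 2 / 13"
    by (rule equi_dist[OF assms(1), of _ _ "-2/13" "2/13"]) (auto simp: assms(2) apex_def field_simps power2_eq_square)
  have 4: "dist ((277 * a + 323 * b + 37 * t) / 637) f = 2 / 13"
    by (rule equi_dist[OF assms(1), of _ _ "78/637" "-110/637"]) (auto simp: assms(2) apex_def field_simps power2_eq_square)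
  show "dist (apex 1 a t b) a = dist ((277 * a + 323 * b + 37 * t) / 637) a" using 1 2 by simp
  show "dist (apex 1 a t b) f = dist ((277 * a + 323 * b + 37 * t) / 637) f" using 3 4 by simp
  show "dist p a = dist (apex 1 a t b) a" "dist p f = dist (apex 1 a t b) f"
    using assms(3,4) 1 3 by (simp_all add: len_of_def)
  show "apex 1 a t b \<noteq> (277 * a + 323 * b + 37 * t) / 637"
  proof
    assume "apex 1 a t b = (277 * a + 323 * b + 37 * t) / 637"
    moreover have "of_real (-176/637) * (b - a) + of_real (208/637) * (t - a) =
        apex 1 a t b - (277 * a + 323 * b + 37 * t) / 637"
      by (simp add: apex_def field_simps)
    ultimately have "0 = cmod (of_real (-176/637) * (b - a) + of_real (208/637) * (t - a))"
      by simp
    then show False unfolding equi_norm[OF assms(1)] by (simp add: power2_eq_square)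
  qed
qed

text \<open>Conflicts. Two flags in a common face, one of them of type \<open>2\<close>, either cross or one has its
  apex on a side of the other.\<close>

lemma face_cross_22:
  "(3 * o' + 5 * x + 5 * y) / 13 \<in> closed_segment x (apex 2 o' x y)"
proof -
  have "(3 * o' + 5 * x + 5 * y) / 13 = (1 - 11/13) *\<^sub>R x + (11/13) *\<^sub>R apex 2 o' x y"
    by (simp add: apex_def scaleR_conv_of_real field_simps)
  then show ?thesis unfolding in_segment by (intro exI[of _ "11/13"]) auto
qed

lemma face_cross_21: "apex 1 o' y x \<in> closed_segment o' (apex 2 o' x y)"
proof -
  have "apex 1 o' y x = (1 - 11/13) *\<^sub>R o' + (11/13) *\<^sub>R apex 2 o' x y"
    by (simp add: apex_def scaleR_conv_of_real field_simps)
  then show ?thesis unfolding in_segment by (intro exI[of _ "11/13"]) auto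
qed

text \<open>The point is symmetric in \<open>a\<close> and \<open>b\<close>, so it lies on the inner
  edges at both ends: these edges cross.\<close>

lemma unit_cross:
  fixes a b t :: complex
  shows "(323 * a + 323 * b + 37 * t) / 683 \<in> closed_segment a ((277 * a + 323 * b + 37 * t) / 637)"
proof -
  have "(323 * a + 323 * b + 37 * t) / 683 = (1 - 637/683) *\<^sub>R a + (637/683) *\<^sub>R ((277 * a + 323 * b + 37 * t) / 637)"
    by (simp add: scaleR_conv_of_real field_simps)
  then show ?thesis unfolding in_segment by (intro exI[of _ "637/683"]) auto
qed

context layout
begin

lemma Z_simps:
  "Z j (m + 1) - Z j m = Complex (1/2) (if odd m then - hgt else hgt)"
  "Z j (m + 2) - Z j m = 1"
  by (auto simp: Z_def complex_eq_iff field_simps)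

lemma equi_Z: "equi (Z j m) (Z j (m + 1)) (Z j (m + 2))"
proof -
  have 1: "cmod (Complex (1/2) (if odd m then - hgt else hgt)) = 1" for m :: nat
    using hgt_sq by (auto simp: cmod_def power2_eq_square)
  have "dist (Z j m) (Z j (m + 1)) = 1" for m
    by (metis 1 Z_simps(1) dist_commute dist_norm)
  from this[of m] this[of "m + 1"] show ?thesis
    unfolding equi_def dist_commute[of "Z j m" "Z j (m + 2)"] dist_norm[of "Z j (m + 2)" "Z j m"] Z_simps(2)
    by simp
qed

lemma Z_inj_3: "Z j (m + 3) \<noteq> Z j m"
  by (simp add: Z_def complex_eq_iff)

lemma Z_spine:
  "dist (Z (j + 1) 0) (Z j 1) = 7 / 13" "dist (Z (j + 1) 0) (Z j 3) = 1"
  "dist (Z (j + 1) 2) (Z j 3) = 7 / 13"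
proof -
  have 1: "Z (j + 1) 0 - Z j 1 = Complex shf gap" "Z (j + 1) 0 - Z j 3 = Complex (shf - 1) gap"
    "Z (j + 1) 2 - Z j 3 = Complex shf gap"
    by (auto simp: Z_def complex_eq_iff field_simps)
  have "shf\<^sup>2 + gap\<^sup>2 = (7/13)\<^sup>2" "(shf - 1)\<^sup>2 + gap\<^sup>2 = 1"
    using gap_sq by (auto simp: shf_def power2_eq_square algebra_simps)
  then have "cmod (Complex shf gap) = 7/13" "cmod (Complex (shf - 1) gap) = 1"
    by (simp_all add: cmod_def)
  then show "dist (Z (j + 1) 0) (Z j 1) = 7 / 13" "dist (Z (j + 1) 0) (Z j 3) = 1"
    "dist (Z (j + 1) 2) (Z j 3) = 7 / 13" unfolding dist_norm 1 by simp_all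
qed

end

text \<open>The three wrong placements at the start of a strip cross an edge of the strip below.\<close>

lemma spine_cross_1:
  fixes a :: complex
  shows "\<exists>x. x \<in> closed_segment a (a + Complex (1/2) (- hgt)) \<and> x \<in> closed_segment (a + 1) (a + Complex shf (- gap))"
proof -
  define d where "d = gap + 2 * hgt * (1 - shf)"
  have d: "0 < d" unfolding d_def shf_def using gap_bounds hgt_bounds by simp
  define s where "s = 2 * gap / d"
  define t where "t = 2 * hgt / d"
  have s: "0 \<le> s" "s \<le> 1" "0 \<le> t" "t \<le> 1"
    using d gap_bounds hgt_bounds unfolding s_def t_def d_def shf_def by (auto simp: divide_le_eq)
  have "(1 - s) *\<^sub>R a + s *\<^sub>R (a + Complex (1/2) (- hgt)) = (1 - t) *\<^sub>R (a + 1) + t *\<^sub>R (a + Complex shf (- gap))"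
  proof -
    have gd: "d - 2 * hgt * (1 - shf) = gap" by (simp add: d_def)
    have "s / 2 = (d - 2 * hgt * (1 - shf)) / d" unfolding gd by (simp add: s_def)
    also have "\<dots> = 1 - t * (1 - shf)" using d by (simp add: t_def diff_divide_distrib)
    finally have e1: "s / 2 = 1 - t * (1 - shf)" .
    have e2: "s * hgt = t * gap" by (simp add: s_def t_def)
    show ?thesis using e1 e2 by (simp add: complex_eq_iff algebra_simps)
  qed
  then show ?thesis unfolding in_segment using s by metis
qed

lemma spine_cross_2:
  fixes a :: complex
  shows "\<exists>x. x \<in> closed_segment a (a + 1) \<and>
     x \<in> closed_segment (a + Complex shf gap) (a + Complex (1 + 2 * shf * shf - 3 * shf) (gap * (2 * shf - 1)))"
proof -
  define t where "t = 1 / (2 - 2 * shf)"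
  define s where "s = shf + t * (1 + 2 * shf * shf - 4 * shf)"
  have s: "0 \<le> s" "s \<le> 1" "0 \<le> t" "t \<le> 1" by (auto simp: s_def t_def shf_def)
  have "(1 - s) *\<^sub>R a + s *\<^sub>R (a + 1) =
     (1 - t) *\<^sub>R (a + Complex shf gap) + t *\<^sub>R (a + Complex (1 + 2 * shf * shf - 3 * shf) (gap * (2 * shf - 1)))"
    by (auto simp: complex_eq_iff s_def t_def shf_def field_simps)
  then show ?thesis unfolding in_segment using s by metis
qed

lemma spine_cross_3:
  fixes a :: complex
  shows "\<exists>x. x \<in> closed_segment a (a + 1) \<and>
     x \<in> closed_segment (a + Complex shf gap) (a + Complex (shf + 1/2) (gap - hgt))"
proof -
  define t where "t = gap / hgt"
  define s where "s = shf + t / 2"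
  have s: "0 \<le> s" "s \<le> 1" "0 \<le> t" "t \<le> 1"
  proof -
    show "0 \<le> t" "t \<le> 1" using gap_bounds hgt_bounds by (auto simp: t_def divide_le_eq)
    then show "0 \<le> s" "s \<le> 1" by (simp_all add: s_def shf_def)
  qed
  have "(1 - s) *\<^sub>R a + s *\<^sub>R (a + 1) =
     (1 - t) *\<^sub>R (a + Complex shf gap) + t *\<^sub>R (a + Complex (shf + 1/2) (gap - hgt))"
    using hgt_pos by (auto simp: complex_eq_iff s_def t_def field_simps)
  then show ?thesis unfolding in_segment using s by metis
qed

text \<open>The gap is about 0.598 times the height of a strip, while flags reach 5/11 or 3/13 of
  this height into the corridor. Two facing flags therefore collide if one of them is long, in spite
  of the horizontal shift.\<close>

lemma corridor_cross:
  fixes a :: complex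
  defines "b \<equiv> a + 1" and "a' \<equiv> a + Complex shf gap"
  shows "\<exists>x. x \<in> closed_segment a (a + Complex (1/2) (5/11 * hgt)) \<and>
       x \<in> closed_segment a' (a' + Complex (1/2) (- (5/11 * hgt)))"
    "\<exists>x. x \<in> closed_segment b (a + Complex (1/2) (3/13 * hgt)) \<and>
       x \<in> closed_segment a' (a' + Complex (1/2) (- (5/11 * hgt)))"
    "\<exists>x. x \<in> closed_segment b (a + Complex (1/2) (5/11 * hgt)) \<and>
       x \<in> closed_segment a' (a' + Complex (1/2) (- (3/13 * hgt)))"
proof -
  define g where "g = gap / hgt"
  have g: "gap = g * hgt" using hgt_pos by (simp add: g_def)
  have gb: "597 / 1000 < g" "g < 6 / 10" unfolding g_def using gap_bounds hgt_bounds hgt_pos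
    by (auto simp: less_divide_eq divide_less_eq)
  show "\<exists>x. x \<in> closed_segment a (a + Complex (1/2) (5/11 * hgt)) \<and>
       x \<in> closed_segment a' (a' + Complex (1/2) (- (5/11 * hgt)))"
  proof -
    define s where "s = (11/10) * g + shf"
    define t where "t = (11/10) * g - shf"
    have s: "0 \<le> s" "s \<le> 1" "0 \<le> t" "t \<le> 1" unfolding s_def t_def shf_def using gb by linarith+
    have "(1 - s) *\<^sub>R a + s *\<^sub>R (a + Complex (1/2) (5/11 * hgt)) =
      (1 - t) *\<^sub>R a' + t *\<^sub>R (a' + Complex (1/2) (- (5/11 * hgt)))"
      unfolding a'_def g by (auto simp: complex_eq_iff s_def t_def field_simps)
    then show ?thesis unfolding in_segment using s by metis
  qed
  show "\<exists>x. x \<in> closed_segment b (a + Complex (1/2) (3/13 * hgt)) \<and>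
       x \<in> closed_segment a' (a' + Complex (1/2) (- (5/11 * hgt)))"
  proof -
    text \<open>Solving $1 - s/2 = \mathit{shf} + t/2$ and $3s/13 = g - 5t/11$.\<close>
    define s where "s = (10/11 * (1 - shf) - g) * (143/32)"
    define t where "t = 2 * (1 - shf) - s"
    have s: "0 \<le> s" "s \<le> 1" "0 \<le> t" "t \<le> 1" using gb unfolding s_def t_def shf_def by (simp_all add: field_simps)
    have "(1 - s) *\<^sub>R b + s *\<^sub>R (a + Complex (1/2) (3/13 * hgt)) =
      (1 - t) *\<^sub>R a' + t *\<^sub>R (a' + Complex (1/2) (- (5/11 * hgt)))"
      unfolding a'_def b_def g by (auto simp: complex_eq_iff s_def t_def field_simps)
    then show ?thesis unfolding in_segment using s by metis
  qed
  show "\<exists>x. x \<in> closed_segment b (a + Complex (1/2) (5/11 * hgt)) \<and>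
       x \<in> closed_segment a' (a' + Complex (1/2) (- (3/13 * hgt)))"
  proof -
    define s where "s = (g - 6/13 * (1 - shf)) * (143/32)"
    define t where "t = 2 * (1 - shf) - s"
    have s: "0 \<le> s" "s \<le> 1" "0 \<le> t" "t \<le> 1" using gb unfolding s_def t_def shf_def by (simp_all add: field_simps)
    have "(1 - s) *\<^sub>R b + s *\<^sub>R (a + Complex (1/2) (5/11 * hgt)) =
      (1 - t) *\<^sub>R a' + t *\<^sub>R (a' + Complex (1/2) (- (3/13 * hgt)))"
      unfolding a'_def b_def g by (auto simp: complex_eq_iff s_def t_def field_simps)
    then show ?thesis unfolding in_segment using s by metis
  qed
qed

section \<open>Realizations force the positions of the layout\<close>

lemma nat_cases_3: "m = 0 \<or> m = 1 \<or> m = 2 \<or> (\<exists>m'. m = m' + 3)" for m :: nat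
  by presburger

lemma cmod_eqI: "x * x + y * y = r * r \<Longrightarrow> 0 \<le> r \<Longrightarrow> cmod (Complex x y) = r"
  by (simp add: cmod_def power2_eq_square)

lemma dist_rel: "dist (a + Complex x y) (a + Complex x' y') = cmod (Complex (x - x') (y - y'))"
proof -
  have "a + Complex x y - (a + Complex x' y') = Complex (x - x') (y - y')" by (simp add: complex_eq_iff)
  then show ?thesis by (simp add: dist_norm)
qed

lemma dist_rel0: "dist (a + Complex x y) a = cmod (Complex x y)"
  "dist (a + Complex x y) (a + 1) = cmod (Complex (x - 1) y)"
  by (simp_all add: dist_norm) (metis add_diff_eq complex_diff diff_zero one_complex.code)

lemma shf_gap: "shf * shf + gap * gap = 7/13 * (7/13)" "(shf - 1) * (shf - 1) + gap * gap = 1 * 1"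
  using gap_sq by (auto simp: shf_def algebra_simps)

lemma spine_choice_1:
  assumes "dist c a = 7/13" "dist c (a + 1) = 1"
  shows "c = a + Complex shf gap \<or> c = a + Complex shf (- gap)"
proof (rule two_points)
  have 1: "dist (a + Complex shf gap) a = 7/13" "dist (a + Complex shf gap) (a + 1) = 1"
    "dist (a + Complex shf (- gap)) a = 7/13" "dist (a + Complex shf (- gap)) (a + 1) = 1"
    unfolding dist_rel0 by (rule cmod_eqI; use shf_gap in simp)+
  show "dist (a + Complex shf gap) a = dist (a + Complex shf (- gap)) a"
    "dist (a + Complex shf gap) (a + 1) = dist (a + Complex shf (- gap)) (a + 1)"
    "dist c a = dist (a + Complex shf gap) a" "dist c (a + 1) = dist (a + Complex shf gap) (a + 1)"
    unfolding 1 assms by (rule refl)+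
qed (use gap_bounds in \<open>auto simp: complex_eq_iff\<close>)

text \<open>The second candidate is the mirror image of the first in the line through the two known
  points; the equation for the square of \<open>gap\<close> makes its coordinates polynomial in
  \<open>shf\<close> and \<open>gap\<close>.\<close>

lemma spine_choice_2:
  assumes "dist c (a + 1) = 7/13" "dist c (a + Complex shf gap) = 1"
  shows "c = a + Complex (1 + shf) gap \<or>
    c = a + Complex (1 + 2 * shf * shf - 3 * shf) (gap * (2 * shf - 1))"
proof (rule two_points)
  let ?q = "a + Complex (1 + 2 * shf * shf - 3 * shf) (gap * (2 * shf - 1))"
  have e: "(gap * (2 * shf - 1)) * (gap * (2 * shf - 1)) = (2 * shf - shf * shf) * ((2 * shf - 1) * (2 * shf - 1))"
    "(gap * (2 * shf - 1) - gap) * (gap * (2 * shf - 1) - gap) = (2 * shf - shf * shf) * ((2 * shf - 2) * (2 * shf - 2))"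
    unfolding gap_sq[symmetric] by (simp_all add: algebra_simps)
  have 1: "dist (a + Complex (1 + shf) gap) (a + 1) = 7/13" "dist (a + Complex (1 + shf) gap) (a + Complex shf gap) = 1"
    "dist ?q (a + 1) = 7/13" "dist ?q (a + Complex shf gap) = 1"
    unfolding dist_rel0 dist_rel by (rule cmod_eqI; (use shf_gap in simp)?; simp only: e; simp add: shf_def)+
  show "dist (a + Complex (1 + shf) gap) (a + 1) = dist ?q (a + 1)"
    "dist (a + Complex (1 + shf) gap) (a + Complex shf gap) = dist ?q (a + Complex shf gap)"
    "dist c (a + 1) = dist (a + Complex (1 + shf) gap) (a + 1)"
    "dist c (a + Complex shf gap) = dist (a + Complex (1 + shf) gap) (a + Complex shf gap)"
    unfolding 1 assms by (rule refl)+
  show "a + 1 \<noteq> a + Complex shf gap" using gap_bounds by (auto simp: complex_eq_iff)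
  show "a + Complex (1 + shf) gap \<noteq> ?q" by (auto simp: complex_eq_iff shf_def)
qed

lemma spine_choice_3:
  assumes "dist c (a + Complex shf gap) = 1" "dist c (a + Complex (1 + shf) gap) = 1"
  shows "c = a + Complex (shf + 1/2) (gap + hgt) \<or> c = a + Complex (shf + 1/2) (gap - hgt)"
proof (rule two_points)
  have 1: "dist (a + Complex (shf + 1/2) (gap + hgt)) (a + Complex shf gap) = 1"
    "dist (a + Complex (shf + 1/2) (gap + hgt)) (a + Complex (1 + shf) gap) = 1"
    "dist (a + Complex (shf + 1/2) (gap - hgt)) (a + Complex shf gap) = 1"
    "dist (a + Complex (shf + 1/2) (gap - hgt)) (a + Complex (1 + shf) gap) = 1"
    unfolding dist_rel by (rule cmod_eqI; simp add: hgt_sq)+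
  show "dist (a + Complex (shf + 1/2) (gap + hgt)) (a + Complex shf gap) = dist (a + Complex (shf + 1/2) (gap - hgt)) (a + Complex shf gap)"
    "dist (a + Complex (shf + 1/2) (gap + hgt)) (a + Complex (1 + shf) gap) = dist (a + Complex (shf + 1/2) (gap - hgt)) (a + Complex (1 + shf) gap)"
    "dist c (a + Complex shf gap) = dist (a + Complex (shf + 1/2) (gap + hgt)) (a + Complex shf gap)"
    "dist c (a + Complex (1 + shf) gap) = dist (a + Complex (shf + 1/2) (gap + hgt)) (a + Complex (1 + shf) gap)"
    unfolding 1 assms by (rule refl)+
qed (use hgt_pos in \<open>auto simp: complex_eq_iff\<close>)

context layout
begin

lemma straight_crossing:
  assumes "straight V E p" "{a, b} \<in> E" "{c, d} \<in> E" "a \<noteq> c" "a \<noteq> d" "b \<noteq> c" "b \<noteq> d"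
    and "\<exists>x. x \<in> closed_segment (p a) (p b) \<and> x \<in> closed_segment (p c) (p d)"
  shows False
proof -
  have "{a, b} \<inter> {c, d} = {}" using assms(4-7) by simp
  then have "closed_segment (p a) (p b) \<inter> closed_segment (p c) (p d) = {}"
    using assms(1-3) unfolding straight_def by blast
  with assms(8) show False by blast
qed

definition normal :: "(vtx \<Rightarrow> complex) \<Rightarrow> bool" where
  "normal p \<longleftrightarrow> realizes p \<and> p (Bd 0 0) = Z 0 0 \<and> p (Bd 0 1) = Z 0 1 \<and> p (Bd 0 2) = Z 0 2"

lemma realizes_motion:
  assumes "linear f" "\<And>z. cmod (f z) = cmod z" "realizes p"
  shows "realizes (\<lambda>v. c + f (p v))"
proof -
  have d: "dist (c + f x) (c + f y) = dist x y" for x y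
    using linear_diff[OF assms(1), of x y] assms(2)[of "x - y"] by (simp add: dist_norm)
  have "inj f"
  proof (rule injI)
    fix x y assume "f x = f y"
    then show "x = y" using d[of x y] by simp
  qed
  from assms(3) show ?thesis unfolding realizes_def straight_affine[OF assms(1) \<open>inj f\<close>] d .
qed

lemma edge01: "{Bd 0 0, Bd 0 1} \<in> E"
  by (simp add: E_def)

lemma Bd_in_V0: "Bd 0 0 \<in> V" "Bd 0 1 \<in> V"
  by (auto simp: V_def)

lemma Z_start: "Z 0 0 = 0" "Z 0 1 = Complex (1/2) hgt" "Z 0 2 = 1"
  by (auto simp: Z_def complex_eq_iff)

text \<open>A rotation and a translation put the first edge into place. If the third vertex then
  lies on the wrong side of it, a reflection corrects this.\<close>

lemma normal_exists:
  assumes "realizes p" "0 < C"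
  shows "\<exists>p. normal p"
proof -
  define u where "u = Z 0 1 / (p (Bd 0 1) - p (Bd 0 0))"
  have d01: "cmod (p (Bd 0 1) - p (Bd 0 0)) = 1"
    using assms(1) unfolding realizes_def by (simp add: dist_norm norm_minus_commute)
  have w: "cmod (Z 0 1) = 1" using equi_Z[of 0 0] by (simp add: equi_def Z_start)
  have u: "cmod u = 1" using d01 w by (simp add: u_def norm_divide)
  define p1 where "p1 = (\<lambda>v. - u * p (Bd 0 0) + u * p v)"
  have r1: "realizes p1" unfolding p1_def
    by (rule realizes_motion[OF _ _ assms(1)]) (auto simp: u norm_mult intro: linearI algebra_simps)
  have ne: "p (Bd 0 1) - p (Bd 0 0) \<noteq> 0" using d01 by auto
  have "p1 (Bd 0 1) = u * (p (Bd 0 1) - p (Bd 0 0))" by (simp add: p1_def algebra_simps)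
  then have p1: "p1 (Bd 0 0) = Z 0 0" "p1 (Bd 0 1) = Z 0 1"
    using ne by (simp_all add: p1_def Z_start(1) u_def)
  have it: "(Bd 0 2, Bd 0 1, Bd 0 0, 0, 0) \<in> set items"
    using strip0_items[of 0, unfolded add_0] assms(2) by (simp add: Mt_def)
  have "dist (p1 (Bd 0 2)) (Z 0 1) = 1" "dist (p1 (Bd 0 2)) (Z 0 0) = 1"
    using r1 it p1 unfolding realizes_def by (auto simp: len_of_def)
  moreover have eq: "equi (Z 0 0) (Z 0 1) (Z 0 2)" using equi_Z[of 0 0] unfolding add_0 .
  define q where "q = Z 0 1 - Z 0 2"
  have "dist q (Z 0 1) = 1" "dist q (Z 0 0) = 1"
    using eq unfolding q_def by (auto simp: equi_def dist_norm Z_start norm_minus_commute)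
  moreover have "q \<noteq> Z 0 2" unfolding q_def Z_start by (simp add: complex_eq_iff)
  ultimately have "p1 (Bd 0 2) = Z 0 2 \<or> p1 (Bd 0 2) = q"
    using eq by (intro two_points[of "Z 0 0" "Z 0 1"]) (auto simp: equi_def dist_commute)
  then show ?thesis
  proof
    assume "p1 (Bd 0 2) = Z 0 2"
    then show ?thesis using r1 p1 unfolding normal_def by blast
  next
    assume q: "p1 (Bd 0 2) = q"
    \<comment> \<open>The square of the unit vector \<open>Z 0 1\<close>; multiplying the conjugate
      by it reflects in the line through 0 and \<open>Z 0 1\<close>.\<close>
    define w where "w = Complex (-1/2) hgt"
    have cw: "cmod w = 1" using hgt_sq by (simp add: w_def cmod_def power2_eq_square)
    have "realizes (\<lambda>v. 0 + w * cnj (p1 v))"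
      by (rule realizes_motion[OF _ _ r1]) (auto simp: cw norm_mult intro!: linearI simp: algebra_simps)
    moreover have "w * cnj (Z 0 0) = Z 0 0" "w * cnj (Z 0 1) = Z 0 1" "w * cnj q = Z 0 2"
      unfolding w_def q_def Z_start using hgt_sq by (simp_all add: complex_eq_iff)
    ultimately have "normal (\<lambda>v. 0 + w * cnj (p1 v))" using p1 q unfolding normal_def by simp
    then show ?thesis by blast
  qed
qed

lemma realizes_item:
  assumes "realizes p" "(v, a, b, k, l) \<in> set items"
  shows "dist (p v) (p a) = len_of k" "dist (p v) (p b) = len_of l" "v \<in> V" "{v, a} \<in> E" "{v, b} \<in> E"
  using assms item_edges[OF assms(2)] unfolding realizes_def by auto

lemma realizes_inj:
  assumes "realizes p" "v \<in> V" "w \<in> V" "v \<noteq> w" shows "p v \<noteq> p w"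
  using assms unfolding realizes_def straight_def by (auto dest: inj_onD)

text \<open>The only other point at the right distances is already occupied by the vertex three
  steps earlier.\<close>

lemma lattice_step:
  assumes "realizes p" "(Bd j (m + 3), Bd j (m + 2), Bd j (m + 1), 0, 0) \<in> set items" "Bd j m \<in> V"
    and "p (Bd j m) = Z j m" "p (Bd j (m + 1)) = Z j (m + 1)" "p (Bd j (m + 2)) = Z j (m + 2)"
  shows "p (Bd j (m + 3)) = Z j (m + 3)"
proof -
  note r = realizes_item[OF assms(1,2)]
  have e: "equi (Z j (m + 1)) (Z j (m + 2)) (Z j (m + 3))" "equi (Z j m) (Z j (m + 1)) (Z j (m + 2))"
    using equi_Z[of j "m + 1"] equi_Z[of j m] by (simp_all add: numeral_3_eq_3 add.assoc)
  have "p (Bd j (m + 3)) = Z j (m + 3) \<or> p (Bd j (m + 3)) = Z j m"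
    by (rule two_points[of "Z j (m + 2)" "Z j (m + 1)"])
      (use e r assms(5,6) Z_inj_3 in \<open>auto simp: equi_def dist_commute len_of_def\<close>)
  moreover have "p (Bd j (m + 3)) \<noteq> p (Bd j m)"
    by (rule realizes_inj[OF assms(1) r(3) assms(3)]) simp
  ultimately show ?thesis using assms(4) by simp
qed

lemma strip0_step: "m + 3 < Mt \<Longrightarrow> (Bd 0 (m + 3), Bd 0 (m + 2), Bd 0 (m + 1), 0, 0) \<in> set items"
proof -
  assume "m + 3 < Mt"
  moreover have "m + 1 + 2 = m + 3" "m + 1 + 1 = m + 2" by simp_all
  ultimately show ?thesis using strip0_items[of "m + 1"] by (simp only:)
qed

lemma body0:
  assumes "normal p" "m < Mt"
  shows "p (Bd 0 m) = Z 0 m \<and> Bd 0 m \<in> V"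
  using assms(2)
proof (induction m rule: less_induct)
  case (less m)
  have r: "realizes p" using assms(1) by (simp add: normal_def)
  consider "m = 0" | "m = 1" | "m = 2" | m' where "m = m' + 3"
    using nat_cases_3[of m] by blast
  then show ?case
  proof cases
    case 3
    then show ?thesis using assms(1) realizes_item(3)[OF r strip0_items[of 0, unfolded add_0]] less.prems
      unfolding normal_def by simp
  next
    case 4
    have "(Bd 0 (m' + 3), Bd 0 (m' + 2), Bd 0 (m' + 1), 0, 0) \<in> set items"
      using strip0_step less.prems 4 by simp
    from lattice_step[OF r this] realizes_item(3)[OF r this] less.IH[of m'] less.IH[of "m' + 1"] less.IH[of "m' + 2"]
    show ?thesis using less.prems 4 by simp
  qed (use assms(1) Bd_in_V0 in \<open>auto simp: normal_def\<close>)
qed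

lemma body_edge:
  assumes "j < 4 * R" "m + 2 < Mt" shows "{Bd j m, Bd j (m + 1)} \<in> E" "{Bd j m, Bd j (m + 2)} \<in> E"
proof -
  have "{Bd j (m + 2), Bd j (m + 1)} \<in> E \<and> {Bd j (m + 2), Bd j m} \<in> E \<and> {Bd j (m + 1), Bd j m} \<in> E"
    if "m + 2 < Mt" for m
    using that
  proof (induction m)
    case 0
    show ?case
    proof (cases j)
      case 0
      have "(Bd 0 2, Bd 0 1, Bd 0 0, 0, 0) \<in> set items" using strip0_items[of 0, unfolded add_0] \<open>0 + 2 < Mt\<close> by simp
      from item_edges[OF this] edge01 show ?thesis unfolding 0 add_0 by (simp add: insert_commute)
    next
      case (Suc j')
      then have "j' + 1 < 4 * R" using assms(1) by simp
      from item_edges[OF body_items(3)[OF this]] item_edges[OF body_items(2)[OF this]]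
      show ?thesis unfolding Suc add_0 by (simp add: insert_commute)
    qed
  next
    case (Suc m)
    have "(Bd j (m + 3), Bd j (m + 2), Bd j (m + 1), 0, 0) \<in> set items"
    proof (cases j)
      case 0
      then show ?thesis using strip0_step Suc.prems by simp
    next
      case j: (Suc j')
      then show ?thesis using body_items(4)[of j' m] assms(1) Suc.prems by simp
    qed
    from item_edges[OF this] Suc show ?case
      by (simp only: add_Suc add_2_eq_Suc' numeral_3_eq_3 add_Suc_right add_0_right Suc_eq_plus1[symmetric])
  qed
  from this[OF assms(2)] show "{Bd j m, Bd j (m + 1)} \<in> E" "{Bd j m, Bd j (m + 2)} \<in> E"
    by (simp_all add: insert_commute)
qed

lemma Z_rel:
  "Z j 3 = Z j 1 + 1" "Z j 2 = Z j 1 + Complex (1/2) (- hgt)"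
  "Z (j + 1) 0 = Z j 1 + Complex shf gap" "Z (j + 1) 2 = Z j 1 + Complex (1 + shf) gap"
  "Z (j + 1) 1 = Z j 1 + Complex (shf + 1/2) (gap + hgt)"
  by (auto simp: Z_def complex_eq_iff field_simps)

text \<open>Each of the three vertices that start a strip has two candidate positions, and the wrong
  one makes an edge cross the strip below. From then on \<open>lattice_step\<close> leaves no
  choice.\<close>

lemma body:
  assumes "normal p" "0 < C"
  shows "j < 4 * R \<Longrightarrow> \<forall>m<Mt. p (Bd j m) = Z j m \<and> Bd j m \<in> V"
proof (induction j)
  case 0
  then show ?case using body0[OF assms(1)] by blast
next
  case (Suc j)
  have r: "realizes p" using assms(1) unfolding normal_def by blast
  then have s: "straight V E p" unfolding realizes_def by blast
  have j: "j + 1 < 4 * R" "j < 4 * R" using Suc.prems by auto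
  have Mt: "14 \<le> Mt" using assms(2) by (simp add: Mt_def)
  have prev: "m < Mt \<Longrightarrow> p (Bd j m) = Z j m \<and> Bd j m \<in> V" for m using Suc.IH[OF j(2)] by blast
  have P: "p (Bd j 1) = Z j 1" "p (Bd j 2) = Z j 2" "p (Bd j 3) = Z j 3" using prev Mt by auto
  have e12: "{Bd j 1, Bd j 2} \<in> E" "{Bd j 1, Bd j 3} \<in> E"
    using body_edge[OF j(2), of 1] Mt by (simp_all add: numeral_2_eq_2 numeral_3_eq_3)
  define a where "a = Z j 1"
  have zs: "Z j 1 = a" "Z j 3 = a + 1" "Z j 2 = a + Complex (1/2) (- hgt)" "Z (j + 1) 0 = a + Complex shf gap"
    "Z (j + 1) 2 = a + Complex (1 + shf) gap" "Z (j + 1) 1 = a + Complex (shf + 1/2) (gap + hgt)"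
    unfolding a_def by (rule refl Z_rel)+
  note i0 = realizes_item[OF r body_items(1)[OF j(1)]]
  note i2 = realizes_item[OF r body_items(2)[OF j(1)]]
  note i1 = realizes_item[OF r body_items(3)[OF j(1)]]
  have len: "len_of 1 = 7/13" "len_of 0 = 1" by (auto simp: len_of_def)
  have c0: "p (Bd (j + 1) 0) = a + Complex shf gap"
  proof -
    have "p (Bd (j + 1) 0) \<noteq> a + Complex shf (- gap)"
    proof
      assume *: "p (Bd (j + 1) 0) = a + Complex shf (- gap)"
      have "\<exists>x. x \<in> closed_segment (p (Bd j 1)) (p (Bd j 2)) \<and> x \<in> closed_segment (p (Bd j 3)) (p (Bd (j + 1) 0))"
        unfolding P zs * by (rule spine_cross_1)
      then show False
        by (rule straight_crossing[OF s e12(1) i0(5)[unfolded insert_commute[of "Bd (j + 1) 0"]], rotated 4]) simp_all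
    qed
    with spine_choice_1[of "p (Bd (j + 1) 0)" a] i0(1,2) show ?thesis unfolding P zs len by blast
  qed
  have c2: "p (Bd (j + 1) 2) = a + Complex (1 + shf) gap"
  proof -
    let ?q = "a + Complex (1 + 2 * shf * shf - 3 * shf) (gap * (2 * shf - 1))"
    have "p (Bd (j + 1) 2) \<noteq> ?q"
    proof
      assume *: "p (Bd (j + 1) 2) = ?q"
      have "\<exists>x. x \<in> closed_segment (p (Bd j 1)) (p (Bd j 3)) \<and> x \<in> closed_segment (p (Bd (j + 1) 0)) (p (Bd (j + 1) 2))"
        unfolding P zs * c0 by (rule spine_cross_2)
      then show False
        by (rule straight_crossing[OF s e12(2) i2(5)[unfolded insert_commute[of "Bd (j + 1) 2"]], rotated 4]) simp_all
    qed
    with spine_choice_2[of "p (Bd (j + 1) 2)" a] i2(1,2) show ?thesis unfolding P zs len c0 by blast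
  qed
  have c1: "p (Bd (j + 1) 1) = a + Complex (shf + 1/2) (gap + hgt)"
  proof -
    have "p (Bd (j + 1) 1) \<noteq> a + Complex (shf + 1/2) (gap - hgt)"
    proof
      assume *: "p (Bd (j + 1) 1) = a + Complex (shf + 1/2) (gap - hgt)"
      have "\<exists>x. x \<in> closed_segment (p (Bd j 1)) (p (Bd j 3)) \<and> x \<in> closed_segment (p (Bd (j + 1) 0)) (p (Bd (j + 1) 1))"
        unfolding P zs * c0 by (rule spine_cross_3)
      then show False
        by (rule straight_crossing[OF s e12(2) i1(4)[unfolded insert_commute[of "Bd (j + 1) 1"]], rotated 4]) simp_all
    qed
    with spine_choice_3[of "p (Bd (j + 1) 1)" a] i1(1,2) show ?thesis unfolding len c0 c2 by blast
  qed
  note c0 = c0[folded zs] note c1 = c1[folded zs] note c2 = c2[folded zs]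
  have "p (Bd (j + 1) m) = Z (j + 1) m \<and> Bd (j + 1) m \<in> V" if "m < Mt" for m
    using that
  proof (induction m rule: less_induct)
    case (less m)
    consider "m = 0" | "m = 1" | "m = 2" | m' where "m = m' + 3"
      using nat_cases_3[of m] by blast
    then show ?case
    proof cases
      case 4
      have it: "(Bd (j + 1) (m' + 3), Bd (j + 1) (m' + 2), Bd (j + 1) (m' + 1), 0, 0) \<in> set items"
        using body_items(4)[OF j(1)] less.prems 4 by simp
      from lattice_step[OF r it] realizes_item(3)[OF r it] less.IH[of m'] less.IH[of "m' + 1"] less.IH[of "m' + 2"]
      show ?thesis using less.prems 4 by simp
    qed (use c0 c1 c2 i0(3) i1(3) i2(3) in auto)
  qed
  then show ?case by simp
qed

end

section \<open>Realizations solve the constraints\<close>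

context layout
begin

type_synonym flag = "nat \<times> nat \<times> nat \<times> nat"

text \<open>A flag \<open>(j, k, m, ty)\<close> sits on the edge from \<open>Bd j m\<close> to \<open>Bd j (m + k)\<close>.\<close>

definition third :: "nat \<Rightarrow> nat \<Rightarrow> nat \<Rightarrow> bool \<Rightarrow> complex" where
  "third k j m b = (let t = if k = 1 then Z j (m + 2) else Z j (m + 1) in if b then t else Z j m + Z j (m + k) - t)"

definition fat :: "vtx \<Rightarrow> flag \<Rightarrow> bool" where
  "fat v f \<longleftrightarrow> (case f of (j, k, m, ty) \<Rightarrow> (v, Bd j m, Bd j (m + k), ty, ty) \<in> set items \<and> (k = 1 \<or> k = 2) \<and>
     (ty = 1 \<or> ty = 2) \<and> j < 4 * R \<and> 0 < m \<and> m + k < Mt \<and> (\<forall>j m. v \<noteq> Bd j m))"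

definition fpos :: "flag \<Rightarrow> bool \<Rightarrow> complex" where
  "fpos f b = (case f of (j, k, m, ty) \<Rightarrow> apex ty (Z j m) (Z j (m + k)) (third k j m b))"

lemma equi_third: "k = 1 \<or> k = 2 \<Longrightarrow> equi (Z j m) (Z j (m + k)) (third k j m b)"
  using equi_Z[of j m] equi_perm(2)[OF equi_Z[of j m]]
  by (auto simp: third_def Let_def intro: equi_reflect simp del: One_nat_def)

lemma third_False: "third k j m False = Z j m + Z j (m + k) - third k j m True"
  by (simp add: third_def)

lemma fpos_cases:
  assumes "normal p" "0 < C" "fat v f" shows "p v = fpos f True \<or> p v = fpos f False"
proof -
  obtain j k m ty where f: "f = (j, k, m, ty)" by (cases f)
  have a: "(v, Bd j m, Bd j (m + k), ty, ty) \<in> set items" "k = 1 \<or> k = 2" "ty = 1 \<or> ty = 2" "j < 4 * R" "m + k < Mt"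
    using assms(3) by (auto simp: fat_def f)
  note r = realizes_item[OF _ a(1), of p]
  have b: "p (Bd j m) = Z j m" "p (Bd j (m + k)) = Z j (m + k)" using body[OF assms(1,2) a(4)] a(5) by auto
  show ?thesis unfolding f fpos_def prod.case third_False
    by (rule apex_cases[OF equi_third[OF a(2)] a(3)]) (use r(1,2) assms(1) b in \<open>simp_all add: normal_def\<close>)
qed

lemma fat_V: "fat v f \<Longrightarrow> v \<in> V"
  unfolding fat_def by (cases f) (use item_edges in blast)

lemma fpos_unique:
  assumes "normal p" "fat v f" "fat v' f" "v \<noteq> v'" shows "p v \<noteq> p v'"
proof -
  have "realizes p" using assms(1) by (simp add: normal_def)
  then show ?thesis
    by (rule realizes_inj[OF _ fat_V[OF assms(2)] fat_V[OF assms(3)] assms(4)])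
qed

text \<open>\<open>z\<close> is the common end of the two carrying edges and \<open>x\<close>,
  \<open>y\<close> are their other ends, so both flags point into the triangle of the three.\<close>

lemma face_conflict:
  assumes "normal p" "0 < C" "ty = 1 \<or> ty = 2" "ty' = 1 \<or> ty' = 2" "ty \<noteq> 1 \<or> ty' \<noteq> 1" "v \<noteq> v'"
    and "j < 4 * R" "x < Mt" "y < Mt" "z < Mt" "distinct [x, y, z]" "\<And>j m. v \<noteq> Bd j m" "\<And>j m. v' \<noteq> Bd j m"
    and "{v, Bd j z} \<in> E" "{v, Bd j x} \<in> E" "{v', Bd j z} \<in> E" "{v', Bd j y} \<in> E" "v \<in> V" "v' \<in> V"
    and v: "p v = apex ty (Z j z) (Z j x) (Z j y)" and v': "p v' = apex ty' (Z j z) (Z j y) (Z j x)"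
  shows False
proof -
  have s: "straight V E p" using assms(1) by (simp add: normal_def realizes_def)
  have b: "p (Bd j x) = Z j x" "p (Bd j y) = Z j y" "p (Bd j z) = Z j z"
    using body[OF assms(1,2,7)] assms(8-10) by auto
  have E: "{Bd j z, v} \<in> E" "{Bd j x, v} \<in> E" "{Bd j z, v'} \<in> E" "{Bd j y, v'} \<in> E"
    using assms(14-17) by (simp_all add: insert_commute)
  consider "ty = 2" "ty' = 2" | "ty = 2" "ty' = 1" | "ty = 1" "ty' = 2" using assms(3-5) by auto
  then show False
  proof cases
    case 1
    have "\<exists>u. u \<in> closed_segment (p (Bd j x)) (p v) \<and> u \<in> closed_segment (p (Bd j y)) (p v')"
      unfolding b v v' 1 using face_cross_22[of "Z j z" "Z j x" "Z j y"] face_cross_22[of "Z j z" "Z j y" "Z j x"]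
      by (intro exI conjI; simp add: add.assoc add.commute add.left_commute)
    then show False
      by (rule straight_crossing[OF s E(2,4), rotated 4]) (use assms(6,11) assms(12)[THEN not_sym] assms(13)[THEN not_sym] assms(12,13) in simp_all)
  next
    case 2
    have "p v' \<in> closed_segment (p (Bd j z)) (p v)"
      unfolding b v v' 2 by (rule face_cross_21)
    then show False using s E(1) assms(19) assms(6,13) unfolding straight_def by metis
  next
    case 3
    have "p v \<in> closed_segment (p (Bd j z)) (p v')"
      unfolding b v v' 3 by (rule face_cross_21)
    then show False using s E(3) assms(18) assms(6,12) unfolding straight_def by metis
  qed
qed

text \<open>The first three cases are the pairs of sides of one triangle, with the booleans saying
  that both flags point into it. In the last case a flag on an upper edge of one strip faces a flag
  on a lower edge of the next across the corridor.\<close>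

definition bad :: "flag \<Rightarrow> bool \<Rightarrow> flag \<Rightarrow> bool \<Rightarrow> bool" where
  "bad f b f' b' \<longleftrightarrow> (case (f, f') of ((j, k, m, ty), (j', k', m', ty')) \<Rightarrow> (ty \<noteq> 1 \<or> ty' \<noteq> 1) \<and>
    ((j' = j \<and> k = 1 \<and> k' = 1 \<and> m' = m + 1 \<and> b \<and> \<not> b') \<or>
     (j' = j \<and> k = 1 \<and> k' = 2 \<and> m' = m \<and> b \<and> b') \<or>
     (j' = j \<and> k = 1 \<and> k' = 2 \<and> m = m' + 1 \<and> \<not> b \<and> b') \<or>
     (j' = j + 1 \<and> k = 2 \<and> k' = 2 \<and> m = m' + 1 \<and> even m' \<and> \<not> b \<and> \<not> b')))"

lemma third_simps:
  "third (Suc 0) j m True = Z j (m + 2)" "third 2 j m True = Z j (m + 1)"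
  "third (Suc 0) j (m + 1) False = Z j m"
  using Z_par[of j m] by (auto simp: third_def algebra_simps eval_nat_numeral)

lemma conflict:
  assumes "normal p" "0 < C" "fat v f" "fat v' f'" "v \<noteq> v'" "bad f b f' b'" "p v = fpos f b" "p v' = fpos f' b'"
  shows False
proof -
  obtain j k m ty where f: "f = (j, k, m, ty)" by (cases f)
  obtain j' k' m' ty' where f': "f' = (j', k', m', ty')" by (cases f')
  have a: "(v, Bd j m, Bd j (m + k), ty, ty) \<in> set items" "k = 1 \<or> k = 2" "ty = 1 \<or> ty = 2" "j < 4 * R" "m + k < Mt"
    "\<And>j m. v \<noteq> Bd j m"
    using assms(3) by (auto simp: fat_def f)
  have a': "(v', Bd j' m', Bd j' (m' + k'), ty', ty') \<in> set items" "k' = 1 \<or> k' = 2" "ty' = 1 \<or> ty' = 2" "j' < 4 * R"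
    "m' + k' < Mt" "\<And>j m. v' \<noteq> Bd j m"
    using assms(4) by (auto simp: fat_def f')
  have r: "realizes p" using assms(1) by (simp add: normal_def)
  then have s: "straight V E p" by (simp add: realizes_def)
  note i = realizes_item(3-5)[OF r a(1)] and i' = realizes_item(3-5)[OF r a'(1)]
  have ty: "ty \<noteq> 1 \<or> ty' \<noteq> 1" using assms(6) by (auto simp: bad_def f f')
  note conf = face_conflict[OF assms(1,2) a(3) a'(3) ty assms(5) a(4) _ _ _ _ a(6) a'(6) _ _ _ _ i(1) i'(1)]
  have p: "p v = apex ty (Z j m) (Z j (m + k)) (third k j m b)" "p v' = apex ty' (Z j' m') (Z j' (m' + k')) (third k' j' m' b')"
    using assms(7,8) by (simp_all add: f f' fpos_def)
  consider (1) "j' = j" "k = 1" "k' = 1" "m' = m + 1" "b" "\<not> b'"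
    | (2) "j' = j" "k = 1" "k' = 2" "m' = m" "b" "b'"
    | (3) "j' = j" "k = 1" "k' = 2" "m = m' + 1" "\<not> b" "b'"
    | (4) "j' = j + 1" "k = 2" "k' = 2" "m = m' + 1" "even m'" "\<not> b" "\<not> b'"
    using assms(6) unfolding bad_def f f' by auto
  then show False
  proof cases
    case 1
    show False
      by (rule conf[of "m" "m + 2" "m + 1"])
        (use 1 i i' a(5) a'(5) p in \<open>simp_all add: apex_commute[of ty "Z j m"] third_simps third_simps(3)[unfolded Suc_eq_plus1[symmetric]]\<close>)
  next
    case 2
    show False
      by (rule conf[of "m + 1" "m + 2" m]) (use 2 i i' a(5) a'(5) p in \<open>simp_all add: third_simps\<close>)
  next
    case 3
    show False
      by (rule conf[of "m' + 1" m' "m' + 2"])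
        (use 3 i i' a(5) a'(5) p in \<open>simp_all add: third_simps third_simps(3)[unfolded Suc_eq_plus1[symmetric]]
           apex_commute[of ty "Z j (Suc m')"] apex_commute[of ty' "Z j m'"]\<close>)
  next
    case 4
    define q where "q = Z j m"
    have Z1: "Z j (m + k) = q + 1" using Z_simps(2)[of j m] 4 by (simp add: q_def algebra_simps)
    have Z2: "third k j m b = q + Complex (1/2) hgt"
      using 4 by (simp add: third_def Z_def q_def complex_eq_iff field_simps)
    have Z3: "Z j' m' = q + Complex shf gap" using 4 by (simp add: Z_def q_def complex_eq_iff field_simps)
    have Z4: "Z j' (m' + k') = q + Complex shf gap + 1" using 4 by (simp add: Z_def q_def complex_eq_iff field_simps)
    have Z5: "third k' j' m' b' = q + Complex shf gap + Complex (1/2) (- hgt)"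
      using 4 by (simp add: third_def Z_def q_def complex_eq_iff field_simps)
    have bd: "p (Bd j m) = q" "p (Bd j (m + k)) = q + 1" "p (Bd j' m') = q + Complex shf gap"
      "p (Bd j' (m' + k')) = q + Complex shf gap + 1"
      using body[OF assms(1,2) a(4)] body[OF assms(1,2) a'(4)] a(5) a'(5) Z1 Z3 Z4 by (auto simp: q_def)
    have A: "apex 2 x (x + 1) (x + Complex (1/2) y) = x + Complex (1/2) (5/11 * y)"
      "apex 1 x (x + 1) (x + Complex (1/2) y) = x + Complex (1/2) (3/13 * y)" for x y
      by (simp_all add: apex_def complex_eq_iff)
    have ne: "Bd j x \<noteq> Bd j' y" for x y using 4 by simp
    have E: "{Bd j m, v} \<in> E" "{Bd j (m + k), v} \<in> E" "{Bd j' m', v'} \<in> E"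
      using i i' by (simp_all add: insert_commute)
    have P: "p v = apex ty q (q + 1) (q + Complex (1/2) hgt)"
      "p v' = apex ty' (q + Complex shf gap) (q + Complex shf gap + 1) (q + Complex shf gap + Complex (1/2) (- hgt))"
      using p unfolding Z1 Z2 Z3 Z4 Z5 by (simp_all add: q_def)
    note sc = straight_crossing[OF s _ E(3), rotated 5]
    have nes: "Bd j x \<noteq> Bd j' y" "Bd j x \<noteq> v'" "v \<noteq> Bd j' y" "v \<noteq> v'" for x y
      using a(6) a'(6) assms(5) ne by metis+
    consider "ty = 2" "ty' = 2" | "ty = 2" "ty' = 1" | "ty = 1" "ty' = 2" using a(3) a'(3) ty by auto
    then show False
    proof cases
      case 1
      have "\<exists>x. x \<in> closed_segment (p (Bd j m)) (p v) \<and> x \<in> closed_segment (p (Bd j' m')) (p v')"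
        unfolding bd P A 1 using corridor_cross(1)[of q] by simp
      then show False using straight_crossing[OF s E(1,3) nes] by blast
    next
      case 2
      have "\<exists>x. x \<in> closed_segment (p (Bd j (m + k))) (p v) \<and> x \<in> closed_segment (p (Bd j' m')) (p v')"
        unfolding bd P A 2 using corridor_cross(3)[of q] by simp
      then show False using straight_crossing[OF s E(2,3) nes] by blast
    next
      case 3
      have "\<exists>x. x \<in> closed_segment (p (Bd j (m + k))) (p v) \<and> x \<in> closed_segment (p (Bd j' m')) (p v')"
        unfolding bd P A 3 using corridor_cross(2)[of q] by simp
      then show False using straight_crossing[OF s E(2,3) nes] by blast
    qed
  qed
qed

section \<open>Signals within a cell and along a row\<close>

definition place :: "nat \<Rightarrow> nat \<Rightarrow> nat \<Rightarrow> flag" where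
  "place r c i = (case entry r c i of (\<sigma>, \<kappa>, \<mu>, ty) \<Rightarrow> (4 * r + \<sigma>, \<kappa>, 8 * c + \<mu>, ty))"

definition st :: "(vtx \<Rightarrow> complex) \<Rightarrow> nat \<Rightarrow> nat \<Rightarrow> nat \<Rightarrow> bool" where
  "st p r c i \<longleftrightarrow> p (Fl r c i) = fpos (place r c i) True"

lemma entry_ok:
  assumes "i < 42"
  shows "case entry r c i of (\<sigma>, \<kappa>, \<mu>, ty) \<Rightarrow> \<sigma> < 4 \<and> (\<kappa> = 1 \<or> \<kappa> = 2) \<and> 0 < \<mu> \<and> \<mu> + \<kappa> < 14 \<and> (ty = 1 \<or> ty = 2)"
proof -
  have "entry r c i \<in> insert (2,1,9,1) (insert (0,1,4,1) (set base_tab))"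
    unfolding entry_def using nth_mem[of i base_tab] assms length_base_tab by auto
  then show ?thesis by (auto simp: base_tab_def)
qed

lemma fat_cell:
  assumes "r < R" "c < C" "i < 42" shows "fat (Fl r c i) (place r c i)"
proof -
  obtain s k m ty where e: "entry r c i = (s, k, m, ty)" by (cases "entry r c i")
  have "flag_item r c i \<in> set (cell r c)" using assms(3) unfolding cell_def by auto
  then have "flag_item r c i \<in> set items" using cell_items[OF assms(1,2)] by blast
  moreover have "s < 4 \<and> (k = 1 \<or> k = 2) \<and> 0 < m \<and> m + k < 14 \<and> (ty = 1 \<or> ty = 2)"
    using entry_ok[OF assms(3), of r c] e by simp
  ultimately show ?thesis using assms(1,2) by (auto simp: fat_def place_def e flag_item_def Mt_def)
qed

text \<open>Every flag has only two positions, so a forbidden pair of sides reads as an implication: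
  one flag on side \<open>b\<close> forces the other off side \<open>b'\<close>. All signals are
  chains of such implications.\<close>

lemma clash:
  assumes "normal p" "r < R" "c < C" "i < 42" "r' < R" "c' < C" "i' < 42"
    and "bad (place r c i) b (place r' c' i') b' \<or> bad (place r' c' i') b' (place r c i) b" "(r, c, i) \<noteq> (r', c', i')"
    and "st p r c i = b"
  shows "st p r' c' i' \<noteq> b'"
proof
  assume s': "st p r' c' i' = b'"
  have C: "0 < C" using assms(3) by simp
  note f = fat_cell[OF assms(2-4)] and f' = fat_cell[OF assms(5-7)]
  have "p (Fl r c i) = fpos (place r c i) b" "p (Fl r' c' i') = fpos (place r' c' i') b'"
    using fpos_cases[OF assms(1) C f] fpos_cases[OF assms(1) C f'] assms(10) s' unfolding st_def by metis+
  then show False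
    using assms(8,9) conflict[OF assms(1) C f f', of b b'] conflict[OF assms(1) C f' f, of b' b] by auto
qed

lemma place_0: "place r c 0 = (4 * r + 1, 1, 8 * c + 3, 2)"
  by (simp add: place_def entry_def base_tab_def)

lemmas place_simps = place_def entry_def base_tab_def bad_def

text \<open>Each signal forces two of the sensors 5 to 8 to point at the unit: the west tap forces 5
  and 6, the north signal (state of 18) forces 5 and 7, the south signal (state of 29) forces 6 and
  8. Sensor 8 points in when its state is false. The chains from 11 and 12 bring the east tap
  towards 7 and 8 up to the link that a literal may cut. The last chain carries the absence of the
  north signal through strip 3.\<close>

lemma cell_clash:
  assumes "normal p" "r < R" "c < C"
  shows "st p r c 0 \<Longrightarrow> st p r c 1" "st p r c 1 \<Longrightarrow> \<not> st p r c 3" "\<not> st p r c 3 \<Longrightarrow> st p r c 24"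
    "st p r c 24 \<Longrightarrow> st p r c 25" "st p r c 25 \<Longrightarrow> st p r c 26" "st p r c 26 \<Longrightarrow> \<not> st p r c 27"
    "\<not> st p r c 27 \<Longrightarrow> st p r c 6" "st p r c 0 \<Longrightarrow> \<not> st p r c 2" "\<not> st p r c 2 \<Longrightarrow> st p r c 13"
    "st p r c 13 \<Longrightarrow> st p r c 14" "st p r c 14 \<Longrightarrow> st p r c 15" "st p r c 15 \<Longrightarrow> \<not> st p r c 16"
    "\<not> st p r c 16 \<Longrightarrow> st p r c 4" "st p r c 4 \<Longrightarrow> st p r c 5" "st p r c 18 \<Longrightarrow> \<not> st p r c 17"
    "\<not> st p r c 17 \<Longrightarrow> \<not> st p r c 16" "st p r c 18 \<Longrightarrow> st p r c 19" "st p r c 19 \<Longrightarrow> \<not> st p r c 20"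
    "\<not> st p r c 20 \<Longrightarrow> st p r c 7" "st p r c 29 \<Longrightarrow> \<not> st p r c 28" "\<not> st p r c 28 \<Longrightarrow> \<not> st p r c 27"
    "st p r c 29 \<Longrightarrow> st p r c 30" "st p r c 30 \<Longrightarrow> \<not> st p r c 31" "\<not> st p r c 31 \<Longrightarrow> st p r c 9"
    "st p r c 9 \<Longrightarrow> \<not> st p r c 8" "\<not> st p r c 11 \<Longrightarrow> \<not> st p r c 10" "\<not> st p r c 10 \<Longrightarrow> st p r c 23"
    "st p r c 23 \<Longrightarrow> \<not> st p r c 22" "\<not> st p r c 12 \<Longrightarrow> st p r c 34" "st p r c 34 \<Longrightarrow> \<not> st p r c 33"
    "\<not> st p r c 18 \<Longrightarrow> st p r c 35" "st p r c 35 \<Longrightarrow> st p r c 36" "st p r c 36 \<Longrightarrow> st p r c 37"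
    "st p r c 37 \<Longrightarrow> st p r c 38" "st p r c 38 \<Longrightarrow> st p r c 39" "st p r c 39 \<Longrightarrow> st p r c 40"
    "st p r c 40 \<Longrightarrow> \<not> st p r c 41"
proof -
  note cl = clash[OF assms(1-3) _ assms(2,3)]
  show "st p r c 0 \<Longrightarrow> st p r c 1"
    using cl[of 0 1 True False] by (simp add: place_simps)
  show "st p r c 1 \<Longrightarrow> \<not> st p r c 3"
    using cl[of 1 3 True True] by (simp add: place_simps)
  show "\<not> st p r c 3 \<Longrightarrow> st p r c 24"
    using cl[of 3 24 False False] by (simp add: place_simps)
  show "st p r c 24 \<Longrightarrow> st p r c 25"
    using cl[of 24 25 True False] by (simp add: place_simps)
  show "st p r c 25 \<Longrightarrow> st p r c 26"
    using cl[of 25 26 True False] by (simp add: place_simps)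
  show "st p r c 26 \<Longrightarrow> \<not> st p r c 27"
    using cl[of 26 27 True True] by (simp add: place_simps)
  show "\<not> st p r c 27 \<Longrightarrow> st p r c 6"
    using cl[of 27 6 False False] by (simp add: place_simps)
  show "st p r c 0 \<Longrightarrow> \<not> st p r c 2"
    using cl[of 0 2 True True] by (simp add: place_simps)
  show "\<not> st p r c 2 \<Longrightarrow> st p r c 13"
    using cl[of 2 13 False False] by (simp add: place_simps)
  show "st p r c 13 \<Longrightarrow> st p r c 14"
    using cl[of 13 14 True False] by (simp add: place_simps)
  show "st p r c 14 \<Longrightarrow> st p r c 15"
    using cl[of 14 15 True False] by (simp add: place_simps)
  show "st p r c 15 \<Longrightarrow> \<not> st p r c 16"
    using cl[of 15 16 True True] by (simp add: place_simps)
  show "\<not> st p r c 16 \<Longrightarrow> st p r c 4"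
    using cl[of 16 4 False False] by (simp add: place_simps)
  show "st p r c 4 \<Longrightarrow> st p r c 5"
    using cl[of 4 5 True False] by (simp add: place_simps)
  show "st p r c 18 \<Longrightarrow> \<not> st p r c 17"
    using cl[of 18 17 True True] by (simp add: place_simps)
  show "\<not> st p r c 17 \<Longrightarrow> \<not> st p r c 16"
    using cl[of 17 16 False True] by (simp add: place_simps)
  show "st p r c 18 \<Longrightarrow> st p r c 19"
    using cl[of 18 19 True False] by (simp add: place_simps)
  show "st p r c 19 \<Longrightarrow> \<not> st p r c 20"
    using cl[of 19 20 True True] by (simp add: place_simps)
  show "\<not> st p r c 20 \<Longrightarrow> st p r c 7"
    using cl[of 20 7 False False] by (simp add: place_simps)
  show "st p r c 29 \<Longrightarrow> \<not> st p r c 28"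
    using cl[of 29 28 True True] by (simp add: place_simps)
  show "\<not> st p r c 28 \<Longrightarrow> \<not> st p r c 27"
    using cl[of 28 27 False True] by (simp add: place_simps)
  show "st p r c 29 \<Longrightarrow> st p r c 30"
    using cl[of 29 30 True False] by (simp add: place_simps)
  show "st p r c 30 \<Longrightarrow> \<not> st p r c 31"
    using cl[of 30 31 True True] by (simp add: place_simps)
  show "\<not> st p r c 31 \<Longrightarrow> st p r c 9"
    using cl[of 31 9 False False] by (simp add: place_simps)
  show "st p r c 9 \<Longrightarrow> \<not> st p r c 8"
    using cl[of 9 8 True True] by (simp add: place_simps)
  show "\<not> st p r c 11 \<Longrightarrow> \<not> st p r c 10"
    using cl[of 11 10 False True] by (simp add: place_simps)
  show "\<not> st p r c 10 \<Longrightarrow> st p r c 23"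
    using cl[of 10 23 False False] by (simp add: place_simps)
  show "st p r c 23 \<Longrightarrow> \<not> st p r c 22"
    using cl[of 23 22 True True] by (simp add: place_simps)
  show "\<not> st p r c 12 \<Longrightarrow> st p r c 34"
    using cl[of 12 34 False False] by (simp add: place_simps)
  show "st p r c 34 \<Longrightarrow> \<not> st p r c 33"
    using cl[of 34 33 True True] by (simp add: place_simps)
  show "\<not> st p r c 18 \<Longrightarrow> st p r c 35"
    using cl[of 18 35 False False] by (simp add: place_simps)
  show "st p r c 35 \<Longrightarrow> st p r c 36"
    using cl[of 35 36 True False] by (simp add: place_simps)
  show "st p r c 36 \<Longrightarrow> st p r c 37"
    using cl[of 36 37 True False] by (simp add: place_simps)
  show "st p r c 37 \<Longrightarrow> st p r c 38"
    using cl[of 37 38 True False] by (simp add: place_simps)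
  show "st p r c 38 \<Longrightarrow> st p r c 39"
    using cl[of 38 39 True False] by (simp add: place_simps)
  show "st p r c 39 \<Longrightarrow> st p r c 40"
    using cl[of 39 40 True False] by (simp add: place_simps)
  show "st p r c 40 \<Longrightarrow> \<not> st p r c 41"
    using cl[of 40 41 True True] by (simp add: place_simps)
qed

text \<open>In the first two claims the link flag is in its wire because no literal of the fitting
  sign has moved it. The third crosses the corridor between two rows: without a north signal here
  there is a south signal in the next row.\<close>

lemma toggle_clash:
  assumes "normal p" "r < R" "c < C"
  shows "\<not> (lit r c \<and> r < R0) \<Longrightarrow> \<not> st p r c 22 \<Longrightarrow> \<not> st p r c 20"
    "\<not> (lit r c \<and> R0 \<le> r) \<Longrightarrow> \<not> st p r c 33 \<Longrightarrow> \<not> st p r c 31"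
    "r + 1 < R \<Longrightarrow> \<not> st p r c 41 \<Longrightarrow> st p (r + 1) c 29"
proof -
  note cl = clash[OF assms(1-3) _ assms(2,3)]
  show "\<not> (lit r c \<and> r < R0) \<Longrightarrow> \<not> st p r c 22 \<Longrightarrow> \<not> st p r c 20"
    using cl[of 22 21 False True] cl[of 21 20 False True] by (auto simp: place_simps)
  show "\<not> (lit r c \<and> R0 \<le> r) \<Longrightarrow> \<not> st p r c 33 \<Longrightarrow> \<not> st p r c 31"
    using cl[of 33 32 False True] cl[of 32 31 False True] by (auto simp: place_simps)
  show "r + 1 < R \<Longrightarrow> \<not> st p r c 41 \<Longrightarrow> st p (r + 1) c 29"
    using clash[OF assms(1-3) _ _ assms(3), of 41 "r + 1" 29 False False] by (simp add: place_simps)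
qed

text \<open>A tap can be doubled by an end flag, so the two directions need not exclude each other.\<close>

definition tap :: "(vtx \<Rightarrow> complex) \<Rightarrow> nat \<Rightarrow> nat \<Rightarrow> bool \<Rightarrow> bool" where
  "tap p r c b \<longleftrightarrow> (\<exists>v. fat v (4 * r + 1, 1, 8 * c + 3, 2) \<and> (\<forall>r c i. v = Fl r c i \<longrightarrow> i = 0) \<and>
     p v = fpos (4 * r + 1, 1, 8 * c + 3, 2) b)"

lemma tap_clash:
  assumes "normal p" "r < R" "c < C"
  shows "tap p r c True \<Longrightarrow> st p r c 1" "tap p r c True \<Longrightarrow> \<not> st p r c 2"
    "tap p r (c + 1) False \<Longrightarrow> \<not> st p r c 11" "tap p r (c + 1) False \<Longrightarrow> \<not> st p r c 12"
proof -
  have C: "0 < C" using assms(3) by simp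
  have *: "st p r c i \<noteq> b'" if t: "tap p r c' b" and "i < 42" "0 < i"
    and bad: "bad (4 * r + 1, 1, 8 * c' + 3, 2) b (place r c i) b' \<or> bad (place r c i) b' (4 * r + 1, 1, 8 * c' + 3, 2) b"
    for c' i b b'
  proof
    assume s: "st p r c i = b'"
    obtain v where v: "fat v (4 * r + 1, 1, 8 * c' + 3, 2)" "\<forall>r c i. v = Fl r c i \<longrightarrow> i = 0" "p v = fpos (4 * r + 1, 1, 8 * c' + 3, 2) b"
      using t unfolding tap_def by blast
    note f = fat_cell[OF assms(2,3) \<open>i < 42\<close>]
    have "p (Fl r c i) = fpos (place r c i) b'"
      using fpos_cases[OF assms(1) C f] s unfolding st_def by metis
    moreover have "v \<noteq> Fl r c i" using v(2) \<open>0 < i\<close> by auto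
    ultimately show False
      using conflict[OF assms(1) C v(1) f, of b b'] conflict[OF assms(1) C f v(1), of b' b] v(3) bad by auto
  qed
  show "tap p r c True \<Longrightarrow> st p r c 1" using *[of c True 1 False] by (simp add: place_simps)
  show "tap p r c True \<Longrightarrow> \<not> st p r c 2" using *[of c True 2 True] by (simp add: place_simps)
  show "tap p r (c + 1) False \<Longrightarrow> \<not> st p r c 11" using *[of "c + 1" False 11 True] by (simp add: place_simps)
  show "tap p r (c + 1) False \<Longrightarrow> \<not> st p r c 12" using *[of "c + 1" False 12 True] by (simp add: place_simps)
qed

text \<open>In the face chosen by flag 42 each of the vertices 43 and 44 has an outer and an inner
  position. The outer one coincides with the apex of a sensor pointing into this face, and the two
  inner ones make edges cross.\<close>

lemma unit_clash:
  assumes "normal p" "r < R" "c < C"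
  shows "\<not> (st p r c 5 \<and> st p r c 6 \<and> st p r c 7 \<and> \<not> st p r c 8)"
proof
  assume s: "st p r c 5 \<and> st p r c 6 \<and> st p r c 7 \<and> \<not> st p r c 8"
  have C: "0 < C" using assms(3) by simp
  have r: "realizes p" using assms(1) by (simp add: normal_def)
  then have str: "straight V E p" by (simp add: realizes_def)
  define j where "j = 4 * r + 1"
  define m where "m = 8 * c + 6"
  define a where "a = Z j (m + 1)"
  define b where "b = Z j (m + 2)"
  have P: "p (Fl r c 5) = apex 1 (Z j m) a b" "p (Fl r c 6) = apex 1 (Z j m) b a"
    "p (Fl r c 7) = apex 1 a (Z j (m + 3)) b" "p (Fl r c 8) = apex 1 b (Z j (m + 3)) a"
  proof -
    have 8: "p (Fl r c 8) = fpos (place r c 8) False"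
      using s fpos_cases[OF assms(1) C fat_cell[OF assms(2,3)], of 8] unfolding st_def by auto
    have "place r c 5 = (j, 1, m, 1)" "place r c 6 = (j, 2, m, 1)" "place r c 7 = (j, 2, m + 1, 1)" "place r c 8 = (j, 1, m + 1 + 1, 1)"
      by (simp_all add: place_simps j_def m_def)
    with s 8 show "p (Fl r c 5) = apex 1 (Z j m) a b" "p (Fl r c 6) = apex 1 (Z j m) b a"
      "p (Fl r c 7) = apex 1 a (Z j (m + 3)) b" "p (Fl r c 8) = apex 1 b (Z j (m + 3)) a"
      unfolding st_def fpos_def a_def b_def
      by (simp_all add: third_simps third_simps(3)[unfolded Suc_eq_plus1[symmetric]] numeral_3_eq_3)
  qed
  have c: "set (cell r c) \<subseteq> set items" by (rule cell_items[OF assms(2,3)])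
  have it: "(Fl r c 42, Bd j (m + 1), Bd j (m + 2), 1, 1) \<in> set items" "(Fl r c 43, Bd j (m + 1), Fl r c 42, 1, 3) \<in> set items"
    "(Fl r c 44, Bd j (m + 2), Fl r c 42, 1, 3) \<in> set items"
    by (rule subsetD[OF c], simp add: cell_def j_def m_def)+
  note i42 = realizes_item[OF r it(1)] and i43 = realizes_item[OF r it(2)] and i44 = realizes_item[OF r it(3)]
  have j: "j < 4 * R" using assms(2) by (simp add: j_def)
  have "m + 2 < Mt" using assms(3) by (simp add: m_def Mt_def)
  then have bd: "p (Bd j (m + 1)) = a" "p (Bd j (m + 2)) = b" using body[OF assms(1) C j] by (auto simp: a_def b_def)
  define t where "t = Z j (m + 3)"
  have eq: "equi a b t" using equi_Z[of j "m + 1"] by (simp add: a_def b_def t_def numeral_3_eq_3)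
  have t': "a + b - t = Z j m" using Z_par[of j m] by (simp add: a_def b_def t_def algebra_simps)
  have V: "Fl r c i \<in> V" if "i < 42" for i
    by (rule fat_V[OF fat_cell[OF assms(2,3) that]])
  have ni: "p (Fl r c i) \<noteq> p (Fl r c 43)" "p (Fl r c i) \<noteq> p (Fl r c 44)" if "i < 42" for i
    using realizes_inj[OF r V[OF that] i43(3)] realizes_inj[OF r V[OF that] i44(3)] that by auto
  \<comment> \<open>Both faces at the common side are treated at once; \<open>u\<close> is the third
    vertex of the face that flag 42 points into.\<close>
  have *: False if e: "equi a b u" and f: "p (Fl r c 42) = apex 1 a b u"
    and g: "\<exists>i<42. p (Fl r c i) = apex 1 a u b" "\<exists>i<42. p (Fl r c i) = apex 1 b u a" for u
  proof -
    have "p (Fl r c 43) = apex 1 a u b \<or> p (Fl r c 43) = (277 * a + 323 * b + 37 * u) / 637"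
      by (rule unit_cases[OF e f]) (use i43(1,2) bd in simp_all)
    then have 43: "p (Fl r c 43) = (277 * a + 323 * b + 37 * u) / 637" using g(1) ni(1) by metis
    have "p (Fl r c 44) = apex 1 b u a \<or> p (Fl r c 44) = (277 * b + 323 * a + 37 * u) / 637"
      by (rule unit_cases[OF equi_perm(1)[OF e]]) (use i44(1,2) bd f apex_commute[of 1 a b u] in simp_all)
    then have 44: "p (Fl r c 44) = (277 * b + 323 * a + 37 * u) / 637" using g(2) ni(2) by metis
    have x: "\<exists>x. x \<in> closed_segment (p (Bd j (m + 1))) (p (Fl r c 43)) \<and> x \<in> closed_segment (p (Bd j (m + 2))) (p (Fl r c 44))"
      unfolding bd 43 44 using unit_cross[of a b u] unit_cross[of b a u]
      by (intro exI conjI; simp add: add.commute)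
    show False
      by (rule straight_crossing[OF str _ _ _ _ _ _ x])
        (use i43(4) i44(4) in \<open>simp_all add: insert_commute\<close>)
  qed
  have "p (Fl r c 42) = apex 1 a b t \<or> p (Fl r c 42) = apex 1 a b (a + b - t)"
    by (rule apex_cases[OF eq]) (use i42(1,2) bd in simp_all)
  then show False
  proof
    assume "p (Fl r c 42) = apex 1 a b t"
    then show False
      by (rule *[OF eq _ exI[of _ 7] exI[of _ 8]]) (simp_all add: P t_def)
  next
    assume f: "p (Fl r c 42) = apex 1 a b (a + b - t)"
    show False
      by (rule *[OF equi_reflect[OF eq] f exI[of _ 5] exI[of _ 6]])
        (simp_all add: P t' apex_commute[of "Suc 0" "Z j m"])
  qed
qed

text \<open>Opposite signals together force all four sensors, so at most one of north and south is
  present, and taps from both sides can meet only at a literal. A literal in a negative row releases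
  sensor 7, which the north signal would force again, and one in a positive row releases sensor 8,
  which the south signal would force again.\<close>

lemma cell_sound:
  assumes "normal p" "r < R" "c < C"
  shows "\<not> (st p r c 18 \<and> st p r c 29)"
    and "tap p r c True \<Longrightarrow> tap p r (c + 1) False \<Longrightarrow>
      (lit r c \<and> r < R0 \<and> \<not> st p r c 18) \<or> (lit r c \<and> R0 \<le> r \<and> \<not> st p r c 29)"
    and "r + 1 < R \<Longrightarrow> \<not> st p r c 18 \<Longrightarrow> st p (r + 1) c 29"
proof -
  note cc = cell_clash[OF assms] and uc = unit_clash[OF assms] and tc = toggle_clash[OF assms] and tp = tap_clash[OF assms]
  have N: "st p r c 5" "st p r c 7" if "st p r c 18" using that by (simp_all add: cc)
  have S: "st p r c 6" "\<not> st p r c 8" if "st p r c 29" using that by (simp_all add: cc)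
  have W: "st p r c 5" "st p r c 6" if "tap p r c True" using tp(1,2)[OF that] by (simp_all add: cc)
  have EN: "st p r c 7" if "tap p r (c + 1) False" "\<not> (lit r c \<and> r < R0)"
  proof -
    have "\<not> st p r c 22" using tp(3)[OF that(1)] by (simp add: cc)
    then show ?thesis using tc(1)[OF that(2)] by (simp add: cc)
  qed
  have ES: "\<not> st p r c 8" if "tap p r (c + 1) False" "\<not> (lit r c \<and> R0 \<le> r)"
  proof -
    have "\<not> st p r c 33" using tp(4)[OF that(1)] by (simp add: cc)
    then show ?thesis using tc(2)[OF that(2)] by (simp add: cc)
  qed
  show "\<not> (st p r c 18 \<and> st p r c 29)" using N S uc by blast
  show "tap p r c True \<Longrightarrow> tap p r (c + 1) False \<Longrightarrow>
      (lit r c \<and> r < R0 \<and> \<not> st p r c 18) \<or> (lit r c \<and> R0 \<le> r \<and> \<not> st p r c 29)"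
    using N S W EN ES uc by (meson not_le)
  show "r + 1 < R \<Longrightarrow> \<not> st p r c 18 \<Longrightarrow> st p (r + 1) c 29"
    using tc(3) by (simp add: cc)
qed

text \<open>Twin flags have different positions, so among them both sides occur, and each end of the
  row sends a signal inwards. A tap between two columns points at least one way.\<close>

lemma row_taps:
  assumes "normal p" "r < R" "0 < C"
  shows "tap p r 0 True" "tap p r C False" "c < C \<Longrightarrow> tap p r c True \<or> tap p r c False"
proof -
  have e: "set (row_ends r) \<subseteq> set items" by (rule end_items[OF assms(2)])
  have f: "fat (En r 0) (4 * r + 1, 1, 8 * 0 + 3, 2)" "fat (En r 1) (4 * r + 1, 1, 8 * C + 3, 2)" "fat (En r 2) (4 * r + 1, 1, 8 * C + 3, 2)"
  proof -
    have "(En r 0, Bd (4 * r + 1) 3, Bd (4 * r + 1) 4, 2, 2) \<in> set (row_ends r)"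
      "(En r 1, Bd (4 * r + 1) (8 * C + 3), Bd (4 * r + 1) (8 * C + 4), 2, 2) \<in> set (row_ends r)"
      "(En r 2, Bd (4 * r + 1) (8 * C + 3), Bd (4 * r + 1) (8 * C + 4), 2, 2) \<in> set (row_ends r)"
      by (simp_all add: row_ends_def)
    note m = this[THEN subsetD[OF e]]
    show "fat (En r 0) (4 * r + 1, 1, 8 * 0 + 3, 2)" "fat (En r 1) (4 * r + 1, 1, 8 * C + 3, 2)" "fat (En r 2) (4 * r + 1, 1, 8 * C + 3, 2)"
      using m assms(2,3) by (simp_all add: fat_def Mt_def add.commute[of "8 * C"])
  qed
  have g: "fat (Fl r c 0) (4 * r + 1, 1, 8 * c + 3, 2)" if "c < C" for c
    using fat_cell[OF assms(2) that, of 0] by (simp only: place_0)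
  note fc = fpos_cases[OF assms(1,3)] and fu = fpos_unique[OF assms(1)]
  show "tap p r 0 True"
    using fc[OF f(1)] fc[OF g[OF assms(3)]] fu[OF f(1) g[OF assms(3)]] f(1) g[OF assms(3)] unfolding tap_def by (metis vtx.distinct(5) vtx.inject(2))
  show "tap p r C False"
    using fc[OF f(2)] fc[OF f(3)] fu[OF f(2,3)] f(2,3) unfolding tap_def
    by (metis vtx.distinct(5) vtx.inject(3) one_neq_zero numeral_eq_one_iff num.distinct(1) n_not_Suc_n Suc_1)
  show "c < C \<Longrightarrow> tap p r c True \<or> tap p r c False"
    using fc[OF g] g unfolding tap_def by (metis vtx.inject(2))
qed

lemma sound:
  assumes "realizes p" "0 < C"
  shows "\<exists>X. (\<forall>r<R0. r < R \<longrightarrow> (\<exists>c<C. lit r c \<and> \<not> X c)) \<and> (\<forall>r. R0 \<le> r \<longrightarrow> r < R \<longrightarrow> (\<exists>c<C. lit r c \<and> X c))"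
proof -
  obtain p where p: "normal p" using normal_exists[OF assms] by blast
  \<comment> \<open>The taps start with a signal to the right and end with one to the left, so
    somewhere along the row the direction changes.\<close>
  have row: "\<exists>c<C. tap p r c True \<and> tap p r (c + 1) False" if "r < R" for r
  proof (rule ccontr)
    assume n: "\<not> ?thesis"
    have "c < C \<Longrightarrow> tap p r c True" for c
    proof (induction c)
      case 0
      show ?case by (rule row_taps(1)[OF p that assms(2)])
    next
      case (Suc c)
      then show ?case using n row_taps(3)[OF p that assms(2), of "Suc c"] by auto
    qed
    from this[of "C - 1"] n row_taps(2)[OF p that assms(2)] assms(2) show False by (metis Suc_diff_1 Suc_eq_plus1 diff_less zero_less_one)
  qed
  \<comment> \<open>A south signal excludes the north signal of its cell and thereby forces the
    south signal of the next row.\<close>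
  have down: "st p r c 29 \<Longrightarrow> r \<le> r' \<Longrightarrow> r' < R \<Longrightarrow> c < C \<Longrightarrow> st p r' c 29" for r r' c
  proof (induction r' )
    case (Suc r')
    show ?case
    proof (cases "r = Suc r'")
      case False
      then have "st p r' c 29" using Suc by simp
      then show ?thesis using cell_sound(1,3)[OF p, of r' c] Suc.prems by simp
    qed (use Suc in simp)
  qed simp
  \<comment> \<open>The variable is read at the first positive row. A true literal in an earlier row
    sends a south signal there, and one in a later row shows that none was there. Without positive
    rows every variable is false.\<close>
  define X where "X c \<longleftrightarrow> R0 < R \<and> \<not> st p R0 c 29" for c
  have "\<exists>c<C. lit r c \<and> \<not> X c" if r: "r < R0" "r < R" for r
  proof -
    obtain c where c: "c < C" "tap p r c True" "tap p r (c + 1) False" using row[OF r(2)] by blast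
    then have l: "lit r c" "\<not> st p r c 18" using cell_sound(2)[OF p r(2) c(1)] r(1) by auto
    have "\<not> X c"
    proof
      assume x: "X c"
      then have "st p (r + 1) c 29" using cell_sound(3)[OF p r(2) c(1)] l(2) r(1) unfolding X_def by simp
      then have "st p R0 c 29" using down[of "r + 1" c R0] x r(1) c(1) unfolding X_def by simp
      then show False using x unfolding X_def by simp
    qed
    with l c(1) show ?thesis by blast
  qed
  moreover have "\<exists>c<C. lit r c \<and> X c" if r: "R0 \<le> r" "r < R" for r
  proof -
    obtain c where c: "c < C" "tap p r c True" "tap p r (c + 1) False" using row[OF r(2)] by blast
    then have l: "lit r c" "\<not> st p r c 29" using cell_sound(2)[OF p r(2) c(1)] r(1) by auto
    then have "X c" using down[of R0 c r] r c(1) unfolding X_def by auto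
    with l c(1) show ?thesis by blast
  qed
  ultimately show ?thesis by (intro exI[of _ X]) blast
qed

end

section \<open>Subdivision of the plane\<close>

text \<open>The norm form of the triangular lattice is positive definite, as completing the square
  shows.\<close>

lemma bary_unique:
  fixes x y t :: complex
  assumes "equi x y t" "a + b + c = 1" "a' + b' + c' = 1"
    and "of_real a * x + of_real b * y + of_real c * t = of_real a' * x + of_real b' * y + of_real c' * t"
  shows "a = a'" "b = b'" "c = c'"
proof -
  have a: "a = 1 - b - c" "a' = 1 - b' - c'" using assms(2,3) by simp_all
  have "of_real (b - b') * (y - x) + of_real (c - c') * (t - x) = 0"
    using assms(4) unfolding a by (simp add: algebra_simps)
  then have "cmod (of_real (b - b') * (y - x) + of_real (c - c') * (t - x)) = 0" by (simp only: norm_zero)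
  then have 0: "(b - b')\<^sup>2 + (b - b') * (c - c') + (c - c')\<^sup>2 = 0"
    unfolding equi_norm[OF assms(1)] by simp
  have "(b - b')\<^sup>2 + (b - b') * (c - c') + (c - c')\<^sup>2 = ((b - b') + (c - c') / 2)\<^sup>2 + 3 / 4 * (c - c')\<^sup>2"
    by (simp add: power2_eq_square field_simps)
  with 0 have "((b - b') + (c - c') / 2)\<^sup>2 + 3 / 4 * (c - c')\<^sup>2 = 0" by simp
  then have "(c - c')\<^sup>2 = 0" "((b - b') + (c - c') / 2)\<^sup>2 = 0"
    using zero_le_power2[of "b - b' + (c - c') / 2"] zero_le_power2[of "c - c'"] by linarith+
  then show "c = c'" "b = b'" by auto
  then show "a = a'" using a by simp
qed

text \<open>Inside a strip \<open>u\<close> and \<open>q\<close> are constant along the two families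
  of slanted lattice lines, so the triangle, edge or vertex containing a point is read off from
  floors and integrality.\<close>

definition pt :: "int \<Rightarrow> real \<Rightarrow> real \<Rightarrow> complex" where
  "pt j u q = Complex (j * (1/2 + shf) + (u + q) / 2) (j * (gap + hgt) + (q - u) * hgt)"

text \<open>In the corridor \<open>w\<close> is the relative height and \<open>u\<close> is constant
  along the lines parallel to the short edges joining the strips.\<close>

definition ct :: "int \<Rightarrow> real \<Rightarrow> real \<Rightarrow> complex" where
  "ct j u w = Complex (j * (1/2 + shf) + 1/2 + u + shf * w) (j * (gap + hgt) + hgt + gap * w)"

text \<open>The last component distinguishes vertices, the two kinds of edges of a strip, faces, and, in the corridor
  between two strips, the lines parallel to its ends and the parallelograms between them.\<close>

definition loc :: "complex \<Rightarrow> int \<times> int \<times> nat" where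
  "loc z = (let j = \<lfloor>Im z / (gap + hgt)\<rfloor>; y = Im z - j * (gap + hgt); x = Re z - j * (1/2 + shf) in
     if y \<le> hgt then (let u = x - y / (2 * hgt); q = x + y / (2 * hgt) in
       (j, \<lfloor>u\<rfloor> + \<lfloor>q\<rfloor>, if u \<in> \<int> \<and> q \<in> \<int> then 0 else if u \<in> \<int> \<or> q \<in> \<int> then 1
          else if q = u \<or> q = u + 1 then 2 else 3))
     else (let u = x - 1/2 - shf * ((y - hgt) / gap) in (j, \<lfloor>u\<rfloor>, if u \<in> \<int> then 4 else 5)))"

lemma gap_pos: "0 < gap" using gap_bounds by simp

lemma floor_strip:
  assumes "0 \<le> y" "y < gap + hgt" shows "\<lfloor>(real_of_int j * (gap + hgt) + y) / (gap + hgt)\<rfloor> = j"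
proof -
  have "0 < gap + hgt" using gap_pos hgt_pos by simp
  then show ?thesis using assms by (simp add: floor_eq_iff field_simps)
qed

lemma loc_pt:
  assumes "u \<le> q" "q \<le> u + 1"
  shows "loc (pt j u q) = (j, \<lfloor>u\<rfloor> + \<lfloor>q\<rfloor>, if u \<in> \<int> \<and> q \<in> \<int> then 0 else if u \<in> \<int> \<or> q \<in> \<int> then 1
          else if q = u \<or> q = u + 1 then 2 else 3)"
proof -
  have y: "(q - u) * hgt \<le> hgt" "0 \<le> (q - u) * hgt" using assms hgt_pos by (simp_all add: mult_left_le_one_le)
  then have f: "\<lfloor>(real_of_int j * (gap + hgt) + (q - u) * hgt) / (gap + hgt)\<rfloor> = j"
    by (intro floor_strip) (use gap_pos in linarith)+
  have h: "(q - u) * hgt / (2 * hgt) = (q - u) / 2" using hgt_pos by simp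
  have uq: "(u + q) / 2 - (q - u) / 2 = u" "(u + q) / 2 + (q - u) / 2 = q" by (simp_all add: field_simps)
  show ?thesis unfolding loc_def pt_def complex.sel f Let_def add_diff_cancel_left' h uq using y(1) by simp
qed

lemma loc_ct:
  assumes "0 < w" "w < 1"
  shows "loc (ct j u w) = (j, \<lfloor>u\<rfloor>, if u \<in> \<int> then 4 else 5)"
proof -
  have y: "0 < gap * w" "gap * w < gap" using assms gap_pos by simp_all
  then have f: "\<lfloor>(real_of_int j * (gap + hgt) + (hgt + gap * w)) / (gap + hgt)\<rfloor> = j"
    by (intro floor_strip) (use hgt_pos in linarith)+
  have h: "(hgt + gap * w - hgt) / gap = w" using gap_pos by simp
  have x: "1/2 + u + shf * w - 1/2 - shf * w = u" by simp
  have "\<not> hgt + gap * w \<le> hgt" using y by simp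
  then show ?thesis unfolding loc_def ct_def complex.sel add.assoc f Let_def add_diff_cancel_left' h
    using x gap_pos by (simp add: add.assoc)
qed

lemma not_int: "of_int i < u \<Longrightarrow> u < of_int i + (1::real) \<Longrightarrow> \<lfloor>u\<rfloor> = i \<and> u \<notin> \<int>"
proof -
  assume u: "of_int i < u" "u < of_int i + 1"
  then have "\<lfloor>u\<rfloor> = i" by (simp add: floor_eq_iff)
  moreover have "u \<notin> \<int>"
  proof
    assume "u \<in> \<int>"
    then obtain k where "u = of_int k" by (auto elim: Ints_cases)
    then show False using u by simp
  qed
  ultimately show ?thesis by simp
qed

lemma pt_comb:
  "a + b + c = 1 \<Longrightarrow> of_real a * pt j u q + of_real b * pt j u' q' + of_real c * pt j u'' q'' =
     pt j (a * u + b * u' + c * u'') (a * q + b * q' + c * q'')"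
proof -
  assume "a + b + c = 1"
  then have a: "a = 1 - b - c" by simp
  show ?thesis unfolding pt_def a by (simp add: complex_eq_iff algebra_simps add_divide_distrib diff_divide_distrib)
qed

context layout
begin

lemma Z_pt: "Z j (2 * i) = pt (int j) (real i) (real i)" "Z j (2 * i + 1) = pt (int j) (real i) (real i + 1)"
  by (simp_all add: Z_def pt_def complex_eq_iff add_divide_distrib)

lemma loc_vertex: "loc (Z j m) = (int j, int m, 0)"
proof (cases "even m")
  case True
  then obtain i where m: "m = 2 * i" by (elim evenE)
  show ?thesis unfolding m Z_pt by (subst loc_pt) auto
next
  case False
  then obtain i where m: "m = 2 * i + 1" by (elim oddE)
  have "real i + 1 \<in> \<int>" by (metis Ints_1 Ints_add Ints_of_nat)
  then show ?thesis unfolding m Z_pt by (subst loc_pt) auto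
qed

lemma loc_face:
  assumes "a + b + c = 1" "0 < a" "0 < b" "0 < c"
  shows "loc (of_real a * Z j m + of_real b * Z j (m + 1) + of_real c * Z j (m + 2)) = (int j, int m, 3)"
proof (cases "even m")
  case True
  then obtain i where m: "m = 2 * i" by (elim evenE)
  have m2: "m + 2 = 2 * (i + 1)" using m by simp
  have a: "a = 1 - b - c" using assms(1) by simp
  have u: "a * real i + b * real i + c * real (i + 1) = real i + c"
    "a * real i + b * (real i + 1) + c * real (i + 1) = real i + b + c" unfolding a by (simp_all add: algebra_simps)
  have i: "\<lfloor>real i + c\<rfloor> = int i \<and> real i + c \<notin> \<int>" "\<lfloor>real i + b + c\<rfloor> = int i \<and> real i + b + c \<notin> \<int>"
    by (rule not_int; use assms in simp)+
  show ?thesis unfolding m2 unfolding m Z_pt pt_comb[OF assms(1)] u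
    by (subst loc_pt) (use assms i in \<open>auto simp: add.assoc\<close>)
next
  case False
  then obtain i where m: "m = 2 * i + 1" by (elim oddE)
  have m2: "m + 2 = 2 * (i + 1) + 1" "m + 1 = 2 * (i + 1)" using m by simp_all
  have a: "a = 1 - b - c" using assms(1) by simp
  have u: "a * real i + b * real (i + 1) + c * real (i + 1) = real i + b + c"
    "a * (real i + 1) + b * real (i + 1) + c * (real (i + 1) + 1) = real i + 1 + c" unfolding a by (simp_all add: algebra_simps)
  have i: "\<lfloor>real i + b + c\<rfloor> = int i \<and> real i + b + c \<notin> \<int>"
    "\<lfloor>real i + 1 + c\<rfloor> = int i + 1 \<and> real i + 1 + c \<notin> \<int>"
    by (rule not_int; use assms in simp)+
  show ?thesis unfolding m2 unfolding m Z_pt pt_comb[OF assms(1)] u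
    by (subst loc_pt) (use assms i in auto)
qed

lemma loc_edge1:
  assumes "a + b = 1" "0 < a" "0 < b"
  shows "loc (of_real a * Z j m + of_real b * Z j (m + 1)) = (int j, int m, 1)"
proof -
  have c: "a + b + 0 = 1" using assms by simp
  have a: "a = 1 - b" using assms(1) by simp
  have p: "of_real a * pt j u q + of_real b * pt j u' q' = pt j (a * u + b * u') (a * q + b * q')" for j u q u' q'
    using pt_comb[OF c, of j u q u' q' 0 0] by simp
  show ?thesis
  proof (cases "even m")
    case True
    then obtain i where m: "m = 2 * i" by (elim evenE)
    have u: "a * real i + b * real i = real i" "a * real i + b * (real i + 1) = real i + b"
      unfolding a by (simp_all add: algebra_simps)
    have "\<lfloor>real i + b\<rfloor> = int i \<and> real i + b \<notin> \<int>" by (rule not_int; use assms in simp)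
    then show ?thesis unfolding m Z_pt p u by (subst loc_pt) (use assms in auto)
  next
    case False
    then obtain i where m: "m = 2 * i + 1" by (elim oddE)
    have m1: "m + 1 = 2 * (i + 1)" using m by simp
    have u: "a * real i + b * real (i + 1) = real i + b" "a * (real i + 1) + b * real (i + 1) = real (i + 1)"
      unfolding a by (simp_all add: algebra_simps)
    have "\<lfloor>real i + b\<rfloor> = int i \<and> real i + b \<notin> \<int>" by (rule not_int; use assms in simp)
    then show ?thesis unfolding m1 unfolding m Z_pt p u using assms
      by (subst loc_pt) (auto simp del: of_nat_add of_nat_Suc)
  qed
qed

lemma loc_edge2:
  assumes "a + b = 1" "0 < a" "0 < b"
  shows "loc (of_real a * Z j m + of_real b * Z j (m + 2)) = (int j, int m, 2)"
proof -
  have c: "a + b + 0 = 1" using assms by simp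
  have a: "a = 1 - b" using assms(1) by simp
  have p: "of_real a * pt j u q + of_real b * pt j u' q' = pt j (a * u + b * u') (a * q + b * q')" for j u q u' q'
    using pt_comb[OF c, of j u q u' q' 0 0] by simp
  show ?thesis
  proof (cases "even m")
    case True
    then obtain i where m: "m = 2 * i" by (elim evenE)
    have m2: "m + 2 = 2 * (i + 1)" using m by simp
    have u: "a * real i + b * real (i + 1) = real i + b"
      unfolding a by (simp_all add: algebra_simps)
    have "\<lfloor>real i + b\<rfloor> = int i \<and> real i + b \<notin> \<int>" by (rule not_int; use assms in simp)
    then show ?thesis unfolding m2 unfolding m Z_pt p u by (subst loc_pt) (use assms in auto)
  next
    case False
    then obtain i where m: "m = 2 * i + 1" by (elim oddE)
    have m2: "m + 2 = 2 * (i + 1) + 1" using m by simp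
    have u: "a * real i + b * real (i + 1) = real i + b" "a * (real i + 1) + b * (real (i + 1) + 1) = real i + b + 1"
      unfolding a by (simp_all add: algebra_simps)
    have i: "\<lfloor>real i + b\<rfloor> = int i \<and> real i + b \<notin> \<int>" "\<lfloor>real i + b + 1\<rfloor> = int i + 1 \<and> real i + b + 1 \<notin> \<int>"
      by (rule not_int; use assms in simp)+
    show ?thesis unfolding m2 unfolding m Z_pt p u by (subst loc_pt) (use assms i in auto)
  qed
qed

lemma corridor_bounds: "0 < hgt / gap" "5 / 11 * (hgt / gap) < 1" "0 < shf * (hgt / gap)" "shf * (hgt / gap) < 1/2"
proof -
  have "hgt / gap < 7 / 4" using gap_bounds hgt_bounds by (simp add: divide_less_eq)
  moreover have "0 < hgt / gap" using gap_pos hgt_pos by simp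
  ultimately show "0 < hgt / gap" "5 / 11 * (hgt / gap) < 1" "0 < shf * (hgt / gap)" "shf * (hgt / gap) < 1/2"
    unfolding shf_def by linarith+
qed

text \<open>No flag reaches further than 5/11 of the height of a strip. This keeps it below the
  opposite strip, and the slant of the corridor over that distance is small enough to keep it in one
  parallelogram.\<close>

lemma loc_corridor:
  assumes "a + b + c = 1" "0 < a" "0 < b" "0 < c" "c \<le> 5/11"
  shows "loc (of_real a * Z j m + of_real b * Z j (m + 2) + of_real c * (Z j m + Z j (m + 2) - Z j (m + 1))) =
     (if odd m then int j else int j - 1, int (m div 2), 5)"
proof -
  define w where "w = c * (hgt / gap)"
  define s where "s = c * (shf * (hgt / gap))"
  have w: "0 < w" "w < 1"
  proof -
    show "0 < w" using assms(4) corridor_bounds(1) unfolding w_def by (rule mult_pos_pos)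
    have "w \<le> 5/11 * (hgt / gap)" unfolding w_def using assms(5) corridor_bounds(1) by (intro mult_right_mono) simp_all
    then show "w < 1" using corridor_bounds(2) by simp
  qed
  have s: "0 < s" "s < c / 2"
    using mult_pos_pos[OF assms(4) corridor_bounds(3)] mult_strict_left_mono[OF corridor_bounds(4) assms(4)] unfolding s_def by simp_all
  have sw: "shf * w = s" "gap * w = c * hgt" using gap_pos by (simp_all add: s_def w_def)
  have a: "a = 1 - b - c" using assms(1) by simp
  show ?thesis
  proof (cases "even m")
    case True
    then obtain i where m: "m = 2 * i" by (elim evenE)
    have "of_real a * Z j m + of_real b * Z j (m + 2) + of_real c * (Z j m + Z j (m + 2) - Z j (m + 1)) =
        ct (int j - 1) (real i + b + c / 2 + s) (1 - w)"
      unfolding ct_def Z_def a m by (simp add: complex_eq_iff right_diff_distrib sw) (simp add: field_simps)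
    moreover have "\<lfloor>real i + b + c / 2 + s\<rfloor> = int i \<and> real i + b + c / 2 + s \<notin> \<int>"
      by (rule not_int; use assms s in simp)
    ultimately show ?thesis using w by (simp only: loc_ct) (simp add: m loc_ct)
  next
    case False
    then obtain i where m: "m = 2 * i + 1" by (elim oddE)
    have "of_real a * Z j m + of_real b * Z j (m + 2) + of_real c * (Z j m + Z j (m + 2) - Z j (m + 1)) =
        ct (int j) (real i + b + c / 2 - s) w"
      unfolding ct_def Z_def a m by (simp add: complex_eq_iff sw) (simp add: field_simps)
    moreover have "\<lfloor>real i + b + c / 2 - s\<rfloor> = int i \<and> real i + b + c / 2 - s \<notin> \<int>"
      by (rule not_int; use assms s in simp)
    ultimately show ?thesis using w by (simp only: loc_ct) (simp add: m loc_ct)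
  qed
qed

lemma loc_spine:
  assumes "a + b = 1" "0 < a" "0 < b"
  shows "loc (of_real a * Z j 1 + of_real b * Z (j + 1) 0) = (int j, 0, 4)"
    "loc (of_real a * Z j 3 + of_real b * Z (j + 1) 0) = (int j, 0, 5)"
    "loc (of_real a * Z j 3 + of_real b * Z (j + 1) 2) = (int j, 1, 4)"
proof -
  have a: "a = 1 - b" using assms(1) by simp
  have b: "0 < b" "b < 1" using assms by simp_all
  have e: "of_real a * Z j 1 + of_real b * Z (j + 1) 0 = ct (int j) 0 b"
    "of_real a * Z j 3 + of_real b * Z (j + 1) 0 = ct (int j) (1 - b) b"
    "of_real a * Z j 3 + of_real b * Z (j + 1) 2 = ct (int j) 1 b"
    unfolding ct_def Z_def a by (simp_all add: complex_eq_iff algebra_simps)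
  have "\<lfloor>1 - b\<rfloor> = 0 \<and> 1 - b \<notin> \<int>" using not_int[of 0 "1 - b"] b by simp
  then show "loc (of_real a * Z j 1 + of_real b * Z (j + 1) 0) = (int j, 0, 4)"
    "loc (of_real a * Z j 3 + of_real b * Z (j + 1) 0) = (int j, 0, 5)"
    "loc (of_real a * Z j 3 + of_real b * Z (j + 1) 2) = (int j, 1, 4)"
    unfolding e loc_ct[OF b] by simp_all
qed

end

section \<open>The states of the flags in a drawing\<close>

text \<open>The state of a cell depends on its position relative to the cell holding the true literal of its row
  (\<open>ph\<close> is 0 before, 1 at, 2 behind this cell and 3 outside the row) and on the negated variable \<open>up\<close>.\<close>

definition states :: "nat \<Rightarrow> bool \<Rightarrow> bool list" where
  "states ph up = (let ne = up \<and> ph < 2; se = \<not> up \<and> ph < 2; nw = up \<and> \<not> ph < 2; sw = \<not> up \<and> \<not> ph < 2; a = (ph = 0) in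
     [ph < 2, \<not> sw, nw, sw, \<not> nw, \<not> nw, \<not> sw, \<not> ne, se, \<not> se, ne \<and> a, ne \<and> a, se \<and> a, \<not> nw, \<not> nw, \<not> nw, nw, nw,
      \<not> up, \<not> ne, ne, ne \<and> a, ne \<and> a, \<not> (ne \<and> a), \<not> sw, \<not> sw, \<not> sw, sw, sw, up, \<not> se, se, se \<and> a, se \<and> a, \<not> (se \<and> a),
      up, up, up, up, up, up, \<not> up])"

definition wstate :: "nat \<Rightarrow> bool \<Rightarrow> nat \<Rightarrow> nat \<Rightarrow> bool" where
  "wstate ph up tg i \<longleftrightarrow> (if i = 42 then ph < 2 else (i = 21 \<and> tg = 1) \<or> (i = 32 \<and> tg = 2) \<or> states ph up ! i)"

definition wentry :: "nat \<Rightarrow> nat \<Rightarrow> nat \<times> nat \<times> nat \<times> nat" where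
  "wentry tg i = (if i = 21 \<and> tg = 1 then (2,1,9,1) else if i = 32 \<and> tg = 2 then (0,1,4,1)
     else if i = 42 then (1,1,7,1) else base_tab ! i)"

text \<open>A tap is counted in the cell into which it points: as index 0 with state true, or as
  index 45 of the cell to its left with state false. In phase 3 the cell is an imaginary one beyond
  an end of the row and contains at most end flags.\<close>

definition occs :: "nat \<Rightarrow> bool \<Rightarrow> nat \<Rightarrow> (nat \<times> (nat \<times> nat \<times> nat \<times> nat) \<times> bool) list" where
  "occs ph up tg = (if ph = 3 then [] else map (\<lambda>i. (i, wentry tg i, wstate ph up tg i)) [1..<43])
     @ (if ph = 2 then [] else [(0, (1,1,3,2), True)]) @ (if ph = 0 then [] else [(45, (1,1,11,2), False)])"

text \<open>The first coordinate is shifted by one, so that the corridor below strip 0 of the row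
  gets number 0.\<close>

definition lcell :: "nat \<times> nat \<times> nat \<times> nat \<Rightarrow> bool \<Rightarrow> nat \<times> nat \<times> nat" where
  "lcell e b = (case e of (s, k, m, ty) \<Rightarrow> if k = 1 then (Suc s, if b then m else m - 1, 3)
     else if b then (Suc s, m, 3) else (if odd m then Suc s else s, m div 2, 5))"

text \<open>In every strip a cell owns a window of 8 faces, and in every corridor a window of 4
  parallelograms, so windows of neighbouring columns are disjoint. The corridors below and above the
  row are shared with adjacent rows; which of them is used depends on \<open>up\<close>.\<close>

definition local_ok :: "bool \<Rightarrow> nat \<times> (nat \<times> nat \<times> nat \<times> nat) \<times> bool \<Rightarrow> bool" where
  "local_ok up = (\<lambda>(i, e, b). case (e, lcell e b) of ((s, k, m, ty), (x, y, z)) \<Rightarrow>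
     (if z = 3 then 1 \<le> x \<and> x < 5 \<and> [4,3,2,4] ! (x - 1) \<le> y \<and> y < [4,3,2,4] ! (x - 1) + 8
      else z = 5 \<and> x < 5 \<and> [1,2,1,2,1] ! x \<le> y \<and> y < [1,2,1,2,1] ! x + 4 \<and> (x = 0 \<longrightarrow> \<not> up) \<and> (x = 4 \<longrightarrow> up)) \<and>
     (k = 1 \<or> k = 2) \<and> (ty = 1 \<or> ty = 2) \<and> s < 4 \<and> 0 < m \<and> m + k < 14)"

text \<open>In the face used by the unit one sensor is turned away, making room for the outer
  vertex. This is the other sensor of that face, which still points in beside the unit.\<close>

definition sensor :: "nat \<Rightarrow> bool \<Rightarrow> nat" where
  "sensor ph up = (if ph < 2 then if up then 8 else 7 else if up then 6 else 5)"

text \<open>\<open>k + 2 * m\<close> identifies a side among the three sides of a face. Two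
  occurrences may share a face only as short flags on different sides, and the unit only with its
  remaining sensor.\<close>

definition pair_ok :: "nat \<Rightarrow> bool \<Rightarrow> nat \<times> (nat \<times> nat \<times> nat \<times> nat) \<times> bool \<Rightarrow>
    nat \<times> (nat \<times> nat \<times> nat \<times> nat) \<times> bool \<Rightarrow> bool" where
  "pair_ok ph up = (\<lambda>(i, e, b) (i', e', b'). lcell e b = lcell e' b' \<longrightarrow>
     snd (snd (lcell e b)) = 3 \<and> snd (snd (snd e)) = 1 \<and> snd (snd (snd e')) = 1 \<and> fst (snd e) + 2 * fst (snd (snd e)) \<noteq> fst (snd e') + 2 * fst (snd (snd e')) \<and>
     i \<noteq> 42 \<and> (i' = 42 \<longrightarrow> i = sensor ph up))"

fun pairs_ok :: "nat \<Rightarrow> bool \<Rightarrow> (nat \<times> (nat \<times> nat \<times> nat \<times> nat) \<times> bool) list \<Rightarrow> bool" where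
  "pairs_ok ph up [] = True"
| "pairs_ok ph up (x # xs) = (list_all (pair_ok ph up x) xs \<and> pairs_ok ph up xs)"

definition check :: "nat \<Rightarrow> bool \<Rightarrow> nat \<Rightarrow> bool" where
  "check ph up tg = (list_all (local_ok up) (occs ph up tg) \<and> pairs_ok ph up (occs ph up tg))"

text \<open>Phase, value of the variable and kind of literal leave finitely many types of cells, so
  disjointness within a cell is decided by evaluation.\<close>

lemma check_before: "check 0 up 0" "check 0 up 1" "check 0 up 2"
proof -
  have "check 0 True 0 \<and> check 0 True 1 \<and> check 0 True 2 \<and> check 0 False 0 \<and> check 0 False 1 \<and> check 0 False 2"
    by code_simp
  then show "check 0 up 0" "check 0 up 1" "check 0 up 2" by (cases up; simp)+
qed

text \<open>Where the horizontal signals meet, a drawing is claimed only for a true literal: a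
  negative one over a false variable or a positive one over a true variable.\<close>

lemma check_at: "check 1 True 1" "check 1 False 2"
proof -
  have "check 1 True 1 \<and> check 1 False 2" by code_simp
  then show "check 1 True 1" "check 1 False 2" by simp_all
qed

lemma check_behind: "check 2 up 0" "check 2 up 1" "check 2 up 2" "check 3 up 0"
proof -
  have "check 2 True 0 \<and> check 2 True 1 \<and> check 2 True 2 \<and> check 2 False 0 \<and> check 2 False 1 \<and> check 2 False 2 \<and>
      check 3 True 0 \<and> check 3 False 0"
    by code_simp
  then show "check 2 up 0" "check 2 up 1" "check 2 up 2" "check 3 up 0" by (cases up; simp)+
qed

lemma pairs_okD:
  "pairs_ok ph up xs \<Longrightarrow> x \<in> set xs \<Longrightarrow> y \<in> set xs \<Longrightarrow> x \<noteq> y \<Longrightarrow> pair_ok ph up x y \<or> pair_ok ph up y x"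
  by (induction xs) (auto simp: list_all_iff)

definition acell :: "nat \<Rightarrow> int \<Rightarrow> nat \<times> nat \<times> nat \<times> nat \<Rightarrow> bool \<Rightarrow> int \<times> int \<times> nat" where
  "acell r c e b = (case lcell e b of (x, y, z) \<Rightarrow> (4 * int r + int x - 1, (if z = 3 then 8 * c else 4 * c) + int y, z))"

text \<open>The corridor between two rows belongs to both. The lower row uses it only if the
  variable is false, the upper row only if it is true, and the value is the same in the whole
  column.\<close>

lemma acell_inject:
  assumes "acell r c e b = acell r' c' e' b'" "local_ok up (i, e, b)" "local_ok up' (i', e', b')" "c = c' \<Longrightarrow> up = up'"
  shows "r = r' \<and> c = c' \<and> lcell e b = lcell e' b'"
proof -
  obtain x y z x' y' z' where l: "lcell e b = (x, y, z)" "lcell e' b' = (x', y', z')" by (metis prod_cases3)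
  have a: "4 * int r + int x = 4 * int r' + int x'" "z' = z"
    "(if z = 3 then 8 * c else 4 * c) + int y = (if z = 3 then 8 * c' else 4 * c') + int y'"
    using assms(1) by (auto simp: acell_def l)
  have b: "if z = 3 then 1 \<le> x \<and> x < 5 \<and> [4,3,2,4] ! (x - 1) \<le> y \<and> y < [4,3,2,4] ! (x - 1) + 8
      else z = 5 \<and> x < 5 \<and> [1,2,1,2,1] ! x \<le> y \<and> y < [1,2,1,2,1] ! x + 4 \<and> (x = 0 \<longrightarrow> \<not> up) \<and> (x = 4 \<longrightarrow> up)"
    "if z = 3 then 1 \<le> x' \<and> x' < 5 \<and> [4,3,2,4] ! (x' - 1) \<le> y' \<and> y' < [4,3,2,4] ! (x' - 1) + 8
      else z = 5 \<and> x' < 5 \<and> [1,2,1,2,1] ! x' \<le> y' \<and> y' < [1,2,1,2,1] ! x' + 4 \<and> (x' = 0 \<longrightarrow> \<not> up') \<and> (x' = 4 \<longrightarrow> up')"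
    using assms(2,3) l a(2) by (auto simp: local_ok_def split: prod.splits)
  show ?thesis
  proof (cases "z = 3")
    case True
    then have "1 \<le> x" "x < 5" "1 \<le> x'" "x' < 5" using b by simp_all
    then have x: "r = r'" "x = x'" using a(1) by presburger+
    then have "c = c'" using a(3) b True by simp
    with x a(2,3) True show ?thesis by (simp add: l)
  next
    case False
    then have z: "x < 5" "x' < 5" "[1,2,1,2,1] ! x \<le> y" "y < [1,2,1,2,1] ! x + 4"
      "[1,2,1,2,1] ! x' \<le> y'" "y' < [1,2,1,2,1] ! x' + 4"
      "x = 0 \<longrightarrow> \<not> up" "x = 4 \<longrightarrow> up" "x' = 0 \<longrightarrow> \<not> up'" "x' = 4 \<longrightarrow> up'" using b by simp_all
    have "(r = r' \<and> x = x') \<or> (x = 0 \<and> x' = 4) \<or> (x = 4 \<and> x' = 0)" using a(1) z(1,2) by presburger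
    then show ?thesis
    proof (elim disjE conjE)
      assume x: "r = r'" "x = x'"
      then have "c = c'" using a(3) z False by simp
      with x a(2,3) False show ?thesis by (simp add: l)
    next
      assume x: "x = 0" "x' = 4"
      then have "c = c'" using a(3) z(3-6) False by simp
      then show ?thesis using z(7-10) x assms(4) by simp
    next
      assume x: "x = 4" "x' = 0"
      then have "c = c'" using a(3) z(3-6) False by simp
      then show ?thesis using z(7-10) x assms(4) by simp
    qed
  qed
qed

text \<open>\<open>cs r\<close> is the column of a true literal chosen in row \<open>r\<close>,
  where the two horizontal signals are made to meet.\<close>

locale drawing = layout +
  fixes X :: "nat \<Rightarrow> bool" and cs :: "nat \<Rightarrow> nat"
  assumes cs: "r < R \<Longrightarrow> cs r < C \<and> lit r (cs r) \<and> (X (cs r) \<longleftrightarrow> R0 \<le> r)"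
begin

definition phase :: "nat \<Rightarrow> int \<Rightarrow> nat" where
  "phase r c = (if c < 0 \<or> int C \<le> c then 3 else if c < int (cs r) then 0 else if c = int (cs r) then 1 else 2)"

definition up :: "int \<Rightarrow> bool" where "up c \<longleftrightarrow> \<not> X (nat c)"

definition tg :: "nat \<Rightarrow> int \<Rightarrow> nat" where
  "tg r c = (if phase r c = 3 then 0 else if lit r (nat c) then if r < R0 then 1 else 2 else 0)"

fun dat :: "vtx \<Rightarrow> nat \<times> int \<times> nat \<times> (nat \<times> nat \<times> nat \<times> nat) \<times> bool" where
  "dat (Fl r c i) = (if i = 0 then if cs r < c then (r, int c - 1, 45, (1,1,11,2), False) else (r, int c, 0, (1,1,3,2), True)
     else (r, int c, i, wentry (tg r c) i, wstate (phase r c) (up c) (tg r c) i))"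
| "dat (En r e) = (if e = 2 then (r, int C, 0, (1,1,3,2), True)
     else (r, if e = 0 then - 1 else int C - 1, 45, (1,1,11,2), False))"
| "dat (Bd j m) = (0, 0, 0, (0,0,0,0), True)"

definition FV :: "vtx set" where
  "FV = {Fl r c i |r c i. r < R \<and> c < C \<and> i < 43} \<union> {En r e |r e. r < R \<and> e < 3}"

lemma tg_entry: "c < C \<Longrightarrow> i < 42 \<Longrightarrow> wentry (tg r (int c)) i = entry r c i"
  by (auto simp: wentry_def tg_def entry_def phase_def)

lemma check_phase: "r < R \<Longrightarrow> check (phase r c) (up c) (tg r c)"
proof -
  assume r: "r < R"
  have t: "tg r c = 0 \<or> tg r c = 1 \<or> tg r c = 2" by (simp add: tg_def)
  have "phase r c = 3 \<or> phase r c = 0 \<or> phase r c = 2 \<or> phase r c = 1" by (simp add: phase_def)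
  then consider "phase r c = 3" | "phase r c = 0" | "phase r c = 2" | "phase r c = 1" by (elim disjE)
  then show ?thesis
  proof cases
    case 1
    then show ?thesis using check_behind(4) by (simp add: tg_def)
  next
    case 2
    show ?thesis unfolding 2 using t check_before by metis
  next
    case 3
    show ?thesis unfolding 3 using t check_behind by metis
  next
    case 4
    then have "c = int (cs r)" by (auto simp: phase_def split: if_splits)
    then have "nat c = cs r" by simp
    then have "tg r c = (if up c then 1 else 2)" using cs[OF r] 4 by (auto simp: tg_def up_def)
    then show ?thesis unfolding 4 using check_at by (cases "up c") simp_all
  qed
qed

lemma dat_occ:
  assumes "v \<in> FV" "dat v = (r, c, i, e, b)"
  shows "r < R" "(i, e, b) \<in> set (occs (phase r c) (up c) (tg r c))" "i = 42 \<longleftrightarrow> (\<exists>r c. v = Fl r c 42)"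
proof -
  have c: "r < R \<Longrightarrow> cs r < C" for r using cs by blast
  have "r < R \<and> (i, e, b) \<in> set (occs (phase r c) (up c) (tg r c)) \<and> (i = 42 \<longleftrightarrow> (\<exists>r c. v = Fl r c 42))"
    using assms(1) unfolding FV_def
  proof (elim UnE CollectE exE conjE)
    fix r' c' i' assume v: "v = Fl r' c' i'" "r' < R" "c' < C" "i' < 43"
    show ?thesis
    proof (cases "i' = 0")
      case True
      then show ?thesis using assms(2) v c[OF v(2)] by (auto simp: occs_def phase_def split: if_splits)
    next
      case False
      then have "i' \<in> set [1..<43]" using v(4) by simp
      moreover have "phase r' (int c') \<noteq> 3" using v(3) by (simp add: phase_def)
      ultimately show ?thesis using assms(2) v False unfolding occs_def by (auto simp del: upt.simps upt_rec_numeral)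
    qed
  next
    fix r' e' assume v: "v = En r' e'" "r' < R" "e' < 3"
    show ?thesis using assms(2) v c[OF v(2)] by (auto simp: occs_def phase_def split: if_splits)
  qed
  then show "r < R" "(i, e, b) \<in> set (occs (phase r c) (up c) (tg r c))" "i = 42 \<longleftrightarrow> (\<exists>r c. v = Fl r c 42)" by blast+
qed

lemma dat_inj: "v \<in> FV \<Longrightarrow> v' \<in> FV \<Longrightarrow> dat v = dat v' \<Longrightarrow> v = v'"
  using cs by (auto simp: FV_def split: if_splits) (fastforce simp: less_Suc_eq numeral_3_eq_3 numeral_2_eq_2)+

lemma dat_ok:
  assumes "v \<in> FV" "dat v = (r, c, i, e, b)" shows "local_ok (up c) (i, e, b)"
  using check_phase[OF dat_occ(1)[OF assms]] dat_occ(2)[OF assms] unfolding check_def list_all_iff by blast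

lemma same_cell:
  assumes "v \<in> FV" "v' \<in> FV" "v \<noteq> v'" "dat v = (r, c, i, (s, k, m, ty), b)" "dat v' = (r', c', i', (s', k', m', ty'), b')"
    and "acell r c (s, k, m, ty) b = acell r' c' (s', k', m', ty') b'"
  shows "r = r'" "c = c'" "snd (snd (lcell (s, k, m, ty) b)) = 3" "lcell (s, k, m, ty) b = lcell (s', k', m', ty') b'"
    "ty = 1" "ty' = 1" "k + 2 * m \<noteq> k' + 2 * m'"
    "(i \<noteq> 42 \<and> i' \<noteq> 42) \<or> (i = 42 \<and> i' = sensor (phase r c) (up c)) \<or> (i' = 42 \<and> i = sensor (phase r c) (up c))"
proof -
  note o = dat_occ[OF assms(1,4)] and o' = dat_occ[OF assms(2,5)]
  have eq: "r = r' \<and> c = c' \<and> lcell (s, k, m, ty) b = lcell (s', k', m', ty') b'"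
    by (rule acell_inject[OF assms(6) dat_ok[OF assms(1,4)] dat_ok[OF assms(2,5)]]) simp
  have "dat v \<noteq> dat v'" using dat_inj assms(1-3) by blast
  then have ne: "(i, (s, k, m, ty), b) \<noteq> (i', (s', k', m', ty'), b')" using assms(4,5) eq by auto
  have "pairs_ok (phase r c) (up c) (occs (phase r c) (up c) (tg r c))"
    using check_phase[OF o(1)] unfolding check_def by blast
  from pairs_okD[OF this o(2) _ ne] o'(2) eq
  have p: "pair_ok (phase r c) (up c) (i, (s, k, m, ty), b) (i', (s', k', m', ty'), b') \<or>
      pair_ok (phase r c) (up c) (i', (s', k', m', ty'), b') (i, (s, k, m, ty), b)" by simp
  from p eq have "snd (snd (lcell (s, k, m, ty) b)) = 3 \<and> ty = 1 \<and> ty' = 1 \<and> k + 2 * m \<noteq> k' + 2 * m' \<and>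
    ((i \<noteq> 42 \<and> i' \<noteq> 42) \<or> (i = 42 \<and> i' = sensor (phase r c) (up c)) \<or> (i' = 42 \<and> i = sensor (phase r c) (up c)))"
    unfolding pair_ok_def by auto
  with eq show "r = r'" "c = c'" "snd (snd (lcell (s, k, m, ty) b)) = 3" "lcell (s, k, m, ty) b = lcell (s', k', m', ty') b'"
    "ty = 1" "ty' = 1" "k + 2 * m \<noteq> k' + 2 * m'"
    "(i \<noteq> 42 \<and> i' \<noteq> 42) \<or> (i = 42 \<and> i' = sensor (phase r c) (up c)) \<or> (i' = 42 \<and> i = sensor (phase r c) (up c))"
    by blast+
qed

end

section \<open>Features of a drawing\<close>

definition bar :: "complex \<Rightarrow> complex \<Rightarrow> complex \<Rightarrow> (real \<Rightarrow> real \<Rightarrow> real \<Rightarrow> bool) \<Rightarrow> complex set" where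
  "bar x y t Q = {P. \<exists>a b c. a + b + c = 1 \<and> P = of_real a * x + of_real b * y + of_real c * t \<and> Q a b c}"

lemma barI: "a + b + c = 1 \<Longrightarrow> Q a b c \<Longrightarrow> of_real a * x + of_real b * y + of_real c * t \<in> bar x y t Q"
  unfolding bar_def by blast

lemma bar_mono: "P \<in> bar x y t Q \<Longrightarrow> (\<And>a b c. a + b + c = 1 \<Longrightarrow> Q a b c \<Longrightarrow> Q' a b c) \<Longrightarrow> P \<in> bar x y t Q'"
  unfolding bar_def by blast

lemma bar_perm:
  "P \<in> bar x y t Q \<Longrightarrow> P \<in> bar y x t (\<lambda>a b c. Q b a c)"
  "P \<in> bar x y t Q \<Longrightarrow> P \<in> bar x t y (\<lambda>a b c. Q a c b)"
proof -
  assume "P \<in> bar x y t Q"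
  then obtain a b c where *: "a + b + c = 1" "P = of_real a * x + of_real b * y + of_real c * t" "Q a b c"
    unfolding bar_def by blast
  show "P \<in> bar y x t (\<lambda>a b c. Q b a c)" unfolding bar_def
    by (rule CollectI, rule exI[of _ b], rule exI[of _ a], rule exI[of _ c]) (use * in \<open>simp add: algebra_simps\<close>)
  show "P \<in> bar x t y (\<lambda>a b c. Q a c b)" unfolding bar_def
    by (rule CollectI, rule exI[of _ a], rule exI[of _ c], rule exI[of _ b]) (use * in \<open>simp add: algebra_simps\<close>)
qed

lemma bar_disjoint:
  assumes "equi x y t" "\<And>a b c. a + b + c = 1 \<Longrightarrow> Q a b c \<Longrightarrow> Q' a b c \<Longrightarrow> False"
  shows "bar x y t Q \<inter> bar x y t Q' = {}"
proof (rule equals0I)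
  fix P assume "P \<in> bar x y t Q \<inter> bar x y t Q'"
  then obtain a b c a' b' c' where *: "a + b + c = 1" "P = of_real a * x + of_real b * y + of_real c * t" "Q a b c"
    "a' + b' + c' = 1" "P = of_real a' * x + of_real b' * y + of_real c' * t" "Q' a' b' c'"
    unfolding bar_def by blast
  then have "a = a'" "b = b'" "c = c'" using bary_unique[OF assms(1), of a b c a' b' c'] by metis+
  then show False using assms(2) * by blast
qed

lemma open_segment_bar:
  assumes "A = of_real a * x + of_real b * y + of_real c * t" "B = of_real a' * x + of_real b' * y + of_real c' * t"
    and "a + b + c = 1" "a' + b' + c' = 1"
    and "\<And>s. 0 < s \<Longrightarrow> s < 1 \<Longrightarrow> Q ((1 - s) * a + s * a') ((1 - s) * b + s * b') ((1 - s) * c + s * c')"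
  shows "open_segment A B \<subseteq> bar x y t Q"
proof
  fix P assume "P \<in> open_segment A B"
  then obtain s where s: "0 < s" "s < 1" "P = (1 - s) *\<^sub>R A + s *\<^sub>R B" by (auto simp: in_segment)
  have "(1 - s) * a + s * a' + ((1 - s) * b + s * b') + ((1 - s) * c + s * c') = (1 - s) * (a + b + c) + s * (a' + b' + c')"
    by (simp add: algebra_simps)
  then have 1: "(1 - s) * a + s * a' + ((1 - s) * b + s * b') + ((1 - s) * c + s * c') = 1" using assms(3,4) by simp
  have "P = of_real ((1 - s) * a + s * a') * x + of_real ((1 - s) * b + s * b') * y + of_real ((1 - s) * c + s * c') * t"
    unfolding s(3) assms(1,2) by (simp add: scaleR_conv_of_real algebra_simps)
  then show "P \<in> bar x y t Q" using barI[of _ _ _ Q, OF 1] assms(5)[OF s(1,2)] by simp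
qed

text \<open>The bound 5/11 is what the corridor can accommodate. For short flags the third
  coordinate is the smallest, so they stay in the part of the face nearest to their own
  side.\<close>

lemma apex_feature:
  assumes "ty = 1 \<or> ty = 2"
  shows "insert (apex ty x y t) (open_segment (apex ty x y t) x \<union> open_segment (apex ty x y t) y) \<subseteq>
    bar x y t (\<lambda>a b c. 0 < a \<and> 0 < b \<and> 0 < c \<and> c \<le> 5/11 \<and> (ty = 1 \<longrightarrow> c < a \<and> c < b))" (is "_ \<subseteq> bar x y t ?Q")
proof -
  define l where "l = (if ty = 1 then 5/13 else 3/11 :: real)"
  define m where "m = (if ty = 1 then 3/13 else 5/11 :: real)"
  have 1: "l + l + m = 1" using assms by (auto simp: l_def m_def)
  have A: "apex ty x y t = of_real l * x + of_real l * y + of_real m * t"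
    by (simp add: apex_def l_def m_def add_divide_distrib)
  have x: "x = of_real 1 * x + of_real 0 * y + of_real 0 * t" "y = of_real 0 * x + of_real 1 * y + of_real 0 * t" by simp_all
  have "apex ty x y t \<in> bar x y t ?Q" unfolding A by (rule barI[OF 1]) (simp add: l_def m_def)
  moreover have "open_segment (apex ty x y t) x \<subseteq> bar x y t ?Q"
    by (rule open_segment_bar[OF A x(1) 1]) (use assms in \<open>auto simp: l_def m_def field_simps\<close>)
  moreover have "open_segment (apex ty x y t) y \<subseteq> bar x y t ?Q"
    by (rule open_segment_bar[OF A x(2) 1]) (use assms in \<open>auto simp: l_def m_def field_simps\<close>)
  ultimately show ?thesis by blast
qed

lemma unit_dist:
  assumes "equi a b t"
  shows "dist ((277 * a + 323 * b + 37 * t) / 637) a = 7 / 13" "dist ((5 * a + 3 * b + 5 * t) / 13) a = 7 / 13"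
    "dist ((277 * a + 323 * b + 37 * t) / 637) (apex 1 a b t) = 2 / 13"
    "dist ((5 * a + 3 * b + 5 * t) / 13) (apex 1 a b t) = 2 / 13"
proof -
  show "dist ((277 * a + 323 * b + 37 * t) / 637) a = 7 / 13"
    by (rule equi_dist[OF assms, of _ _ "323/637" "37/637"]) (auto simp: field_simps power2_eq_square)
  show "dist ((5 * a + 3 * b + 5 * t) / 13) a = 7 / 13"
    by (rule equi_dist[OF assms, of _ _ "3/13" "5/13"]) (auto simp: field_simps power2_eq_square)
  show "dist ((5 * a + 3 * b + 5 * t) / 13) (apex 1 a b t) = 2 / 13"
    by (rule equi_dist[OF assms, of _ _ "-2/13" "2/13"]) (auto simp: apex_def field_simps power2_eq_square)
  show "dist ((277 * a + 323 * b + 37 * t) / 637) (apex 1 a b t) = 2 / 13"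
    by (rule equi_dist[OF assms, of _ _ "78/637" "-110/637"]) (auto simp: apex_def field_simps power2_eq_square)
qed

text \<open>A choice unit with its outer vertex \<open>G\<close> at \<open>a\<close> and its inner vertex \<open>H\<close> at \<open>b\<close>: the line
  \<open>3 \<beta> = 5 \<gamma>\<close> through \<open>a\<close> and \<open>F\<close> separates them.\<close>

lemma unit_separation:
  fixes a b t :: complex
  assumes e: "equi a b t" and F: "F = apex 1 a b t" and G: "G = (5 * a + 3 * b + 5 * t) / 13"
    and H: "H = (277 * b + 323 * a + 37 * t) / 637"
  shows "insert F (open_segment F a \<union> open_segment F b) \<union> insert G (open_segment G a \<union> open_segment G F) \<union>
      insert H (open_segment H b \<union> open_segment H F) \<subseteq> bar a b t (\<lambda>x y z. 0 < x \<and> 0 < y \<and> 0 < z \<and> z \<le> 5/11 \<and> z \<le> x)"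
    and "open_segment F a \<inter> open_segment H b = {}" "open_segment F b \<inter> open_segment G a = {}"
    "open_segment G a \<inter> open_segment H b = {}" "open_segment G a \<inter> open_segment H F = {}"
    "open_segment G F \<inter> open_segment H b = {}"
    and "F \<notin> open_segment G a" "F \<notin> open_segment H b" "G \<notin> open_segment F a" "G \<notin> open_segment F b"
    "G \<notin> open_segment H b" "G \<notin> open_segment H F" "H \<notin> open_segment F a" "H \<notin> open_segment F b"
    "H \<notin> open_segment G a" "H \<notin> open_segment G F" "F \<noteq> G" "F \<noteq> H" "G \<noteq> H"
proof -
  have a: "a = of_real 1 * a + of_real 0 * b + of_real 0 * t" "b = of_real 0 * a + of_real 1 * b + of_real 0 * t" by simp_all
  have F': "F = of_real (5/13) * a + of_real (5/13) * b + of_real (3/13) * t" by (simp add: F apex_def add_divide_distrib)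
  have G': "G = of_real (5/13) * a + of_real (3/13) * b + of_real (5/13) * t" by (simp add: G add_divide_distrib)
  have H': "H = of_real (323/637) * a + of_real (277/637) * b + of_real (37/637) * t" by (simp add: H add_divide_distrib)
  let ?P = "\<lambda>x y z :: real. 0 < x \<and> 0 < y \<and> 0 < z \<and> z \<le> 5/11 \<and> z \<le> x"
  let ?p = "\<lambda>x y z :: real. ?P x y z \<and> 3 * y > 5 * z"
  let ?n = "\<lambda>x y z :: real. ?P x y z \<and> 3 * y < 5 * z"
  let ?o = "\<lambda>x y z :: real. ?P x y z \<and> 3 * y = 5 * z"
  have f: "F \<in> bar a b t ?o" unfolding F' by (rule barI) simp_all
  have g: "G \<in> bar a b t ?n" unfolding G' by (rule barI) simp_all
  have h: "H \<in> bar a b t ?p" "H \<in> bar a b t (\<lambda>x y z. y < x)" unfolding H' by (rule barI; simp)+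
  have fa: "open_segment F a \<subseteq> bar a b t ?o" by (rule open_segment_bar[OF F' a(1)]) (simp_all add: field_simps)
  have fb: "open_segment F b \<subseteq> bar a b t ?p" by (rule open_segment_bar[OF F' a(2)]) (simp_all add: field_simps)
  have fb2: "open_segment F b \<subseteq> bar a b t (\<lambda>x y z. x < y)" by (rule open_segment_bar[OF F' a(2)]) (simp_all add: field_simps)
  have ga: "open_segment G a \<subseteq> bar a b t ?n" by (rule open_segment_bar[OF G' a(1)]) (simp_all add: field_simps)
  have gf: "open_segment G F \<subseteq> bar a b t ?n" by (rule open_segment_bar[OF G' F']) (simp_all add: field_simps)
  have hb: "open_segment H b \<subseteq> bar a b t ?p" by (rule open_segment_bar[OF H' a(2)]) (simp_all add: field_simps)
  have hf: "open_segment H F \<subseteq> bar a b t ?p" by (rule open_segment_bar[OF H' F']) (simp_all add: field_simps)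
  have d: "bar a b t ?o \<inter> bar a b t ?p = {}" "bar a b t ?o \<inter> bar a b t ?n = {}" "bar a b t ?p \<inter> bar a b t ?n = {}"
    "bar a b t (\<lambda>x y z. y < x) \<inter> bar a b t (\<lambda>x y z. x < y) = {}"
    by (rule bar_disjoint[OF e]; simp)+
  have m: "bar a b t ?o \<subseteq> bar a b t ?P" "bar a b t ?p \<subseteq> bar a b t ?P" "bar a b t ?n \<subseteq> bar a b t ?P"
    using bar_mono[of _ a b t] by (auto intro: bar_mono)
  show "insert F (open_segment F a \<union> open_segment F b) \<union> insert G (open_segment G a \<union> open_segment G F) \<union>
      insert H (open_segment H b \<union> open_segment H F) \<subseteq> bar a b t ?P"
    using f g h(1) fa fb ga gf hb hf m by blast
  show "open_segment F a \<inter> open_segment H b = {}" using fa hb d by blast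
  show "open_segment F b \<inter> open_segment G a = {}" using fb ga d by blast
  show "open_segment G a \<inter> open_segment H b = {}" using ga hb d by blast
  show "open_segment G a \<inter> open_segment H F = {}" using ga hf d by blast
  show "open_segment G F \<inter> open_segment H b = {}" using gf hb d by blast
  show "F \<notin> open_segment G a" using f ga d by blast
  show "F \<notin> open_segment H b" using f hb d by blast
  show "G \<notin> open_segment F a" using g fa d by blast
  show "G \<notin> open_segment F b" using g fb d by blast
  show "G \<notin> open_segment H b" using g hb d by blast
  show "G \<notin> open_segment H F" using g hf d by blast
  show "H \<notin> open_segment F a" using h fa d by blast
  show "H \<notin> open_segment F b" using h fb2 d by blast
  show "H \<notin> open_segment G a" using h ga d by blast
  show "H \<notin> open_segment G F" using h gf d by blast
  show "F \<noteq> G" "F \<noteq> H" "G \<noteq> H" using f g h d by blast+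
qed

context layout
begin

definition tri :: "nat \<Rightarrow> nat \<Rightarrow> (real \<Rightarrow> real \<Rightarrow> real \<Rightarrow> bool) \<Rightarrow> complex set" where
  "tri j m Q = bar (Z j m) (Z j (m + 1)) (Z j (m + 2)) Q"

text \<open>The points of a face nearest to the side opposite vertex \<open>n\<close>. The three
  regions are disjoint, which lets three short flags share a face.\<close>

definition lowest :: "nat \<Rightarrow> real \<Rightarrow> real \<Rightarrow> real \<Rightarrow> bool" where
  "lowest n a b c \<longleftrightarrow> (n = 0 \<and> a < b \<and> a < c) \<or> (n = 1 \<and> b < a \<and> b < c) \<or> (n = 2 \<and> c < a \<and> c < b)"

lemma lowest_disjoint: "n \<noteq> n' \<Longrightarrow> tri j m (lowest n) \<inter> tri j m (lowest n') = {}"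
  unfolding tri_def by (rule bar_disjoint[OF equi_Z]) (auto simp: lowest_def)

definition fcell :: "nat \<Rightarrow> nat \<Rightarrow> nat \<Rightarrow> bool \<Rightarrow> int \<times> int \<times> nat" where
  "fcell j k m b = (if k = 1 then (int j, if b then int m else int m - 1, 3) else if b then (int j, int m, 3)
     else (if odd m then int j else int j - 1, int (m div 2), 5))"

lemma fcell_loc:
  assumes "k = 1 \<or> k = 2" "0 < m"
    and "P \<in> bar (Z j m) (Z j (m + k)) (third k j m b) (\<lambda>a b c. 0 < a \<and> 0 < b \<and> 0 < c \<and> c \<le> 5/11)"
  shows "loc P = fcell j k m b"
proof -
  obtain n where n: "m = n + 1" using assms(2) by (cases m) auto
  obtain a b' c where *: "a + b' + c = 1" "P = of_real a * Z j m + of_real b' * Z j (m + k) + of_real c * third k j m b"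
    "0 < a" "0 < b'" "0 < c" "c \<le> 5/11"
    using assms(3) unfolding bar_def by blast
  have p: "c + a + b' = 1" "a + c + b' = 1" using *(1) by simp_all
  consider "k = 1" "b" | "k = 1" "\<not> b" | "k = 2" "b" | "k = 2" "\<not> b" using assms(1) by blast
  then show ?thesis
  proof cases
    case 1
    then show ?thesis using loc_face[OF *(1,3,4,5), of j m] *(2) by (simp add: third_simps fcell_def)
  next
    case 2
    then show ?thesis using loc_face[OF p(1) *(5,3,4), of j n] *(2) third_simps(3)[of j n] n
      by (simp add: fcell_def algebra_simps)
  next
    case 3
    then show ?thesis using loc_face[OF p(2) *(3,5,4), of j m] *(2) third_simps(2)[of j m]
      by (simp add: fcell_def algebra_simps)
  next
    case 4
    have "third k j m b = Z j m + Z j (m + 2) - Z j (m + 1)" using 4 by (simp add: third_def)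
    then show ?thesis using loc_corridor[OF *(1,3,4,5,6), of j m] *(2) 4 by (simp add: fcell_def)
  qed
qed

text \<open>The sides of face \<open>M\<close> have \<open>k + 2 * m\<close> equal to
  \<open>2 * M + 1\<close>, \<open>2 * M + 2\<close> and \<open>2 * M + 3\<close>; the difference
  turns this code into the index of the opposite vertex.\<close>

lemma fcell_lowest:
  assumes "k = 1 \<or> k = 2" "0 < m" "fcell j k m b = (int j, int M, 3)"
    and "P \<in> bar (Z j m) (Z j (m + k)) (third k j m b) (\<lambda>a b c. c < a \<and> c < b)"
  shows "P \<in> tri j M (lowest (2 * M + 3 - (k + 2 * m)))"
proof -
  obtain n where n: "m = n + 1" using assms(2) by (cases m) auto
  consider "k = 1" "b" | "k = 1" "\<not> b" | "k = 2" "b" | "k = 2" "\<not> b" using assms(1) by blast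
  then show ?thesis
  proof cases
    case 1
    then show ?thesis using assms(3,4) unfolding tri_def
      by (auto simp: fcell_def third_simps lowest_def elim: bar_mono)
  next
    case 2
    then have M: "M = n" using assms(3) n by (simp add: fcell_def)
    show ?thesis using bar_perm(1)[OF bar_perm(2)[OF assms(4)]] 2 third_simps(3)[of j n] unfolding tri_def M n
      by (auto simp: lowest_def elim: bar_mono)
  next
    case 3
    then have M: "M = m" using assms(3) n by (simp add: fcell_def)
    show ?thesis using bar_perm(2)[OF assms(4)] 3 third_simps(2)[of j m] unfolding tri_def M
      by (auto simp: lowest_def elim: bar_mono)
  next
    case 4
    then show ?thesis using assms(3) by (simp add: fcell_def split: if_splits)
  qed
qed

end

section \<open>Drawing the layout of a solution\<close>

lemma open_segment_comb:
  "P \<in> open_segment A B \<Longrightarrow> \<exists>a b. a + b = 1 \<and> 0 < a \<and> 0 < b \<and> P = of_real a * A + of_real b * (B :: complex)"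
  unfolding in_segment scaleR_conv_of_real by (metis diff_add_cancel diff_gt_0_iff_gt)

lemma closed_segment_cases: "P \<in> closed_segment A B \<Longrightarrow> P = A \<or> P = B \<or> P \<in> open_segment A B"
  by (auto simp: open_segment_def)

lemma e8: "8 + 8 * c = 8 * c + (8::nat)" by simp

context layout
begin

lemma items_cases:
  assumes "(v, a, b, k, l) \<in> set items"
  shows "(\<exists>j m. v = Bd j (m + 2) \<and> a = Bd j (m + 1) \<and> b = Bd j m \<and> k = 0 \<and> l = 0) \<or>
     (\<exists>j. v = Bd (j + 1) 0 \<and> a = Bd j 1 \<and> b = Bd j 3 \<and> k = 1 \<and> l = 0) \<or>
     (\<exists>j. v = Bd (j + 1) 2 \<and> a = Bd j 3 \<and> b = Bd (j + 1) 0 \<and> k = 1 \<and> l = 0) \<or>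
     (\<exists>j. v = Bd (j + 1) 1 \<and> a = Bd (j + 1) 0 \<and> b = Bd (j + 1) 2 \<and> k = 0 \<and> l = 0) \<or>
     (\<exists>r c i. r < R \<and> c < C \<and> i < 42 \<and> (v, a, b, k, l) = flag_item r c i) \<or>
     (\<exists>r c. r < R \<and> c < C \<and> (v, a, b, k, l) \<in> {(Fl r c 42, Bd (4 * r + 1) (8 * c + 7), Bd (4 * r + 1) (8 * c + 8), 1, 1),
      (Fl r c 43, Bd (4 * r + 1) (8 * c + 7), Fl r c 42, 1, 3), (Fl r c 44, Bd (4 * r + 1) (8 * c + 8), Fl r c 42, 1, 3)}) \<or>
     (\<exists>r<R. (v, a, b, k, l) \<in> set (row_ends r))" (is "?A \<or> ?B \<or> ?C \<or> ?D \<or> ?E \<or> ?F \<or> ?G")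
proof -
  have "(v, a, b, k, l) \<in> set strip0 \<or> (\<exists>j. (v, a, b, k, l) \<in> set (strip j)) \<or>
      (\<exists>r<R. \<exists>c<C. (v, a, b, k, l) \<in> set (cell r c)) \<or> ?G"
    using assms unfolding items_def by auto
  then show ?thesis
  proof (elim disjE exE conjE)
    assume "(v, a, b, k, l) \<in> set strip0"
    then have ?A unfolding strip0_def by auto
    then show ?thesis by (rule disjI1)
  next
    fix j assume "(v, a, b, k, l) \<in> set (strip j)"
    then have "(v, a, b, k, l) = (Bd (j + 1) 0, Bd j 1, Bd j 3, 1, 0) \<or> (v, a, b, k, l) = (Bd (j + 1) 2, Bd j 3, Bd (j + 1) 0, 1, 0) \<or>
        (v, a, b, k, l) = (Bd (j + 1) 1, Bd (j + 1) 0, Bd (j + 1) 2, 0, 0) \<or>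
        (\<exists>m. (v, a, b, k, l) = (Bd (j + 1) (m + 3), Bd (j + 1) (m + 2), Bd (j + 1) (m + 1), 0, 0))"
      unfolding strip_def by auto
    then show ?thesis
    proof (elim disjE exE)
      fix m assume "(v, a, b, k, l) = (Bd (j + 1) (m + 3), Bd (j + 1) (m + 2), Bd (j + 1) (m + 1), 0, 0)"
      then have "v = Bd (j + 1) (m + 1 + 2) \<and> a = Bd (j + 1) (m + 1 + 1) \<and> b = Bd (j + 1) (m + 1) \<and> k = 0 \<and> l = 0" by simp
      then have ?A by blast
      then show ?thesis by (rule disjI1)
    next
      assume "(v, a, b, k, l) = (Bd (j + 1) 0, Bd j 1, Bd j 3, 1, 0)"
      then have ?B by (intro exI[of _ j]) (simp only: prod.inject simp_thms)
      then show ?thesis by (rule disjI1[THEN disjI2])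
    next
      assume "(v, a, b, k, l) = (Bd (j + 1) 2, Bd j 3, Bd (j + 1) 0, 1, 0)"
      then have ?C by (intro exI[of _ j]) (simp only: prod.inject simp_thms)
      then show ?thesis by (rule disjI1[THEN disjI2, THEN disjI2])
    next
      assume "(v, a, b, k, l) = (Bd (j + 1) 1, Bd (j + 1) 0, Bd (j + 1) 2, 0, 0)"
      then have ?D by (intro exI[of _ j]) (simp only: prod.inject simp_thms)
      then show ?thesis by (rule disjI1[THEN disjI2, THEN disjI2, THEN disjI2])
    qed
  next
    fix r c assume rc: "r < R" "c < C" "(v, a, b, k, l) \<in> set (cell r c)"
    then have "(v, a, b, k, l) \<in> flag_item r c ` {0..<42} \<or> (v, a, b, k, l) \<in> {(Fl r c 42, Bd (4 * r + 1) (8 * c + 7), Bd (4 * r + 1) (8 * c + 8), 1, 1),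
      (Fl r c 43, Bd (4 * r + 1) (8 * c + 7), Fl r c 42, 1, 3), (Fl r c 44, Bd (4 * r + 1) (8 * c + 8), Fl r c 42, 1, 3)}"
      unfolding cell_def set_append set_map set_upt by auto
    then show ?thesis
    proof
      assume "(v, a, b, k, l) \<in> flag_item r c ` {0..<42}"
      then obtain i where "i < 42" "(v, a, b, k, l) = flag_item r c i" by auto
      with rc(1,2) have ?E by blast
      then show ?thesis by (rule disjI1[THEN disjI2, THEN disjI2, THEN disjI2, THEN disjI2])
    next
      assume "(v, a, b, k, l) \<in> {(Fl r c 42, Bd (4 * r + 1) (8 * c + 7), Bd (4 * r + 1) (8 * c + 8), 1, 1),
      (Fl r c 43, Bd (4 * r + 1) (8 * c + 7), Fl r c 42, 1, 3), (Fl r c 44, Bd (4 * r + 1) (8 * c + 8), Fl r c 42, 1, 3)}"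
      with rc(1,2) have ?F by (intro exI conjI)
      then show ?thesis by (rule disjI1[THEN disjI2, THEN disjI2, THEN disjI2, THEN disjI2, THEN disjI2])
    qed
  next
    fix r assume "r < R" "(v, a, b, k, l) \<in> set (row_ends r)"
    then have ?G by (intro exI conjI)
    then show ?thesis by (intro disjI2)
  qed
qed

end

context drawing
begin

fun base :: "nat \<times> int \<times> nat \<times> (nat \<times> nat \<times> nat \<times> nat) \<times> bool \<Rightarrow> nat" where
  "base (r, c, i, (s, k, m, ty), b) = nat (8 * c + int m)"

fun wpos :: "nat \<times> int \<times> nat \<times> (nat \<times> nat \<times> nat \<times> nat) \<times> bool \<Rightarrow> complex" where
  "wpos (r, c, i, (s, k, m, ty), b) = (let j = 4 * r + s; n = nat (8 * c + int m) in
     apex ty (Z j n) (Z j (n + k)) (third k j n b))"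

definition "ua r c = Z (4 * r + 1) (8 * c + 7)"
definition "ub r c = Z (4 * r + 1) (8 * c + 8)"
definition "ut r c = third 1 (4 * r + 1) (8 * c + 7) (phase r (int c) < 2)"

text \<open>The unit has its outer vertex at the side whose sensor is turned away: it is 43 or 44
  according to the value of the variable, in whichever face the unit lies.\<close>

fun wp :: "vtx \<Rightarrow> complex" where
  "wp (Bd j m) = Z j m"
| "wp (En r e) = wpos (dat (En r e))"
| "wp (Fl r c i) = (if i = 43 then if up (int c) then (5 * ua r c + 3 * ub r c + 5 * ut r c) / 13
       else (277 * ua r c + 323 * ub r c + 37 * ut r c) / 637
     else if i = 44 then if up (int c) then (277 * ub r c + 323 * ua r c + 37 * ut r c) / 637
       else (5 * ub r c + 3 * ua r c + 5 * ut r c) / 13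
     else wpos (dat (Fl r c i)))"

fun nbs :: "nat \<times> int \<times> nat \<times> (nat \<times> nat \<times> nat \<times> nat) \<times> bool \<Rightarrow> vtx set" where
  "nbs (r, c, i, (s, k, m, ty), b) = (let j = 4 * r + s; n = nat (8 * c + int m) in {Bd j n, Bd j (n + k)})"

fun nb :: "vtx \<Rightarrow> vtx set" where
  "nb (Bd j m) = {}"
| "nb (En r e) = nbs (dat (En r e))"
| "nb (Fl r c i) = (if i = 43 then {Bd (4 * r + 1) (8 * c + 7), Fl r c 42}
     else if i = 44 then {Bd (4 * r + 1) (8 * c + 8), Fl r c 42} else nbs (dat (Fl r c i)))"

text \<open>What a vertex adds to the drawing: its own point and the open edges to the two vertices
  it was attached to.\<close>

definition feat :: "vtx \<Rightarrow> complex set" where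
  "feat v = insert (wp v) (\<Union>x\<in>nb v. open_segment (wp v) (wp x))"

text \<open>The three vertices of a unit share a face and are represented by one of them; collisions
  among them are excluded separately by \<open>unit_pair\<close>.\<close>

fun rep :: "vtx \<Rightarrow> vtx" where
  "rep (Fl r c i) = (if i = 43 \<or> i = 44 then Fl r c 42 else Fl r c i)"
| "rep v = v"

definition NV :: "vtx set" where
  "NV = FV \<union> {Fl r c i |r c i. r < R \<and> c < C \<and> (i = 43 \<or> i = 44)}"

definition cl :: "vtx \<Rightarrow> int \<times> int \<times> nat" where
  "cl v = (case dat (rep v) of (r, c, i, e, b) \<Rightarrow> acell r c e b)"

lemma rep_FV: "v \<in> NV \<Longrightarrow> rep v \<in> FV"
  by (auto simp: NV_def FV_def)

text \<open>The end flag on the left is assigned to the imaginary column -1, where only offset 11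
  occurs, so the vertex index is still a positive number. In corridors the second label is positive,
  which keeps flags off the diagonal joining two strips.\<close>

lemma dat_facts:
  assumes "v \<in> FV" "dat v = (r, c, i, (s, k, m, ty), b)"
  shows "k = 1 \<or> k = 2" "ty = 1 \<or> ty = 2" "0 < 8 * c + int m" "acell r c (s, k, m, ty) b = fcell (4 * r + s) k (nat (8 * c + int m)) b"
    "snd (snd (acell r c (s, k, m, ty) b)) = 3 \<or> (snd (snd (acell r c (s, k, m, ty) b)) = 5 \<and> 0 < fst (snd (acell r c (s, k, m, ty) b)))"
proof -
  have ok: "k = 1 \<or> k = 2" "ty = 1 \<or> ty = 2" "0 < m"
    using dat_ok[OF assms] by (auto simp: local_ok_def split: prod.splits)
  have c: "0 \<le> c \<or> (c = - 1 \<and> m = 11 \<and> k = 1)"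
    using assms cs by (auto simp: FV_def split: if_splits)
  then have n: "0 < 8 * c + int m" using ok(3) by auto
  have y: "k = 2 \<Longrightarrow> \<not> b \<Longrightarrow> 0 < m div 2"
    using dat_ok[OF assms] by (auto simp: local_ok_def lcell_def nth_Cons split: prod.splits if_splits nat.splits)
  have "k = 2 \<Longrightarrow> odd (nat (8 * c + int m)) = odd m \<and> int (nat (8 * c + int m) div 2) = 4 * c + int (m div 2)"
  proof -
    assume "k = 2"
    then have "0 \<le> c" using c by auto
    then obtain c' where "c = int c'" by (metis zero_le_imp_eq_int)
    then have "nat (8 * c + int m) = 8 * c' + m" by simp
    moreover have "(8 * c' + m) div 2 = 4 * c' + m div 2" by presburger
    ultimately show ?thesis using \<open>c = int c'\<close> by simp
  qed
  then show "acell r c (s, k, m, ty) b = fcell (4 * r + s) k (nat (8 * c + int m)) b"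
    using ok(1,3) n by (auto simp: acell_def fcell_def lcell_def)
  show "snd (snd (acell r c (s, k, m, ty) b)) = 3 \<or> (snd (snd (acell r c (s, k, m, ty) b)) = 5 \<and> 0 < fst (snd (acell r c (s, k, m, ty) b)))"
    using ok(1) y c by (auto simp: acell_def lcell_def)
  show "k = 1 \<or> k = 2" "ty = 1 \<or> ty = 2" "0 < 8 * c + int m" using ok n by blast+
qed

lemma wp_FV: "v \<in> FV \<Longrightarrow> wp v = wpos (dat v)" "v \<in> FV \<Longrightarrow> nb v = nbs (dat v)" "v \<in> FV \<Longrightarrow> rep v = v"
  by (auto simp: FV_def)

lemma feat_FV:
  assumes "v \<in> FV" "dat v = (r, c, i, (s, k, m, ty), b)" "n = nat (8 * c + int m)" "j = 4 * r + s"
  shows "feat v \<subseteq> bar (Z j n) (Z j (n + k)) (third k j n b)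
    (\<lambda>a b c. 0 < a \<and> 0 < b \<and> 0 < c \<and> c \<le> 5/11 \<and> (ty = 1 \<longrightarrow> c < a \<and> c < b))"
proof -
  have "feat v = insert (apex ty (Z j n) (Z j (n + k)) (third k j n b)) (open_segment (apex ty (Z j n) (Z j (n + k)) (third k j n b)) (Z j n) \<union>
      open_segment (apex ty (Z j n) (Z j (n + k)) (third k j n b)) (Z j (n + k)))"
    unfolding feat_def wp_FV(1,2)[OF assms(1)] assms(2) by (simp add: assms(3,4) Let_def)
  then show ?thesis using apex_feature[OF dat_facts(2)[OF assms(1,2)]] by simp
qed

lemma feat_FV_loc: "v \<in> FV \<Longrightarrow> P \<in> feat v \<Longrightarrow> loc P = cl v"
proof -
  assume v: "v \<in> FV" and P: "P \<in> feat v"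
  obtain r c i s k m ty b where d: "dat v = (r, c, i, (s, k, m, ty), b)" by (metis prod_cases7 surj_pair)
  note f = dat_facts[OF v d]
  have "loc P = fcell (4 * r + s) k (nat (8 * c + int m)) b"
    by (rule fcell_loc[OF f(1)]) (use f(3) bar_mono[OF subsetD[OF feat_FV[OF v d refl refl] P]] in auto)
  then show ?thesis using f(4) by (simp add: cl_def wp_FV(3)[OF v] d)
qed

lemma fcell_face: "0 < n \<Longrightarrow> snd (snd (fcell j k n b)) = 3 \<Longrightarrow> \<exists>M. fcell j k n b = (int j, int M, 3)"
  by (cases n; cases b; cases "k = 1") (auto simp: fcell_def intro: exI[of _ n])

lemma feat_tri:
  assumes "v \<in> FV" "dat v = (r, c, i, (s, k, m, 1), b)" "acell r c (s, k, m, 1) b = (int j, int M, 3)"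
  shows "feat v \<subseteq> tri j M (lowest (2 * M + 3 - (k + 2 * nat (8 * c + int m))))"
proof
  fix P assume P: "P \<in> feat v"
  note f = dat_facts[OF assms(1,2)]
  have "j = 4 * r + s"
    using assms(3) by (auto simp: acell_def lcell_def split: if_splits)
  then show "P \<in> tri j M (lowest (2 * M + 3 - (k + 2 * nat (8 * c + int m))))"
    by (intro fcell_lowest[OF f(1)]) (use f(3,4) assms(3) bar_mono[OF subsetD[OF feat_FV[OF assms(1,2) refl refl] P]] in auto)
qed

lemma unit_dat: "dat (Fl r c 42) = (r, int c, 42, (1,1,7,1), phase r (int c) < 2)"
  by (simp add: wentry_def wstate_def)

lemma unit_equi: "equi (ua r c) (ub r c) (ut r c)"
  using equi_third[of 1 "4 * r + 1" "8 * c + 7"] by (simp add: ua_def ub_def ut_def e8)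

lemma unit_apex: "wp (Fl r c 42) = apex 1 (ua r c) (ub r c) (ut r c)"
  using unit_dat[of r c] by (simp add: ua_def ub_def ut_def e8 Let_def nat_add_distrib nat_mult_distrib del: dat.simps)

lemma unit_apex': "wp (Fl r c 42) = apex 1 (ub r c) (ua r c) (ut r c)"
  using unit_apex[of r c] apex_commute[of 1 "ua r c" "ub r c" "ut r c"] by (simp only:)

lemma unit_nb: "nb (Fl r c 42) = {Bd (4 * r + 1) (8 * c + 7), Bd (4 * r + 1) (8 * c + 8)}"
  using unit_dat[of r c] by (simp add: e8 Let_def nat_add_distrib nat_mult_distrib del: dat.simps)

lemma unit_cl: "cl (Fl r c 42) = fcell (4 * r + 1) 1 (8 * c + 7) (phase r (int c) < 2)"
  using unit_dat[of r c] by (simp add: cl_def acell_def lcell_def fcell_def del: dat.simps)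

lemma wp_unit: "wp (Bd (4 * r + 1) (8 * c + 7)) = ua r c" "wp (Bd (4 * r + 1) (8 * c + 8)) = ub r c"
  by (simp_all add: ua_def ub_def)

lemma feat_unit:
  assumes "i = 42 \<or> i = 43 \<or> i = 44"
  shows "feat (Fl r c i) \<subseteq> bar (ua r c) (ub r c) (ut r c)
     (\<lambda>x y z. 0 < x \<and> 0 < y \<and> 0 < z \<and> z \<le> 5/11 \<and> (if up (int c) then z \<le> x else z \<le> y))"
proof -
  have f: "feat (Fl r c 42) = insert (wp (Fl r c 42)) (open_segment (wp (Fl r c 42)) (ua r c) \<union> open_segment (wp (Fl r c 42)) (ub r c))"
    "feat (Fl r c 43) = insert (wp (Fl r c 43)) (open_segment (wp (Fl r c 43)) (ua r c) \<union> open_segment (wp (Fl r c 43)) (wp (Fl r c 42)))"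
    "feat (Fl r c 44) = insert (wp (Fl r c 44)) (open_segment (wp (Fl r c 44)) (ub r c) \<union> open_segment (wp (Fl r c 44)) (wp (Fl r c 42)))"
    unfolding feat_def unit_nb by (simp_all add: wp_unit[unfolded Suc_eq_plus1[symmetric]] del: wp.simps)
  show ?thesis
  proof (cases "up (int c)")
    case True
    have "wp (Fl r c 43) = (5 * ua r c + 3 * ub r c + 5 * ut r c) / 13" "wp (Fl r c 44) = (277 * ub r c + 323 * ua r c + 37 * ut r c) / 637"
      using True by simp_all
    from unit_separation(1)[OF unit_equi unit_apex this]
    have "feat (Fl r c 42) \<union> feat (Fl r c 43) \<union> feat (Fl r c 44) \<subseteq> bar (ua r c) (ub r c) (ut r c) (\<lambda>x y z. 0 < x \<and> 0 < y \<and> 0 < z \<and> z \<le> 5/11 \<and> z \<le> x)"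
      unfolding f .
    then have "feat (Fl r c i) \<subseteq> bar (ua r c) (ub r c) (ut r c) (\<lambda>x y z. 0 < x \<and> 0 < y \<and> 0 < z \<and> z \<le> 5/11 \<and> z \<le> x)"
      using assms by blast
    then show ?thesis using True by (simp del: wp.simps)
  next
    case False
    have "wp (Fl r c 44) = (5 * ub r c + 3 * ua r c + 5 * ut r c) / 13" "wp (Fl r c 43) = (277 * ua r c + 323 * ub r c + 37 * ut r c) / 637"
      using False by simp_all
    from unit_separation(1)[OF equi_perm(1)[OF unit_equi] unit_apex' this]
    have "feat (Fl r c 42) \<union> feat (Fl r c 44) \<union> feat (Fl r c 43) \<subseteq> bar (ub r c) (ua r c) (ut r c) (\<lambda>x y z. 0 < x \<and> 0 < y \<and> 0 < z \<and> z \<le> 5/11 \<and> z \<le> x)"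
      unfolding f Un_commute[of "open_segment (wp (Fl r c 42)) (ua r c)"] .
    then have "feat (Fl r c i) \<subseteq> bar (ub r c) (ua r c) (ut r c) (\<lambda>x y z. 0 < x \<and> 0 < y \<and> 0 < z \<and> z \<le> 5/11 \<and> z \<le> x)"
      using assms by blast
    note sub = this
    show ?thesis
    proof
      fix P assume "P \<in> feat (Fl r c i)"
      from bar_perm(1)[OF subsetD[OF sub this]]
      show "P \<in> bar (ua r c) (ub r c) (ut r c) (\<lambda>x y z. 0 < x \<and> 0 < y \<and> 0 < z \<and> z \<le> 5/11 \<and> (if up (int c) then z \<le> x else z \<le> y))"
        by (rule bar_mono) (use False in simp)
    qed
  qed
qed

lemma feat_loc: "v \<in> NV \<Longrightarrow> P \<in> feat v \<Longrightarrow> loc P = cl v"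
proof -
  assume v: "v \<in> NV" and P: "P \<in> feat v"
  show ?thesis
  proof (cases "v \<in> FV")
    case True
    then show ?thesis using feat_FV_loc P by blast
  next
    case False
    then obtain r c i where i: "v = Fl r c i" "i = 43 \<or> i = 44" using v by (auto simp: NV_def)
    have "P \<in> bar (ua r c) (ub r c) (ut r c)
     (\<lambda>x y z. 0 < x \<and> 0 < y \<and> 0 < z \<and> z \<le> 5/11 \<and> (if up (int c) then z \<le> x else z \<le> y))"
      using feat_unit[of i r c] P i by blast
    then have "loc P = fcell (4 * r + 1) 1 (8 * c + 7) (phase r (int c) < 2)"
      by (intro fcell_loc) (auto simp: ua_def ub_def ut_def e8 elim: bar_mono)
    moreover have "cl v = cl (Fl r c 42)" using i by (auto simp: cl_def)
    ultimately show ?thesis by (simp add: unit_cl)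
  qed
qed

text \<open>\<open>n\<close> is the vertex opposite the side of the sensor, so the sensor lies in
  the region where coordinate \<open>n\<close> is strictly smallest. The inequality in
  \<open>feat_unit\<close> says that the unit never enters this region.\<close>

lemma sensor_disjoint:
  assumes "v \<in> FV" "dat v = (r', c', sensor (phase r (int c)) (up (int c)), (s, k, m, ty), b)" "c' = int c"
    and "acell r' c' (s, k, m, ty) b = cl (Fl r c 42)" "ty = 1" and i: "i = 42 \<or> i = 43 \<or> i = 44"
  shows "feat v \<inter> feat (Fl r c i) = {}"
proof -
  let ?i = "sensor (phase r (int c)) (up (int c))"
  define M where "M = (if phase r (int c) < 2 then 8 * c + 7 else 8 * c + 6)"
  define n where "n = (if phase r (int c) < 2 then 0 else 1) + (if up (int c) then 0 else 1 :: nat)"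
  have "(s, k, m, ty) = wentry (tg r' c') ?i"
    using dat_occ(2)[OF assms(1,2)] by (auto simp: occs_def sensor_def split: if_splits)
  then have "(s, k, m, ty) = base_tab ! ?i" by (simp add: wentry_def sensor_def)
  then have n: "2 * M + 3 - (k + 2 * nat (8 * c' + int m)) = n"
    by (simp add: sensor_def base_tab_def n_def M_def assms(3) split: if_splits)
  have "cl (Fl r c 42) = (int (4 * r + 1), int M, 3)"
    unfolding unit_cl by (simp add: fcell_def M_def)
  then have "acell r' c' (s, k, m, 1) b = (int (4 * r + 1), int M, 3)" using assms(4,5) by simp
  then have "feat v \<subseteq> tri (4 * r + 1) M (lowest n)"
    using feat_tri[OF assms(1) assms(2)[unfolded assms(5)]] n by metis
  moreover have "feat (Fl r c i) \<subseteq> tri (4 * r + 1) M (\<lambda>x y z. \<not> lowest n x y z)"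
  proof
    fix P assume "P \<in> feat (Fl r c i)"
    then have P: "P \<in> bar (ua r c) (ub r c) (ut r c)
     (\<lambda>x y z. 0 < x \<and> 0 < y \<and> 0 < z \<and> z \<le> 5/11 \<and> (if up (int c) then z \<le> x else z \<le> y))" using feat_unit[OF i] by blast
    show "P \<in> tri (4 * r + 1) M (\<lambda>x y z. \<not> lowest n x y z)"
    proof (cases "phase r (int c) < 2")
      case True
      then have "ut r c = Z (4 * r + 1) (M + 2)" "ua r c = Z (4 * r + 1) M" "ub r c = Z (4 * r + 1) (M + 1)"
        by (simp_all add: ut_def ua_def ub_def M_def third_simps e8)
      then show ?thesis using P True unfolding tri_def by (auto simp: lowest_def n_def elim!: bar_mono)
    next
      case False
      have "8 * c + 7 = 8 * c + 6 + 1" by simp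
      then have "ut r c = Z (4 * r + 1) M"
        using False third_simps(3)[of "4 * r + 1" "8 * c + 6"] by (simp add: ut_def M_def add.commute[of "7::nat" "8 * c"])
      moreover have "ua r c = Z (4 * r + 1) (M + 1)" "ub r c = Z (4 * r + 1) (M + 2)"
        using False by (simp_all add: ua_def ub_def M_def e8 add.commute[of "7::nat" "8 * c"])
      ultimately show ?thesis using bar_perm(1)[OF bar_perm(2)[OF P]] False unfolding tri_def
        by (auto simp: lowest_def n_def elim!: bar_mono)
    qed
  qed
  moreover have "tri (4 * r + 1) M (lowest n) \<inter> tri (4 * r + 1) M (\<lambda>x y z. \<not> lowest n x y z) = {}"
    unfolding tri_def by (rule bar_disjoint[OF equi_Z]) simp
  ultimately show ?thesis by blast
qed

text \<open>By the evaluated check, two features in one face are either short flags on different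
  sides, hence in different regions, or a unit and its sensor.\<close>

lemma feat_disjoint:
  assumes "v \<in> NV" "w \<in> NV" "rep v \<noteq> rep w" "cl v = cl w"
  shows "feat v \<inter> feat w = {}"
proof -
  obtain r c i s k m ty b where d: "dat (rep v) = (r, c, i, (s, k, m, ty), b)" by (metis prod_cases7 surj_pair)
  obtain r' c' i' s' k' m' ty' b' where d': "dat (rep w) = (r', c', i', (s', k', m', ty'), b')" by (metis prod_cases7 surj_pair)
  note F = rep_FV[OF assms(1)] and F' = rep_FV[OF assms(2)]
  have a: "acell r c (s, k, m, ty) b = acell r' c' (s', k', m', ty') b'" using assms(4) by (simp add: cl_def d d')
  note sc = same_cell[OF F F' assms(3) d d' a]
  note f = dat_facts[OF F d] and f' = dat_facts[OF F' d']
  have 42: "rep u = Fl r c 42 \<Longrightarrow> u \<in> NV \<Longrightarrow> \<exists>i. u = Fl r c i \<and> (i = 42 \<or> i = 43 \<or> i = 44)" for u r c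
    by (cases u) (auto split: if_splits)
  have n42: "(\<nexists>r c. rep u = Fl r c 42) \<Longrightarrow> u \<in> NV \<Longrightarrow> u \<in> FV" for u
    by (auto simp: NV_def)
  have o: "i = 42 \<longleftrightarrow> (\<exists>r c. rep v = Fl r c 42)" "i' = 42 \<longleftrightarrow> (\<exists>r c. rep w = Fl r c 42)"
    using dat_occ(3)[OF F d] dat_occ(3)[OF F' d'] by blast+
  have ns: "sensor x y \<noteq> 42" for x y by (simp add: sensor_def)
  from sc(8) show ?thesis
  proof (elim disjE conjE)
    assume "i \<noteq> 42" "i' \<noteq> 42"
    then have v: "v \<in> FV" "w \<in> FV" using o n42 assms(1,2) by blast+
    have "snd (snd (acell r c (s, k, m, ty) b)) = 3" using sc(3) by (auto simp: acell_def split: prod.splits)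
    moreover have "0 < nat (8 * c + int m)" using f(3) by simp
    ultimately obtain M where M: "acell r c (s, k, m, ty) b = (int (4 * r + s), int M, 3)"
      using f(1,4) fcell_face by metis
    have dv: "dat v = (r, c, i, (s, k, m, 1), b)" "dat w = (r', c', i', (s', k', m', 1), b')"
      using d d' wp_FV(3)[OF v(1)] wp_FV(3)[OF v(2)] sc(5,6) by simp_all
    have "feat v \<subseteq> tri (4 * r + s) M (lowest (2 * M + 3 - (k + 2 * nat (8 * c + int m))))"
      by (rule feat_tri[OF v(1) dv(1)]) (use M sc(5) in simp)
    moreover have "feat w \<subseteq> tri (4 * r + s) M (lowest (2 * M + 3 - (k' + 2 * nat (8 * c' + int m'))))"
      by (rule feat_tri[OF v(2) dv(2)]) (use M a sc(5,6) in simp)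
    moreover have "2 * M + 3 - (k + 2 * nat (8 * c + int m)) \<noteq> 2 * M + 3 - (k' + 2 * nat (8 * c' + int m'))"
    proof -
      have "k + 2 * nat (8 * c + int m) \<noteq> k' + 2 * nat (8 * c' + int m')"
        using sc(2,7) f(3) f'(3) by linarith
      moreover have "k + 2 * nat (8 * c + int m) \<le> 2 * M + 3"
        using M f(1,3,4) by (auto simp: fcell_def split: if_splits)
      moreover have "k' + 2 * nat (8 * c' + int m') \<le> 2 * M + 3"
        using M a f'(1,3,4) by (auto simp: fcell_def split: if_splits)
      ultimately show ?thesis by linarith
    qed
    ultimately show ?thesis using lowest_disjoint by blast
  next
    assume i: "i = 42" "i' = sensor (phase r c) (up c)"
    then obtain r0 c0 where v: "rep v = Fl r0 c0 42" using o by blast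
    then have rc: "r0 = r" "c = int c0" using d unit_dat[of r0 c0] by (auto simp del: dat.simps)
    have w: "w \<in> FV" using o n42 assms(2) i ns by metis
    obtain i0 where i0: "v = Fl r c0 i0" "i0 = 42 \<or> i0 = 43 \<or> i0 = 44" using 42[OF v assms(1)] rc by blast
    have "feat w \<inter> feat (Fl r c0 i0) = {}"
    proof (rule sensor_disjoint[OF w _ _ _ sc(6) i0(2)])
      show "dat w = (r', c', sensor (phase r (int c0)) (up (int c0)), (s', k', m', ty'), b')"
        using d' wp_FV(3)[OF w] i rc by simp
      show "c' = int c0" using sc(2) rc by simp
      show "acell r' c' (s', k', m', ty') b' = cl (Fl r c0 42)"
        using a d v rc by (simp add: cl_def del: dat.simps)
    qed
    then show ?thesis using i0 by blast
  next
    assume i: "i' = 42" "i = sensor (phase r c) (up c)"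
    then obtain r0 c0 where v: "rep w = Fl r0 c0 42" using o by blast
    then have rc: "r0 = r'" "c' = int c0" using d' unit_dat[of r0 c0] by (auto simp del: dat.simps)
    have w: "v \<in> FV" using o n42 assms(1) i ns by metis
    obtain i0 where i0: "w = Fl r' c0 i0" "i0 = 42 \<or> i0 = 43 \<or> i0 = 44" using 42[OF v assms(2)] rc by blast
    have "feat v \<inter> feat (Fl r' c0 i0) = {}"
    proof (rule sensor_disjoint[OF w _ _ _ sc(5) i0(2)])
      show "dat v = (r, c, sensor (phase r' (int c0)) (up (int c0)), (s, k, m, ty), b)"
        using d wp_FV(3)[OF w] i rc sc(1,2) by simp
      show "c = int c0" using sc(2) rc by simp
      show "acell r c (s, k, m, ty) b = cl (Fl r' c0 42)"
        using a d' v rc by (simp add: cl_def del: dat.simps)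
    qed
    then show ?thesis using i0 by blast
  qed
qed

end

section \<open>Assembling the features and the strips into one straight-line drawing\<close>

context drawing
begin

text \<open>The triple is the label under \<open>loc\<close> of the open edge, so different edges of
  the strips are disjoint because their labels differ.\<close>

inductive bed :: "vtx \<Rightarrow> vtx \<Rightarrow> int \<times> int \<times> nat \<Rightarrow> bool" where
  "bed (Bd j m) (Bd j (m + 1)) (int j, int m, 1)"
| "bed (Bd j m) (Bd j (m + 2)) (int j, int m, 2)"
| "bed (Bd j 1) (Bd (j + 1) 0) (int j, 0, 4)"
| "bed (Bd j 3) (Bd (j + 1) 0) (int j, 0, 5)"
| "bed (Bd j 3) (Bd (j + 1) 2) (int j, 1, 4)"

lemma bed_loc: "bed a b L \<Longrightarrow> P \<in> open_segment (wp a) (wp b) \<Longrightarrow> loc P = L"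
proof (erule bed.cases)
  fix j m assume "a = Bd j m" "b = Bd j (m + 1)" "L = (int j, int m, 1)" "P \<in> open_segment (wp a) (wp b)"
  then show "loc P = L" using open_segment_comb[of P "Z j m" "Z j (m + 1)"] loc_edge1[of _ _ j m] by auto
next
  fix j m assume "a = Bd j m" "b = Bd j (m + 2)" "L = (int j, int m, 2)" "P \<in> open_segment (wp a) (wp b)"
  then show "loc P = L" using open_segment_comb[of P "Z j m" "Z j (m + 2)"] loc_edge2[of _ _ j m] by auto
next
  fix j assume "a = Bd j 1" "b = Bd (j + 1) 0" "L = (int j, 0, 4)" "P \<in> open_segment (wp a) (wp b)"
  then show "loc P = L" using open_segment_comb[of P "Z j 1" "Z (j + 1) 0"] loc_spine(1)[of _ _ j] by auto
next
  fix j assume "a = Bd j 3" "b = Bd (j + 1) 0" "L = (int j, 0, 5)" "P \<in> open_segment (wp a) (wp b)"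
  then show "loc P = L" using open_segment_comb[of P "Z j 3" "Z (j + 1) 0"] loc_spine(2)[of _ _ j] by auto
next
  fix j assume "a = Bd j 3" "b = Bd (j + 1) 2" "L = (int j, 1, 4)" "P \<in> open_segment (wp a) (wp b)"
  then show "loc P = L" using open_segment_comb[of P "Z j 3" "Z (j + 1) 2"] loc_spine(3)[of _ _ j] by auto
qed

lemma bed_unique: "bed a b L \<Longrightarrow> bed a' b' L \<Longrightarrow> a' = a \<and> b' = b"
  by (auto elim!: bed.cases)

lemma bed_label: "bed a b L \<Longrightarrow> snd (snd L) \<in> {1, 2, 4} \<or> snd (snd L) = 5 \<and> fst (snd L) = 0"
  by (auto elim!: bed.cases)

text \<open>Comparison with \<open>bed_label\<close> shows that features never share a label with
  edges of the strips: the only edge of kind 5 has second component 0.\<close>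

lemma cl_label: "v \<in> NV \<Longrightarrow> snd (snd (cl v)) = 3 \<or> snd (snd (cl v)) = 5 \<and> 0 < fst (snd (cl v))"
proof -
  assume v: "v \<in> NV"
  obtain r c i s k m ty b where d: "dat (rep v) = (r, c, i, (s, k, m, ty), b)" by (metis surj_pair)
  show ?thesis using dat_facts(5)[OF rep_FV[OF v] d] by (simp add: cl_def d)
qed

lemma FV_item:
  assumes "v \<in> FV" "dat v = (r, c, i, (s, k, m, ty), b)" "n = nat (8 * c + int m)"
  shows "v \<in> NV \<and> nb v = {Bd (4 * r + s) n, Bd (4 * r + s) (n + k)} \<and>
    dist (wp v) (wp (Bd (4 * r + s) n)) = len_of ty \<and> dist (wp v) (wp (Bd (4 * r + s) (n + k))) = len_of ty"
proof -
  note f = dat_facts[OF assms(1,2)]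
  have "wp v = apex ty (Z (4 * r + s) n) (Z (4 * r + s) (n + k)) (third k (4 * r + s) n b)"
    unfolding wp_FV(1)[OF assms(1)] assms(2) by (simp add: Let_def assms(3))
  moreover have "nb v = {Bd (4 * r + s) n, Bd (4 * r + s) (n + k)}"
    unfolding wp_FV(2)[OF assms(1)] assms(2) by (simp add: Let_def assms(3))
  ultimately show ?thesis using apex_dist[OF equi_third[OF f(1), of "4 * r + s" n b] f(2)] assms(1) by (simp add: NV_def)
qed

definition new_item :: "vtx \<Rightarrow> vtx \<Rightarrow> vtx \<Rightarrow> nat \<Rightarrow> nat \<Rightarrow> bool" where
  "new_item v a b k l \<longleftrightarrow> v \<in> NV \<and> nb v = {a, b} \<and> dist (wp v) (wp a) = len_of k \<and> dist (wp v) (wp b) = len_of l"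

lemma new_flag_item:
  assumes "r < R" "c < C" "i < 42" "(v, a, b, k, l) = flag_item r c i"
  shows "new_item v a b k l"
proof -
  obtain s k' m ty where e: "entry r c i = (s, k', m, ty)" by (metis surj_pair)
  have v: "v = Fl r c i" "a = Bd (4 * r + s) (8 * c + m)" "b = Bd (4 * r + s) (8 * c + m + k')" "k = ty" "l = ty"
    using assms(4) by (simp_all add: flag_item_def e)
  have F: "v \<in> FV" using assms(1-3) v(1) by (auto simp: FV_def)
  have "\<exists>c' i' m' b'. dat v = (r, c', i', (s, k', m', ty), b') \<and> nat (8 * c' + int m') = 8 * c + m"
  proof (cases "i = 0")
    case True
    then have "(s, k', m, ty) = (1, 1, 3, 2)" using e by (simp add: entry_def base_tab_def)
    then show ?thesis using True v(1) by (auto simp: nat_add_distrib nat_mult_distrib)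
  next
    case False
    then have "dat v = (r, int c, i, (s, k', m, ty), wstate (phase r c) (up c) (tg r c) i)"
      using v(1) e tg_entry[OF assms(2,3), of r] by simp
    then show ?thesis by (auto simp: nat_add_distrib nat_mult_distrib)
  qed
  then obtain c' i' m' b' where d: "dat v = (r, c', i', (s, k', m', ty), b')" "8 * c + m = nat (8 * c' + int m')" by metis
  show ?thesis using FV_item[OF F d] v unfolding new_item_def by blast
qed

lemma new_unit_item:
  assumes "r < R" "c < C" "(v, a, b, k, l) \<in> {(Fl r c 42, Bd (4 * r + 1) (8 * c + 7), Bd (4 * r + 1) (8 * c + 8), 1, 1),
      (Fl r c 43, Bd (4 * r + 1) (8 * c + 7), Fl r c 42, 1, 3), (Fl r c 44, Bd (4 * r + 1) (8 * c + 8), Fl r c 42, 1, 3)}"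
  shows "new_item v a b k l"
proof -
  have N: "Fl r c 42 \<in> NV" "Fl r c 43 \<in> NV" "Fl r c 44 \<in> NV" using assms(1,2) by (auto simp: NV_def FV_def)
  have len: "len_of 1 = 7 / 13" "len_of 3 = 2 / 13" by (simp_all add: len_of_def)
  note d = unit_dist[OF unit_equi[of r c], folded unit_apex] unit_dist[OF equi_perm(1)[OF unit_equi[of r c]], folded unit_apex']
  have n: "nb (Fl r c 43) = {Bd (4 * r + 1) (8 * c + 7), Fl r c 42}" "nb (Fl r c 44) = {Bd (4 * r + 1) (8 * c + 8), Fl r c 42}" by simp_all
  have D: "dist (wp (Fl r c 43)) (ua r c) = 7/13 \<and> dist (wp (Fl r c 43)) (wp (Fl r c 42)) = 2/13"
    "dist (wp (Fl r c 44)) (ub r c) = 7/13 \<and> dist (wp (Fl r c 44)) (wp (Fl r c 42)) = 2/13"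
    using d by (cases "up (int c)"; simp only: wp.simps(3)[of r c 43] wp.simps(3)[of r c 44]; simp del: wp.simps)+
  have D42: "dist (wp (Fl r c 42)) (ua r c) = 7/13 \<and> dist (wp (Fl r c 42)) (ub r c) = 7/13"
    using apex_dist[OF unit_equi[of r c], of 1] unfolding unit_apex len by simp
  from assms(3) consider "(v, a, b, k, l) = (Fl r c 42, Bd (4 * r + 1) (8 * c + 7), Bd (4 * r + 1) (8 * c + 8), 1, 1)"
    | "(v, a, b, k, l) = (Fl r c 43, Bd (4 * r + 1) (8 * c + 7), Fl r c 42, 1, 3)"
    | "(v, a, b, k, l) = (Fl r c 44, Bd (4 * r + 1) (8 * c + 8), Fl r c 42, 1, 3)" by (elim insertE emptyE)
  then show ?thesis
  proof cases
    case 1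
    then have v: "v = Fl r c 42" "a = Bd (4 * r + 1) (8 * c + 7)" "b = Bd (4 * r + 1) (8 * c + 8)" "k = 1" "l = 1" by simp_all
    show ?thesis unfolding new_item_def v wp_unit len using N(1) unit_nb D42 by blast
  next
    case 2
    then have v: "v = Fl r c 43" "a = Bd (4 * r + 1) (8 * c + 7)" "b = Fl r c 42" "k = 1" "l = 3" by simp_all
    show ?thesis unfolding new_item_def v wp_unit len using N(2) n D by blast
  next
    case 3
    then have v: "v = Fl r c 44" "a = Bd (4 * r + 1) (8 * c + 8)" "b = Fl r c 42" "k = 1" "l = 3" by simp_all
    show ?thesis unfolding new_item_def v wp_unit len using N(3) n D by blast
  qed
qed

lemma new_end_item:
  assumes "r < R" "(v, a, b, k, l) \<in> set (row_ends r)" shows "new_item v a b k l"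
proof -
  from assms(2) consider "(v, a, b, k, l) = (En r 0, Bd (4 * r + 1) 3, Bd (4 * r + 1) 4, 2, 2)"
    | "(v, a, b, k, l) = (En r 1, Bd (4 * r + 1) (8 * C + 3), Bd (4 * r + 1) (8 * C + 4), 2, 2)"
    | "(v, a, b, k, l) = (En r 2, Bd (4 * r + 1) (8 * C + 3), Bd (4 * r + 1) (8 * C + 4), 2, 2)"
    unfolding row_ends_def set_simps by (elim insertE emptyE)
  then show ?thesis
  proof cases
    case 1
    then have v: "v = En r 0" "a = Bd (4 * r + 1) 3" "b = Bd (4 * r + 1) (3 + 1)" "k = 2" "l = 2" by simp_all
    have F: "En r 0 \<in> FV" using assms(1) by (simp add: FV_def)
    have d: "dat (En r 0) = (r, -1, 45, (1,1,11,2), False)" by simp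
    have n: "3 = nat (8 * (-1) + int 11)" by arith
    show ?thesis unfolding new_item_def v using FV_item[OF F d n] by blast
  next
    case 2
    then have v: "v = En r 1" "a = Bd (4 * r + 1) (8 * C + 3)" "b = Bd (4 * r + 1) (8 * C + 3 + 1)" "k = 2" "l = 2" by simp_all
    have F: "En r 1 \<in> FV" using assms(1) by (simp add: FV_def)
    have d: "dat (En r 1) = (r, int C - 1, 45, (1,1,11,2), False)" by simp
    have "8 * (int C - 1) + int 11 = int (8 * C + 3)" by simp
    then have n: "8 * C + 3 = nat (8 * (int C - 1) + int 11)" by (simp only: nat_int)
    show ?thesis unfolding new_item_def v using FV_item[OF F d n] by blast
  next
    case 3
    then have v: "v = En r 2" "a = Bd (4 * r + 1) (8 * C + 3)" "b = Bd (4 * r + 1) (8 * C + 3 + 1)" "k = 2" "l = 2" by simp_all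
    have F: "En r 2 \<in> FV" using assms(1) by (simp add: FV_def)
    have "8 * int C + int 3 = int (8 * C + 3)" by simp
    then have n: "8 * C + 3 = nat (8 * int C + int 3)" by (simp only: nat_int)
    have d: "dat (En r 2) = (r, int C, 0, (1,1,3,2), True)" by simp
    show ?thesis unfolding new_item_def v using FV_item[OF F d n] by blast
  qed
qed

lemma body_or_new:
  assumes "(v, a, b, k, l) \<in> set items"
  shows "((\<exists>j m. v = Bd j m) \<and> (\<exists>L. bed a v L) \<and> (\<exists>L. bed b v L \<or> bed v b L) \<and>
      dist (wp v) (wp a) = len_of k \<and> dist (wp v) (wp b) = len_of l) \<or> new_item v a b k l"
  using items_cases[OF assms]
proof (elim disjE exE conjE)
  fix j m assume v: "v = Bd j (m + 2)" "a = Bd j (m + 1)" "b = Bd j m" "k = 0" "l = 0"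
  have "bed a v (int j, int (m + 1), 1)" "bed b v (int j, int m, 2)"
    using bed.intros(1)[of j "m + 1"] bed.intros(2)[of j m] v by simp_all
  moreover have "dist (wp v) (wp a) = len_of k \<and> dist (wp v) (wp b) = len_of l"
    using equi_Z[of j m] v by (simp add: equi_def dist_commute len_of_def)
  ultimately show ?thesis using v(1) by blast
next
  fix j assume v: "v = Bd (j + 1) 0" "a = Bd j 1" "b = Bd j 3" "k = 1" "l = 0"
  have "bed a v (int j, 0, 4)" "bed b v (int j, 0, 5)" unfolding v by (rule bed.intros)+
  moreover have "dist (wp v) (wp a) = len_of k \<and> dist (wp v) (wp b) = len_of l"
    using Z_spine[of j] unfolding v wp.simps by (simp add: len_of_def)
  ultimately show ?thesis using v(1) by blast
next
  fix j assume v: "v = Bd (j + 1) 2" "a = Bd j 3" "b = Bd (j + 1) 0" "k = 1" "l = 0"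
  have "bed a v (int j, 1, 4)" "bed b v (int (j + 1), int 0, 2)"
    using bed.intros(5)[of j] bed.intros(2)[of "j + 1" 0] v by (simp_all only: add_0)
  moreover have "dist (wp v) (wp a) = len_of k \<and> dist (wp v) (wp b) = len_of l"
    using Z_spine[of j] equi_Z[of "j + 1" 0, unfolded add_0] unfolding v wp.simps by (simp add: len_of_def equi_def dist_commute)
  ultimately show ?thesis using v(1) by blast
next
  fix j assume v: "v = Bd (j + 1) 1" "a = Bd (j + 1) 0" "b = Bd (j + 1) 2" "k = 0" "l = 0"
  have "bed a v (int (j + 1), int 0, 1)" using bed.intros(1)[of "j + 1" 0] unfolding v by (simp only: add_0)
  moreover have "bed v b (int (j + 1), int 1, 1)" using bed.intros(1)[of "j + 1" 1] unfolding v by (simp only: one_add_one)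
  moreover have "dist (wp v) (wp a) = len_of k \<and> dist (wp v) (wp b) = len_of l"
    using equi_Z[of "j + 1" 0, unfolded add_0] unfolding v wp.simps by (simp add: len_of_def equi_def dist_commute)
  ultimately show ?thesis using v(1) by blast
next
  fix r c i assume "r < R" "c < C" "i < 42" "(v, a, b, k, l) = flag_item r c i"
  then show ?thesis using new_flag_item by blast
next
  fix r c assume "r < R" "c < C" "(v, a, b, k, l) \<in> {(Fl r c 42, Bd (4 * r + 1) (8 * c + 7), Bd (4 * r + 1) (8 * c + 8), 1, 1),
      (Fl r c 43, Bd (4 * r + 1) (8 * c + 7), Fl r c 42, 1, 3), (Fl r c 44, Bd (4 * r + 1) (8 * c + 8), Fl r c 42, 1, 3)}"
  then show ?thesis by (intro disjI2 new_unit_item)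
next
  fix r assume "r < R" "(v, a, b, k, l) \<in> set (row_ends r)"
  then show ?thesis by (intro disjI2 new_end_item)
qed

lemma V_cases: "v \<in> V \<Longrightarrow> (\<exists>j m. v = Bd j m) \<or> v \<in> NV"
proof -
  assume "v \<in> V"
  then consider "v = Bd 0 0 \<or> v = Bd 0 1" | a b k l where "(v, a, b, k, l) \<in> set items" unfolding V_def by auto
  then show ?thesis
  proof cases
    case 2
    then show ?thesis using body_or_new[OF 2] unfolding new_item_def by blast
  qed blast
qed

lemma E_cases:
  assumes "{a, b} \<in> E"
  shows "(\<exists>a' b' L. bed a' b' L \<and> {a', b'} = {a, b}) \<or> (\<exists>v x. v \<in> NV \<and> x \<in> nb v \<and> {v, x} = {a, b})"
proof -
  consider "{a, b} = {Bd 0 0, Bd 0 1}" | v x y k l where "(v, x, y, k, l) \<in> set items" "{a, b} = {v, x} \<or> {a, b} = {v, y}"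
    using assms unfolding E_def by auto
  then show ?thesis
  proof cases
    case 1
    then show ?thesis using bed.intros(1)[of 0 0] by (metis add_0)
  next
    case 2
    from body_or_new[OF 2(1)] 2(2) show ?thesis unfolding new_item_def
      by (metis insert_commute insertCI)
  qed
qed

lemma unit_facts:
  fixes r c
  defines "A \<equiv> ua r c" and "B \<equiv> ub r c" and "F \<equiv> wp (Fl r c 42)" and "G \<equiv> wp (Fl r c 43)" and "H \<equiv> wp (Fl r c 44)"
  shows "open_segment F A \<inter> open_segment H B = {} \<and> open_segment F B \<inter> open_segment G A = {} \<and>
    open_segment G A \<inter> open_segment H B = {} \<and> open_segment G A \<inter> open_segment H F = {} \<and>
    open_segment G F \<inter> open_segment H B = {} \<and> F \<notin> open_segment G A \<and> F \<notin> open_segment H B \<and>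
    G \<notin> open_segment F A \<and> G \<notin> open_segment F B \<and> G \<notin> open_segment H B \<and> G \<notin> open_segment H F \<and>
    H \<notin> open_segment F A \<and> H \<notin> open_segment F B \<and> H \<notin> open_segment G A \<and> H \<notin> open_segment G F \<and>
    F \<noteq> G \<and> F \<noteq> H \<and> G \<noteq> H"
proof (cases "up (int c)")
  case True
  have "wp (Fl r c 43) = (5 * ua r c + 3 * ub r c + 5 * ut r c) / 13" "wp (Fl r c 44) = (277 * ub r c + 323 * ua r c + 37 * ut r c) / 637"
    using True by simp_all
  note s = unit_separation(2-)[OF unit_equi unit_apex this]
  show ?thesis unfolding A_def B_def F_def G_def H_def by (intro conjI) (rule s | (subst Int_commute, rule s) | (rule not_sym, rule s))+
next
  case False
  have "wp (Fl r c 44) = (5 * ub r c + 3 * ua r c + 5 * ut r c) / 13" "wp (Fl r c 43) = (277 * ua r c + 323 * ub r c + 37 * ut r c) / 637"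
    using False by simp_all
  note s = unit_separation(2-)[OF equi_perm(1)[OF unit_equi] unit_apex' this]
  show ?thesis unfolding A_def B_def F_def G_def H_def by (intro conjI) (rule s | (subst Int_commute, rule s) | (rule not_sym, rule s))+
qed

lemma unit_pair:
  assumes "v \<in> NV" "w \<in> NV" "rep v = rep w" "v \<noteq> w"
  shows "wp v \<noteq> wp w" "y \<in> nb w \<Longrightarrow> v \<noteq> y \<Longrightarrow> wp v \<notin> open_segment (wp w) (wp y)"
    "x \<in> nb v \<Longrightarrow> y \<in> nb w \<Longrightarrow> {v, x} \<inter> {w, y} = {} \<Longrightarrow> open_segment (wp v) (wp x) \<inter> open_segment (wp w) (wp y) = {}"
proof -
  have "\<exists>r c i j. v = Fl r c i \<and> w = Fl r c j \<and> (i = 42 \<or> i = 43 \<or> i = 44) \<and> (j = 42 \<or> j = 43 \<or> j = 44) \<and> i \<noteq> j"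
    using assms(3,4) by (cases v; cases w) (auto split: if_splits)
  then obtain r c i j where v: "v = Fl r c i" "w = Fl r c j" and ij: "i = 42 \<or> i = 43 \<or> i = 44" "j = 42 \<or> j = 43 \<or> j = 44" "i \<noteq> j"
    by blast
  note uf = unit_facts[of r c]
  define A where "A = Bd (4 * r + 1) (8 * c + 7)"
  define B where "B = Bd (4 * r + 1) (8 * c + 8)"
  have AB: "ua r c = wp A" "ub r c = wp B" unfolding A_def B_def wp_unit by simp_all
  have n: "nb (Fl r c 42) = {A, B}" "nb (Fl r c 43) = {A, Fl r c 42}" "nb (Fl r c 44) = {B, Fl r c 42}"
    unfolding A_def B_def by (simp_all only: unit_nb) simp_all
  define F where "F = Fl r c 42"
  define G where "G = Fl r c 43"
  define H where "H = Fl r c 44"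
  note uf = uf[folded F_def G_def H_def, unfolded AB] and n = n[folded F_def G_def H_def]
  have vw: "(v = F \<and> w = G) \<or> (v = F \<and> w = H) \<or> (v = G \<and> w = F) \<or> (v = G \<and> w = H) \<or> (v = H \<and> w = F) \<or> (v = H \<and> w = G)"
    using v ij unfolding F_def G_def H_def by blast
  show "wp v \<noteq> wp w" using vw uf by metis
  have uc: "open_segment (wp H) (wp B) \<inter> open_segment (wp F) (wp A) = {}" "open_segment (wp G) (wp A) \<inter> open_segment (wp F) (wp B) = {}"
    "open_segment (wp H) (wp B) \<inter> open_segment (wp G) (wp A) = {}" "open_segment (wp H) (wp F) \<inter> open_segment (wp G) (wp A) = {}"
    "open_segment (wp H) (wp B) \<inter> open_segment (wp G) (wp F) = {}"
    by (subst Int_commute, use uf in simp)+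
  have y: "v \<noteq> y \<Longrightarrow> wp v \<notin> open_segment (wp w) (wp y)" if "y \<in> nb w" for y
    using vw
  proof (elim disjE conjE)
    assume *: "v = F" "w = G"
    with that n have "y = A \<or> y = F" by simp
    then show "v \<noteq> y \<Longrightarrow> wp v \<notin> open_segment (wp w) (wp y)" by (rule disjE) (simp_all add: * uf)
  next
    assume *: "v = F" "w = H"
    with that n have "y = B \<or> y = F" by simp
    then show "v \<noteq> y \<Longrightarrow> wp v \<notin> open_segment (wp w) (wp y)" by (rule disjE) (simp_all add: * uf)
  next
    assume *: "v = G" "w = F"
    with that n have "y = A \<or> y = B" by simp
    then show "v \<noteq> y \<Longrightarrow> wp v \<notin> open_segment (wp w) (wp y)" by (rule disjE) (simp_all add: * uf)
  next
    assume *: "v = G" "w = H"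
    with that n have "y = B \<or> y = F" by simp
    then show "v \<noteq> y \<Longrightarrow> wp v \<notin> open_segment (wp w) (wp y)" by (rule disjE) (simp_all add: * uf)
  next
    assume *: "v = H" "w = F"
    with that n have "y = A \<or> y = B" by simp
    then show "v \<noteq> y \<Longrightarrow> wp v \<notin> open_segment (wp w) (wp y)" by (rule disjE) (simp_all add: * uf)
  next
    assume *: "v = H" "w = G"
    with that n have "y = A \<or> y = F" by simp
    then show "v \<noteq> y \<Longrightarrow> wp v \<notin> open_segment (wp w) (wp y)" by (rule disjE) (simp_all add: * uf)
  qed
  then show "y \<in> nb w \<Longrightarrow> v \<noteq> y \<Longrightarrow> wp v \<notin> open_segment (wp w) (wp y)" by blast
  assume xy: "x \<in> nb v" "y \<in> nb w" and d: "{v, x} \<inter> {w, y} = {}"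
  show "open_segment (wp v) (wp x) \<inter> open_segment (wp w) (wp y) = {}"
    using vw
  proof (elim disjE conjE)
    assume *: "v = F" "w = G"
    with xy n have "x = A \<or> x = B" "y = A \<or> y = F" by simp_all
    then show ?thesis using d by (elim disjE) (simp_all add: * uf uc)
  next
    assume *: "v = F" "w = H"
    with xy n have "x = A \<or> x = B" "y = B \<or> y = F" by simp_all
    then show ?thesis using d by (elim disjE) (simp_all add: * uf uc)
  next
    assume *: "v = G" "w = F"
    with xy n have "x = A \<or> x = F" "y = A \<or> y = B" by simp_all
    then show ?thesis using d by (elim disjE) (simp_all add: * uf uc)
  next
    assume *: "v = G" "w = H"
    with xy n have "x = A \<or> x = F" "y = B \<or> y = F" by simp_all
    then show ?thesis using d by (elim disjE) (simp_all add: * uf uc)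
  next
    assume *: "v = H" "w = F"
    with xy n have "x = B \<or> x = F" "y = A \<or> y = B" by simp_all
    then show ?thesis using d by (elim disjE) (simp_all add: * uf uc)
  next
    assume *: "v = H" "w = G"
    with xy n have "x = B \<or> x = F" "y = A \<or> y = F" by simp_all
    then show ?thesis using d by (elim disjE) (simp_all add: * uf uc)
  qed
qed

lemma wp_inj:
  assumes "v \<in> V" "w \<in> V" "wp v = wp w" shows "v = w"
proof (rule ccontr)
  assume ne: "v \<noteq> w"
  have self: "wp x \<in> feat x" for x by (simp add: feat_def)
  from V_cases[OF assms(1)] V_cases[OF assms(2)] show False
  proof (elim disjE exE)
    fix j m j' m' assume *: "v = Bd j m" "w = Bd j' m'"
    have "loc (wp v) = (int j, int m, 0)" "loc (wp w) = (int j', int m', 0)" unfolding * wp.simps by (rule loc_vertex)+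
    then have "(int j, int m, 0 :: nat) = (int j', int m', 0)" unfolding assms(3) by (rule trans[OF sym])
    then show False using ne unfolding * by simp
  next
    fix j m assume *: "v = Bd j m" "w \<in> NV"
    have "loc (wp v) = (int j, int m, 0)" unfolding * wp.simps by (rule loc_vertex)
    then have "cl w = (int j, int m, 0)" unfolding assms(3) feat_loc[OF *(2) self] .
    then show False using cl_label[OF *(2)] by simp
  next
    fix j m assume *: "v \<in> NV" "w = Bd j m"
    have "loc (wp w) = (int j, int m, 0)" unfolding * wp.simps by (rule loc_vertex)
    then have "cl v = (int j, int m, 0)" unfolding assms(3)[symmetric] feat_loc[OF *(1) self] .
    then show False using cl_label[OF *(1)] by simp
  next
    assume 4: "v \<in> NV" "w \<in> NV"
    have "cl v = cl w" using feat_loc[OF 4(1) self] feat_loc[OF 4(2) self] unfolding assms(3) by (rule trans[OF sym])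
    moreover have "wp w \<in> feat v \<inter> feat w" using self[of v] self[of w] unfolding assms(3) by (rule IntI)
    ultimately have r: "rep v = rep w" using feat_disjoint[OF 4] by blast
    show False using unit_pair(1)[OF 4 r ne] assms(3) by (rule notE)
  qed
qed

lemma feat_segment: "x \<in> nb v \<Longrightarrow> P \<in> open_segment (wp v) (wp x) \<Longrightarrow> P \<in> feat v"
  unfolding feat_def by blast

lemma vertex_off_edge:
  assumes "u \<in> V" "wp u \<in> open_segment (wp a) (wp b)" "{a, b} \<in> E" "u \<noteq> a" "u \<noteq> b"
  shows False
proof -
  have self: "wp x \<in> feat x" for x by (simp add: feat_def)
  have oc: "{a', b'} = {a, b} \<Longrightarrow> wp u \<in> open_segment (wp a') (wp b')" for a' b'
    using assms(2) by (auto simp: doubleton_eq_iff open_segment_commute)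
  from E_cases[OF assms(3)] show False
  proof (elim disjE exE conjE)
    fix a' b' L assume e: "bed a' b' L" "{a', b'} = {a, b}"
    have L: "loc (wp u) = L" by (rule bed_loc[OF e(1) oc[OF e(2)]])
    from V_cases[OF assms(1)] show False
    proof (elim disjE exE)
      fix j m assume "u = Bd j m"
      then show False using L loc_vertex[of j m] bed_label[OF e(1)] by auto
    next
      assume "u \<in> NV"
      then show False using L feat_loc[OF _ self] cl_label bed_label[OF e(1)] by fastforce
    qed
  next
    fix v x assume v: "v \<in> NV" "x \<in> nb v" "{v, x} = {a, b}"
    have P: "wp u \<in> open_segment (wp v) (wp x)" by (rule oc[OF v(3)])
    have L: "loc (wp u) = cl v" by (rule feat_loc[OF v(1) feat_segment[OF v(2) P]])
    have ne: "u \<noteq> v" "u \<noteq> x" using v(3) assms(4,5) by (auto simp: doubleton_eq_iff)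
    from V_cases[OF assms(1)] show False
    proof (elim disjE exE)
      fix j m assume "u = Bd j m"
      then have "cl v = (int j, int m, 0)" using L loc_vertex[of j m] by simp
      then show False using cl_label[OF v(1)] by simp
    next
      assume u: "u \<in> NV"
      have "cl u = cl v" using L feat_loc[OF u self] by simp
      then have "rep u = rep v" using feat_disjoint[OF u v(1)] self[of u] feat_segment[OF v(2) P] by blast
      then show False using unit_pair(2)[OF u v(1) _ ne(1) v(2) ne(2)] P by blast
    qed
  qed
qed

lemma edges_disjoint:
  assumes "P \<in> open_segment (wp a) (wp b)" "P \<in> open_segment (wp c) (wp d)" "{a, b} \<in> E" "{c, d} \<in> E" "{a, b} \<inter> {c, d} = {}"
  shows False
proof -
  have oc: "{a', b'} = {a, b} \<Longrightarrow> P \<in> open_segment (wp a') (wp b')" "{a', b'} = {c, d} \<Longrightarrow> P \<in> open_segment (wp a') (wp b')" for a' b'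
    using assms(1,2) by (auto simp: doubleton_eq_iff open_segment_commute)
  have bn: False if e: "bed a' b' L" "P \<in> open_segment (wp a') (wp b')" and v: "v \<in> NV" "x \<in> nb v" "P \<in> open_segment (wp v) (wp x)"
    for a' b' L v x
  proof -
    have "L = cl v" using bed_loc[OF e] feat_loc[OF v(1) feat_segment[OF v(2,3)]] by simp
    then show False using bed_label[OF e(1)] cl_label[OF v(1)] by auto
  qed
  from E_cases[OF assms(3)] E_cases[OF assms(4)] show False
  proof (elim disjE exE conjE)
    fix a' b' L c' d' L' assume e: "bed a' b' L" "{a', b'} = {a, b}" "bed c' d' L'" "{c', d'} = {c, d}"
    have "L = L'" using bed_loc[OF e(1) oc(1)[OF e(2)]] bed_loc[OF e(3) oc(2)[OF e(4)]] by simp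
    then have "{a', b'} = {c', d'}" using bed_unique e(1,3) by blast
    then show False using e(2,4) assms(5) by blast
  next
    fix a' b' L v x assume "bed a' b' L" "{a', b'} = {a, b}" "v \<in> NV" "x \<in> nb v" "{v, x} = {c, d}"
    then show False using bn oc by metis
  next
    fix a' b' L v x assume "bed a' b' L" "{a', b'} = {c, d}" "v \<in> NV" "x \<in> nb v" "{v, x} = {a, b}"
    then show False using bn oc by metis
  next
    fix v x w y assume v: "v \<in> NV" "x \<in> nb v" "{v, x} = {a, b}" and w: "w \<in> NV" "y \<in> nb w" "{w, y} = {c, d}"
    note P = oc(1)[OF v(3)] oc(2)[OF w(3)]
    have ne: "{v, x} \<inter> {w, y} = {}" using assms(5) unfolding v(3) w(3) .
    have "cl v = cl w" using feat_loc[OF v(1) feat_segment[OF v(2) P(1)]] feat_loc[OF w(1) feat_segment[OF w(2) P(2)]] by simp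
    then have "rep v = rep w" using feat_disjoint[OF v(1) w(1)] feat_segment[OF v(2) P(1)] feat_segment[OF w(2) P(2)] by blast
    then show False using unit_pair(3)[OF v(1) w(1) _ _ v(2) w(2) ne] ne P by blast
  qed
qed

lemma realizes_wp:
  assumes EV: "\<And>e. e \<in> E \<Longrightarrow> e \<subseteq> V" shows "realizes wp"
  unfolding realizes_def
proof (intro conjI)
  show "dist (wp (Bd 0 0)) (wp (Bd 0 1)) = 1" using equi_Z[of 0 0] by (simp add: equi_def)
  show "\<forall>(v, a, b, k, l)\<in>set items. dist (wp v) (wp a) = len_of k \<and> dist (wp v) (wp b) = len_of l"
    using body_or_new unfolding new_item_def by blast
  have vertex: "u = a \<or> u = b" if "{a, b} \<in> E" "u \<in> V" "wp u \<in> closed_segment (wp a) (wp b)" for a b u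
    using closed_segment_cases[OF that(3)] vertex_off_edge[OF that(2) _ that(1)] wp_inj[OF that(2)] EV[OF that(1)] by blast
  have edge: "closed_segment (wp a) (wp b) \<inter> closed_segment (wp c) (wp d) = {}"
    if "{a, b} \<in> E" "{c, d} \<in> E" "{a, b} \<inter> {c, d} = {}" for a b c d
  proof (rule equals0I)
    fix P assume P: "P \<in> closed_segment (wp a) (wp b) \<inter> closed_segment (wp c) (wp d)"
    have ends: "a \<in> V" "b \<in> V" "c \<in> V" "d \<in> V" using EV that(1,2) by blast+
    have "P \<noteq> wp a" "P \<noteq> wp b" using P vertex[OF that(2)] ends that(3) by blast+
    moreover have "P \<noteq> wp c" "P \<noteq> wp d" using P vertex[OF that(1)] ends that(3) by blast+
    ultimately have "P \<in> open_segment (wp a) (wp b)" "P \<in> open_segment (wp c) (wp d)"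
      using P closed_segment_cases by blast+
    then show False using edges_disjoint that by blast
  qed
  show "straight V E wp" unfolding straight_def using wp_inj vertex edge by (auto intro: inj_onI)
qed

end

section \<open>Graphs built by attaching vertices to edges\<close>

text \<open>Disjoint compact sets have positive distance, and moving one end of a segment by less
  than this distance moves none of its points further.\<close>

lemma nearby_segment:
  fixes m x w :: complex
  assumes "compact K" "closed_segment m x \<inter> K = {}"
  shows "eventually (\<lambda>\<epsilon>. closed_segment (m + of_real \<epsilon> * w) x \<inter> K = {}) (at_right (0::real))"
proof -
  obtain d where d: "0 < d" "\<And>y z. y \<in> closed_segment m x \<Longrightarrow> z \<in> K \<Longrightarrow> d \<le> dist y z"
    using separate_compact_closed[OF compact_segment compact_imp_closed[OF assms(1)] assms(2)] by blast
  have "closed_segment (m + of_real \<epsilon> * w) x \<inter> K = {}" if e: "0 < \<epsilon>" "\<epsilon> < d / (cmod w + 1)" for \<epsilon>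
  proof (rule equals0I)
    fix y assume y: "y \<in> closed_segment (m + of_real \<epsilon> * w) x \<inter> K"
    then obtain u where u: "0 \<le> u" "u \<le> 1" "y = (1 - u) *\<^sub>R (m + of_real \<epsilon> * w) + u *\<^sub>R x" by (auto simp: in_segment)
    define y' where "y' = (1 - u) *\<^sub>R m + u *\<^sub>R x"
    have "y' \<in> closed_segment m x" using u by (auto simp: in_segment y'_def)
    then have "d \<le> dist y' y" using d(2) y by blast
    also have "dist y' y = (1 - u) * \<epsilon> * cmod w"
    proof -
      have "y' - y = - (of_real ((1 - u) * \<epsilon>) * w)" by (simp add: u(3) y'_def scaleR_conv_of_real algebra_simps)
      moreover have "\<bar>(1 - u) * \<epsilon>\<bar> = (1 - u) * \<epsilon>" using u e(1) by simp
      ultimately show ?thesis by (simp only: dist_norm norm_minus_cancel norm_mult norm_of_real)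
    qed
    also have "\<dots> \<le> \<epsilon> * cmod w" using u e(1) by (simp add: mult_left_le_one_le mult_right_mono)
    also have "\<dots> \<le> \<epsilon> * (cmod w + 1)" using e(1) by simp
    also have "\<dots> < d" using e(2) by (simp add: less_divide_eq add_nonneg_pos)
    finally show False by simp
  qed
  moreover have "0 < d / (cmod w + 1)" using d(1) by (simp add: add_nonneg_pos)
  ultimately show ?thesis unfolding eventually_at_right_field by blast
qed

text \<open>Planarity is required of the instances that cannot be realized as well, so it is proved
  without regard to lengths: the new vertex is put very close to the midpoint of the edge it is
  attached to.\<close>

lemma straight_ear:
  assumes s: "straight V E p" and fin: "finite V" "finite E" and ab: "{a, b} \<in> E" and v: "v \<notin> V"
    and E: "\<And>e. e \<in> E \<Longrightarrow> e \<subseteq> V \<and> card e = 2"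
  shows "\<exists>q. straight (insert v V) (E \<union> {{v, a}, {v, b}}) (p(v := q))"
proof -
  have inj: "inj_on p V" and on: "\<And>a b v. {a, b} \<in> E \<Longrightarrow> v \<in> V \<Longrightarrow> p v \<in> closed_segment (p a) (p b) \<Longrightarrow> v = a \<or> v = b"
    and dis: "\<And>a b c d. {a, b} \<in> E \<Longrightarrow> {c, d} \<in> E \<Longrightarrow> {a, b} \<inter> {c, d} = {} \<Longrightarrow>
        closed_segment (p a) (p b) \<inter> closed_segment (p c) (p d) = {}"
    using s unfolding straight_def by blast+
  have abV: "a \<in> V" "b \<in> V" "a \<noteq> b" using E[OF ab] by (auto simp: card_2_iff)
  define m where "m = (p a + p b) / 2"
  \<comment> \<open>The direction perpendicular to the edge; leaving the midpoint along it leaves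
    the line of the edge.\<close>
  define w where "w = \<i> * (p b - p a)"
  have ne: "p a \<noteq> p b" using inj abV by (auto dest: inj_onD)
  have half: "closed_segment m (p x) \<subseteq> closed_segment (p x) (p y) \<and> p y \<notin> closed_segment m (p x)"
    if xy: "(x = a \<and> y = b) \<or> (x = b \<and> y = a)" for x y
  proof -
    have mx: "m = (1/2) *\<^sub>R p x + (1/2) *\<^sub>R p y" using xy by (auto simp: m_def scaleR_conv_of_real field_simps)
    have "m \<in> closed_segment (p x) (p y)" unfolding in_segment mx by (rule exI[of _ "1/2"]) simp
    then have 1: "closed_segment m (p x) \<subseteq> closed_segment (p x) (p y)" by (simp add: subset_closed_segment)
    have "p y \<noteq> (1 - u) *\<^sub>R m + u *\<^sub>R p x" if "0 \<le> u" for u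
    proof
      assume "p y = (1 - u) *\<^sub>R m + u *\<^sub>R p x"
      then have "(1 + u) *\<^sub>R (p y - p x) = 0" unfolding mx by (simp add: scaleR_conv_of_real field_simps)
      then show False using that ne xy by auto
    qed
    with 1 show ?thesis by (auto simp: in_segment)
  qed
  have C1: "closed_segment m (p x) \<inter> {p u} = {}" if xy: "(x = a \<and> y = b) \<or> (x = b \<and> y = a)" and u: "u \<in> V" "u \<noteq> x" for x y u
  proof (rule ccontr)
    assume "\<not> ?thesis"
    then have *: "p u \<in> closed_segment m (p x)" by simp
    then have "p u \<in> closed_segment (p x) (p y)" using half[OF xy] by blast
    moreover have "{x, y} \<in> E" using xy ab by (auto simp: insert_commute)
    ultimately have "u = y" using on u by blast
    then show False using * half[OF xy] by blast
  qed
  \<comment> \<open>In the limit the new edges are the halves of the old edge. A half avoids every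
    edge that does not contain its end \<open>x\<close>, including those at the other end
    \<open>y\<close>, and this survives a small displacement.\<close>
  have C2: "closed_segment m (p x) \<inter> closed_segment (p c) (p d) = {}"
    if xy: "(x = a \<and> y = b) \<or> (x = b \<and> y = a)" and cd: "{c, d} \<in> E" "x \<notin> {c, d}" for x y c d
  proof (rule equals0I)
    fix z assume z: "z \<in> closed_segment m (p x) \<inter> closed_segment (p c) (p d)"
    have xyE: "{x, y} \<in> E" using xy ab by (auto simp: insert_commute)
    have zxy: "z \<in> closed_segment (p y) (p x)" using z half[OF xy] by (auto simp: closed_segment_commute)
    have zy: "z \<noteq> p y" using z half[OF xy] by blast
    have "y \<in> {c, d}"
    proof (rule ccontr)
      assume "y \<notin> {c, d}"
      then have "{x, y} \<inter> {c, d} = {}" using cd(2) by simp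
      from dis[OF xyE cd(1) this] show False using z zxy by (auto simp: closed_segment_commute)
    qed
    then obtain d' where d': "{c, d} = {y, d'}" by auto
    have V': "d' \<in> V" "x \<in> V" "d' \<noteq> y" using E[OF cd(1)] abV xy unfolding d' by (auto simp: card_insert_if split: if_splits)
    have "z \<in> closed_segment (p y) (p d')"
      using z d' by (auto simp: doubleton_eq_iff closed_segment_commute)
    from segments_common_end[OF zxy this zy] show False
      using on[of y d' x] on[of y x d'] cd d' V' xyE xy abV(3) by (auto simp: insert_commute)
  qed
  have ab': "(a = a \<and> b = b) \<or> (a = b \<and> b = a)" "(b = a \<and> a = b) \<or> (b = b \<and> a = a)" by simp_all
  let ?Q = "\<lambda>\<epsilon>. m + of_real \<epsilon> * w"
  have ev1: "eventually (\<lambda>\<epsilon>. \<forall>u\<in>V - {x}. closed_segment (?Q \<epsilon>) (p x) \<inter> {p u} = {}) (at_right 0)"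
    if "(x = a \<and> y = b) \<or> (x = b \<and> y = a)" for x y
  proof (rule eventually_ball_finite)
    show "finite (V - {x})" using fin by simp
    show "\<forall>u\<in>V - {x}. eventually (\<lambda>\<epsilon>. closed_segment (?Q \<epsilon>) (p x) \<inter> {p u} = {}) (at_right 0)"
      by (intro ballI nearby_segment) (use C1[OF that] in auto)
  qed
  have ev2: "eventually (\<lambda>\<epsilon>. \<forall>e\<in>{e \<in> E. x \<notin> e}. closed_segment (?Q \<epsilon>) (p x) \<inter> convex hull (p ` e) = {}) (at_right 0)"
    if xy: "(x = a \<and> y = b) \<or> (x = b \<and> y = a)" for x y
  proof (rule eventually_ball_finite)
    show "finite {e \<in> E. x \<notin> e}" using fin by simp
    show "\<forall>e\<in>{e \<in> E. x \<notin> e}. eventually (\<lambda>\<epsilon>. closed_segment (?Q \<epsilon>) (p x) \<inter> convex hull (p ` e) = {}) (at_right 0)"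
    proof
      fix e assume e: "e \<in> {e \<in> E. x \<notin> e}"
      then have "card e = 2" using E by blast
      then obtain c d where cd: "e = {c, d}" by (auto simp: card_2_iff)
      show "eventually (\<lambda>\<epsilon>. closed_segment (?Q \<epsilon>) (p x) \<inter> convex hull (p ` e) = {}) (at_right 0)"
        unfolding cd hull_image_edge by (rule nearby_segment) (use C2[OF xy] e cd in auto)
    qed
  qed
  have pos: "eventually (\<lambda>\<epsilon>::real. 0 < \<epsilon>) (at_right 0)" by (simp add: eventually_at_right_less)
  have "eventually (\<lambda>\<epsilon>. 0 < \<epsilon> \<and> (\<forall>u\<in>V - {a}. closed_segment (?Q \<epsilon>) (p a) \<inter> {p u} = {}) \<and> (\<forall>u\<in>V - {b}. closed_segment (?Q \<epsilon>) (p b) \<inter> {p u} = {}) \<and>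
      (\<forall>e\<in>{e \<in> E. a \<notin> e}. closed_segment (?Q \<epsilon>) (p a) \<inter> convex hull (p ` e) = {}) \<and>
      (\<forall>e\<in>{e \<in> E. b \<notin> e}. closed_segment (?Q \<epsilon>) (p b) \<inter> convex hull (p ` e) = {})) (at_right 0)"
    by (intro eventually_conj pos ev1[OF ab'(1)] ev1[OF ab'(2)] ev2[OF ab'(1)] ev2[OF ab'(2)])
  from eventually_happens'[OF trivial_limit_at_right_real this]
  obtain \<epsilon> where e: "0 < \<epsilon> \<and> (\<forall>u\<in>V - {a}. closed_segment (?Q \<epsilon>) (p a) \<inter> {p u} = {}) \<and> (\<forall>u\<in>V - {b}. closed_segment (?Q \<epsilon>) (p b) \<inter> {p u} = {}) \<and>
      (\<forall>e\<in>{e \<in> E. a \<notin> e}. closed_segment (?Q \<epsilon>) (p a) \<inter> convex hull (p ` e) = {}) \<and>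
      (\<forall>e\<in>{e \<in> E. b \<notin> e}. closed_segment (?Q \<epsilon>) (p b) \<inter> convex hull (p ` e) = {})" by blast
  then have \<epsilon>: "0 < \<epsilon>" by blast
  have Q1: "u \<in> V \<Longrightarrow> u \<noteq> a \<Longrightarrow> p u \<notin> closed_segment (?Q \<epsilon>) (p a)" "u \<in> V \<Longrightarrow> u \<noteq> b \<Longrightarrow> p u \<notin> closed_segment (?Q \<epsilon>) (p b)" for u
    using e by blast+
  have Q2: "d \<in> E \<Longrightarrow> a \<notin> d \<Longrightarrow> closed_segment (?Q \<epsilon>) (p a) \<inter> convex hull (p ` d) = {}"
    "d \<in> E \<Longrightarrow> b \<notin> d \<Longrightarrow> closed_segment (?Q \<epsilon>) (p b) \<inter> convex hull (p ` d) = {}" for d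
    using e by blast+
  define q where "q = ?Q \<epsilon>"
  note Q1 = Q1[folded q_def] and Q2 = Q2[folded q_def]
  have qV: "p u \<noteq> q" if "u \<in> V" for u using Q1[OF that] abV by (cases "u = a") auto
  have qE: "q \<notin> closed_segment (p c) (p d)" if cd: "{c, d} \<in> E" for c d
  proof (cases "a \<in> {c, d} \<and> b \<in> {c, d}")
    case True
    then have "{c, d} = {a, b}" using abV(3) by auto
    then have *: "closed_segment (p c) (p d) = closed_segment (p a) (p b)" by (auto simp: doubleton_eq_iff closed_segment_commute)
    have "q \<noteq> (1 - u) *\<^sub>R p a + u *\<^sub>R p b" for u
    proof
      assume "q = (1 - u) *\<^sub>R p a + u *\<^sub>R p b"
      then have "(of_real (1/2 - u) + of_real \<epsilon> * \<i>) * (p b - p a) = 0"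
        by (simp add: q_def m_def w_def scaleR_conv_of_real field_simps)
      then have "of_real (1/2 - u) + of_real \<epsilon> * \<i> = 0" using ne by simp
      then show False using \<epsilon> by (simp add: complex_eq_iff)
    qed
    then show ?thesis unfolding * by (auto simp: in_segment)
  next
    case False
    then show ?thesis using Q2(1)[OF cd] Q2(2)[OF cd] unfolding hull_image_edge by auto
  qed
  have old: "\<And>c d. {c, d} \<in> E \<Longrightarrow> c \<in> V \<and> d \<in> V \<and> c \<noteq> v \<and> d \<noteq> v" using E v by blast
  let ?p = "p(v := q)"
  have pold: "u \<in> V \<Longrightarrow> ?p u = p u" for u using v by auto
  have newcase: "\<exists>x. (x = a \<or> x = b) \<and> {c, d} = {v, x} \<and> closed_segment (?p c) (?p d) = closed_segment q (p x)"
    if "{c, d} \<in> {{v, a}, {v, b}}" for c d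
    using that abV pold v by (auto simp: doubleton_eq_iff closed_segment_commute)
  have Q2': "closed_segment q (p x) \<inter> closed_segment (p c) (p d) = {}" if "x = a \<or> x = b" "{c, d} \<in> E" "x \<notin> {c, d}" for x c d
    using that Q2[of "{c, d}"] unfolding hull_image_edge by blast
  have "straight (insert v V) (E \<union> {{v, a}, {v, b}}) ?p"
    unfolding straight_def
  proof (intro conjI allI impI)
    show "inj_on ?p (insert v V)" using inj qV v by (auto simp: inj_on_def)
  next
    fix c d u assume *: "{c, d} \<in> E \<union> {{v, a}, {v, b}}" "u \<in> insert v V" "?p u \<in> closed_segment (?p c) (?p d)"
    show "u = c \<or> u = d"
    proof (cases "{c, d} \<in> E")
      case True
      have cd: "?p c = p c" "?p d = p d" using old[OF True] by auto
      have seg: "?p u \<in> closed_segment (p c) (p d)" using *(3) unfolding cd .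
      show ?thesis
      proof (cases "u = v")
        case eq: True
        have "q \<in> closed_segment (p c) (p d)" using seg unfolding eq fun_upd_same .
        with qE[OF True] show ?thesis by (rule notE)
      next
        case neq: False
        have "p u \<in> closed_segment (p c) (p d)" using seg unfolding fun_upd_other[OF neq] .
        moreover have "u \<in> V" using *(2) neq by blast
        ultimately show ?thesis by (intro on[OF True])
      qed
    next
      case False
      then have "{c, d} \<in> {{v, a}, {v, b}}" using *(1) by (simp only: Un_iff simp_thms)
      from newcase[OF this]
      obtain x where x: "x = a \<or> x = b" "{c, d} = {v, x}" "closed_segment (?p c) (?p d) = closed_segment q (p x)"
        by (elim exE conjE)
      have seg: "?p u \<in> closed_segment q (p x)" using *(3) unfolding x(3) .
      have "u = v \<or> u = x"
      proof (rule disjCI)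
        assume ux: "u \<noteq> x"
        show "u = v"
        proof (rule ccontr)
          assume neq: "u \<noteq> v"
          have "p u \<in> closed_segment q (p x)" using seg unfolding fun_upd_other[OF neq] .
          moreover have "u \<in> V" using *(2) neq by blast
          ultimately show False using Q1(1)[of u] Q1(2)[of u] x(1) ux by (elim disjE) simp_all
        qed
      qed
      then show ?thesis using doubleton_eq_iff[of c d v x, THEN iffD1, OF x(2)] by (elim disjE conjE) simp_all
    qed
  next
    fix c d c' d' assume *: "{c, d} \<in> E \<union> {{v, a}, {v, b}}" "{c', d'} \<in> E \<union> {{v, a}, {v, b}}" "{c, d} \<inter> {c', d'} = {}"
    from *(1,2) show "closed_segment (?p c) (?p d) \<inter> closed_segment (?p c') (?p d') = {}"
    proof (elim UnE)
      assume 1: "{c, d} \<in> E" "{c', d'} \<in> E"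
      have "?p c = p c" "?p d = p d" "?p c' = p c'" "?p d' = p d'" using old[OF 1(1)] old[OF 1(2)] by auto
      then show ?thesis using dis[OF 1 *(3)] by (simp only:)
    next
      assume 2: "{c, d} \<in> {{v, a}, {v, b}}" "{c', d'} \<in> E"
      obtain x where x: "x = a \<or> x = b" "{c, d} = {v, x}" "closed_segment (?p c) (?p d) = closed_segment q (p x)"
        using newcase[OF 2(1)] by (elim exE conjE)
      have "x \<notin> {c', d'}" using *(3) x(2) by blast
      moreover have "?p c' = p c'" "?p d' = p d'" using old[OF 2(2)] by auto
      ultimately show ?thesis using Q2'[OF x(1) 2(2)] unfolding x(3) by (simp only: simp_thms not_False_eq_True)
    next
      assume 3: "{c, d} \<in> E" "{c', d'} \<in> {{v, a}, {v, b}}"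
      obtain x where x: "x = a \<or> x = b" "{c', d'} = {v, x}" "closed_segment (?p c') (?p d') = closed_segment q (p x)"
        using newcase[OF 3(2)] by (elim exE conjE)
      have "x \<notin> {c, d}" using *(3) x(2) by blast
      moreover have "?p c = p c" "?p d = p d" using old[OF 3(1)] by auto
      ultimately show ?thesis using Q2'[OF x(1) 3(1)] unfolding x(3) Int_commute[of _ "closed_segment q (p x)"] by (simp only: simp_thms not_False_eq_True)
    next
      assume 4: "{c, d} \<in> {{v, a}, {v, b}}" "{c', d'} \<in> {{v, a}, {v, b}}"
      obtain x where x: "{c, d} = {v, x}" using newcase[OF 4(1)] by (elim exE conjE)
      obtain y where y: "{c', d'} = {v, y}" using newcase[OF 4(2)] by (elim exE conjE)
      have "v \<in> {c, d} \<inter> {c', d'}" unfolding x y by simp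
      then show ?thesis unfolding *(3) by simp
    qed
  qed
  then show ?thesis by blast
qed

type_synonym 'a ear = "'a \<times> 'a \<times> 'a \<times> nat \<times> nat"

fun grows :: "'a set \<Rightarrow> 'a set set \<Rightarrow> 'a ear list \<Rightarrow> bool" where
  "grows V E [] = True"
| "grows V E ((v, a, b, k, l) # its) = (v \<notin> V \<and> {a, b} \<in> E \<and> grows (insert v V) (E \<union> {{v, a}, {v, b}}) its)"

definition ear_edges :: "'a ear list \<Rightarrow> 'a set set" where
  "ear_edges its = (\<Union>(v, a, b, k, l) \<in> set its. {{v, a}, {v, b}})"

lemma ear_edges_simps [simp]:
  "ear_edges [] = {}" "ear_edges ((v, a, b, k, l) # its) = {{v, a}, {v, b}} \<union> ear_edges its"
  "ear_edges (xs @ ys) = ear_edges xs \<union> ear_edges ys"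
  by (auto simp: ear_edges_def)

lemma grows_planar:
  assumes "grows V E its" "straight V E p" "finite V" "finite E" "\<And>e. e \<in> E \<Longrightarrow> e \<subseteq> V \<and> card e = 2"
  shows "(\<exists>p. straight (V \<union> fst ` set its) (E \<union> ear_edges its) p) \<and>
     (\<forall>e \<in> E \<union> ear_edges its. e \<subseteq> V \<union> fst ` set its \<and> card e = 2)"
  using assms
proof (induction its arbitrary: V E p)
  case Nil
  then show ?case by auto
next
  case (Cons it its)
  obtain v a b k l where it: "it = (v, a, b, k, l)" by (metis prod_cases5)
  have g: "v \<notin> V" "{a, b} \<in> E" "grows (insert v V) (E \<union> {{v, a}, {v, b}}) its" using Cons.prems(1) by (simp_all add: it)
  obtain q where q: "straight (insert v V) (E \<union> {{v, a}, {v, b}}) (p(v := q))"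
    using straight_ear[OF Cons.prems(2-4) g(2,1) Cons.prems(5)] by blast
  have ab: "a \<in> V" "b \<in> V" using Cons.prems(5)[OF g(2)] by auto
  have E': "e \<subseteq> insert v V \<and> card e = 2" if e: "e \<in> E \<union> {{v, a}, {v, b}}" for e
  proof (cases "e \<in> E")
    case True
    then show ?thesis using Cons.prems(5) by blast
  next
    case False
    then have "e = {v, a} \<or> e = {v, b}" using e by blast
    moreover have "v \<noteq> a" "v \<noteq> b" using ab g(1) by blast+
    ultimately show ?thesis using ab by auto
  qed
  have eq: "V \<union> fst ` set (it # its) = insert v V \<union> fst ` set its"
    "E \<union> ear_edges (it # its) = (E \<union> {{v, a}, {v, b}}) \<union> ear_edges its" by (auto simp: it)
  show ?case unfolding eq by (rule Cons.IH[OF g(3) q _ _ E']) (use Cons.prems(3,4) in simp_all)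
qed

lemma grows_two_tree:
  "grows V E its \<Longrightarrow> two_tree V E \<Longrightarrow> two_tree (V \<union> fst ` set its) (E \<union> ear_edges its)"
proof (induction its arbitrary: V E)
  case (Cons it its)
  obtain v a b k l where it: "it = (v, a, b, k, l)" by (metis prod_cases5)
  have g: "v \<notin> V" "{a, b} \<in> E" "grows (insert v V) (E \<union> {{v, a}, {v, b}}) its" using Cons.prems(1) by (simp_all add: it)
  have eq: "V \<union> fst ` set (it # its) = insert v V \<union> fst ` set its"
    "E \<union> ear_edges (it # its) = (E \<union> {{v, a}, {v, b}}) \<union> ear_edges its" by (auto simp: it)
  show ?case unfolding eq by (rule Cons.IH[OF g(3) two_tree.extend[OF Cons.prems(2) g(2,1)]])
qed simp

definition edge_list :: "'a ear list \<Rightarrow> 'a set list" where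
  "edge_list its = concat (map (\<lambda>(v, a, b, k, l). [{v, a}, {v, b}]) its)"

lemma edge_list_simps [simp]:
  "edge_list [] = []" "edge_list ((v, a, b, k, l) # its) = {v, a} # {v, b} # edge_list its"
  "set (edge_list its) = ear_edges its"
  by (auto simp: edge_list_def ear_edges_def)

lemma straight_edge: "x \<noteq> y \<Longrightarrow> straight {x, y} {{x, y}} (\<lambda>v. if v = x then 0 else 1)"
  unfolding straight_def by (auto simp: inj_on_def doubleton_eq_iff)

lemma grows_distinct:
  "grows V E its \<Longrightarrow> (\<And>e. e \<in> E \<Longrightarrow> e \<subseteq> V \<and> card e = 2) \<Longrightarrow>
    distinct (edge_list its) \<and> ear_edges its \<inter> E = {}"
proof (induction its arbitrary: V E)
  case (Cons it its)
  obtain v a b k l where it: "it = (v, a, b, k, l)" by (metis prod_cases5)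
  have g: "v \<notin> V" "{a, b} \<in> E" "grows (insert v V) (E \<union> {{v, a}, {v, b}}) its" using Cons.prems(1) by (simp_all add: it)
  have ab: "a \<in> V" "b \<in> V" "a \<noteq> b" using Cons.prems(2)[OF g(2)] by (auto simp: card_2_iff)
  have vn: "v \<noteq> a" "v \<noteq> b" using ab g(1) by blast+
  have E': "e \<subseteq> insert v V \<and> card e = 2" if e: "e \<in> E \<union> {{v, a}, {v, b}}" for e
    using e Cons.prems(2)[of e] ab vn by auto
  have IH: "distinct (edge_list its)" "ear_edges its \<inter> (E \<union> {{v, a}, {v, b}}) = {}"
    using Cons.IH[OF g(3) E'] by blast+
  have "{v, a} \<noteq> {v, b}" using ab(3) by (simp add: doubleton_eq_iff)
  moreover have "{v, a} \<notin> E" "{v, b} \<notin> E" using Cons.prems(2) g(1) by blast+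
  ultimately show ?case using IH unfolding it by simp
qed simp

text \<open>Only the condition that the carrying edge exists already. That every attached vertex is
  new is shown separately by counting, in \<open>V_vlist\<close>.\<close>

fun okE :: "'a set set \<Rightarrow> 'a ear list \<Rightarrow> bool" where
  "okE E [] = True"
| "okE E ((v, a, b, k, l) # its) = ({a, b} \<in> E \<and> okE (E \<union> {{v, a}, {v, b}}) its)"

lemma grows_okE:
  "okE E its \<Longrightarrow> distinct (map fst its) \<Longrightarrow> fst ` set its \<inter> V = {} \<Longrightarrow> grows V E its"
proof (induction its arbitrary: E V)
  case (Cons it its)
  obtain v a b k l where it: "it = (v, a, b, k, l)" by (metis prod_cases5)
  have "grows (insert v V) (E \<union> {{v, a}, {v, b}}) its"
    by (rule Cons.IH) (use Cons.prems it in auto)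
  then show ?case using Cons.prems it by auto
qed simp

lemma okE_append: "okE E (xs @ ys) \<longleftrightarrow> okE E xs \<and> okE (E \<union> ear_edges xs) ys"
proof (induction xs arbitrary: E)
  case (Cons x xs)
  obtain v a b k l where x: "x = (v, a, b, k, l)" by (metis prod_cases5)
  have "E \<union> {{v, a}, {v, b}} \<union> ear_edges xs = E \<union> ear_edges (x # xs)" unfolding x by auto
  then show ?case using Cons.IH[of "E \<union> {{v, a}, {v, b}}"] unfolding x by auto
qed simp

lemma okE_mono: "okE E xs \<Longrightarrow> E \<subseteq> E' \<Longrightarrow> okE E' xs"
proof (induction xs arbitrary: E E')
  case (Cons x xs)
  obtain v a b k l where x: "x = (v, a, b, k, l)" by (metis prod_cases5)
  have "okE (E' \<union> {{v, a}, {v, b}}) xs" by (rule Cons.IH[of "E \<union> {{v, a}, {v, b}}"]) (use Cons.prems x in auto)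
  then show ?case using Cons.prems unfolding x by auto
qed simp

lemma okE_static: "(\<And>v a b k l. (v, a, b, k, l) \<in> set xs \<Longrightarrow> {a, b} \<in> E) \<Longrightarrow> okE E xs"
proof (induction xs)
  case (Cons x xs)
  obtain v a b k l where x: "x = (v, a, b, k, l)" by (metis prod_cases5)
  have "okE E xs"
  proof (rule Cons.IH)
    fix v a b k l assume "(v, a, b, k, l) \<in> set xs"
    then have "(v, a, b, k, l) \<in> set (x # xs)" by simp
    then show "{a, b} \<in> E" by (rule Cons.prems)
  qed
  then have "okE (E \<union> {{v, a}, {v, b}}) xs" by (rule okE_mono) auto
  moreover have "{a, b} \<in> E" using Cons.prems[of v a b k l] x by simp
  ultimately show ?case unfolding x by simp
qed simp

lemma okE_concat: "(\<And>x. x \<in> set xs \<Longrightarrow> okE E (f x)) \<Longrightarrow> okE E (concat (map f xs))"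
  by (induction xs) (auto simp: okE_append intro: okE_mono)

lemma ear_edgesI: "(v, a, b, k, l) \<in> set its \<Longrightarrow> {v, a} \<in> ear_edges its \<and> {v, b} \<in> ear_edges its"
  unfolding ear_edges_def by force

lemma ear_edges_item: "e \<in> ear_edges its \<Longrightarrow> \<exists>v. v \<in> fst ` set its \<and> v \<in> e"
  unfolding ear_edges_def by force

lemma okE_zigzag:
  assumes "{h 1, h 0} \<in> E" shows "okE E (map (\<lambda>m. (h (m + 2), h (m + 1), h m, 0, 0)) [0..<n])"
proof (induction n)
  case (Suc n)
  have "{h (n + 1), h n} \<in> E \<union> ear_edges (map (\<lambda>m. (h (m + 2), h (m + 1), h m, 0, 0)) [0..<n])"
  proof (cases n)
    case (Suc n')
    have "(h (n' + 2), h (n' + 1), h n', 0, 0) \<in> set (map (\<lambda>m. (h (m + 2), h (m + 1), h m, 0, 0)) [0..<n])"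
      using Suc by auto
    from ear_edgesI[OF this] show ?thesis using Suc by simp
  qed (use assms in simp)
  then show ?case using Suc by (simp add: okE_append)
qed simp

lemma upt_nested: "concat (map (\<lambda>i. map (\<lambda>j. f (i * b + j)) [0..<b]) [0..<a]) = map f [0..<a * b]"
proof (induction a)
  case (Suc a)
  have "[0..<Suc a * b] = [0..<a * b] @ [a * b..<a * b + b]"
    using upt_add_eq_append[of 0 "a * b" b] by (simp add: add.commute)
  moreover have "[a * b..<a * b + b] = map (\<lambda>j. a * b + j) [0..<b]" by (simp add: map_add_upt add.commute)
  ultimately show ?case using Suc by (simp add: o_def)
qed simp

section \<open>Growing the layout and numbering its vertices\<close>

context layout
begin

definition row_size :: nat where "row_size = 45 * C + 3"

definition nverts :: nat where "nverts = 4 * R * Mt + R * row_size"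

fun vid :: "vtx \<Rightarrow> nat" where
  "vid (Bd j m) = j * Mt + m"
| "vid (Fl r c k) = 4 * R * Mt + (r * row_size + (c * 45 + k))"
| "vid (En r e) = 4 * R * Mt + (r * row_size + (45 * C + e))"

definition vlist :: "vtx list" where
  "vlist = concat (map (\<lambda>j. map (Bd j) [0..<Mt]) [0..<4 * R]) @
     concat (map (\<lambda>r. concat (map (\<lambda>c. map (Fl r c) [0..<45]) [0..<C]) @ map (En r) [0..<3]) [0..<R])"

text \<open>Listing the vertices in the order of their numbers gives injectivity and the range of
  the numbering at once.\<close>

lemma vid_vlist: "map vid vlist = [0..<nverts]"
proof -
  have 1: "map vid (concat (map (\<lambda>j. map (Bd j) [0..<Mt]) [0..<4 * R])) = [0..<4 * R * Mt]"
    using upt_nested[of "\<lambda>x. x" Mt "4 * R"] by (simp add: map_concat o_def)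
  have 2: "map vid (concat (map (\<lambda>c. map (Fl r c) [0..<45]) [0..<C]) @ map (En r) [0..<3]) =
      map (\<lambda>j. 4 * R * Mt + (r * row_size + j)) [0..<row_size]" for r
  proof -
    have "map vid (concat (map (\<lambda>c. map (Fl r c) [0..<45]) [0..<C])) = map (\<lambda>j. 4 * R * Mt + (r * row_size + j)) [0..<C * 45]"
      using upt_nested[of "\<lambda>j. 4 * R * Mt + (r * row_size + j)" 45 C] by (simp add: map_concat o_def)
    moreover have "map vid (map (En r) [0..<3]) = map (\<lambda>j. 4 * R * Mt + (r * row_size + j)) [C * 45..<C * 45 + 3]"
    proof -
      have "[C * 45..<C * 45 + 3] = map (\<lambda>e. e + C * 45) [0..<3]"
        unfolding map_add_upt by (simp only: add.commute)
      then show ?thesis by (simp add: o_def add.commute mult.commute)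
    qed
    moreover have "[0..<row_size] = [0..<C * 45] @ [C * 45..<C * 45 + 3]"
      using upt_add_eq_append[of 0 "C * 45" 3] by (simp add: row_size_def mult.commute)
    ultimately show ?thesis by (simp only: map_append)
  qed
  have "map vid (concat (map (\<lambda>r. concat (map (\<lambda>c. map (Fl r c) [0..<45]) [0..<C]) @ map (En r) [0..<3]) [0..<R])) =
      map (\<lambda>j. 4 * R * Mt + j) [0..<R * row_size]"
    unfolding map_concat map_map o_def 2 by (rule upt_nested)
  also have "\<dots> = [4 * R * Mt..<nverts]" by (simp add: map_add_upt nverts_def add.commute)
  finally show ?thesis unfolding vlist_def map_append 1
    using upt_add_eq_append[of 0 "4 * R * Mt" "R * row_size"] by (simp add: nverts_def)
qed

lemma vlist_sub: "0 < R \<Longrightarrow> set vlist \<subseteq> V"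
proof
  fix v assume R: "0 < R" and "v \<in> set vlist"
  then consider j m where "v = Bd j m" "j < 4 * R" "m < Mt" | r c k where "v = Fl r c k" "r < R" "c < C" "k < 45"
    | r e where "v = En r e" "r < R" "e < 3"
    unfolding vlist_def by auto
  then show "v \<in> V"
  proof cases
    case 1
    have m: "m = 0 \<or> m = 1 \<or> m = 2 \<or> (\<exists>m'. m = m' + 3)" by (rule nat_cases_3)
    show ?thesis
    proof (cases j)
      case 0
      show ?thesis
      proof (cases "m < 2")
        case True
        then have "m = 0 \<or> m = 1" by auto
        then show ?thesis using 1(1) 0 Bd_in_V0 by auto
      next
        case False
        then obtain n where "m = n + 2" by (metis le_add_diff_inverse2 not_less)
        then show ?thesis using item_edges strip0_items[of n] 1 0 by simp
      qed
    next
      case (Suc i)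
      then have "i + 1 < 4 * R" using 1(2) by simp
      then show ?thesis using m 1 Suc item_edges body_items[of i] by fastforce
    qed
  next
    case 2
    have "v \<in> fst ` set (cell r c)"
    proof (cases "k < 42")
      case True
      then have "flag_item r c k \<in> set (cell r c)" unfolding cell_def by auto
      moreover have "fst (flag_item r c k) = v" by (simp add: flag_item_def 2(1) split: prod.splits)
      ultimately show ?thesis by (metis imageI)
    next
      case False
      then have "k = 42 \<or> k = 43 \<or> k = 44" using 2(4) by auto
      then show ?thesis using 2(1) unfolding cell_def by (auto simp: image_Un)
    qed
    then show ?thesis using cell_items[OF 2(2,3)] unfolding V_def by blast
  next
    case 3
    then have "e = 0 \<or> e = 1 \<or> e = 2" by auto
    then have "v \<in> fst ` set (row_ends r)" using 3(1) by (auto simp: row_ends_def)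
    then show ?thesis using end_items[OF 3(2)] unfolding V_def by blast
  qed
qed

lemma length_items: "0 < R \<Longrightarrow> length items + 2 = nverts"
proof -
  assume R: "0 < R"
  have s0: "length strip0 = Mt - 2" "\<And>j. length (strip j) = Mt"
    by (simp_all add: strip0_def strip_def Mt_def)
  have c: "\<And>r c. length (cell r c) = 45" "\<And>r. length (row_ends r) = 3" by (simp_all add: cell_def row_ends_def)
  have "length items = (Mt - 2) + (4 * R - 1) * Mt + R * row_size"
    unfolding items_def by (simp add: length_concat o_def s0 c sum_list_triv row_size_def mult.commute)
  moreover have "2 \<le> Mt" by (simp add: Mt_def)
  moreover obtain R' where "4 * R = Suc R'" using R by (cases "4 * R") auto
  ultimately show ?thesis by (simp add: nverts_def)
qed

text \<open>By counting: the list consists of \<open>nverts\<close> distinct vertices, all in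
  \<open>V\<close>, while \<open>V\<close> comes from two vertices and one per item,
  \<open>nverts\<close> in total. So both enumerate \<open>V\<close> and no vertex is attached
  twice.\<close>

lemma V_vlist: assumes "0 < R" shows "V = set vlist" "distinct (map fst items)" "fst ` set items \<inter> {Bd 0 0, Bd 0 1} = {}"
proof -
  have d: "distinct vlist" using distinct_map[of vid vlist] vid_vlist by simp
  have l: "length vlist = nverts" using arg_cong[OF vid_vlist, of length] by simp
  have cV: "card (set vlist) = nverts" using distinct_card[OF d] l by simp
  have V: "V = set (Bd 0 0 # Bd 0 1 # map fst items)" by (auto simp: V_def)
  have le: "card V \<le> nverts" unfolding V using card_length[of "Bd 0 0 # Bd 0 1 # map fst items"] length_items[OF assms] by simp
  have "finite V" unfolding V by simp
  then show eq: "V = set vlist" using card_seteq[OF _ vlist_sub[OF assms]] cV le by simp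
  have "card (set (Bd 0 0 # Bd 0 1 # map fst items)) = length (Bd 0 0 # Bd 0 1 # map fst items)"
    using cV eq V length_items[OF assms] by simp
  then have "distinct (Bd 0 0 # Bd 0 1 # map fst items)" by (rule card_distinct)
  then show "distinct (map fst items)" "fst ` set items \<inter> {Bd 0 0, Bd 0 1} = {}" by auto
qed

lemma vid_V: assumes "0 < R" shows "inj_on vid V" "vid ` V = {..<nverts}"
proof -
  have "distinct (map vid vlist)" unfolding vid_vlist by simp
  then show "inj_on vid V" unfolding V_vlist(1)[OF assms] by (simp add: distinct_map)
  have "set (map vid vlist) = {..<nverts}" unfolding vid_vlist by (simp add: atLeast0LessThan)
  then show "vid ` V = {..<nverts}" unfolding V_vlist(1)[OF assms] by simp
qed

lemma E_items: "E = {{Bd 0 0, Bd 0 1}} \<union> ear_edges items"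
  unfolding E_def ear_edges_def ..

definition bitems :: "vtx ear list" where
  "bitems = strip0 @ concat (map strip [0..<4 * R - 1])"

lemma okE_bitems: "okE {{Bd 0 0, Bd 0 1}} bitems"
proof -
  let ?E = "{{Bd 0 0, Bd 0 1}} \<union> ear_edges strip0"
  have 0: "okE {{Bd 0 0, Bd 0 1}} strip0"
    unfolding strip0_def by (rule okE_zigzag) (simp add: insert_commute)
  have Mt: "6 \<le> Mt" by (simp add: Mt_def)
  have "(Bd 0 3, Bd 0 2, Bd 0 1, 0, 0) \<in> set strip0"
    unfolding strip0_def using Mt by (auto intro!: image_eqI[of _ _ 1])
  from ear_edgesI[OF this] have start: "{Bd 0 1, Bd 0 3} \<in> ?E" by (simp add: insert_commute)
  have "okE ?E (concat (map strip [0..<n])) \<and> {Bd n 1, Bd n 3} \<in> ?E \<union> ear_edges (concat (map strip [0..<n]))" for n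
  proof (induction n)
    case (Suc n)
    let ?F = "?E \<union> ear_edges (concat (map strip [0..<n]))"
    let ?a = "[(Bd (n + 1) 0, Bd n 1, Bd n 3, 1, 0), (Bd (n + 1) 2, Bd n 3, Bd (n + 1) 0, 1, 0),
      (Bd (n + 1) 1, Bd (n + 1) 0, Bd (n + 1) 2, 0, 0)] :: vtx ear list"
    let ?b = "map (\<lambda>m. (Bd (n + 1) (m + 3), Bd (n + 1) (m + 2), Bd (n + 1) (m + 1), 0, 0)) [0..<Mt - 3] :: vtx ear list"
    have a: "okE ?F ?a" using Suc by (simp add: insert_commute)
    have b: "okE (?F \<union> ear_edges ?a) ?b"
      using okE_zigzag[of "\<lambda>m. Bd (n + 1) (m + 1)" "?F \<union> ear_edges ?a" "Mt - 3"]
      by (simp add: numeral_3_eq_3 numeral_2_eq_2 insert_commute)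
    have st: "strip n = ?a @ ?b" by (simp add: strip_def)
    have "okE ?F (strip n)" unfolding st okE_append using a b by blast
    moreover have "(Bd (n + 1) 3, Bd (n + 1) 2, Bd (n + 1) 1, 0, 0) \<in> set (strip n)"
      unfolding st using Mt by (auto intro!: image_eqI[of _ _ 0])
    ultimately show ?case using Suc ear_edgesI[of "Bd (n + 1) 3" _ "Bd (n + 1) 1" _ _ "strip n"]
      by (simp add: okE_append insert_commute)
  qed (use start in simp)
  then show ?thesis unfolding bitems_def okE_append using 0 by blast
qed

lemma body_edge_bitems:
  assumes "{Bd j m, Bd j' m'} \<in> E"
  shows "{Bd j m, Bd j' m'} \<in> {{Bd 0 0, Bd 0 1}} \<union> ear_edges bitems"
proof -
  let ?c = "concat (map (\<lambda>r. concat (map (cell r) [0..<C]) @ row_ends r) [0..<R])"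
  have "{Bd j m, Bd j' m'} \<notin> ear_edges ?c"
  proof
    assume "{Bd j m, Bd j' m'} \<in> ear_edges ?c"
    from ear_edges_item[OF this] obtain v where v: "v \<in> fst ` set ?c" "v \<in> {Bd j m, Bd j' m'}" by (elim exE conjE)
    note v(1)
    then have "(\<exists>r c. v \<in> fst ` set (cell r c)) \<or> (\<exists>r. v \<in> fst ` set (row_ends r))" by auto
    moreover have "fst ` set (cell r c) \<subseteq> range (Fl r c)" for r c
      unfolding cell_def flag_item_def by (auto split: prod.splits)
    ultimately have "(\<exists>r c. v \<in> range (Fl r c)) \<or> (\<exists>r. v \<in> fst ` set (row_ends r))" by blast
    then show False using v(2) by (auto simp: row_ends_def)
  qed
  then show ?thesis using assms unfolding E_items items_def bitems_def by (simp del: set_concat)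
qed

lemma entry_m: assumes "i < 42" shows "fst (snd (snd (entry r c i))) + 2 < 14"
proof -
  have "entry r c i \<in> insert (2,1,9,1) (insert (0,1,4,1) (set base_tab))"
    unfolding entry_def using nth_mem[of i base_tab] assms length_base_tab by auto
  then show ?thesis by (auto simp: base_tab_def)
qed

lemma okE_items: assumes "0 < C" shows "okE {{Bd 0 0, Bd 0 1}} items"
proof -
  let ?E = "{{Bd 0 0, Bd 0 1}} \<union> ear_edges bitems"
  have e: "{Bd j m, Bd j (m + k)} \<in> ?E" if "j < 4 * R" "m + 2 < Mt" "k = 1 \<or> k = 2" for j m k
    using that(3)
  proof
    assume k: "k = 1"
    show ?thesis unfolding k by (rule body_edge_bitems[OF body_edge(1)[OF that(1,2)]])
  next
    assume k: "k = 2"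
    show ?thesis unfolding k by (rule body_edge_bitems[OF body_edge(2)[OF that(1,2)]])
  qed
  have cell: "okE ?E (cell r c)" if rc: "r < R" "c < C" for r c
  proof -
    have f: "okE ?E (map (flag_item r c) [0..<42])"
    proof (rule okE_static)
      fix v a b k l assume "(v, a, b, k, l) \<in> set (map (flag_item r c) [0..<42])"
      then obtain i where i: "i < 42" "(v, a, b, k, l) = flag_item r c i" by auto
      obtain s k' m ty where en: "entry r c i = (s, k', m, ty)" by (metis surj_pair)
      have "s < 4" "k' = 1 \<or> k' = 2" "m + k' < 14" "0 < m" using entry_ok[OF i(1), of r c] en by auto
      moreover have "a = Bd (4 * r + s) (8 * c + m)" "b = Bd (4 * r + s) (8 * c + m + k')"
        using i(2) en by (simp_all add: flag_item_def)
      moreover have m12: "m + 2 < 14"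
        using entry_m[OF i(1), of r c] en by simp
      ultimately show "{a, b} \<in> ?E" using e[of "4 * r + s" "8 * c + m" k'] rc by (simp add: Mt_def)
    qed
    have "{Bd (4 * r + 1) (8 * c + 7), Bd (4 * r + 1) (8 * c + 8)} \<in> ?E"
      using e[of "4 * r + 1" "8 * c + 7" 1] rc by (simp add: Mt_def add.commute[of 8])
    note h = this
    have "okE (?E \<union> ear_edges (map (flag_item r c) [0..<42])) [(Fl r c 42, Bd (4 * r + 1) (8 * c + 7), Bd (4 * r + 1) (8 * c + 8), 1, 1),
      (Fl r c 43, Bd (4 * r + 1) (8 * c + 7), Fl r c 42, 1, 3), (Fl r c 44, Bd (4 * r + 1) (8 * c + 8), Fl r c 42, 1, 3)]"
      unfolding okE.simps
      by (intro conjI TrueI, rule UnI1, rule h, rule UnI2, simp add: insert_commute, rule UnI1, rule UnI2, simp add: insert_commute)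
    then show ?thesis unfolding cell_def okE_append using f by (rule conjI[rotated])
  qed
  have ends: "okE ?E (row_ends r)" if r: "r < R" for r
  proof (rule okE_static)
    fix v a b k l assume "(v, a, b, k, l) \<in> set (row_ends r)"
    then have "(a = Bd (4 * r + 1) 3 \<and> b = Bd (4 * r + 1) (3 + 1)) \<or> (a = Bd (4 * r + 1) (8 * C + 3) \<and> b = Bd (4 * r + 1) (8 * C + 3 + 1))"
      by (auto simp: row_ends_def)
    moreover have "{Bd (4 * r + 1) 3, Bd (4 * r + 1) (3 + 1)} \<in> ?E"
      by (rule e) (use r assms in \<open>simp_all add: Mt_def\<close>)
    moreover have "{Bd (4 * r + 1) (8 * C + 3), Bd (4 * r + 1) (8 * C + 3 + 1)} \<in> ?E"
      by (rule e) (use r assms in \<open>simp_all add: Mt_def\<close>)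
    ultimately show "{a, b} \<in> ?E" by (elim disjE conjE) (simp_all only:)
  qed
  have "okE ?E (concat (map (\<lambda>r. concat (map (cell r) [0..<C]) @ row_ends r) [0..<R]))"
  proof (rule okE_concat)
    fix r assume "r \<in> set [0..<R]"
    then have r: "r < R" by simp
    have "okE ?E (concat (map (cell r) [0..<C]))" by (rule okE_concat) (use cell[OF r] in simp)
    moreover have "okE (?E \<union> ear_edges (concat (map (cell r) [0..<C]))) (row_ends r)" by (rule okE_mono[OF ends[OF r] Un_upper1])
    ultimately show "okE ?E (concat (map (cell r) [0..<C]) @ row_ends r)" unfolding okE_append by (rule conjI)
  qed
  then have "okE {{Bd 0 0, Bd 0 1}} (bitems @ concat (map (\<lambda>r. concat (map (cell r) [0..<C]) @ row_ends r) [0..<R]))"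
    unfolding okE_append using okE_bitems by (intro conjI)
  then show ?thesis unfolding items_def bitems_def append_assoc .
qed

lemma grows_items: "0 < C \<Longrightarrow> 0 < R \<Longrightarrow> grows {Bd 0 0, Bd 0 1} {{Bd 0 0, Bd 0 1}} items"
  by (rule grows_okE[OF okE_items V_vlist(2) V_vlist(3)])

lemma E_V: assumes "0 < C" "0 < R" "e \<in> E" shows "e \<subseteq> V \<and> card e = 2"
proof -
  have "(\<forall>e \<in> E. e \<subseteq> V \<and> card e = 2)" unfolding E_items V_def
    by (rule grows_planar[OF grows_items[OF assms(1,2)] straight_edge, THEN conjunct2]) simp_all
  then show ?thesis using assms(3) by (rule bspec)
qed

end

section \<open>The encoded graph of a layout and its properties\<close>

lemma straight_cong:
  assumes "\<And>v. v \<in> V \<Longrightarrow> p v = q v" "\<And>e. e \<in> E \<Longrightarrow> e \<subseteq> V" "straight V E p"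
  shows "straight V E q"
proof -
  have E: "\<And>a b. {a, b} \<in> E \<Longrightarrow> p a = q a \<and> p b = q b" using assms(1,2) by blast
  have "inj_on q V" using assms(1,3) inj_on_cong[of V p q] unfolding straight_def by blast
  moreover have "\<forall>a b v. {a, b} \<in> E \<longrightarrow> v \<in> V \<longrightarrow> q v \<in> closed_segment (q a) (q b) \<longrightarrow> v = a \<or> v = b"
    using assms(1,3) E unfolding straight_def by metis
  moreover have "\<forall>a b c d. {a, b} \<in> E \<longrightarrow> {c, d} \<in> E \<longrightarrow> {a, b} \<inter> {c, d} = {} \<longrightarrow>
        closed_segment (q a) (q b) \<inter> closed_segment (q c) (q d) = {}"
    using assms(3) E unfolding straight_def by metis
  ultimately show ?thesis unfolding straight_def by (intro conjI)
qed

lemma two_tree_edges: "two_tree A F \<Longrightarrow> \<forall>e\<in>F. e \<subseteq> A"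
proof (induction rule: two_tree.induct)
  case (extend A F u w v)
  have uw: "{u, w} \<subseteq> A" using extend.IH extend.hyps(2) by (rule bspec)
  show ?case
  proof
    fix e assume "e \<in> F \<union> {{v, u}, {v, w}}"
    then consider "e \<in> F" | "e = {v, u}" | "e = {v, w}" by (elim UnE insertE emptyE)
    then show "e \<subseteq> insert v A"
    proof cases
      case 1
      then have "e \<subseteq> A" using extend.IH by (rule bspec[rotated])
      then show ?thesis by (rule subset_insertI2)
    qed (use uw in auto)
  qed
qed simp

lemma two_tree_sub: "two_tree A F \<Longrightarrow> e \<in> F \<Longrightarrow> e \<subseteq> A"
  using two_tree_edges by blast

lemma two_tree_image:
  "two_tree A F \<Longrightarrow> inj_on f A \<Longrightarrow> two_tree (f ` A) ((`) f ` F)"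
proof (induction rule: two_tree.induct)
  case (triangle a b c)
  then have "distinct [f a, f b, f c]" by (auto simp: inj_on_def)
  from two_tree.triangle[OF this] show ?case by simp
next
  case (extend A F u w v)
  have "inj_on f A" using extend.prems by (rule inj_on_subset) (rule subset_insertI)
  note 1 = extend.IH[OF this]
  have 2: "{f u, f w} \<in> (`) f ` F" using imageI[OF extend.hyps(2), of "(`) f"] by simp
  have 3: "f v \<notin> f ` A" using extend.prems extend.hyps(3) by (simp add: inj_on_insert)
  from two_tree.extend[OF 1 2 3] show ?case by (simp add: image_Un)
qed

definition num_of :: "nat \<Rightarrow> nat" where
  "num_of k = (if k = 0 then 1 else if k = 1 then 7 else if k = 2 then 7 else 2)"

definition den_of :: "nat \<Rightarrow> nat" where
  "den_of k = (if k = 0 then 1 else if k = 1 then 13 else if k = 2 then 11 else 13)"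

lemma len_of_quotient: "real (num_of k) / real (den_of k) = len_of k" "0 < num_of k" "0 < den_of k"
  by (simp_all add: num_of_def den_of_def len_of_def)

context layout
begin

definition code_entries :: "vtx ear \<Rightarrow> (nat \<times> nat \<times> nat \<times> nat) list" where
  "code_entries = (\<lambda>(v, a, b, k, l). [(vid v, vid a, num_of k, den_of k), (vid v, vid b, num_of l, den_of l)])"

definition layout_code :: code where
  "layout_code = (nverts, (vid (Bd 0 0), vid (Bd 0 1), 1, 1) # concat (map code_entries items))"

definition lengths :: "(vtx set \<times> real) list" where
  "lengths = ({Bd 0 0, Bd 0 1}, 1) # concat (map (\<lambda>(v, a, b, k, l). [({v, a}, len_of k), ({v, b}, len_of l)]) items)"

lemma edge_lengths_code: "edge_lengths layout_code = map (\<lambda>(e, x). (vid ` e, x)) lengths"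
proof -
  have "map (\<lambda>(u, v, a, b). ({u, v}, real a / real b)) (concat (map code_entries its)) =
      map (\<lambda>(e, x). (vid ` e, x)) (concat (map (\<lambda>(v, a, b, k, l). [({v, a}, len_of k), ({v, b}, len_of l)]) its))" for its
    by (induction its) (auto simp: code_entries_def len_of_quotient)
  then show ?thesis unfolding edge_lengths_def layout_code_def lengths_def by simp
qed

lemma fst_lengths: "map fst lengths = {Bd 0 0, Bd 0 1} # edge_list items"
proof -
  have "map fst (concat (map (\<lambda>(v, a, b, k, l). [({v, a}, len_of k), ({v, b}, len_of l)]) its)) = edge_list its" for its :: "vtx ear list"
    unfolding edge_list_def by (induction its) auto
  then show ?thesis unfolding lengths_def by simp
qed

lemma set_fst_lengths: "fst ` set lengths = E"
  using arg_cong[OF fst_lengths, of set] by (simp add: E_items del: One_nat_def)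

lemma distinct_fst_lengths: "0 < C \<Longrightarrow> 0 < R \<Longrightarrow> distinct (map fst lengths)"
  using grows_distinct[OF grows_items] unfolding fst_lengths by simp

lemma lengthsI:
  assumes "(v, a, b, k, l) \<in> set items" shows "({v, a}, len_of k) \<in> set lengths" "({v, b}, len_of l) \<in> set lengths"
proof -
  let ?F = "\<lambda>(v, a, b, k, l). [({v, a}, len_of k), ({v, b}, len_of l)]"
  have "z \<in> set lengths" if "z \<in> set (?F (v, a, b, k, l))" for z
    unfolding lengths_def set_simps set_concat set_map using that assms by (intro insertI2 UnionI[of "set (?F (v, a, b, k, l))"] imageI)
  then show "({v, a}, len_of k) \<in> set lengths" "({v, b}, len_of l) \<in> set lengths" by simp_all
qed

lemma lengthsD:
  assumes "(e, y) \<in> set lengths"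
  shows "(e = {Bd 0 0, Bd 0 1} \<and> y = 1) \<or> (\<exists>v c d k l. (v, c, d, k, l) \<in> set items \<and> ((e = {v, c} \<and> y = len_of k) \<or> (e = {v, d} \<and> y = len_of l)))"
proof (cases "e = {Bd 0 0, Bd 0 1} \<and> y = 1")
  case False
  then have "(e, y) \<in> set (concat (map (\<lambda>(v, a, b, k, l). [({v, a}, len_of k), ({v, b}, len_of l)]) items))"
    using assms unfolding lengths_def set_simps insert_iff prod.inject by (elim disjE) simp_all
  then obtain it where it: "it \<in> set items" "(e, y) \<in> set ((\<lambda>(v, a, b, k, l). [({v, a}, len_of k), ({v, b}, len_of l)]) it)"
    unfolding set_concat set_map by (elim UnionE imageE) (simp only:)
  obtain v c d k l where v: "it = (v, c, d, k, l)" by (metis prod_cases5)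
  have "(e = {v, c} \<and> y = len_of k) \<or> (e = {v, d} \<and> y = len_of l)" using it(2) unfolding v by simp
  then show ?thesis using it(1) unfolding v by blast
qed (rule disjI1)

context
  assumes C: "0 < C" and R: "0 < R"
begin

lemma vid_image_inj: "inj_on ((`) vid) E"
  using inj_on_image_Pow[OF vid_V(1)[OF R]] by (rule inj_on_subset) (use E_V[OF C R] in blast)

lemma distinct_code: "distinct (map fst (edge_lengths layout_code))"
proof -
  have "map fst (edge_lengths layout_code) = map ((`) vid) (map fst lengths)"
    unfolding edge_lengths_code by (simp add: o_def case_prod_beta)
  moreover have "inj_on ((`) vid) (set (map fst lengths))" using vid_image_inj set_fst_lengths by simp
  ultimately show ?thesis using distinct_fst_lengths[OF C R] distinct_map by metis
qed

lemma edges_code: "edges (graph_of layout_code) = (`) vid ` E"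
  unfolding graph_of_def edge_lengths_code set_fst_lengths[symmetric] by (simp add: image_image case_prod_beta)

lemma verts_code: "verts (graph_of layout_code) = vid ` V"
  unfolding graph_of_def using vid_V(2)[OF R] by (simp add: layout_code_def)

lemma len_code: "(e, y) \<in> set lengths \<Longrightarrow> len (graph_of layout_code) (vid ` e) = y"
proof -
  assume "(e, y) \<in> set lengths"
  then have "(vid ` e, y) \<in> set (edge_lengths layout_code)" unfolding edge_lengths_code set_map by (rule rev_image_eqI) simp
  then have "map_of (edge_lengths layout_code) (vid ` e) = Some y" by (rule map_of_is_SomeI[OF distinct_code])
  then show ?thesis by (simp add: graph_of_def)
qed

lemma E_lengths: "e \<in> E \<Longrightarrow> \<exists>y. (e, y) \<in> set lengths"
  unfolding set_fst_lengths[symmetric] by force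

lemma snd_lengths: "snd ` set lengths = {1, 7/13, 7/11, 2/13}"
proof
  have len: "len_of k \<in> {1, 7/13, 7/11, 2/13}" for k by (simp add: len_of_def)
  show "snd ` set lengths \<subseteq> {1, 7/13, 7/11, 2/13}"
  proof
    fix y assume "y \<in> snd ` set lengths"
    then obtain e where "(e, y) \<in> set lengths" by auto
    from lengthsD[OF this] show "y \<in> {1, 7/13, 7/11, 2/13}"
      using len by (elim disjE exE conjE) (simp_all only: insertI1)
  qed
  have mem: "len_of k \<in> snd ` set lengths" "len_of l \<in> snd ` set lengths" if "(v, a, b, k, l) \<in> set items" for v a b k l
    using imageI[OF lengthsI(1)[OF that], of snd] imageI[OF lengthsI(2)[OF that], of snd] by simp_all
  \<comment> \<open>A unit and an end flag exist as soon as there is a cell; with the first edge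
    they witness that all four lengths occur, so their number is exactly 4.\<close>
  have "(Fl 0 0 43, Bd (4 * 0 + 1) (8 * 0 + 7), Fl 0 0 42, 1, 3) \<in> set (cell 0 0)" by (simp add: cell_def)
  then have 1: "(Fl 0 0 43, Bd (4 * 0 + 1) (8 * 0 + 7), Fl 0 0 42, 1, 3) \<in> set items" by (rule subsetD[OF cell_items[OF R C]])
  have "(En 0 0, Bd (4 * 0 + 1) 3, Bd (4 * 0 + 1) 4, 2, 2) \<in> set (row_ends 0)" by (simp add: row_ends_def)
  then have 2: "(En 0 0, Bd (4 * 0 + 1) 3, Bd (4 * 0 + 1) 4, 2, 2) \<in> set items" by (rule subsetD[OF end_items[OF R]])
  have "1 \<in> snd ` set lengths" by (simp add: lengths_def)
  moreover have "7/13 \<in> snd ` set lengths" using mem(1)[OF 1] by (simp add: len_of_def)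
  moreover have "2/13 \<in> snd ` set lengths" using mem(2)[OF 1] by (simp add: len_of_def)
  moreover have "7/11 \<in> snd ` set lengths" using mem(1)[OF 2] by (simp add: len_of_def)
  ultimately show "{1, 7/13, 7/11, 2/13} \<subseteq> snd ` set lengths" by simp
qed

lemma num_lengths_code: "num_lengths (graph_of layout_code) = 4"
proof -
  have "len (graph_of layout_code) ` edges (graph_of layout_code) = snd ` set lengths"
  proof (intro set_eqI iffI)
    fix y assume "y \<in> len (graph_of layout_code) ` edges (graph_of layout_code)"
    then obtain e where e: "e \<in> E" "y = len (graph_of layout_code) (vid ` e)" unfolding edges_code by blast
    obtain z where z: "(e, z) \<in> set lengths" using E_lengths[OF e(1)] by blast
    then show "y \<in> snd ` set lengths" using len_code[OF z] e(2) by force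
  next
    fix y assume "y \<in> snd ` set lengths"
    then obtain e where e: "(e, y) \<in> set lengths" by auto
    from imageI[OF this, of fst] have "e \<in> E" unfolding set_fst_lengths by simp
    then show "y \<in> len (graph_of layout_code) ` edges (graph_of layout_code)"
      unfolding edges_code using len_code[OF e] by blast
  qed
  then show ?thesis unfolding num_lengths_def snd_lengths by simp
qed

lemma weighted_code: "weighted_graph (graph_of layout_code)"
  unfolding weighted_graph_def
proof (intro conjI ballI)
  show "finite (verts (graph_of layout_code))" by (simp add: graph_of_def)
  fix e' assume "e' \<in> edges (graph_of layout_code)"
  then obtain e where e: "e \<in> E" "e' = vid ` e" unfolding edges_code by blast
  have eV: "e \<subseteq> V" "card e = 2" using E_V[OF C R e(1)] by blast+
  show "e' \<subseteq> verts (graph_of layout_code)" unfolding verts_code e(2) using eV by blast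
  show "card e' = 2" unfolding e(2) using card_image[OF inj_on_subset[OF vid_V(1)[OF R] eV(1)]] eV(2) by simp
  obtain y where y: "(e, y) \<in> set lengths" using E_lengths[OF e(1)] by blast
  from imageI[OF this, of snd] have "y \<in> {1, 7/13, 7/11, 2/13}" unfolding snd_lengths by simp
  then show "0 < len (graph_of layout_code) e'" unfolding e(2) len_code[OF y] by auto
qed

lemma valid_layout_code: "valid_code layout_code"
  unfolding valid_code_def
proof (intro conjI distinct_code ballI)
  fix t assume t: "t \<in> set (snd layout_code)"
  obtain u v a b where uv: "t = (u, v, a, b)" by (metis surj_pair)
  have "({u, v}, real a / real b) \<in> set (edge_lengths layout_code)"
    unfolding edge_lengths_def set_map by (rule rev_image_eqI[OF t]) (simp add: uv)
  from imageI[OF this, of fst] have "{u, v} \<in> edges (graph_of layout_code)" by (simp add: graph_of_def)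
  then have "{u, v} \<subseteq> verts (graph_of layout_code) \<and> card {u, v} = 2" using weighted_code unfolding weighted_graph_def by blast
  then have "u < fst layout_code \<and> v < fst layout_code \<and> u \<noteq> v" by (auto simp: graph_of_def)
  moreover have "0 < a \<and> 0 < b" using t uv unfolding layout_code_def code_entries_def by (auto simp: len_of_quotient)
  ultimately show "case t of (u, v, a, b) \<Rightarrow> u < fst layout_code \<and> v < fst layout_code \<and> u \<noteq> v \<and> 0 < a \<and> 0 < b"
    by (simp add: uv)
qed

text \<open>A 2-tree starts from a triangle while the layout starts from an edge, so the first item
  is split off: it closes the first triangle.\<close>

lemma two_tree_code: "two_tree (verts (graph_of layout_code)) (edges (graph_of layout_code))"
proof -
  have g: "grows {Bd 0 0, Bd 0 1} {{Bd 0 0, Bd 0 1}} items" by (rule grows_items[OF C R])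
  have ne: "items \<noteq> []" using end_items[OF R] by (auto simp: row_ends_def)
  then obtain it its where items: "items = it # its" by (cases items) auto
  obtain v a b k l where it: "it = (v, a, b, k, l)" by (metis prod_cases5)
  have h: "v \<notin> {Bd 0 0, Bd 0 1}" "{a, b} = {Bd 0 0, Bd 0 1}"
    "grows (insert v {Bd 0 0, Bd 0 1}) ({{Bd 0 0, Bd 0 1}} \<union> {{v, a}, {v, b}}) its"
    using g unfolding items it grows.simps by simp_all
  have "two_tree {Bd 0 0, Bd 0 1, v} {{Bd 0 0, Bd 0 1}, {Bd 0 1, v}, {Bd 0 0, v}}"
    by (rule two_tree.triangle) (use h(1) in auto)
  moreover have "{Bd 0 0, Bd 0 1, v} = insert v {Bd 0 0, Bd 0 1}" by blast
  moreover have "{{Bd 0 0, Bd 0 1}, {Bd 0 1, v}, {Bd 0 0, v}} = {{Bd 0 0, Bd 0 1}} \<union> {{v, a}, {v, b}}"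
    using h(2) unfolding doubleton_eq_iff by (elim disjE conjE; hypsubst; blast)
  ultimately have "two_tree (insert v {Bd 0 0, Bd 0 1}) ({{Bd 0 0, Bd 0 1}} \<union> {{v, a}, {v, b}})" by (simp only:)
  from grows_two_tree[OF h(3) this]
  have "two_tree (insert v {Bd 0 0, Bd 0 1} \<union> fst ` set its) ({{Bd 0 0, Bd 0 1}} \<union> {{v, a}, {v, b}} \<union> ear_edges its)" .
  moreover have "insert v {Bd 0 0, Bd 0 1} \<union> fst ` set its = V" unfolding V_def items it list.set image_insert fst_conv by blast
  moreover have "{{Bd 0 0, Bd 0 1}} \<union> {{v, a}, {v, b}} \<union> ear_edges its = E" unfolding E_items items it ear_edges_simps by blast
  ultimately have "two_tree V E" by (simp only:)
  from two_tree_image[OF this vid_V(1)[OF R]] show ?thesis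
    unfolding verts_code edges_code .
qed

lemma straight_code: "straight (verts (graph_of layout_code)) (edges (graph_of layout_code)) q \<longleftrightarrow> straight V E (q \<circ> vid)"
  unfolding verts_code edges_code by (rule straight_image[OF vid_V(1)[OF R]]) (use E_V[OF C R] in blast)

lemma transfer: "straight V E p \<Longrightarrow> straight V E ((p \<circ> inv_into V vid) \<circ> vid)"
proof -
  assume 1: "straight V E p"
  have 2: "p v = ((p \<circ> inv_into V vid) \<circ> vid) v" if "v \<in> V" for v using inv_into_f_f[OF vid_V(1)[OF R] that] by simp
  have 3: "e \<subseteq> V" if "e \<in> E" for e using E_V[OF C R that] by (rule conjunct1)
  show ?thesis by (rule straight_cong[OF 2 3 1])
qed

lemma edges_2: "e \<in> edges (graph_of layout_code) \<Longrightarrow> e \<subseteq> verts (graph_of layout_code) \<and> card e = 2"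
  using weighted_code unfolding weighted_graph_def by blast

lemma planar_code: "planar (graph_of layout_code)"
proof -
  have "\<exists>p. straight V E p" unfolding E_items V_def
    by (rule grows_planar[OF grows_items[OF C R] straight_edge, THEN conjunct1]) simp_all
  then obtain p where "straight V E p" by (elim exE)
  then have "straight (verts (graph_of layout_code)) (edges (graph_of layout_code)) (p \<circ> inv_into V vid)"
    using transfer straight_code by blast
  then show ?thesis unfolding planar_def using planar_drawing_straight[OF edges_2] by blast
qed

lemma realizes_lengths:
  "realizes p \<longleftrightarrow> straight V E p \<and> (\<forall>a b y. ({a, b}, y) \<in> set lengths \<longrightarrow> dist (p a) (p b) = y)" (is "_ \<longleftrightarrow> _ \<and> ?D")
proof -
  let ?I = "\<forall>(v, a, b, k, l) \<in> set items. dist (p v) (p a) = len_of k \<and> dist (p v) (p b) = len_of l"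
  have "?D \<longleftrightarrow> dist (p (Bd 0 0)) (p (Bd 0 1)) = 1 \<and> ?I"
  proof
    assume D: ?D
    have base: "dist (p (Bd 0 0)) (p (Bd 0 1)) = 1" by (rule D[rule_format]) (simp add: lengths_def)
    have ?I
    proof
      fix it assume it: "it \<in> set items"
      obtain v a b k l where v: "it = (v, a, b, k, l)" by (metis prod_cases5)
      note m = it[unfolded v]
      show "case it of (v, a, b, k, l) \<Rightarrow> dist (p v) (p a) = len_of k \<and> dist (p v) (p b) = len_of l"
        unfolding v prod.case by (intro conjI D[rule_format, OF lengthsI(1)[OF m]] D[rule_format, OF lengthsI(2)[OF m]])
    qed
    with base show "dist (p (Bd 0 0)) (p (Bd 0 1)) = 1 \<and> ?I" by (rule conjI)
  next
    assume I: "dist (p (Bd 0 0)) (p (Bd 0 1)) = 1 \<and> ?I"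
    show ?D
    proof (intro allI impI)
      fix a b y assume ab: "({a, b}, y) \<in> set lengths"
      have swap: "dist (p a) (p b) = z" if "{a, b} = {u, w}" "dist (p u) (p w) = z" for u w z
        using that unfolding doubleton_eq_iff by (elim disjE conjE) (simp_all add: dist_commute)
      from lengthsD[OF ab] show "dist (p a) (p b) = y"
      proof (elim disjE exE conjE)
        assume *: "{a, b} = {Bd 0 0, Bd 0 1}" "y = 1"
        show ?thesis unfolding *(2) by (rule swap[OF *(1) conjunct1[OF I]])
      next
        fix v c d k l assume *: "(v, c, d, k, l) \<in> set items" "{a, b} = {v, c}" "y = len_of k"
        have "dist (p v) (p c) = len_of k" using bspec[OF conjunct2[OF I] *(1)] by simp
        then show ?thesis unfolding *(3) by (rule swap[OF *(2)])
      next
        fix v c d k l assume *: "(v, c, d, k, l) \<in> set items" "{a, b} = {v, d}" "y = len_of l"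
        have "dist (p v) (p d) = len_of l" using bspec[OF conjunct2[OF I] *(1)] by simp
        then show ?thesis unfolding *(3) by (rule swap[OF *(2)])
      qed
    qed
  qed
  then show ?thesis unfolding realizes_def by (simp only:)
qed

lemma drawing_code: "planar_drawing (graph_of layout_code) q (\<lambda>e. convex hull (q ` e)) \<longleftrightarrow> straight V E (q \<circ> vid)"
  by (rule trans[OF planar_drawing_straight[OF edges_2] straight_code])

lemma realization_code: "(\<exists>q. planar_straight_line_realization (graph_of layout_code) q) \<longleftrightarrow> (\<exists>p. realizes p)"
proof
  assume "\<exists>q. planar_straight_line_realization (graph_of layout_code) q"
  then obtain q where q0: "planar_straight_line_realization (graph_of layout_code) q" by (elim exE)
  have q1: "straight V E (q \<circ> vid)"
    by (rule drawing_code[THEN iffD1, OF q0[unfolded planar_straight_line_realization_def, THEN conjunct1]])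
  note q2 = q0[unfolded planar_straight_line_realization_def, THEN conjunct2, rule_format]
  have d: "dist ((q \<circ> vid) a) ((q \<circ> vid) b) = y" if ab: "({a, b}, y) \<in> set lengths" for a b y
  proof -
    have "{a, b} \<in> E" using imageI[OF ab, of fst] unfolding set_fst_lengths by simp
    then have "vid ` {a, b} \<in> edges (graph_of layout_code)" unfolding edges_code by (rule imageI)
    then show ?thesis using q2[of "vid a" "vid b"] len_code[OF ab] by simp
  qed
  have "realizes (q \<circ> vid)" unfolding realizes_lengths by (intro conjI allI impI q1 d)
  then show "\<exists>p. realizes p" by blast
next
  assume "\<exists>p. realizes p"
  then obtain p where p0: "realizes p" by (elim exE)
  note p = p0[unfolded realizes_lengths, THEN conjunct1] p0[unfolded realizes_lengths, THEN conjunct2, rule_format]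
  define q where "q = p \<circ> inv_into V vid"
  have qv: "q (vid v) = p v" if "v \<in> V" for v using that vid_V(1)[OF R] by (simp add: q_def)
  have d: "dist (q u) (q v) = len (graph_of layout_code) {u, v}" if uv: "{u, v} \<in> edges (graph_of layout_code)" for u v
  proof -
    obtain e where e: "e \<in> E" "{u, v} = vid ` e" using uv unfolding edges_code by (elim imageE)
    have eV: "e \<subseteq> V" "card e = 2" using E_V[OF C R e(1)] by blast+
    then obtain a b where ab: "e = {a, b}" by (auto simp: card_2_iff)
    have abV: "a \<in> V" "b \<in> V" using eV(1) ab by simp_all
    obtain y where y: "({a, b}, y) \<in> set lengths" using E_lengths[OF e(1)] unfolding ab by (elim exE)
    have "dist (q (vid a)) (q (vid b)) = y" using p(2)[OF y] qv abV by simp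
    moreover have "len (graph_of layout_code) {u, v} = y" unfolding e(2) ab by (rule len_code[OF y])
    moreover have "{u, v} = {vid a, vid b}" using e(2) ab by simp
    ultimately show ?thesis unfolding doubleton_eq_iff by (elim disjE conjE) (simp_all add: dist_commute)
  qed
  have s: "straight V E (q \<circ> vid)" unfolding q_def by (rule transfer[OF p(1)])
  have "planar_straight_line_realization (graph_of layout_code) q"
    unfolding planar_straight_line_realization_def
    by (intro conjI allI impI drawing_code[THEN iffD2, OF s] d)
  then show "\<exists>q. planar_straight_line_realization (graph_of layout_code) q" by blast
qed

lemma realizable_iff:
  "(\<exists>p. realizes p) \<longleftrightarrow> (\<exists>X. (\<forall>r<R0. r < R \<longrightarrow> (\<exists>c<C. lit r c \<and> \<not> X c)) \<and>
     (\<forall>r. R0 \<le> r \<longrightarrow> r < R \<longrightarrow> (\<exists>c<C. lit r c \<and> X c)))"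
proof
  assume "\<exists>p. realizes p"
  then obtain p where "realizes p" by (elim exE)
  from sound[OF this C] show "\<exists>X. (\<forall>r<R0. r < R \<longrightarrow> (\<exists>c<C. lit r c \<and> \<not> X c)) \<and> (\<forall>r. R0 \<le> r \<longrightarrow> r < R \<longrightarrow> (\<exists>c<C. lit r c \<and> X c))" .
next
  assume "\<exists>X. (\<forall>r<R0. r < R \<longrightarrow> (\<exists>c<C. lit r c \<and> \<not> X c)) \<and> (\<forall>r. R0 \<le> r \<longrightarrow> r < R \<longrightarrow> (\<exists>c<C. lit r c \<and> X c))"
  then obtain X where X0: "(\<forall>r<R0. r < R \<longrightarrow> (\<exists>c<C. lit r c \<and> \<not> X c)) \<and> (\<forall>r. R0 \<le> r \<longrightarrow> r < R \<longrightarrow> (\<exists>c<C. lit r c \<and> X c))"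
    by (elim exE)
  note X = X0[THEN conjunct1, rule_format] X0[THEN conjunct2, rule_format]
  have "\<forall>r. \<exists>c. r < R \<longrightarrow> c < C \<and> lit r c \<and> (X c \<longleftrightarrow> R0 \<le> r)"
  proof
    fix r
    show "\<exists>c. r < R \<longrightarrow> c < C \<and> lit r c \<and> (X c \<longleftrightarrow> R0 \<le> r)"
    proof (cases "r < R")
      case True
      show ?thesis
      proof (cases "R0 \<le> r")
        case neg: True
        obtain c where "c < C \<and> lit r c \<and> X c" using X(2)[OF neg True] by (elim exE)
        then show ?thesis using neg by (intro exI[of _ c]) simp
      next
        case False
        then have neg: "r < R0" by simp
        obtain c where "c < C \<and> lit r c \<and> \<not> X c" using X(1)[OF neg True] by (elim exE)
        then show ?thesis using neg by (intro exI[of _ c]) simp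
      qed
    qed simp
  qed
  from choice[OF this] obtain cs where cs: "\<forall>r. r < R \<longrightarrow> cs r < C \<and> lit r (cs r) \<and> (X (cs r) \<longleftrightarrow> R0 \<le> r)" by (elim exE)
  interpret drawing R C R0 lit X cs by unfold_locales (rule mp[OF spec[OF cs]])
  have "realizes wp" by (rule realizes_wp) (rule conjunct1[OF E_V[OF C R]])
  then show "\<exists>p. realizes p" by blast
qed

end

end

section \<open>The reduction\<close>

definition sq :: "gn list \<Rightarrow> gn" where
  "sq gs = foldr Sq gs Nop"

lemma gsem_sq [simp]: "gsem x \<sigma> (sq gs) = concat (map (gsem x \<sigma>) gs)"
  by (induction gs) (simp_all add: sq_def)

lemma wf_gn_sq [simp]: "wf_gn n (sq gs) \<longleftrightarrow> (\<forall>g\<in>set gs. wf_gn n g)"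
  by (induction gs) (simp_all add: sq_def)

lemma bound_vars_sq [simp]: "bound_vars (sq gs) = (\<Union>g\<in>set gs. bound_vars g)"
  by (induction gs) (simp_all add: sq_def)

definition addx :: "ex list \<Rightarrow> ex" where
  "addx es = foldr Add es (Cn 0)"

lemma ev_addx: "ev x \<sigma> (addx es) \<noteq> 0 \<longleftrightarrow> (\<exists>e\<in>set es. ev x \<sigma> e \<noteq> 0)"
  by (induction es) (simp_all add: addx_def)

lemma vars_below_addx [simp]: "vars_below n (addx es) \<longleftrightarrow> (\<forall>e\<in>set es. vars_below n e)"
  by (induction es) (simp_all add: addx_def)

lemma vars_below_mono: "vars_below m e \<Longrightarrow> m \<le> n \<Longrightarrow> vars_below n e"
  by (induction e) auto

definition itemg :: "ex \<Rightarrow> ex \<Rightarrow> ex \<Rightarrow> nat \<Rightarrow> nat \<Rightarrow> gn" where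
  "itemg v a b k l = sq [Em v, Em a, Em (Cn (num_of k)), Em (Cn (den_of k)), Em v, Em b, Em (Cn (num_of l)), Em (Cn (den_of l))]"

lemma wf_itemg [simp]: "wf_gn n (itemg v a b k l) \<longleftrightarrow> vars_below n v \<and> vars_below n a \<and> vars_below n b"
  by (auto simp: itemg_def)

lemma bound_itemg [simp]: "bound_vars (itemg v a b k l) = {}"
  by (simp add: itemg_def)

definition env :: "nat \<Rightarrow> nat \<Rightarrow> nat \<Rightarrow> nat \<Rightarrow> nat \<Rightarrow> nat" where
  "env t i t' i' = (\<lambda>_. 0)(1 := t, 2 := i, 3 := t', 4 := i')"

lemma env_simps [simp]: "env t i t' i' (Suc 0) = t" "env t i t' i' 2 = i" "env t i t' i' 3 = t'" "env t i t' i' 4 = i'"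
  by (simp_all add: env_def)

lemma ev_env: "vars_below 3 e \<Longrightarrow> ev x (env t i t' i') e = ev x (at_pos t i) e"
  by (rule ev_cong[of 3]) (auto simp: env_def at_pos_def)

lemma concat_concat_map: "concat (concat xss) = concat (map concat xss)"
  by (induction xss) simp_all

lemma upt_nested3:
  "concat (map f [0..<a * b * c]) =
     concat (map (\<lambda>h. concat (map (\<lambda>i. concat (map (\<lambda>j. f ((h * b + i) * c + j)) [0..<c])) [0..<b])) [0..<a])"
proof -
  have 1: "concat (map g [0..<a * b]) = concat (map (\<lambda>i. concat (map (\<lambda>j. g (i * b + j)) [0..<b])) [0..<a])" for g :: "nat \<Rightarrow> 'a list" and a b
    unfolding upt_nested[symmetric] by (simp add: map_concat o_def concat_concat_map)
  show ?thesis unfolding 1[of f "a * b" c] 1[of _ a b] ..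
qed

text \<open>\<open>ns\<close> and \<open>ps\<close> are the negative and positive schemes, to be
  instantiated at times below \<open>P\<close> and positions below \<open>W\<close>;
  \<open>K\<close> is the number of kinds of variables. The generator built here does not depend on
  \<open>x\<close>, so one program serves all inputs.\<close>

locale program =
  fixes x :: "bool list" and P W :: ex and ns ps :: "scheme list" and K :: nat
  assumes closed: "vars_below 0 P" "vars_below 0 W"
    and schemes: "f \<in> set (ns @ ps) \<Longrightarrow> vars_below 3 (fst f) \<and> (\<forall>(\<kappa>, d, e) \<in> set (snd f). vars_below 3 e)"
begin

definition "nP = ev x (\<lambda>_. 0) P"
definition "nW = ev x (\<lambda>_. 0) W"

lemma ev_PW [simp]: "ev x \<sigma> P = nP" "ev x \<sigma> W = nW"
  unfolding nP_def nW_def using ev_cong[OF closed(1)] ev_cong[OF closed(2)] by blast+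

lemma vars_PW [simp]: "vars_below n P" "vars_below n W"
  using vars_below_mono[OF closed(1)] vars_below_mono[OF closed(2)] by simp_all

text \<open>A row is laid out for every instance of a scheme, and the row of an inactive instance
  would have no literal and could not be drawn. It gets the additional variable of kind
  \<open>K\<close> at time and position 0 instead.\<close>

definition litx :: "scheme \<Rightarrow> nat \<Rightarrow> ex" where
  "litx f \<kappa> = Add (addx (map (\<lambda>(\<kappa>', d, e). Mul (fst f) (Mul (eqx (Vr 3) (Add (Vr 1) (Cn d))) (eqx (Vr 4) e)))
       (filter (\<lambda>(\<kappa>', d, e). \<kappa>' = \<kappa>) (snd f))))
     (if \<kappa> = K then Mul (notx (fst f)) (Mul (notx (Vr 3)) (notx (Vr 4))) else Cn 0)"

definition "nF = length (ns @ ps)"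

definition lit :: "nat \<Rightarrow> nat \<Rightarrow> bool" where
  "lit r c \<longleftrightarrow> ev x (env (r div nW mod nP) (r mod nW) (c div nW mod nP) (c mod nW))
     (litx ((ns @ ps) ! (r div nW div nP)) (c div nW div nP)) \<noteq> 0"

definition "nR = nF * nP * nW"
definition "nC = (K + 1) * nP * nW"
definition "n0 = length ns * nP * nW"

sublocale layout nR nC n0 lit .

definition index :: "nat \<Rightarrow> nat \<Rightarrow> nat \<Rightarrow> nat" where
  "index h t i = (h * nP + t) * nW + i"

lemma index_less:
  assumes "t < nP" "i < nW" shows "index h t i < a * nP * nW \<longleftrightarrow> h < a"
proof
  assume "h < a"
  then have "Suc h * nP \<le> a * nP" by (intro mult_le_mono1) simp
  then have "Suc (h * nP + t) \<le> a * nP" using assms(1) by simp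
  then have "Suc (h * nP + t) * nW \<le> a * nP * nW" by (rule mult_le_mono1)
  then show "index h t i < a * nP * nW" using assms(2) by (simp add: index_def)
next
  assume l: "index h t i < a * nP * nW"
  show "h < a"
  proof (rule ccontr)
    assume "\<not> h < a"
    then have "a * nP * nW \<le> h * nP * nW" by simp
    also have "\<dots> \<le> index h t i" by (simp add: index_def add_mult_distrib)
    finally show False using l by simp
  qed
qed

lemma index_simps:
  assumes "t < nP" "i < nW"
  shows "index h t i mod nW = i" "index h t i div nW mod nP = t" "index h t i div nW div nP = h"
  using assms by (simp_all add: index_def)

lemma index_exists: "r < a * nP * nW \<Longrightarrow> \<exists>h t i. h < a \<and> t < nP \<and> i < nW \<and> r = index h t i"
proof -
  assume r: "r < a * nP * nW"
  then have "0 < nW" "0 < nP" by (auto intro: Nat.gr0I)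
  then have ti: "r div nW mod nP < nP" "r mod nW < nW" by simp_all
  have eq: "r = index (r div nW div nP) (r div nW mod nP) (r mod nW)" unfolding index_def by (simp only: div_mult_mod_eq)
  moreover have "r div nW div nP < a" using r index_less[OF ti] eq by metis
  ultimately show ?thesis using ti by blast
qed

lemma index_bound:
  assumes "t < nP" "i < nW"
  shows "index h t i < nR \<longleftrightarrow> h < nF" "index h t i < nC \<longleftrightarrow> h < K + 1" "index h t i < n0 \<longleftrightarrow> h < length ns"
  unfolding nR_def nC_def n0_def by (rule index_less[OF assms])+

lemma index_split:
  "r < nR \<Longrightarrow> \<exists>h t i. h < nF \<and> t < nP \<and> i < nW \<and> r = index h t i"
  "r < nC \<Longrightarrow> \<exists>h t i. h < K + 1 \<and> t < nP \<and> i < nW \<and> r = index h t i"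
  "r < n0 \<Longrightarrow> \<exists>h t i. h < length ns \<and> t < nP \<and> i < nW \<and> r = index h t i"
  unfolding nR_def nC_def n0_def by (rule index_exists, assumption)+

lemma nested_upt:
  "concat (map f [0..<nR]) = concat (map (\<lambda>h. concat (map (\<lambda>t. concat (map (\<lambda>i. f (index h t i)) [0..<nW])) [0..<nP])) [0..<nF])"
  "concat (map f [0..<nC]) = concat (map (\<lambda>h. concat (map (\<lambda>t. concat (map (\<lambda>i. f (index h t i)) [0..<nW])) [0..<nP])) [0..<K + 1])"
  unfolding nR_def nC_def index_def by (rule upt_nested3)+

lemma lit_index:
  assumes "t < nP" "i < nW" "t' < nP" "i' < nW"
  shows "lit (index h t i) (index \<kappa> t' i') \<longleftrightarrow> ev x (env t i t' i') (litx ((ns @ ps) ! h) \<kappa>) \<noteq> 0"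
  unfolding lit_def index_simps[OF assms(1,2)] index_simps[OF assms(3,4)] ..

lemma lit_iff:
  assumes "t < nP" "i < nW" "t' < nP" "i' < nW" "h < nF" and f: "f = (ns @ ps) ! h"
  shows "lit (index h t i) (index \<kappa> t' i') \<longleftrightarrow>
    ev x (at_pos t i) (fst f) \<noteq> 0 \<and> (\<exists>(\<kappa>', d, e) \<in> set (snd f). \<kappa>' = \<kappa> \<and> t' = t + d \<and> i' = ev x (at_pos t i) e) \<or>
    \<kappa> = K \<and> ev x (at_pos t i) (fst f) = 0 \<and> t' = 0 \<and> i' = 0"
proof -
  have "f \<in> set (ns @ ps)" using assms(5) unfolding f nF_def by (rule nth_mem)
  from schemes[OF this] have s: "vars_below 3 (fst f)" "\<And>\<kappa> d e. (\<kappa>, d, e) \<in> set (snd f) \<Longrightarrow> vars_below 3 e" by auto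
  have g: "ev x (env t i t' i') (fst f) = ev x (at_pos t i) (fst f)" by (rule ev_env[OF s(1)])
  have "ev x (env t i t' i') (addx (map (\<lambda>(\<kappa>', d, e). Mul (fst f) (Mul (eqx (Vr 3) (Add (Vr 1) (Cn d))) (eqx (Vr 4) e)))
       (filter (\<lambda>(\<kappa>', d, e). \<kappa>' = \<kappa>) (snd f)))) \<noteq> 0 \<longleftrightarrow>
    ev x (at_pos t i) (fst f) \<noteq> 0 \<and> (\<exists>(\<kappa>', d, e) \<in> set (snd f). \<kappa>' = \<kappa> \<and> t' = t + d \<and> i' = ev x (at_pos t i) e)"
    unfolding ev_addx using ev_env[OF s(2)] g by (fastforce split: if_splits)
  then show ?thesis unfolding lit_index[OF assms(1-4)] litx_def f[symmetric] using g by auto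
qed

lemma rows_iff:
  assumes range: "\<And>f t i \<kappa> d e. f \<in> set (ns @ ps) \<Longrightarrow> t < nP \<Longrightarrow> i < nW \<Longrightarrow> ev x (at_pos t i) (fst f) \<noteq> 0 \<Longrightarrow>
      (\<kappa>, d, e) \<in> set (snd f) \<Longrightarrow> \<kappa> < K \<and> t + d < nP \<and> ev x (at_pos t i) e < nW"
    and active: "\<And>f. f \<in> set ps \<Longrightarrow> fst f = Cn 1"
  shows "(\<exists>X. (\<forall>r<n0. r < nR \<longrightarrow> (\<exists>c<nC. lit r c \<and> \<not> X c)) \<and>
       (\<forall>r. n0 \<le> r \<longrightarrow> r < nR \<longrightarrow> (\<exists>c<nC. lit r c \<and> X c))) \<longleftrightarrow>
    (\<exists>X. (\<forall>f\<in>set ns. scheme_sat x nP nW (\<lambda>\<kappa> t i. \<not> X \<kappa> t i) f) \<and> (\<forall>f\<in>set ps. scheme_sat x nP nW X f))"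
    (is "(\<exists>X. ?L X) \<longleftrightarrow> (\<exists>X. ?R X)")
proof
  assume "\<exists>X. ?L X"
  then obtain X where X: "?L X" by blast
  define Y where "Y \<kappa> t i = X (index \<kappa> t i)" for \<kappa> t i
  have sat: "scheme_sat x nP nW (\<lambda>\<kappa> t i. Q (index \<kappa> t i)) f"
    if h: "h < nF" "f = (ns @ ps) ! h" and Q: "\<And>r. \<exists>t<nP. \<exists>i<nW. r = index h t i \<Longrightarrow> \<exists>c<nC. lit r c \<and> Q c" for f h Q
    unfolding scheme_sat_def
  proof (intro allI impI)
    fix t i assume t: "t < nP" "i < nW" and g: "ev x (at_pos t i) (fst f) \<noteq> 0"
    obtain c where c: "c < nC" "lit (index h t i) c" "Q c" using Q[of "index h t i"] t by blast
    obtain \<kappa> t' i' where k: "t' < nP" "i' < nW" "c = index \<kappa> t' i'" using index_split(2)[OF c(1)] by blast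
    from c(2) g show "\<exists>(\<kappa>, d, e)\<in>set (snd f). Q (index \<kappa> (t + d) (ev x (at_pos t i) e))"
      unfolding k(3) lit_iff[OF t k(1,2) h] using c(3) k(3) by auto
  qed
  have "scheme_sat x nP nW (\<lambda>\<kappa> t i. \<not> Y \<kappa> t i) f" if f: "f \<in> set ns" for f
  proof -
    obtain h where h: "h < length ns" "f = ns ! h" using f by (auto simp: in_set_conv_nth)
    then have h': "h < nF" "f = (ns @ ps) ! h" by (simp_all add: nF_def nth_append)
    show ?thesis unfolding Y_def
    proof (rule sat[OF h'])
      fix r assume "\<exists>t<nP. \<exists>i<nW. r = index h t i"
      then have "r < n0" "r < nR" using index_bound h(1) h'(1) by blast+
      then show "\<exists>c<nC. lit r c \<and> \<not> X c" using X by blast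
    qed
  qed
  moreover have "scheme_sat x nP nW Y f" if f: "f \<in> set ps" for f
  proof -
    obtain h where h: "h < length ps" "f = ps ! h" using f by (auto simp: in_set_conv_nth)
    then have h': "length ns + h < nF" "f = (ns @ ps) ! (length ns + h)" by (simp_all add: nF_def)
    show ?thesis unfolding Y_def
    proof (rule sat[OF h'])
      fix r assume "\<exists>t<nP. \<exists>i<nW. r = index (length ns + h) t i"
      then have "\<not> r < n0" "r < nR" using index_bound h'(1) by (metis not_add_less1, blast)
      then show "\<exists>c<nC. lit r c \<and> X c" using X by (meson not_less)
    qed
  qed
  ultimately show "\<exists>X. ?R X" by blast
next
  assume "\<exists>X. ?R X"
  then obtain X where X: "?R X" by blast
  \<comment> \<open>Columns of the additional kind are false, which makes the literal of an inactive
    row true: such rows are negative, as positive schemes are always active.\<close>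
  define Y where "Y c \<longleftrightarrow> c div nW div nP < K \<and> X (c div nW div nP) (c div nW mod nP) (c mod nW)" for c
  have Y: "Y (index \<kappa> t i) \<longleftrightarrow> \<kappa> < K \<and> X \<kappa> t i" if "t < nP" "i < nW" for \<kappa> t i
    unfolding Y_def index_simps[OF that] ..
  have row: "\<exists>c<nC. lit (index h t i) c \<and> Q c"
    if h: "h < nF" "f = (ns @ ps) ! h" and t: "t < nP" "i < nW" and g: "ev x (at_pos t i) (fst f) \<noteq> 0"
      and s: "scheme_sat x nP nW (\<lambda>\<kappa> t i. Z \<kappa> t i) f" and Q: "\<And>\<kappa> t i. \<kappa> < K \<Longrightarrow> t < nP \<Longrightarrow> i < nW \<Longrightarrow> Z \<kappa> t i \<Longrightarrow> Q (index \<kappa> t i)"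
    for f h t i Z Q
  proof -
    from s t g obtain \<kappa> d e where l: "(\<kappa>, d, e) \<in> set (snd f)" "Z \<kappa> (t + d) (ev x (at_pos t i) e)"
      unfolding scheme_sat_def by blast
    have f: "f \<in> set (ns @ ps)" unfolding h(2) by (rule nth_mem) (use h(1) in \<open>simp only: nF_def\<close>)
    have rg: "\<kappa> < K" "t + d < nP" "ev x (at_pos t i) e < nW" using range[OF f t g l(1)] by blast+
    have "lit (index h t i) (index \<kappa> (t + d) (ev x (at_pos t i) e))"
      unfolding lit_iff[OF t rg(2,3) h] using g l(1) by blast
    moreover have "index \<kappa> (t + d) (ev x (at_pos t i) e) < nC" using index_bound(2)[OF rg(2,3)] rg(1) by simp
    ultimately show ?thesis using Q[OF rg l(2)] by blast
  qed
  have "\<exists>c<nC. lit r c \<and> \<not> Y c" if r: "r < n0" for r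
  proof -
    obtain h t i where h: "h < length ns" "t < nP" "i < nW" "r = index h t i" using index_split(3)[OF r] by blast
    have hF: "h < nF" "ns ! h = (ns @ ps) ! h" using h(1) by (simp_all add: nF_def nth_append)
    show ?thesis
    proof (cases "ev x (at_pos t i) (fst (ns ! h)) = 0")
      case True
      have 0: "0 < nP" "0 < nW" using h(2,3) by simp_all
      have "lit r (index K 0 0)" unfolding h(4) lit_iff[OF h(2,3) 0 hF] using True by simp
      moreover have "index K 0 0 < nC" using index_bound(2)[OF 0] by simp
      moreover have "\<not> Y (index K 0 0)" using Y[OF 0] by simp
      ultimately show ?thesis by blast
    next
      case False
      have "scheme_sat x nP nW (\<lambda>\<kappa> t i. \<not> X \<kappa> t i) (ns ! h)" using X h(1) by simp
      then show ?thesis unfolding h(4) by (rule row[OF hF h(2,3) False]) (simp add: Y)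
    qed
  qed
  moreover have "\<exists>c<nC. lit r c \<and> Y c" if r: "n0 \<le> r" "r < nR" for r
  proof -
    obtain h t i where h: "h < nF" "t < nP" "i < nW" "r = index h t i" using index_split(1)[OF r(2)] by blast
    have "\<not> h < length ns" using r(1) index_bound(3)[OF h(2,3), of h] h(4) by simp
    then have f: "(ns @ ps) ! h \<in> set ps" using h(1) by (simp add: nF_def nth_append)
    have "scheme_sat x nP nW X ((ns @ ps) ! h)" using X f by blast
    moreover have "ev x (at_pos t i) (fst ((ns @ ps) ! h)) \<noteq> 0" unfolding active[OF f] by simp
    ultimately show ?thesis unfolding h(4) by (intro row[OF h(1) refl h(2,3)]) (auto simp: Y)
  qed
  ultimately show "\<exists>X. ?L X" by blast
qed

section \<open>The generator program of the reduction\<close>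

definition "Rx = Mul (Mul (Cn nF) P) W"
definition "Cx = Mul (Mul (Cn (K + 1)) P) W"
definition "Mx = Add (Mul (Cn 8) Cx) (Cn 6)"
definition "Bx = Mul (Mul (Cn 4) Rx) Mx"
definition "Sx = Add (Mul (Cn 45) Cx) (Cn 3)"
definition "bdx j m = Add (Mul j Mx) m"
definition "flx r c k = Add Bx (Add (Mul r Sx) (Add (Mul c (Cn 45)) (Cn k)))"
definition "enx r e = Add Bx (Add (Mul r Sx) (Add (Mul (Cn 45) Cx) (Cn e)))"
text \<open>Row and column numbers in mixed radix. The loop variables 1 and 2 are time and position
  of the clause, 3 and 4 those of the variable.\<close>

definition "rx h = Add (Mul (Add (Mul (Cn h) P) (Vr 1)) W) (Vr 2)"
definition "cx \<kappa> = Add (Mul (Add (Mul (Cn \<kappa>) P) (Vr 3)) W) (Vr 4)"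

definition flag_shift :: "nat \<Rightarrow> nat \<Rightarrow> nat \<Rightarrow> nat \<Rightarrow> ex" where
  "flag_shift h \<kappa> q m = (let L = notx (notx (litx ((ns @ ps) ! h) \<kappa>)) in
     if q = 21 \<and> h < length ns then Add (Cn 7) (Mul (Cn 2) L)
     else if q = 32 \<and> length ns \<le> h then Sub (Cn 10) (Mul (Cn 6) L) else Cn m)"

definition flagg :: "nat \<Rightarrow> nat \<Rightarrow> nat \<Rightarrow> gn" where
  "flagg h \<kappa> q = (case base_tab ! q of (s, k, m, ty) \<Rightarrow>
     let j = Add (Mul (Cn 4) (rx h)) (Cn s); m' = Add (Mul (Cn 8) (cx \<kappa>)) (flag_shift h \<kappa> q m) in
     itemg (flx (rx h) (cx \<kappa>) q) (bdx j m') (bdx j (Add m' (Cn k))) ty ty)"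

definition cellg :: "nat \<Rightarrow> nat \<Rightarrow> gn" where
  "cellg h \<kappa> = (let j = Add (Mul (Cn 4) (rx h)) (Cn 1); m = (\<lambda>n. Add (Mul (Cn 8) (cx \<kappa>)) (Cn n)); f = flx (rx h) (cx \<kappa>) in
     Sq (sq (map (flagg h \<kappa>) [0..<42])) (sq [itemg (f 42) (bdx j (m 7)) (bdx j (m 8)) 1 1,
       itemg (f 43) (bdx j (m 7)) (f 42) 1 3, itemg (f 44) (bdx j (m 8)) (f 42) 1 3]))"

definition endsg :: "nat \<Rightarrow> gn" where
  "endsg h = (let j = Add (Mul (Cn 4) (rx h)) (Cn 1); m = (\<lambda>n. Add (Mul (Cn 8) Cx) (Cn n)); f = enx (rx h) in
     sq [itemg (f 0) (bdx j (Cn 3)) (bdx j (Cn 4)) 2 2, itemg (f 1) (bdx j (m 3)) (bdx j (m 4)) 2 2,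
       itemg (f 2) (bdx j (m 3)) (bdx j (m 4)) 2 2])"

definition rowg :: "nat \<Rightarrow> gn" where
  "rowg h = Fr 1 P (Fr 2 W (Sq (sq (map (\<lambda>\<kappa>. Fr 3 P (Fr 4 W (cellg h \<kappa>))) [0..<K + 1])) (endsg h)))"

definition strip0g :: gn where
  "strip0g = Fr 5 (Sub Mx (Cn 2)) (itemg (bdx (Cn 0) (Add (Vr 5) (Cn 2))) (bdx (Cn 0) (Add (Vr 5) (Cn 1))) (bdx (Cn 0) (Vr 5)) 0 0)"

definition stripsg :: gn where
  "stripsg = (let j = Vr 6; j' = Add (Vr 6) (Cn 1) in Fr 6 (Sub (Mul (Cn 4) Rx) (Cn 1))
     (Sq (sq [itemg (bdx j' (Cn 0)) (bdx j (Cn 1)) (bdx j (Cn 3)) 1 0, itemg (bdx j' (Cn 2)) (bdx j (Cn 3)) (bdx j' (Cn 0)) 1 0,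
        itemg (bdx j' (Cn 1)) (bdx j' (Cn 0)) (bdx j' (Cn 2)) 0 0])
     (Fr 5 (Sub Mx (Cn 3)) (itemg (bdx j' (Add (Vr 5) (Cn 3))) (bdx j' (Add (Vr 5) (Cn 2))) (bdx j' (Add (Vr 5) (Cn 1))) 0 0))))"

definition prog :: gn where
  "prog = sq ([Em (Add Bx (Mul Rx Sx)), Em (Cn 0), Em (Cn 1), Em (Cn 1), Em (Cn 1), strip0g, stripsg] @ map rowg [0..<nF])"

lemma vars_static [simp]: "vars_below n Rx" "vars_below n Cx" "vars_below n Mx" "vars_below n Bx" "vars_below n Sx"
  "vars_below n (bdx a b) \<longleftrightarrow> vars_below n a \<and> vars_below n b" "vars_below n (flx a b k) \<longleftrightarrow> vars_below n a \<and> vars_below n b"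
  "vars_below n (enx a k) \<longleftrightarrow> vars_below n a" "vars_below 7 (rx h)" "vars_below 7 (cx h)"
  by (auto simp: Rx_def Cx_def Mx_def Bx_def Sx_def bdx_def flx_def enx_def rx_def cx_def)

lemma vars_litx: "h < nF \<Longrightarrow> vars_below 7 (litx ((ns @ ps) ! h) \<kappa>)"
proof -
  assume "h < nF"
  then have "(ns @ ps) ! h \<in> set (ns @ ps)" unfolding nF_def by (rule nth_mem)
  from schemes[OF this] have s: "vars_below 7 (fst ((ns @ ps) ! h))"
    "\<And>\<kappa> d e. (\<kappa>, d, e) \<in> set (snd ((ns @ ps) ! h)) \<Longrightarrow> vars_below 7 e" using vars_below_mono[of 3 _ 7] by fastforce+
  then show ?thesis unfolding litx_def by (auto dest: s(2))
qed

lemma bound_flagg: "bound_vars (flagg h \<kappa> q) = {}"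
  unfolding flagg_def by (simp add: Let_def split: prod.splits)

lemma bound_cellg: "bound_vars (cellg h \<kappa>) = {}" "bound_vars (endsg h) = {}"
  by (auto simp: cellg_def endsg_def Let_def bound_flagg)

lemma wf_prog: "wf_gn 7 prog"
proof -
  have f: "wf_gn 7 (flagg h \<kappa> q)" if "h < nF" for h \<kappa> q
    using vars_litx[OF that] unfolding flagg_def flag_shift_def by (auto simp: Let_def split: prod.splits)
  have c: "wf_gn 7 (cellg h \<kappa>)" if "h < nF" for h \<kappa>
    using f[OF that] unfolding cellg_def by (simp add: Let_def del: upt_rec_numeral)
  have e: "wf_gn 7 (endsg h)" for h unfolding endsg_def by (simp add: Let_def)
  have "wf_gn 7 (rowg h)" if "h < nF" for h
    unfolding rowg_def using c[OF that] e by (auto simp: bound_cellg)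
  then show ?thesis unfolding prog_def by (auto simp: strip0g_def stripsg_def Let_def)
qed

definition enc :: "vtx ear \<Rightarrow> bool list" where
  "enc it = concat (map (\<lambda>(u, v, a, b). encode_nat u @ encode_nat v @ encode_nat a @ encode_nat b) (code_entries it))"

lemma gsem_itemg:
  "ev x \<sigma> v = vid v' \<Longrightarrow> ev x \<sigma> a = vid a' \<Longrightarrow> ev x \<sigma> b = vid b' \<Longrightarrow> gsem x \<sigma> (itemg v a b k l) = enc (v', a', b', k, l)"
  by (simp add: itemg_def enc_def code_entries_def)

lemma ev_static [simp]: "ev x \<sigma> Rx = nR" "ev x \<sigma> Cx = nC" "ev x \<sigma> Mx = Mt"
  "ev x \<sigma> Bx = 4 * nR * Mt" "ev x \<sigma> Sx = row_size"
proof -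
  show 1: "ev x \<sigma> Rx = nR" "ev x \<sigma> Cx = nC" by (simp_all add: Rx_def Cx_def nR_def nC_def)
  show "ev x \<sigma> Mx = Mt" by (simp add: Mx_def Mt_def 1)
  then show "ev x \<sigma> Bx = 4 * nR * Mt" by (simp add: Bx_def 1)
  show "ev x \<sigma> Sx = row_size" by (simp add: Sx_def row_size_def 1)
qed

lemma ev_vid: "ev x \<sigma> j = j' \<Longrightarrow> ev x \<sigma> m = m' \<Longrightarrow> ev x \<sigma> (bdx j m) = vid (Bd j' m')"
  "ev x \<sigma> r = r' \<Longrightarrow> ev x \<sigma> c = c' \<Longrightarrow> ev x \<sigma> (flx r c k) = vid (Fl r' c' k)"
  "ev x \<sigma> r = r' \<Longrightarrow> ev x \<sigma> (enx r k) = vid (En r' k)"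
  by (simp_all add: bdx_def flx_def enx_def)

lemma ev_rx: "ev x (env t i t' i') (rx h) = index h t i" "ev x (env t i t' i') (cx \<kappa>) = index \<kappa> t' i'"
  by (simp_all add: rx_def cx_def index_def)

lemma gsem_flagg:
  assumes "t < nP" "i < nW" "t' < nP" "i' < nW" "h < nF" "q < 42"
  shows "gsem x (env t i t' i') (flagg h \<kappa> q) = enc (flag_item (index h t i) (index \<kappa> t' i') q)"
proof -
  let ?r = "index h t i" let ?c = "index \<kappa> t' i'"
  obtain s k m ty where b: "base_tab ! q = (s, k, m, ty)" by (metis surj_pair)
  define m' where "m' = ev x (env t i t' i') (flag_shift h \<kappa> q m)"
  have "ev x (env t i t' i') (notx (notx (litx ((ns @ ps) ! h) \<kappa>))) = (if lit ?r ?c then 1 else 0)"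
    unfolding lit_index[OF assms(1-4)] by simp
  then have m': "m' = (if q = 21 \<and> h < length ns then 7 + 2 * (if lit ?r ?c then 1 else 0)
     else if q = 32 \<and> length ns \<le> h then 10 - 6 * (if lit ?r ?c then 1 else 0) else m)"
    unfolding m'_def flag_shift_def Let_def by simp
  have "?r < n0 \<longleftrightarrow> h < length ns" by (rule index_bound(3)[OF assms(1,2)])
  then have "entry ?r ?c q = (s, k, m', ty)"
    using b m' by (auto simp: entry_def base_tab_def)
  then have "flag_item ?r ?c q = (Fl ?r ?c q, Bd (4 * ?r + s) (8 * ?c + m'), Bd (4 * ?r + s) (8 * ?c + m' + k), ty, ty)"
    by (simp add: flag_item_def)
  moreover have "gsem x (env t i t' i') (flagg h \<kappa> q) =
      enc (Fl ?r ?c q, Bd (4 * ?r + s) (8 * ?c + m'), Bd (4 * ?r + s) (8 * ?c + m' + k), ty, ty)"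
    unfolding flagg_def b prod.case Let_def
    by (rule gsem_itemg; rule ev_vid; simp add: ev_rx m'_def)
  ultimately show ?thesis by simp
qed

lemma gsem_cellg:
  assumes "t < nP" "i < nW" "t' < nP" "i' < nW" "h < nF"
  shows "gsem x (env t i t' i') (cellg h \<kappa>) = concat (map enc (cell (index h t i) (index \<kappa> t' i')))"
proof -
  have "map (gsem x (env t i t' i')) (map (flagg h \<kappa>) [0..<42]) = map enc (map (flag_item (index h t i) (index \<kappa> t' i')) [0..<42])"
    unfolding map_map o_def by (rule map_cong[OF refl]) (use gsem_flagg[OF assms] in simp)
  then have "gsem x (env t i t' i') (sq (map (flagg h \<kappa>) [0..<42])) = concat (map enc (map (flag_item (index h t i) (index \<kappa> t' i')) [0..<42]))"
    by (simp only: gsem_sq)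
  then show ?thesis unfolding cellg_def cell_def Let_def gsem.simps map_append concat_append gsem_sq list.map concat.simps
    by (intro arg_cong2[of _ _ _ _ append] gsem_itemg ev_vid refl) (simp_all add: ev_rx)
qed

lemma gsem_endsg: "gsem x (env t i 0 0) (endsg h) = concat (map enc (row_ends (index h t i)))"
  unfolding endsg_def row_ends_def Let_def gsem_sq list.map concat.simps
  by (intro arg_cong2[of _ _ _ _ append] gsem_itemg ev_vid refl) (simp_all add: ev_rx)

lemma gsem_rowg:
  assumes "h < nF"
  shows "gsem x (\<lambda>_. 0) (rowg h) = concat (map (\<lambda>t. concat (map (\<lambda>i. concat (map enc
     (concat (map (cell (index h t i)) [0..<nC]) @ row_ends (index h t i)))) [0..<nW])) [0..<nP])"
proof -
  have "gsem x ((\<lambda>_. 0)(1 := t, 2 := i)) (Sq (sq (map (\<lambda>\<kappa>. Fr 3 P (Fr 4 W (cellg h \<kappa>))) [0..<K + 1])) (endsg h)) =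
      concat (map enc (concat (map (cell (index h t i)) [0..<nC]) @ row_ends (index h t i)))"
    if t: "t < nP" "i < nW" for t i
  proof -
    have e0: "(\<lambda>_. 0)(1 := t, 2 := i) = env t i 0 0" by (auto simp: env_def fun_eq_iff)
    have e1: "(env t i 0 0)(3 := t', 4 := i') = env t i t' i'" for t' i' by (auto simp: env_def fun_eq_iff)
    have "gsem x (env t i 0 0) (Fr 3 P (Fr 4 W (cellg h \<kappa>))) =
        concat (map (\<lambda>t'. concat (map (\<lambda>i'. concat (map enc (cell (index h t i) (index \<kappa> t' i')))) [0..<nW])) [0..<nP])" for \<kappa>
      unfolding gsem.simps ev_PW e1 by (intro arg_cong[of _ _ concat] map_cong refl) (use gsem_cellg[OF t _ _ assms] in simp)
    then have "gsem x (env t i 0 0) (sq (map (\<lambda>\<kappa>. Fr 3 P (Fr 4 W (cellg h \<kappa>))) [0..<K + 1])) =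
        concat (map (\<lambda>c. concat (map enc (cell (index h t i) c))) [0..<nC])"
      unfolding nested_upt gsem_sq map_map o_def by (simp only:)
    also have "\<dots> = concat (map enc (concat (map (cell (index h t i)) [0..<nC])))"
      by (simp add: map_concat o_def concat_concat_map)
    finally show ?thesis unfolding e0 gsem.simps(3) gsem_endsg by simp
  qed
  then show ?thesis unfolding rowg_def gsem.simps(4) ev_PW
    by (intro arg_cong[of _ _ concat] map_cong refl) simp_all
qed

lemma gsem_strip0g: "gsem x \<sigma> strip0g = concat (map enc strip0)"
  unfolding strip0g_def strip0_def gsem.simps map_map o_def
  by (intro arg_cong[of _ _ concat] map_cong gsem_itemg ev_vid) simp_all

lemma gsem_stripsg: "gsem x \<sigma> stripsg = concat (map enc (concat (map strip [0..<4 * nR - 1])))"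
proof -
  have "gsem x \<sigma> stripsg = concat (map (\<lambda>j. concat (map enc (strip j))) [0..<4 * nR - 1])"
    unfolding stripsg_def Let_def gsem.simps(4)[of x \<sigma>]
  proof (intro arg_cong[of _ _ concat] map_cong)
    fix j
    show "gsem x (\<sigma>(6 := j)) (Sq (sq [itemg (bdx (Add (Vr 6) (Cn 1)) (Cn 0)) (bdx (Vr 6) (Cn 1)) (bdx (Vr 6) (Cn 3)) 1 0,
        itemg (bdx (Add (Vr 6) (Cn 1)) (Cn 2)) (bdx (Vr 6) (Cn 3)) (bdx (Add (Vr 6) (Cn 1)) (Cn 0)) 1 0,
        itemg (bdx (Add (Vr 6) (Cn 1)) (Cn 1)) (bdx (Add (Vr 6) (Cn 1)) (Cn 0)) (bdx (Add (Vr 6) (Cn 1)) (Cn 2)) 0 0])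
      (Fr 5 (Sub Mx (Cn 3)) (itemg (bdx (Add (Vr 6) (Cn 1)) (Add (Vr 5) (Cn 3))) (bdx (Add (Vr 6) (Cn 1)) (Add (Vr 5) (Cn 2)))
        (bdx (Add (Vr 6) (Cn 1)) (Add (Vr 5) (Cn 1))) 0 0))) = concat (map enc (strip j))"
      unfolding strip_def gsem.simps gsem_sq map_append concat_append list.map concat.simps map_map o_def
      by (intro arg_cong2[of _ _ _ _ append] arg_cong[of _ _ concat] map_cong gsem_itemg ev_vid refl) simp_all
  qed simp
  then show ?thesis by (simp add: map_concat o_def concat_concat_map)
qed

lemma gsem_prog: "gsem x (\<lambda>_. 0) prog = encode layout_code"
proof -
  have "map (gsem x (\<lambda>_. 0)) (map rowg [0..<nF]) = map (\<lambda>h. concat (map (\<lambda>t. concat (map (\<lambda>i. concat (map enc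
     (concat (map (cell (index h t i)) [0..<nC]) @ row_ends (index h t i)))) [0..<nW])) [0..<nP])) [0..<nF]"
    unfolding map_map o_def by (rule map_cong[OF refl]) (use gsem_rowg in simp)
  then have rows: "concat (map (gsem x (\<lambda>_. 0)) (map rowg [0..<nF])) =
      concat (map (\<lambda>r. concat (map enc (concat (map (cell r) [0..<nC]) @ row_ends r))) [0..<nR])"
    unfolding nested_upt(1) by (simp only:)
  have cc: "concat (map enc (concat (map f xs))) = concat (map (\<lambda>z. concat (map enc (f z))) xs)" for f :: "nat \<Rightarrow> vtx ear list" and xs
    by (simp add: map_concat o_def concat_concat_map)
  have its: "concat (map enc items) = concat (map enc strip0) @ concat (map enc (concat (map strip [0..<4 * nR - 1]))) @
      concat (map (gsem x (\<lambda>_. 0)) (map rowg [0..<nF]))"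
    unfolding items_def map_append concat_append rows cc ..
  have "concat (map (\<lambda>(u, v, a, b). encode_nat u @ encode_nat v @ encode_nat a @ encode_nat b) (concat (map code_entries its))) = concat (map enc its)" for its
    by (induction its) (simp_all add: enc_def)
  note enc_eq = this
  show ?thesis unfolding encode_def layout_code_def prog_def gsem_sq enc_eq map_append concat_append list.map concat.simps
      fst_conv snd_conv prod.case its gsem_strip0g gsem_stripsg gsem.simps(1)
    by (simp add: nverts_def del: upt_Suc)
qed

end

section \<open>The reduction from acceptance and NP-hardness\<close>

context ntm_list
begin

lemma vars_aux [simp]: "vars_below n Pe" "vars_below n We" "vars_below 3 sucx" "vars_below 3 (nextp a j)" "vars_below 3 (initx j)"
  by (simp_all add: Pe_def We_def sucx_def nextp_def initx_def)

lemma vars_schemes: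
  "f \<in> set (neg @ pos) \<Longrightarrow> vars_below 3 (fst f) \<and> (\<forall>(\<kappa>, d, e) \<in> set (snd f). vars_below 3 e)"
  unfolding neg_def pos_def neg1_def neg2_def neg3_def neg4_def neg5_def neg6_def neg7_def by auto

lemma tp_pos: "0 < tp x"
  by (simp add: tp_def)

text \<open>Activity conditions switch off the instances whose literals would refer to a time after
  the last row or to a cell outside the window.\<close>

lemma schemes_in_range:
  assumes "f \<in> set (neg @ pos)" "t < tp x" "i < Suc (2 * tp x)" "ev x (at_pos t i) (fst f) \<noteq> 0" "(\<kappa>, d, e) \<in> set (snd f)"
  shows "\<kappa> < m + k * S \<and> t + d < tp x \<and> ev x (at_pos t i) e < Suc (2 * tp x)"
proof -
  have "f \<in> set neg1 \<or> f \<in> set neg2 \<or> f \<in> set neg3 \<or> f \<in> set neg4 \<or> f \<in> set neg5 \<or> f \<in> set neg6 \<or> f \<in> set neg7 \<or> f \<in> set pos"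
    using assms(1) by (auto simp: neg_def)
  then show ?thesis
  proof (elim disjE)
    assume "f \<in> set neg1" then show ?thesis using assms(2-5) unfolding neg1_def by auto
  next
    assume "f \<in> set neg2" then show ?thesis using assms(2-5) unfolding neg2_def by (auto split: if_splits)
  next
    assume "f \<in> set neg3" then show ?thesis using assms(2-5) unfolding neg3_def by auto
  next
    assume "f \<in> set neg4" then show ?thesis using assms(2-5) unfolding neg4_def by (auto dest: cv_less)
  next
    assume "f \<in> set neg5" then show ?thesis using assms(2-5) tp_pos[of x] unfolding neg5_def by (auto dest: cv_less split: if_splits)
  next
    assume "f \<in> set neg6" then show ?thesis using assms(2-5) unfolding neg6_def by (auto dest: cv_less split: if_splits)
  next
    assume "f \<in> set neg7" then show ?thesis using assms(2-5) unfolding neg7_def by (auto dest: cv_less)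
  next
    assume "f \<in> set pos" then show ?thesis using assms(2-5) unfolding pos_def by ((auto simp: cv_less; fail) | (auto, rule cv_less, assumption+))
  qed
qed

lemma pos_active: "f \<in> set pos \<Longrightarrow> fst f = Cn 1"
  unfolding pos_def by auto

lemma accepts_iff:
  "accepts M x \<longleftrightarrow> (\<exists>X. (\<forall>f\<in>set neg. scheme_sat x (tp x) (Suc (2 * tp x)) (\<lambda>\<kappa> t i. \<not> X \<kappa> t i) f) \<and>
     (\<forall>f\<in>set pos. scheme_sat x (tp x) (Suc (2 * tp x)) X f))"
  using accepts_scheme_sat scheme_sat_accepts by blast

abbreviation "reduction_prog \<equiv> program.prog Pe We neg pos (m + k * S)"

lemma program: "program Pe We neg pos"
  by unfold_locales (use vars_schemes in auto)

lemma polytime_reduction: "polytime_computable (\<lambda>x. gsem x (\<lambda>_. 0) reduction_prog)"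
  by (rule polytime_computable_gsem[OF program.wf_prog[OF program]])

lemma reduction:
  "\<exists>c. gsem x (\<lambda>_. 0) reduction_prog = encode c \<and> valid_code c \<and> weighted_graph (graph_of c) \<and> planar (graph_of c) \<and>
     two_tree (verts (graph_of c)) (edges (graph_of c)) \<and> num_lengths (graph_of c) = 4 \<and>
     (accepts M x \<longleftrightarrow> (\<exists>p. planar_straight_line_realization (graph_of c) p))"
proof -
  interpret G: program x Pe We neg pos "m + k * S" by (rule program)
  have n: "G.nP = tp x" "G.nW = Suc (2 * tp x)" by (simp_all add: G.nP_def G.nW_def)
  have C: "0 < G.nC" and R: "0 < G.nR"
  proof -
    have "0 < length pos" by (simp add: pos_def)
    then have "0 < G.nF" by (simp add: G.nF_def del: length_greater_0_conv)
    moreover have "0 < G.nP" "0 < G.nW" unfolding n using tp_pos[of x] by simp_all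
    ultimately show "0 < G.nC" "0 < G.nR" by (simp_all add: G.nR_def G.nC_def)
  qed
  have acc: "accepts M x \<longleftrightarrow> (\<exists>X. (\<forall>f\<in>set neg. scheme_sat x G.nP G.nW (\<lambda>\<kappa> t i. \<not> X \<kappa> t i) f) \<and>
      (\<forall>f\<in>set pos. scheme_sat x G.nP G.nW X f))" unfolding n by (rule accepts_iff)
  have "(\<exists>p. planar_straight_line_realization (graph_of G.layout_code) p) \<longleftrightarrow> accepts M x"
    unfolding G.realization_code[OF C R] G.realizable_iff[OF C R] acc
  proof (rule G.rows_iff)
    fix f t i \<kappa> d e
    assume "f \<in> set (neg @ pos)" "t < G.nP" "i < G.nW" "ev x (at_pos t i) (fst f) \<noteq> 0" "(\<kappa>, d, e) \<in> set (snd f)"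
    then show "\<kappa> < m + k * S \<and> t + d < G.nP \<and> ev x (at_pos t i) e < G.nW" unfolding n by (rule schemes_in_range)
  next
    fix f assume "f \<in> set pos"
    then show "fst f = Cn 1" by (rule pos_active)
  qed
  then show ?thesis
    using G.gsem_prog G.valid_layout_code[OF C R] G.weighted_code[OF C R] G.planar_code[OF C R] G.two_tree_code[OF C R]
      G.num_lengths_code[OF C R] by blast
qed

end

lemma (in ntm) finite_ext_trans: "finite (ext_trans M S Q)"
proof -
  have 1: "finite {rs. set rs \<subseteq> {..<S} \<and> length rs = tape_count M}" by (rule finite_lists_length_eq) simp
  have "{(q, rs, Q, stay rs) |rs. length rs = tape_count M \<and> set rs \<subseteq> {..<S} \<and> T rs} \<subseteq>
      (\<lambda>rs. (q, rs, Q, stay rs)) ` {rs. set rs \<subseteq> {..<S} \<and> length rs = tape_count M}" for q T by auto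
  from finite_subset[OF this finite_imageI[OF 1]]
  have 2: "finite {(q, rs, Q, stay rs) |rs. length rs = tape_count M \<and> set rs \<subseteq> {..<S} \<and> T rs}" for q T .
  have 3: "finite {(q, rs, Q, stay rs) |rs. length rs = tape_count M \<and> set rs \<subseteq> {..<S}}" for q
    using 2[of q "\<lambda>_. True"] by simp
  show ?thesis unfolding ext_trans_def
    by (intro finite_UnI 2 3) (use wf in \<open>simp add: wf_tm_def\<close>)
qed

lemma NP_reduction:
  assumes "L \<in> NP"
  shows "\<exists>f. polytime_computable f \<and> (\<forall>x. \<exists>c. f x = encode c \<and> valid_code c \<and> weighted_graph (graph_of c) \<and> planar (graph_of c) \<and>
     two_tree (verts (graph_of c)) (edges (graph_of c)) \<and> num_lengths (graph_of c) = 4 \<and>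
     (x \<in> L \<longleftrightarrow> (\<exists>p. planar_straight_line_realization (graph_of c) p)))"
proof -
  obtain M p where M: "wf_tm M" "runs_in_time M p" "L = {x. accepts M x}" using assms by (auto simp: NP_def)
  obtain S Q where "ntm M p S Q" using ntm_exists[OF M(1,2)] by blast
  then interpret ntm M p S Q .
  obtain trs where trs: "set trs = ext_trans M S Q" using finite_list[OF finite_ext_trans] by blast
  interpret ntm_list M p S Q trs by unfold_locales (rule trs)
  show ?thesis using polytime_reduction reduction unfolding M(3) mem_Collect_eq by blast
qed

text \<open>Every produced instance is a 2-tree with exactly four lengths, so hardness holds for
  each class containing these graphs, in particular for both classes of the theorem.\<close>

lemma NP_hard_FEPR:
  assumes "\<And>G :: nat wgraph. two_tree (verts G) (edges G) \<Longrightarrow> num_lengths G = 4 \<Longrightarrow> K G"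
  shows "NP_hard (FEPR_on K)"
  unfolding NP_hard_def
proof
  fix L assume "L \<in> NP"
  from NP_reduction[OF this] obtain f where f: "polytime_computable f"
    and c: "\<And>x. \<exists>c. f x = encode c \<and> valid_code c \<and> weighted_graph (graph_of c) \<and> planar (graph_of c) \<and>
     two_tree (verts (graph_of c)) (edges (graph_of c)) \<and> num_lengths (graph_of c) = 4 \<and>
     (x \<in> L \<longleftrightarrow> (\<exists>p. planar_straight_line_realization (graph_of c) p))" by blast
  have "f x \<in> instances (FEPR_on K) \<and> (x \<in> L \<longleftrightarrow> f x \<in> yes_instances (FEPR_on K))" for x
  proof -
    obtain c where c: "f x = encode c" "valid_code c" "weighted_graph (graph_of c)" "planar (graph_of c)"
      "two_tree (verts (graph_of c)) (edges (graph_of c))" "num_lengths (graph_of c) = 4"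
      "x \<in> L \<longleftrightarrow> (\<exists>p. planar_straight_line_realization (graph_of c) p)" using c by blast
    have K: "K (graph_of c)" by (rule assms[OF c(5,6)])
    have "f x \<in> instances (FEPR_on K)" unfolding FEPR_on_def problem.select_convs
      by (rule CollectI, rule exI[of _ c]) (intro conjI c(1-4) K)
    moreover have "f x \<in> yes_instances (FEPR_on K) \<longleftrightarrow> (\<exists>p. planar_straight_line_realization (graph_of c) p)"
    proof
      assume "f x \<in> yes_instances (FEPR_on K)"
      then obtain c' where c': "f x = encode c'" "\<exists>p. planar_straight_line_realization (graph_of c') p"
        unfolding FEPR_on_def problem.select_convs by blast
      \<comment> \<open>A string is a yes-instance if some code of it is realizable; injectivity of
        the encoding makes this the code produced.\<close>
      have "c' = c" using c'(1) c(1) encode_inject by metis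
      then show "\<exists>p. planar_straight_line_realization (graph_of c) p" using c'(2) by simp
    next
      assume p: "\<exists>p. planar_straight_line_realization (graph_of c) p"
      show "f x \<in> yes_instances (FEPR_on K)" unfolding FEPR_on_def problem.select_convs
        by (rule CollectI, rule exI[of _ c]) (intro conjI c(1-4) K p)
    qed
    ultimately show ?thesis using c(7) by blast
  qed
  then show "\<exists>f. polytime_computable f \<and> (\<forall>x. f x \<in> instances (FEPR_on K) \<and> (x \<in> L \<longleftrightarrow> f x \<in> yes_instances (FEPR_on K)))"
    using f by blast
qed

theorem theorem5:
  "NP_hard (FEPR_on (\<lambda>G. two_tree (verts G) (edges G))) \<and>
   NP_hard (FEPR_on (\<lambda>G. two_tree (verts G) (edges G) \<and> num_lengths G = 4))"
  by (intro conjI NP_hard_FEPR) simp_all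

end
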